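(* Let $R$ be a ring, $M$ an $R$-bimodule, $n\ge1$, and $X$ a left $R$-module. (1) If $\mathrm{Tor}^R_j(M^{\otimes_R i},X)=0$ for any $i,j\ge1$, then $pd({}_{R\ltimes_n M}\mathbf{T}(X))=pd({}_RX)$ and $fd({}_{R\ltimes_n M}\mathbf{T}(X))=fd({}_RX)$. (2) If $\mathrm{Ext}_R^j(M^{\otimes_R i},X)=0$ for any $i,j\ge1$, then $id({}_{R\ltimes_n M}\mathbf{H}(X))=id({}_RX)$.
   Context: All rings are nonzero, associative, with identity; all modules are unitary. $M^{\otimes_R 0}=R$, $M^{\otimes_R 1}=M$, $M^{\otimes_R (i+1)}=M\otimes_R M^{\otimes_R i}$. The $n$-trivial extension $R\ltimes_n M$ is the abelian group $\coprod_{i=0}^n M^{\otimes_R i}$ with multiplication $(m_0,\dots,m_n)(m_0',\dots,m_n')=\big(\sum_{i+j=k}m_i\otimes m_j'\big)_{0\le k\le n}$ (using the canonical identifications $R\otimes_R N=N=N\otimes_R R$). For a left $R$-module $X$, $\mathbf{T}(X)$ is the left $R\ltimes_n M$-module $(R\ltimes_n M)\otimes_R X$; that is, $\coprod_{i=0}^n(M^{\otimes_R i}\otimes_R X)$ on which $(0,m,0,\dots,0)$ acts by $(x_0,\dots,x_n)\mapsto(0,m\otimes x_0,\dots,m\otimes x_{n-1})$. $\mathbf{H}(X)$ is the left $R\ltimes_n M$-module $\mathrm{Hom}_R(R\ltimes_n M,X)$; that is, $\coprod_{i=0}^n\mathrm{Hom}_R^i(M,X)$ on which $(0,m,0,\dots,0)$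 acts by $(x_0,\dots,x_n)\mapsto(x_1(m),\dots,x_n(m),0)$, where $\mathrm{Hom}^0_R(M,X)=X$ and $\mathrm{Hom}_R^i(M,X)=\mathrm{Hom}_R(M,\mathrm{Hom}_R^{i-1}(M,X))$. $pd$, $id$, $fd$ denote projective, injective and flat dimension. *)

theory Defs
  imports "HOL-Algebra.Module" "HOL-Algebra.AbelCoset" "HOL-Algebra.Free_Abelian_Groups" "HOL-Library.Extended_Nat"
begin

section \<open>Modules over noncommutative rings\<close>

text \<open>
  The library locale \<^locale>\<open>module\<close> requires a commutative ring of scalars. We reuse its record type
  but not the locale. As there, the fields \<^const>\<open>mult\<close> and \<^const>\<open>one\<close> of a module record carry no
  information.
\<close>

record ('a, 'c, 'b) bimodule = "('a, 'b) module" +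
  rsmult :: "'b \<Rightarrow> 'c \<Rightarrow> 'b" (infixl \<open>\<odot>\<^sub>r\<index>\<close> 70)

locale left_module = R?: ring R + X?: abelian_group X
  for R :: "('a, 'e) ring_scheme" (structure) and X :: "('a, 'b, 'f) module_scheme" (structure) +
  assumes smult_closed: "\<lbrakk>a \<in> carrier R; x \<in> carrier X\<rbrakk> \<Longrightarrow> a \<odot>\<^bsub>X\<^esub> x \<in> carrier X"
    and smult_l_distr: "\<lbrakk>a \<in> carrier R; b \<in> carrier R; x \<in> carrier X\<rbrakk> \<Longrightarrow>
      (a \<oplus>\<^bsub>R\<^esub> b) \<odot>\<^bsub>X\<^esub> x = a \<odot>\<^bsub>X\<^esub> x \<oplus>\<^bsub>X\<^esub> b \<odot>\<^bsub>X\<^esub> x"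
    and smult_r_distr: "\<lbrakk>a \<in> carrier R; x \<in> carrier X; y \<in> carrier X\<rbrakk> \<Longrightarrow>
      a \<odot>\<^bsub>X\<^esub> (x \<oplus>\<^bsub>X\<^esub> y) = a \<odot>\<^bsub>X\<^esub> x \<oplus>\<^bsub>X\<^esub> a \<odot>\<^bsub>X\<^esub> y"
    and smult_assoc: "\<lbrakk>a \<in> carrier R; b \<in> carrier R; x \<in> carrier X\<rbrakk> \<Longrightarrow>
      (a \<otimes>\<^bsub>R\<^esub> b) \<odot>\<^bsub>X\<^esub> x = a \<odot>\<^bsub>X\<^esub> (b \<odot>\<^bsub>X\<^esub> x)"
    and smult_one: "x \<in> carrier X \<Longrightarrow> \<one>\<^bsub>R\<^esub> \<odot>\<^bsub>X\<^esub> x = x"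

text \<open>A right module is a bimodule record of which the left multiplication is ignored.\<close>

locale right_module = R?: ring R + X?: abelian_group X
  for R :: "('c, 'e) ring_scheme" (structure) and X :: "('a, 'c, 'b, 'f) bimodule_scheme" (structure) +
  assumes rsmult_closed: "\<lbrakk>a \<in> carrier R; x \<in> carrier X\<rbrakk> \<Longrightarrow> x \<odot>\<^sub>r\<^bsub>X\<^esub> a \<in> carrier X"
    and rsmult_r_distr: "\<lbrakk>a \<in> carrier R; b \<in> carrier R; x \<in> carrier X\<rbrakk> \<Longrightarrow>
      x \<odot>\<^sub>r\<^bsub>X\<^esub> (a \<oplus>\<^bsub>R\<^esub> b) = x \<odot>\<^sub>r\<^bsub>X\<^esub> a \<oplus>\<^bsub>X\<^esub> x \<odot>\<^sub>r\<^bsub>X\<^esub> b"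
    and rsmult_l_distr: "\<lbrakk>a \<in> carrier R; x \<in> carrier X; y \<in> carrier X\<rbrakk> \<Longrightarrow>
      (x \<oplus>\<^bsub>X\<^esub> y) \<odot>\<^sub>r\<^bsub>X\<^esub> a = x \<odot>\<^sub>r\<^bsub>X\<^esub> a \<oplus>\<^bsub>X\<^esub> y \<odot>\<^sub>r\<^bsub>X\<^esub> a"
    and rsmult_assoc: "\<lbrakk>a \<in> carrier R; b \<in> carrier R; x \<in> carrier X\<rbrakk> \<Longrightarrow>
      x \<odot>\<^sub>r\<^bsub>X\<^esub> (a \<otimes>\<^bsub>R\<^esub> b) = (x \<odot>\<^sub>r\<^bsub>X\<^esub> a) \<odot>\<^sub>r\<^bsub>X\<^esub> b"
    and rsmult_one: "x \<in> carrier X \<Longrightarrow> x \<odot>\<^sub>r\<^bsub>X\<^esub> \<one>\<^bsub>R\<^esub> = x"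

definition is_bimodule ::
    "('a, 'e) ring_scheme \<Rightarrow> ('c, 'g) ring_scheme \<Rightarrow> ('a, 'c, 'b, 'f) bimodule_scheme \<Rightarrow> bool" where
  "is_bimodule S R M \<longleftrightarrow> left_module S M \<and> right_module R M \<and>
     (\<forall>a\<in>carrier S. \<forall>x\<in>carrier M. \<forall>b\<in>carrier R.
        (a \<odot>\<^bsub>M\<^esub> x) \<odot>\<^sub>r\<^bsub>M\<^esub> b = a \<odot>\<^bsub>M\<^esub> (x \<odot>\<^sub>r\<^bsub>M\<^esub> b))"

definition left_hom ::
    "('a, 'e) ring_scheme \<Rightarrow> ('a, 'b, 'f) module_scheme \<Rightarrow> ('a, 'c, 'g) module_scheme \<Rightarrow> ('b \<Rightarrow> 'c) set" where
  "left_hom R X Y = {f \<in> carrier X \<rightarrow> carrier Y.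
     (\<forall>x\<in>carrier X. \<forall>y\<in>carrier X. f (x \<oplus>\<^bsub>X\<^esub> y) = f x \<oplus>\<^bsub>Y\<^esub> f y) \<and>
     (\<forall>a\<in>carrier R. \<forall>x\<in>carrier X. f (a \<odot>\<^bsub>X\<^esub> x) = a \<odot>\<^bsub>Y\<^esub> f x)}"

definition right_hom ::
    "('c, 'e) ring_scheme \<Rightarrow> ('a, 'c, 'b, 'f) bimodule_scheme \<Rightarrow> ('a', 'c, 'b', 'g) bimodule_scheme
      \<Rightarrow> ('b \<Rightarrow> 'b') set" where
  "right_hom R X Y = {f \<in> carrier X \<rightarrow> carrier Y.
     (\<forall>x\<in>carrier X. \<forall>y\<in>carrier X. f (x \<oplus>\<^bsub>X\<^esub> y) = f x \<oplus>\<^bsub>Y\<^esub> f y) \<and>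
     (\<forall>a\<in>carrier R. \<forall>x\<in>carrier X. f (x \<odot>\<^sub>r\<^bsub>X\<^esub> a) = f x \<odot>\<^sub>r\<^bsub>Y\<^esub> a)}"

text \<open>The ring \<open>S\<close> as a bimodule, by restriction of scalars along \<open>f\<close> on the left and \<open>g\<close> on the right.\<close>

definition ring_bimodule ::
    "('s, 'e) ring_scheme \<Rightarrow> ('a \<Rightarrow> 's) \<Rightarrow> ('c \<Rightarrow> 's) \<Rightarrow> ('a, 'c, 's) bimodule" where
  "ring_bimodule S f g =
    \<lparr>carrier = carrier S, mult = undefined, one = undefined, ring.zero = \<zero>\<^bsub>S\<^esub>, add = add S,
     smult = (\<lambda>a s. f a \<otimes>\<^bsub>S\<^esub> s), rsmult = (\<lambda>s c. s \<otimes>\<^bsub>S\<^esub> g c)\<rparr>"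


section \<open>Tensor products and modules of homomorphisms\<close>

text \<open>
  \<open>N \<otimes>\<^sub>R X\<close>, for a right module \<open>N\<close> and a left module \<open>X\<close>, is the free abelian group on
  \<open>N \<times> X\<close> modulo \<open>tensor_rel R N X\<close>.
\<close>

definition tensor_rel ::
    "('r, 'e) ring_scheme \<Rightarrow> ('s, 'r, 'n, 'f) bimodule_scheme \<Rightarrow> ('r, 'x, 'g) module_scheme
      \<Rightarrow> ('n \<times> 'x \<Rightarrow>\<^sub>0 int) set" where
  "tensor_rel R N X = generate (free_Abelian_group (carrier N \<times> carrier X))
     ({frag_of (a \<oplus>\<^bsub>N\<^esub> b, x) - frag_of (a, x) - frag_of (b, x) | a b x.
         a \<in> carrier N \<and> b \<in> carrier N \<and> x \<in> carrier X} \<union>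
      {frag_of (a, x \<oplus>\<^bsub>X\<^esub> y) - frag_of (a, x) - frag_of (a, y) | a x y.
         a \<in> carrier N \<and> x \<in> carrier X \<and> y \<in> carrier X} \<union>
      {frag_of (a \<odot>\<^sub>r\<^bsub>N\<^esub> r, x) - frag_of (a, r \<odot>\<^bsub>X\<^esub> x) | a r x.
         a \<in> carrier N \<and> r \<in> carrier R \<and> x \<in> carrier X})"

definition tensor_class ::
    "('r, 'e) ring_scheme \<Rightarrow> ('s, 'r, 'n, 'f) bimodule_scheme \<Rightarrow> ('r, 'x, 'g) module_scheme
      \<Rightarrow> ('n \<times> 'x \<Rightarrow>\<^sub>0 int) \<Rightarrow> ('n \<times> 'x \<Rightarrow>\<^sub>0 int) set" where
  "tensor_class R N X u = tensor_rel R N X #>\<^bsub>free_Abelian_group (carrier N \<times> carrier X)\<^esub> u"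

text \<open>
  The map \<open>f \<otimes> g\<close> with codomain \<open>N \<otimes>\<^sub>R X\<close>. Its argument \<open>c\<close> is an element of a tensor product,
  i.e. a coset, all of whose members have the same image.
\<close>

definition tensor_map ::
    "('r, 'e) ring_scheme \<Rightarrow> ('s, 'r, 'n, 'f) bimodule_scheme \<Rightarrow> ('r, 'x, 'g) module_scheme
      \<Rightarrow> ('a \<Rightarrow> 'n) \<Rightarrow> ('b \<Rightarrow> 'x) \<Rightarrow> ('a \<times> 'b \<Rightarrow>\<^sub>0 int) set \<Rightarrow> ('n \<times> 'x \<Rightarrow>\<^sub>0 int) set" where
  "tensor_map R N X f g c =
     the_elem ((\<lambda>u. tensor_class R N X (frag_extend (\<lambda>(a, x). frag_of (f a, g x)) u)) ` c)"

text \<open>For an \<open>S\<close>-\<open>R\<close>-bimodule \<open>N\<close>, this is \<open>N \<otimes>\<^sub>R X\<close> as a left \<open>S\<close>-module.\<close>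

definition tensor_module ::
    "('r, 'e) ring_scheme \<Rightarrow> ('s, 'r, 'n, 'f) bimodule_scheme \<Rightarrow> ('r, 'x, 'g) module_scheme
      \<Rightarrow> ('s, ('n \<times> 'x \<Rightarrow>\<^sub>0 int) set) module" where
  "tensor_module R N X =
    (let Q = free_Abelian_group (carrier N \<times> carrier X) Mod tensor_rel R N X in
      \<lparr>carrier = carrier Q, mult = undefined, one = undefined, ring.zero = \<one>\<^bsub>Q\<^esub>, add = monoid.mult Q,
       smult = (\<lambda>s. tensor_map R N X (smult N s) id)\<rparr>)"

definition tensor_bimodule ::
    "('r, 'e) ring_scheme \<Rightarrow> ('s, 'r, 'n, 'f) bimodule_scheme \<Rightarrow> ('r, 't, 'x, 'g) bimodule_scheme
      \<Rightarrow> ('s, 't, ('n \<times> 'x \<Rightarrow>\<^sub>0 int) set) bimodule" where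
  "tensor_bimodule R N X = module.extend (tensor_module R N X)
     \<lparr>rsmult = (\<lambda>c t. tensor_map R N X id (\<lambda>x. x \<odot>\<^sub>r\<^bsub>X\<^esub> t) c)\<rparr>"

text \<open>For an \<open>R\<close>-\<open>S\<close>-bimodule \<open>B\<close>, this is \<open>Hom\<^sub>R(B, X)\<close> as a left \<open>S\<close>-module.\<close>

definition hom_module ::
    "('r, 'e) ring_scheme \<Rightarrow> ('r, 's, 'b, 'f) bimodule_scheme \<Rightarrow> ('r, 'x, 'g) module_scheme
      \<Rightarrow> ('s, 'b \<Rightarrow> 'x) module" where
  "hom_module R B X =
    \<lparr>carrier = left_hom R B X \<inter> extensional (carrier B), mult = undefined, one = undefined,
     ring.zero = (\<lambda>b\<in>carrier B. \<zero>\<^bsub>X\<^esub>), add = (\<lambda>f g. \<lambda>b\<in>carrier B. f b \<oplus>\<^bsub>X\<^esub> g b),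
     smult = (\<lambda>s f. \<lambda>b\<in>carrier B. f (b \<odot>\<^sub>r\<^bsub>B\<^esub> s))\<rparr>"


section \<open>Projective, injective and flat modules; homological dimensions\<close>

text \<open>
  Quantifying over all \<open>R\<close>-modules means quantifying over a type large enough to hold the ones that
  matter. The type \<open>('r, 'x) univ\<close> has cardinality \<open>\<kappa> = (|'x| + 1) ^ \<lambda>\<close>, \<open>\<lambda> = max |'r| \<aleph>\<^sub>0\<close>, whence
  \<open>\<kappa> ^ \<lambda> = \<kappa>\<close>, \<open>|'r| \<le> \<kappa>\<close> and \<open>|'x| \<le> \<kappa>\<close>. It therefore has room for the free module on any
  module of type \<open>'x\<close>, for all one-sided ideals of \<open>R\<close> (so that Baer's criteria for injectivity and
  flatness apply), for kernels and cokernels, and for injective hulls, the cardinality of which is at most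
  \<open>\<kappa> ^ \<lambda>\<close>. Hence the notions below agree with those that refer to all modules.
\<close>

type_synonym ('r, 'x) univ = "'r list \<Rightarrow> 'x option"

definition projective_module :: "('r, 'e) ring_scheme \<Rightarrow> ('r, 'p, 'f) module_scheme \<Rightarrow> bool" where
  "projective_module R P \<longleftrightarrow> left_module R P \<and>
     (\<forall>(B :: ('r, ('r, 'p) univ) module) (C :: ('r, ('r, 'p) univ) module) g f.
        left_module R B \<longrightarrow> left_module R C \<longrightarrow>
        g \<in> left_hom R B C \<longrightarrow> g ` carrier B = carrier C \<longrightarrow> f \<in> left_hom R P C \<longrightarrow>
        (\<exists>h\<in>left_hom R P B. \<forall>x\<in>carrier P. g (h x) = f x))"

definition injective_module :: "('r, 'e) ring_scheme \<Rightarrow> ('r, 'i, 'f) module_scheme \<Rightarrow> bool" where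
  "injective_module R I \<longleftrightarrow> left_module R I \<and>
     (\<forall>(A :: ('r, ('r, 'i) univ) module) (B :: ('r, ('r, 'i) univ) module) g f.
        left_module R A \<longrightarrow> left_module R B \<longrightarrow>
        g \<in> left_hom R A B \<longrightarrow> inj_on g (carrier A) \<longrightarrow> f \<in> left_hom R A I \<longrightarrow>
        (\<exists>h\<in>left_hom R B I. \<forall>x\<in>carrier A. h (g x) = f x))"

text \<open>The type \<^typ>\<open>unit\<close> stands in for the absent left scalars of the right modules \<open>A\<close> and \<open>B\<close>.\<close>

definition flat_module :: "('r, 'e) ring_scheme \<Rightarrow> ('r, 'p, 'f) module_scheme \<Rightarrow> bool" where
  "flat_module R P \<longleftrightarrow> left_module R P \<and>
     (\<forall>(A :: (unit, 'r, ('r, 'p) univ) bimodule) (B :: (unit, 'r, ('r, 'p) univ) bimodule) g.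
        right_module R A \<longrightarrow> right_module R B \<longrightarrow>
        g \<in> right_hom R A B \<longrightarrow> inj_on g (carrier A) \<longrightarrow>
        inj_on (tensor_map R B P g id) (carrier (tensor_module R A P)))"

text \<open>Exactness of \<open>\<dots> \<rightarrow> P 2 \<rightarrow> P 1 \<rightarrow> P 0 \<rightarrow> X \<rightarrow> 0\<close>, with \<open>d i : P (i + 1) \<rightarrow> P i\<close> and \<open>e : P 0 \<rightarrow> X\<close>.\<close>

definition left_resolution ::
    "('r, 'e) ring_scheme \<Rightarrow> ('r, 'x, 'f) module_scheme \<Rightarrow>
      (nat \<Rightarrow> ('r, 'u) module) \<Rightarrow> (nat \<Rightarrow> 'u \<Rightarrow> 'u) \<Rightarrow> ('u \<Rightarrow> 'x) \<Rightarrow> bool" where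
  "left_resolution R X P d e \<longleftrightarrow>
     (\<forall>i. left_module R (P i)) \<and>
     e \<in> left_hom R (P 0) X \<and> (\<forall>i. d i \<in> left_hom R (P (Suc i)) (P i)) \<and>
     e ` carrier (P 0) = carrier X \<and>
     d 0 ` carrier (P 1) = a_kernel (P 0) X e \<and>
     (\<forall>i. d (Suc i) ` carrier (P (Suc (Suc i))) = a_kernel (P (Suc i)) (P i) (d i))"

text \<open>Exactness of \<open>0 \<rightarrow> X \<rightarrow> I 0 \<rightarrow> I 1 \<rightarrow> I 2 \<rightarrow> \<dots>\<close>, with \<open>d i : I i \<rightarrow> I (i + 1)\<close> and \<open>e : X \<rightarrow> I 0\<close>.\<close>

definition right_resolution ::
    "('r, 'e) ring_scheme \<Rightarrow> ('r, 'x, 'f) module_scheme \<Rightarrow>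
      (nat \<Rightarrow> ('r, 'u) module) \<Rightarrow> (nat \<Rightarrow> 'u \<Rightarrow> 'u) \<Rightarrow> ('x \<Rightarrow> 'u) \<Rightarrow> bool" where
  "right_resolution R X I d e \<longleftrightarrow>
     (\<forall>i. left_module R (I i)) \<and>
     e \<in> left_hom R X (I 0) \<and> (\<forall>i. d i \<in> left_hom R (I i) (I (Suc i))) \<and>
     inj_on e (carrier X) \<and>
     e ` carrier X = a_kernel (I 0) (I 1) (d 0) \<and>
     (\<forall>i. d i ` carrier (I i) = a_kernel (I (Suc i)) (I (Suc (Suc i))) (d (Suc i)))"

text \<open>With these conventions the zero module has dimension \<open>0\<close>; \<open>\<infinity>\<close> is the infimum of the empty set.\<close>

definition pd :: "('r, 'e) ring_scheme \<Rightarrow> ('r, 'x, 'f) module_scheme \<Rightarrow> enat" where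
  "pd R X = Inf {enat k | k.
     \<exists>(P :: nat \<Rightarrow> ('r, ('r, 'x) univ) module) d e.
       left_resolution R X P d e \<and> (\<forall>i. projective_module R (P i)) \<and>
       (\<forall>i>k. carrier (P i) = {\<zero>\<^bsub>P i\<^esub>})}"

definition fd :: "('r, 'e) ring_scheme \<Rightarrow> ('r, 'x, 'f) module_scheme \<Rightarrow> enat" where
  "fd R X = Inf {enat k | k.
     \<exists>(P :: nat \<Rightarrow> ('r, ('r, 'x) univ) module) d e.
       left_resolution R X P d e \<and> (\<forall>i. flat_module R (P i)) \<and>
       (\<forall>i>k. carrier (P i) = {\<zero>\<^bsub>P i\<^esub>})}"

definition injd :: "('r, 'e) ring_scheme \<Rightarrow> ('r, 'x, 'f) module_scheme \<Rightarrow> enat" where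
  "injd R X = Inf {enat k | k.
     \<exists>(I :: nat \<Rightarrow> ('r, ('r, 'x) univ) module) d e.
       right_resolution R X I d e \<and> (\<forall>i. injective_module R (I i)) \<and>
       (\<forall>i>k. carrier (I i) = {\<zero>\<^bsub>I i\<^esub>})}"


section \<open>Tor and Ext\<close>

text \<open>
  \<open>Tor R N X j\<close> is the homology of \<open>N \<otimes>\<^sub>R P\<close> at \<open>j\<close> for a chosen projective resolution \<open>P\<close> of \<open>X\<close>,
  and \<open>Ext R N X j\<close> the cohomology of \<open>Hom\<^sub>R(N, I)\<close> at \<open>j\<close> for a chosen injective resolution \<open>I\<close> of \<open>X\<close>.
\<close>

definition projective_resolution ::
    "('r, 'e) ring_scheme \<Rightarrow> ('r, 'x, 'f) module_scheme \<Rightarrow>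
      (nat \<Rightarrow> ('r, ('r, 'x) univ) module) \<times> (nat \<Rightarrow> ('r, 'x) univ \<Rightarrow> ('r, 'x) univ) \<times> (('r, 'x) univ \<Rightarrow> 'x)" where
  "projective_resolution R X = (SOME (P, d, e).
     left_resolution R X P d e \<and> (\<forall>i. projective_module R (P i)))"

definition injective_resolution ::
    "('r, 'e) ring_scheme \<Rightarrow> ('r, 'x, 'f) module_scheme \<Rightarrow>
      (nat \<Rightarrow> ('r, ('r, 'x) univ) module) \<times> (nat \<Rightarrow> ('r, 'x) univ \<Rightarrow> ('r, 'x) univ) \<times> ('x \<Rightarrow> ('r, 'x) univ)" where
  "injective_resolution R X = (SOME (I, d, e).
     right_resolution R X I d e \<and> (\<forall>i. injective_module R (I i)))"

definition Tor ::
    "('r, 'e) ring_scheme \<Rightarrow> ('s, 'r, 'n, 'f) bimodule_scheme \<Rightarrow> ('r, 'x, 'g) module_scheme \<Rightarrow> nat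
      \<Rightarrow> ('n \<times> ('r, 'x) univ \<Rightarrow>\<^sub>0 int) set set monoid" where
  "Tor R N X j =
    (let (P, d, e) = projective_resolution R X;
         C = (\<lambda>i. tensor_module R N (P i));
         D = (\<lambda>i. tensor_map R N (P i) id (d i));
         Z = (case j of 0 \<Rightarrow> carrier (C 0) | Suc i \<Rightarrow> a_kernel (C (Suc i)) (C i) (D i))
     in (C j)\<lparr>carrier := Z\<rparr> A_Mod (D j ` carrier (C (Suc j))))"

definition Ext ::
    "('r, 'e) ring_scheme \<Rightarrow> ('r, 's, 'n, 'f) bimodule_scheme \<Rightarrow> ('r, 'x, 'g) module_scheme \<Rightarrow> nat
      \<Rightarrow> ('n \<Rightarrow> ('r, 'x) univ) set monoid" where
  "Ext R N X j =
    (let (I, d, e) = injective_resolution R X;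
         C = (\<lambda>i. hom_module R N (I i));
         D = (\<lambda>i. compose (carrier N) (d i));
         B = (case j of 0 \<Rightarrow> {\<zero>\<^bsub>C 0\<^esub>} | Suc i \<Rightarrow> D i ` carrier (C i))
     in (C j)\<lparr>carrier := a_kernel (C j) (C (Suc j)) (D j)\<rparr> A_Mod B)"


section \<open>Tensor powers and the n-trivial extension\<close>

text \<open>
  The tensor powers of \<open>M\<close> have to live in one common type. An element of \<open>M \<otimes>\<^sub>R N\<close>, with
  \<open>N\<close> a tensor power already relabelled to \<open>('r, 'm) tens\<close>, is a finite sum of elements \<open>m \<otimes> x\<close>,
  and is relabelled to \<open>Formal ps\<close> with \<open>ps\<close> a chosen list of the pairs \<open>(m, x)\<close> of such a sum.
\<close>

datatype ('r, 'm) tens =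
    Scalar (the_scalar: 'r)
  | Vector (the_vector: 'm)
  | Formal (the_pairs: "('m \<times> ('r, 'm) tens) list")

definition tensor_code ::
    "('r, 'e) ring_scheme \<Rightarrow> ('r, 'r, 'm, 'f) bimodule_scheme \<Rightarrow> ('r, 'r, ('r, 'm) tens, 'g) bimodule_scheme
      \<Rightarrow> ('m \<times> ('r, 'm) tens \<Rightarrow>\<^sub>0 int) set \<Rightarrow> ('r, 'm) tens" where
  "tensor_code R M N c = Formal (SOME ps.
     set ps \<subseteq> carrier M \<times> carrier N \<and> tensor_class R M N (sum_list (map frag_of ps)) = c)"

text \<open>Relabelling the elements of a bimodule along a map \<open>f\<close> that is injective on its carrier.\<close>

definition relabel ::
    "('b \<Rightarrow> 'd) \<Rightarrow> ('a, 'c, 'b) bimodule \<Rightarrow> ('a, 'c, 'd) bimodule" where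
  "relabel f B =
    (let g = inv_into (carrier B) f in
      \<lparr>carrier = f ` carrier B, mult = undefined, one = undefined, ring.zero = f \<zero>\<^bsub>B\<^esub>,
       add = (\<lambda>x y. f (g x \<oplus>\<^bsub>B\<^esub> g y)), smult = (\<lambda>a x. f (a \<odot>\<^bsub>B\<^esub> g x)),
       rsmult = (\<lambda>x c. f (g x \<odot>\<^sub>r\<^bsub>B\<^esub> c))\<rparr>)"

fun tensor_power ::
    "'r ring \<Rightarrow> ('r, 'r, 'm) bimodule \<Rightarrow> nat \<Rightarrow> ('r, 'r, ('r, 'm) tens) bimodule" where
  "tensor_power R M 0 = relabel Scalar (ring_bimodule R id id)"
| "tensor_power R M (Suc 0) = relabel Vector M"
| "tensor_power R M (Suc (Suc i)) =
     relabel (tensor_code R M (tensor_power R M (Suc i))) (tensor_bimodule R M (tensor_power R M (Suc i)))"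

text \<open>The element \<open>m \<otimes> y\<close> of \<open>M\<^bsup>\<otimes>(j + 1)\<^esup>\<close>, for \<open>m\<close> in \<open>M\<close> and \<open>y\<close> in \<open>M\<^bsup>\<otimes>j\<^esup>\<close>; here \<open>m \<otimes> r = m r\<close>.\<close>

fun tensor_cons ::
    "'r ring \<Rightarrow> ('r, 'r, 'm) bimodule \<Rightarrow> nat \<Rightarrow> 'm \<Rightarrow> ('r, 'm) tens \<Rightarrow> ('r, 'm) tens" where
  "tensor_cons R M 0 m y = Vector (m \<odot>\<^sub>r\<^bsub>M\<^esub> the_scalar y)"
| "tensor_cons R M (Suc j) m y =
     tensor_code R M (tensor_power R M (Suc j)) (tensor_class R M (tensor_power R M (Suc j)) (frag_of (m, y)))"

text \<open>
  The canonical map \<open>M\<^bsup>\<otimes>i\<^esup> \<times> M\<^bsup>\<otimes>j\<^esup> \<rightarrow> M\<^bsup>\<otimes>(i + j)\<^esup>\<close>, i.e. \<open>(x, y) \<mapsto> x \<otimes> y\<close> followed by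
  \<open>R \<otimes> N = N = N \<otimes> R\<close> and associativity: \<open>(\<Sum> m \<otimes> x) \<otimes> y = \<Sum> m \<otimes> (x \<otimes> y)\<close>.
\<close>

fun tensor_mult ::
    "'r ring \<Rightarrow> ('r, 'r, 'm) bimodule \<Rightarrow> nat \<Rightarrow> nat \<Rightarrow> ('r, 'm) tens \<Rightarrow> ('r, 'm) tens \<Rightarrow> ('r, 'm) tens" where
  "tensor_mult R M 0 j x y = the_scalar x \<odot>\<^bsub>tensor_power R M j\<^esub> y"
| "tensor_mult R M (Suc 0) j x y = tensor_cons R M j (the_vector x) y"
| "tensor_mult R M (Suc (Suc i)) j x y =
     foldr (\<lambda>(m, x') s. tensor_cons R M (Suc i + j) m (tensor_mult R M (Suc i) j x' y)
                          \<oplus>\<^bsub>tensor_power R M (Suc (Suc i) + j)\<^esub> s)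
       (the_pairs x) \<zero>\<^bsub>tensor_power R M (Suc (Suc i) + j)\<^esub>"

definition scalar_emb :: "nat \<Rightarrow> 'r ring \<Rightarrow> ('r, 'r, 'm) bimodule \<Rightarrow> 'r \<Rightarrow> nat \<Rightarrow> ('r, 'm) tens" where
  "scalar_emb n R M r = (\<lambda>k\<in>{..n}. if k = 0 then Scalar r else \<zero>\<^bsub>tensor_power R M k\<^esub>)"

definition triv_ext :: "nat \<Rightarrow> 'r ring \<Rightarrow> ('r, 'r, 'm) bimodule \<Rightarrow> (nat \<Rightarrow> ('r, 'm) tens) ring" where
  "triv_ext n R M =
    \<lparr>carrier = (\<Pi>\<^sub>E k\<in>{..n}. carrier (tensor_power R M k)),
     mult = (\<lambda>u v. \<lambda>k\<in>{..n}. \<Oplus>\<^bsub>tensor_power R M k\<^esub>i\<in>{..k}. tensor_mult R M i (k - i) (u i) (v (k - i))),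
     one = scalar_emb n R M \<one>\<^bsub>R\<^esub>,
     ring.zero = (\<lambda>k\<in>{..n}. \<zero>\<^bsub>tensor_power R M k\<^esub>),
     add = (\<lambda>u v. \<lambda>k\<in>{..n}. u k \<oplus>\<^bsub>tensor_power R M k\<^esub> v k)\<rparr>"

definition T_functor ::
    "nat \<Rightarrow> 'r ring \<Rightarrow> ('r, 'r, 'm) bimodule \<Rightarrow> ('r, 'x) module
      \<Rightarrow> (nat \<Rightarrow> ('r, 'm) tens, ((nat \<Rightarrow> ('r, 'm) tens) \<times> 'x \<Rightarrow>\<^sub>0 int) set) module" where
  "T_functor n R M X = tensor_module R (ring_bimodule (triv_ext n R M) id (scalar_emb n R M)) X"

definition H_functor ::
    "nat \<Rightarrow> 'r ring \<Rightarrow> ('r, 'r, 'm) bimodule \<Rightarrow> ('r, 'x) module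
      \<Rightarrow> (nat \<Rightarrow> ('r, 'm) tens, (nat \<Rightarrow> ('r, 'm) tens) \<Rightarrow> 'x) module" where
  "H_functor n R M X = hom_module R (ring_bimodule (triv_ext n R M) (scalar_emb n R M) id) X"

end

theory Submission
  imports Defs
begin

text \<open>
  Let \<open>S\<close> be the n-trivial extension. A projective resolution \<open>P\<close> of \<open>X\<close> over \<open>R\<close> stays exact under
  \<open>S \<otimes>\<^sub>R -\<close>, because \<open>S\<close> is, as a right \<open>R\<close>-module, the direct sum of the tensor powers of \<open>M\<close>; so
  \<open>S \<otimes>\<^sub>R P\<close> is a projective resolution of \<open>S \<otimes>\<^sub>R X\<close>. That the dimension is at most \<open>k\<close> can be read off
  from any one projective resolution: the image of \<open>P (k + 1)\<close> has to be a direct summand of \<open>P k\<close>.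
  A splitting passes from \<open>P\<close> to \<open>S \<otimes>\<^sub>R P\<close> by functoriality, and back because the ring map \<open>R \<rightarrow> S\<close>
  has a retraction \<open>S \<rightarrow> R\<close>. Injective dimension is treated dually, with \<open>Hom\<^sub>R(S, -)\<close>. For flat dimension
  the resolution \<open>P\<close> is replaced by its character modules \<open>Hom(P, Q/Z)\<close>, which are injective if and only if
  the terms of \<open>P\<close> are flat.
\<close>

text \<open>The definitions of projective, injective and flat modules quantify over a single
  universe type, and this type changes with the type of the module; so at first nothing can be
  lifted or extended along maps of modules of other types, such as induced ones. Two descriptions
  without universes remove the obstacle: a projective module is a retract of a free one, and an
  injective one satisfies Baer's criterion, which mentions ideals only. What remains of the
  universes is a question of cardinality: the terms of induced and coinduced resolutions are
  relabelled along injections into the types that \<open>pd\<close>, \<open>fd\<close> and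
  \<open>injd\<close> prescribe. The hypotheses on Tor and Ext concern the positive tensor powers;
  degree zero is a copy of the ring and preserves exactness for free. A flat resolution cannot be
  compared with a projective one by chain maps in both directions, because flat modules have no
  lifting property. Characters turn both into injective resolutions of the same module, where the
  comparison works.\<close>

abbreviation (input) sub_zero ("\<zero>\<^sub>_" [1000] 1000) where "\<zero>\<^sub>G \<equiv> ring.zero G"
abbreviation (input) sub_one ("\<one>\<^sub>_" [1000] 1000) where "\<one>\<^sub>G \<equiv> monoid.one G"
abbreviation (input) sub_add ("(_ \<oplus>\<^sub>_ _)" [65, 1000, 66] 65) where "x \<oplus>\<^sub>G y \<equiv> ring.add G x y"
abbreviation (input) sub_mult ("(_ \<otimes>\<^sub>_ _)" [70, 1000, 71] 70) where "x \<otimes>\<^sub>G y \<equiv> monoid.mult G x y"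
abbreviation (input) sub_smult ("(_ \<odot>\<^sub>_ _)" [70, 1000, 71] 70) where "x \<odot>\<^sub>G y \<equiv> module.smult G x y"
abbreviation (input) sub_rsmult ("(_ \<odot>\<^sub>r\<^sub>_ _)" [70, 1000, 71] 70) where "x \<odot>\<^sub>r\<^sub>G y \<equiv> rsmult G x y"
abbreviation (input) sub_minus ("(_ \<ominus>\<^sub>_ _)" [65, 1000, 66] 65) where "x \<ominus>\<^sub>G y \<equiv> a_minus G x y"
abbreviation (input) sub_inv ("(\<ominus>\<^sub>_ _)" [1000, 81] 80) where "\<ominus>\<^sub>G x \<equiv> a_inv G x"

lemmas ring_rules = ring.ring_simprules

section \<open>Additive maps and submodules\<close>

lemmas ag_closed = abelian_monoid.a_closed[OF abelian_group.axioms(1)]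
lemmas ag_zero = abelian_monoid.zero_closed[OF abelian_group.axioms(1)]
lemmas ag_l_zero = abelian_monoid.l_zero[OF abelian_group.axioms(1)]
lemmas ag_r_zero = abelian_monoid.r_zero[OF abelian_group.axioms(1)]
lemmas ag_assoc = abelian_monoid.a_assoc[OF abelian_group.axioms(1)]
lemmas ag_comm = abelian_monoid.a_comm[OF abelian_group.axioms(1)]
lemmas ag_lcomm = abelian_monoid.a_lcomm[OF abelian_group.axioms(1)]
lemmas ag_inv = abelian_group.a_inv_closed
lemmas ag_diff = abelian_group.minus_closed
lemmas ag_neg_add = abelian_group.minus_add
lemmas ag_l_neg = abelian_group.l_neg
lemmas ag_r_neg = abelian_group.r_neg

lemma
  assumes "abelian_group G"
  shows ag_neg_zero: "\<ominus>\<^sub>G \<zero>\<^sub>G = \<zero>\<^sub>G"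
    and ag_diff_self: "x \<in> carrier G ==> x \<ominus>\<^sub>G x = \<zero>\<^sub>G"
    and ag_diff_zero: "x \<in> carrier G ==> x \<ominus>\<^sub>G \<zero>\<^sub>G = x"
proof -
  interpret abelian_group G by fact
  show "\<ominus>\<^sub>G \<zero>\<^sub>G = \<zero>\<^sub>G" "x \<in> carrier G ==> x \<ominus>\<^sub>G x = \<zero>\<^sub>G" "x \<in> carrier G ==> x \<ominus>\<^sub>G \<zero>\<^sub>G = x"
    by (simp_all add: r_neg minus_eq)
qed

lemma
  assumes "abelian_group G"
  shows ag_neg_diff: "x \<in> carrier G ==> y \<in> carrier G ==> \<ominus>\<^sub>G (x \<ominus>\<^sub>G y) = y \<ominus>\<^sub>G x"
    and ag_diff_eq_zero: "x \<in> carrier G ==> y \<in> carrier G ==> x \<ominus>\<^sub>G y = \<zero>\<^sub>G \<longleftrightarrow> x = y"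
    and ag_diff_add: "x \<in> carrier G ==> y \<in> carrier G ==> x \<ominus>\<^sub>G y \<oplus>\<^sub>G y = x"
    and ag_diff_trans: "x \<in> carrier G ==> y \<in> carrier G ==> z \<in> carrier G ==>
      (x \<ominus>\<^sub>G y) \<oplus>\<^sub>G (y \<ominus>\<^sub>G z) = x \<ominus>\<^sub>G z"
    and ag_add_diff_add: "x \<in> carrier G ==> y \<in> carrier G ==> z \<in> carrier G ==> w \<in> carrier G ==>
      (x \<oplus>\<^sub>G y) \<ominus>\<^sub>G (z \<oplus>\<^sub>G w) = (x \<ominus>\<^sub>G z) \<oplus>\<^sub>G (y \<ominus>\<^sub>G w)"
    and ag_add4: "x \<in> carrier G ==> y \<in> carrier G ==> z \<in> carrier G ==> w \<in> carrier G ==>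
      (x \<oplus>\<^sub>G y) \<oplus>\<^sub>G (z \<oplus>\<^sub>G w) = (x \<oplus>\<^sub>G z) \<oplus>\<^sub>G (y \<oplus>\<^sub>G w)"
    and ag_cancel: "x \<in> carrier G ==> y \<in> carrier G ==> z \<in> carrier G ==>
      x \<oplus>\<^sub>G y = x \<oplus>\<^sub>G z \<longleftrightarrow> y = z"
    and ag_eq_neg: "x \<in> carrier G ==> y \<in> carrier G ==> x \<oplus>\<^sub>G y = \<zero>\<^sub>G ==> y = \<ominus>\<^sub>G x"
proof -
  interpret abelian_group G by fact
  show d0: "x \<in> carrier G ==> y \<in> carrier G ==> x \<ominus>\<^sub>G y = \<zero>\<^sub>G \<longleftrightarrow> x = y" for x y
    by (metis a_inv_closed add.inv_equality minus_eq minus_minus r_neg)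
  show "x \<in> carrier G ==> y \<in> carrier G ==> \<ominus>\<^sub>G (x \<ominus>\<^sub>G y) = y \<ominus>\<^sub>G x"
    by (simp add: minus_eq minus_add a_comm)
  show "x \<in> carrier G ==> y \<in> carrier G ==> x \<ominus>\<^sub>G y \<oplus>\<^sub>G y = x"
    by (simp_all add: minus_eq a_assoc l_neg r_neg)
  show "x \<in> carrier G ==> y \<in> carrier G ==> z \<in> carrier G ==>
      (x \<ominus>\<^sub>G y) \<oplus>\<^sub>G (y \<ominus>\<^sub>G z) = x \<ominus>\<^sub>G z"
    by (simp add: minus_eq a_assoc r_neg1)
  show "x \<in> carrier G ==> y \<in> carrier G ==> z \<in> carrier G ==> w \<in> carrier G ==>
      (x \<oplus>\<^sub>G y) \<ominus>\<^sub>G (z \<oplus>\<^sub>G w) = (x \<ominus>\<^sub>G z) \<oplus>\<^sub>G (y \<ominus>\<^sub>G w)"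
    "x \<in> carrier G ==> y \<in> carrier G ==> z \<in> carrier G ==> w \<in> carrier G ==>
      (x \<oplus>\<^sub>G y) \<oplus>\<^sub>G (z \<oplus>\<^sub>G w) = (x \<oplus>\<^sub>G z) \<oplus>\<^sub>G (y \<oplus>\<^sub>G w)"
    by (simp_all add: minus_eq minus_add a_ac)
  show "x \<in> carrier G ==> y \<in> carrier G ==> z \<in> carrier G ==>
      x \<oplus>\<^sub>G y = x \<oplus>\<^sub>G z \<longleftrightarrow> y = z"
    by auto
  show "x \<in> carrier G ==> y \<in> carrier G ==> x \<oplus>\<^sub>G y = \<zero>\<^sub>G ==> y = \<ominus>\<^sub>G x"
    by (metis a_comm minus_equality)
qed

lemma abelian_groupI':
  assumes "\<And>x y. x \<in> carrier G ==> y \<in> carrier G ==> x \<oplus>\<^sub>G y \<in> carrier G"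
    and "\<zero>\<^sub>G \<in> carrier G"
    and "\<And>x y z. x \<in> carrier G ==> y \<in> carrier G ==> z \<in> carrier G ==>
      x \<oplus>\<^sub>G y \<oplus>\<^sub>G z = x \<oplus>\<^sub>G (y \<oplus>\<^sub>G z)"
    and "\<And>x y. x \<in> carrier G ==> y \<in> carrier G ==> x \<oplus>\<^sub>G y = y \<oplus>\<^sub>G x"
    and "\<And>x. x \<in> carrier G ==> \<zero>\<^sub>G \<oplus>\<^sub>G x = x"
    and "\<And>x. x \<in> carrier G ==> \<exists>y\<in>carrier G. y \<oplus>\<^sub>G x = \<zero>\<^sub>G"
  shows "abelian_group G"
  using assms by (intro abelian_groupI) auto

text \<open>Formulated on \<open>ring_scheme\<close>, so that rings, modules and bimodules over any
  scalars count as abelian groups; module maps, characters and maps out of tensor products can then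
  be compared as additive maps.\<close>

definition ahom :: "('a, 'e) ring_scheme => ('b, 'f) ring_scheme => ('a => 'b) set" where
  "ahom G H = {f \<in> carrier G \<rightarrow> carrier H.
     \<forall>x\<in>carrier G. \<forall>y\<in>carrier G. f (x \<oplus>\<^sub>G y) = f x \<oplus>\<^sub>H f y}"

lemma ahomI:
  assumes "\<And>x. x \<in> carrier G ==> f x \<in> carrier H"
    and "\<And>x y. x \<in> carrier G ==> y \<in> carrier G ==> f (x \<oplus>\<^sub>G y) = f x \<oplus>\<^sub>H f y"
  shows "f \<in> ahom G H"
  using assms by (auto simp: ahom_def)

lemma ahom_closed: "f \<in> ahom G H ==> x \<in> carrier G ==> f x \<in> carrier H"
  by (auto simp: ahom_def)

lemma ahom_add: "f \<in> ahom G H ==> x \<in> carrier G ==> y \<in> carrier G ==> f (x \<oplus>\<^sub>G y) = f x \<oplus>\<^sub>H f y"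
  by (auto simp: ahom_def)

lemma ahom_zero:
  assumes "f \<in> ahom G H" "abelian_group G" "abelian_group H"
  shows "f \<zero>\<^sub>G = \<zero>\<^sub>H"
proof -
  have "f \<zero>\<^sub>G \<oplus>\<^sub>H f \<zero>\<^sub>G = f \<zero>\<^sub>G \<oplus>\<^sub>H \<zero>\<^sub>H"
    using assms by (metis ahom_add ahom_closed ag_zero ag_r_zero)
  then show ?thesis
    using assms by (simp add: ag_cancel ahom_closed ag_zero)
qed

lemma ahom_neg:
  assumes "f \<in> ahom G H" "abelian_group G" "abelian_group H" "x \<in> carrier G"
  shows "f (\<ominus>\<^sub>G x) = \<ominus>\<^sub>H f x"
  using assms by (intro ag_eq_neg) (simp_all add: ahom_closed ag_inv ag_r_neg ahom_zero flip: ahom_add)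

lemma ahom_diff:
  assumes "f \<in> ahom G H" "abelian_group G" "abelian_group H" "x \<in> carrier G" "y \<in> carrier G"
  shows "f (x \<ominus>\<^sub>G y) = f x \<ominus>\<^sub>H f y"
  using assms by (simp add: a_minus_def ahom_add ahom_neg ag_inv)

lemma ahom_comp: "f \<in> ahom G H ==> g \<in> ahom H K ==> (\<lambda>x. g (f x)) \<in> ahom G K"
  by (intro ahomI) (simp_all add: ahom_closed ahom_add)

lemma ahom_plus:
  assumes "f \<in> ahom G H" "g \<in> ahom G H" "abelian_group H"
  shows "(\<lambda>x. f x \<oplus>\<^sub>H g x) \<in> ahom G H"
  using assms by (intro ahomI) (simp_all add: ag_closed ahom_closed ahom_add ag_add4)

lemma left_homI:
  assumes "\<And>x. x \<in> carrier X ==> f x \<in> carrier Y"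
    and "\<And>x y. x \<in> carrier X ==> y \<in> carrier X ==> f (x \<oplus>\<^sub>X y) = f x \<oplus>\<^sub>Y f y"
    and "\<And>a x. a \<in> carrier R ==> x \<in> carrier X ==> f (a \<odot>\<^sub>X x) = a \<odot>\<^sub>Y f x"
  shows "f \<in> left_hom R X Y"
  using assms by (auto simp: left_hom_def)

lemma lh_ahom: "f \<in> left_hom R X Y ==> f \<in> ahom X Y"
  by (auto simp: left_hom_def ahom_def)

lemma lh_iff: "f \<in> left_hom R X Y \<longleftrightarrow>
    f \<in> ahom X Y \<and> (\<forall>a\<in>carrier R. \<forall>x\<in>carrier X. f (a \<odot>\<^sub>X x) = a \<odot>\<^sub>Y f x)"
  by (auto simp: left_hom_def ahom_def)

lemma lh_closed: "f \<in> left_hom R X Y ==> x \<in> carrier X ==> f x \<in> carrier Y"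
  by (auto simp: left_hom_def)

lemma lh_add:
  "f \<in> left_hom R X Y ==> x \<in> carrier X ==> y \<in> carrier X ==> f (x \<oplus>\<^sub>X y) = f x \<oplus>\<^sub>Y f y"
  by (auto simp: left_hom_def)

lemma lh_smult:
  "f \<in> left_hom R X Y ==> a \<in> carrier R ==> x \<in> carrier X ==> f (a \<odot>\<^sub>X x) = a \<odot>\<^sub>Y f x"
  by (auto simp: left_hom_def)

lemma lh_comp: "f \<in> left_hom R X Y ==> g \<in> left_hom R Y Z ==> (\<lambda>x. g (f x)) \<in> left_hom R X Z"
  by (intro left_homI) (simp_all add: lh_closed lh_add lh_smult)

lemma lh_id: "(\<lambda>x. x) \<in> left_hom R X X"
  by (auto simp: left_hom_def)

lemma left_moduleD:
  assumes "left_module R X"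
  shows lm_ring: "ring R" and lm_ag: "abelian_group X"
    and lm_closed: "a \<in> carrier R ==> x \<in> carrier X ==> a \<odot>\<^sub>X x \<in> carrier X"
    and lm_l_distr: "a \<in> carrier R ==> b \<in> carrier R ==> x \<in> carrier X ==>
      (a \<oplus>\<^sub>R b) \<odot>\<^sub>X x = a \<odot>\<^sub>X x \<oplus>\<^sub>X b \<odot>\<^sub>X x"
    and lm_r_distr: "a \<in> carrier R ==> x \<in> carrier X ==> y \<in> carrier X ==>
      a \<odot>\<^sub>X (x \<oplus>\<^sub>X y) = a \<odot>\<^sub>X x \<oplus>\<^sub>X a \<odot>\<^sub>X y"
    and lm_assoc: "a \<in> carrier R ==> b \<in> carrier R ==> x \<in> carrier X ==>
      (a \<otimes>\<^sub>R b) \<odot>\<^sub>X x = a \<odot>\<^sub>X (b \<odot>\<^sub>X x)"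
    and lm_one: "x \<in> carrier X ==> \<one>\<^sub>R \<odot>\<^sub>X x = x"
  using assms by (auto simp: left_module_def left_module_axioms_def)

lemma right_moduleD:
  assumes "right_module R X"
  shows rm_ring: "ring R" and rm_ag: "abelian_group X"
    and rm_closed: "a \<in> carrier R ==> x \<in> carrier X ==> x \<odot>\<^sub>r\<^sub>X a \<in> carrier X"
    and rm_r_distr: "a \<in> carrier R ==> b \<in> carrier R ==> x \<in> carrier X ==>
      x \<odot>\<^sub>r\<^sub>X (a \<oplus>\<^sub>R b) = x \<odot>\<^sub>r\<^sub>X a \<oplus>\<^sub>X x \<odot>\<^sub>r\<^sub>X b"
    and rm_l_distr: "a \<in> carrier R ==> x \<in> carrier X ==> y \<in> carrier X ==>
      (x \<oplus>\<^sub>X y) \<odot>\<^sub>r\<^sub>X a = x \<odot>\<^sub>r\<^sub>X a \<oplus>\<^sub>X y \<odot>\<^sub>r\<^sub>X a"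
    and rm_assoc: "a \<in> carrier R ==> b \<in> carrier R ==> x \<in> carrier X ==>
      x \<odot>\<^sub>r\<^sub>X (a \<otimes>\<^sub>R b) = (x \<odot>\<^sub>r\<^sub>X a) \<odot>\<^sub>r\<^sub>X b"
    and rm_one: "x \<in> carrier X ==> x \<odot>\<^sub>r\<^sub>X \<one>\<^sub>R = x"
  using assms by (auto simp: right_module_def right_module_axioms_def)

lemma left_moduleI:
  assumes "ring R" "abelian_group X"
    "\<And>a x. a \<in> carrier R ==> x \<in> carrier X ==> a \<odot>\<^sub>X x \<in> carrier X"
    "\<And>a b x. a \<in> carrier R ==> b \<in> carrier R ==> x \<in> carrier X ==>
      (a \<oplus>\<^sub>R b) \<odot>\<^sub>X x = a \<odot>\<^sub>X x \<oplus>\<^sub>X b \<odot>\<^sub>X x"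
    "\<And>a x y. a \<in> carrier R ==> x \<in> carrier X ==> y \<in> carrier X ==>
      a \<odot>\<^sub>X (x \<oplus>\<^sub>X y) = a \<odot>\<^sub>X x \<oplus>\<^sub>X a \<odot>\<^sub>X y"
    "\<And>a b x. a \<in> carrier R ==> b \<in> carrier R ==> x \<in> carrier X ==>
      (a \<otimes>\<^sub>R b) \<odot>\<^sub>X x = a \<odot>\<^sub>X (b \<odot>\<^sub>X x)"
    "\<And>x. x \<in> carrier X ==> \<one>\<^sub>R \<odot>\<^sub>X x = x"
  shows "left_module R X"
  using assms by (simp add: left_module_def left_module_axioms_def)

lemma right_moduleI:
  assumes "ring R" "abelian_group X"
    "\<And>a x. a \<in> carrier R ==> x \<in> carrier X ==> x \<odot>\<^sub>r\<^sub>X a \<in> carrier X"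
    "\<And>a b x. a \<in> carrier R ==> b \<in> carrier R ==> x \<in> carrier X ==>
      x \<odot>\<^sub>r\<^sub>X (a \<oplus>\<^sub>R b) = x \<odot>\<^sub>r\<^sub>X a \<oplus>\<^sub>X x \<odot>\<^sub>r\<^sub>X b"
    "\<And>a x y. a \<in> carrier R ==> x \<in> carrier X ==> y \<in> carrier X ==>
      (x \<oplus>\<^sub>X y) \<odot>\<^sub>r\<^sub>X a = x \<odot>\<^sub>r\<^sub>X a \<oplus>\<^sub>X y \<odot>\<^sub>r\<^sub>X a"
    "\<And>a b x. a \<in> carrier R ==> b \<in> carrier R ==> x \<in> carrier X ==>
      x \<odot>\<^sub>r\<^sub>X (a \<otimes>\<^sub>R b) = (x \<odot>\<^sub>r\<^sub>X a) \<odot>\<^sub>r\<^sub>X b"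
    "\<And>x. x \<in> carrier X ==> x \<odot>\<^sub>r\<^sub>X \<one>\<^sub>R = x"
  shows "right_module R X"
  using assms by (simp add: right_module_def right_module_axioms_def)

lemma lm_smult_ahom: "left_module R X ==> a \<in> carrier R ==> smult X a \<in> ahom X X"
  by (intro ahomI) (simp_all add: lm_closed lm_r_distr)

lemma lm_scalar_ahom: "left_module R X ==> x \<in> carrier X ==> (\<lambda>a. a \<odot>\<^sub>X x) \<in> ahom R X"
  by (intro ahomI) (simp_all add: lm_closed lm_l_distr)

lemma ring_ag: "ring R ==> abelian_group R"
  by (simp add: ring_def)

lemma lm_smult_zero: "left_module R X ==> a \<in> carrier R ==> a \<odot>\<^sub>X \<zero>\<^sub>X = \<zero>\<^sub>X"
  by (rule ahom_zero[OF lm_smult_ahom]) (auto intro: lm_ag)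

lemma lm_zero_smult: "left_module R X ==> x \<in> carrier X ==> \<zero>\<^sub>R \<odot>\<^sub>X x = \<zero>\<^sub>X"
  by (rule ahom_zero[OF lm_scalar_ahom]) (auto intro: ring_ag lm_ring lm_ag)

lemma lm_smult_neg: "left_module R X ==> a \<in> carrier R ==> x \<in> carrier X ==> a \<odot>\<^sub>X (\<ominus>\<^sub>X x) = \<ominus>\<^sub>X (a \<odot>\<^sub>X x)"
  by (rule ahom_neg[OF lm_smult_ahom]) (auto intro: lm_ag)

lemma lm_neg_smult: "left_module R X ==> a \<in> carrier R ==> x \<in> carrier X ==> (\<ominus>\<^sub>R a) \<odot>\<^sub>X x = \<ominus>\<^sub>X (a \<odot>\<^sub>X x)"
  by (rule ahom_neg[OF lm_scalar_ahom]) (auto intro: ring_ag lm_ring lm_ag)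

lemma lm_smult_diff: "left_module R X ==> a \<in> carrier R ==> x \<in> carrier X ==> y \<in> carrier X ==>
    a \<odot>\<^sub>X (x \<ominus>\<^sub>X y) = a \<odot>\<^sub>X x \<ominus>\<^sub>X a \<odot>\<^sub>X y"
  by (rule ahom_diff[OF lm_smult_ahom]) (auto intro: lm_ag)

lemmas lm = lm_ag lm_closed ag_closed ag_zero ag_inv ag_diff

lemma lh_plus:
  assumes "f \<in> left_hom R X Y" "g \<in> left_hom R X Y" "left_module R Y"
  shows "(\<lambda>x. f x \<oplus>\<^sub>Y g x) \<in> left_hom R X Y"
  using assms by (intro left_homI)
    (simp_all add: lm lh_closed lh_add lh_smult lm_r_distr ag_add4)

lemma lh_minus:
  assumes "f \<in> left_hom R X Y" "g \<in> left_hom R X Y" "left_module R Y"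
  shows "(\<lambda>x. f x \<ominus>\<^sub>Y g x) \<in> left_hom R X Y"
  using assms by (intro left_homI)
    (simp_all add: lm lh_closed lh_add lh_smult lm_smult_diff ag_add_diff_add)

lemma lh_zero: "left_module R Y ==> (\<lambda>x. \<zero>\<^sub>Y) \<in> left_hom R X Y"
  by (intro left_homI) (simp_all add: lm lm_smult_zero ag_l_zero)

lemma lh_zero_zero:
  "f \<in> left_hom R X Y ==> left_module R X ==> left_module R Y ==> f \<zero>\<^sub>X = \<zero>\<^sub>Y"
  by (meson ahom_zero lh_ahom lm_ag)

lemma lh_diff:
  "f \<in> left_hom R X Y ==> left_module R X ==> left_module R Y ==> x \<in> carrier X ==> y \<in> carrier X ==>
    f (x \<ominus>\<^sub>X y) = f x \<ominus>\<^sub>Y f y"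
  by (meson ahom_diff lh_ahom lm_ag)

lemma a_kernel_eq: "a_kernel G H h = {x \<in> carrier G. h x = \<zero>\<^sub>H}"
  by (auto simp: a_kernel_def')

definition submod :: "('a, 'e) ring_scheme => ('a, 'b, 'f) module_scheme => 'b set => bool" where
  "submod R X N \<longleftrightarrow> N \<subseteq> carrier X \<and> \<zero>\<^sub>X \<in> N \<and> (\<forall>x\<in>N. \<forall>y\<in>N. x \<oplus>\<^sub>X y \<in> N) \<and>
     (\<forall>a\<in>carrier R. \<forall>x\<in>N. a \<odot>\<^sub>X x \<in> N)"

lemma submodD:
  assumes "submod R X N"
  shows submod_sub: "x \<in> N ==> x \<in> carrier X" and submod_zero: "\<zero>\<^sub>X \<in> N"
    and submod_add: "x \<in> N ==> y \<in> N ==> x \<oplus>\<^sub>X y \<in> N"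
    and submod_smult: "a \<in> carrier R ==> x \<in> N ==> a \<odot>\<^sub>X x \<in> N"
  using assms by (auto simp: submod_def)

text \<open>Closure under negation comes from the scalar minus one.\<close>

lemma submod_neg:
  assumes "left_module R X" "submod R X N" "x \<in> N"
  shows "\<ominus>\<^sub>X x \<in> N"
proof -
  have "(\<ominus>\<^sub>R \<one>\<^sub>R) \<odot>\<^sub>X x \<in> N"
    using assms by (meson submod_smult lm_ring ring_ag ag_inv ring_rules(6))
  moreover have "(\<ominus>\<^sub>R \<one>\<^sub>R) \<odot>\<^sub>X x = \<ominus>\<^sub>X x"
    using assms by (metis lm_neg_smult lm_one submod_sub lm_ring ring_rules(6))
  ultimately show ?thesis by simp
qed

lemma submod_diff:
  "left_module R X ==> submod R X N ==> x \<in> N ==> y \<in> N ==> x \<ominus>\<^sub>X y \<in> N"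
  by (simp add: a_minus_def submod_add submod_neg)

lemma lmod_sub:
  assumes "left_module R X" "submod R X N"
  shows "left_module R (X\<lparr>carrier := N\<rparr>)"
proof (intro left_moduleI abelian_groupI')
  fix x assume "x \<in> carrier (X\<lparr>carrier := N\<rparr>)"
  then show "\<exists>y\<in>carrier (X\<lparr>carrier := N\<rparr>). y \<oplus>\<^sub>(X\<lparr>carrier := N\<rparr>) x = \<zero>\<^sub>(X\<lparr>carrier := N\<rparr>)"
    using assms by (auto intro!: bexI[of _ "\<ominus>\<^sub>X x"] simp: submod_neg ag_l_neg lm_ag submod_sub)
qed (use assms in \<open>simp_all add: submod_add submod_zero submod_smult lm lm_l_distr lm_r_distr lm_assoc lm_one
      lm_ring ag_assoc ag_comm ag_lcomm ag_r_zero ag_l_zero submod_sub\<close>)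

lemma submod_carrier: "left_module R X ==> submod R X (carrier X)"
  by (simp add: submod_def lm)

lemma submod_zero_set: "left_module R X ==> submod R X {\<zero>\<^sub>X}"
  by (simp add: submod_def lm lm_smult_zero ag_l_zero)

lemma submod_kernel:
  assumes "left_module R X" "left_module R Y" "f \<in> left_hom R X Y"
  shows "submod R X (a_kernel X Y f)"
  using assms by (auto simp: submod_def a_kernel_eq lm lh_add lh_smult lm_smult_zero
      ag_l_zero intro: lh_zero_zero)

lemma submod_image:
  assumes "left_module R X" "left_module R Y" "f \<in> left_hom R X Y"
  shows "submod R Y (f ` carrier X)"
  unfolding submod_def
proof (intro conjI ballI)
  show "\<zero>\<^sub>Y \<in> f ` carrier X"
    using assms by (metis ag_zero image_eqI lh_zero_zero lm_ag)
next
  fix x y assume "x \<in> f ` carrier X" "y \<in> f ` carrier X"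
  then show "x \<oplus>\<^sub>Y y \<in> f ` carrier X"
    using assms by (auto simp: lm simp flip: lh_add)
next
  fix a x assume "x \<in> f ` carrier X" "a \<in> carrier R"
  then show "a \<odot>\<^sub>Y x \<in> f ` carrier X"
    using assms by (auto simp: lm simp flip: lh_smult)
qed (use assms in \<open>auto simp: lh_closed\<close>)

lemma lh_sub_dom: "f \<in> left_hom R X Y ==> N \<subseteq> carrier X ==> f \<in> left_hom R (X\<lparr>carrier := N\<rparr>) Y"
  by (intro left_homI) (auto simp: lh_closed lh_add lh_smult subset_iff)

lemma lh_into_sub: "f \<in> left_hom R X Y ==> f ` carrier X \<subseteq> N ==> f \<in> left_hom R X (Y\<lparr>carrier := N\<rparr>)"
  by (auto simp: left_hom_def)

lemma lh_from_sub: "f \<in> left_hom R X (Y\<lparr>carrier := N\<rparr>) ==> N \<subseteq> carrier Y ==> f \<in> left_hom R X Y"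
  by (auto simp: left_hom_def)

lemma lh_inj_iff:
  assumes "left_module R X" "left_module R Y" "f \<in> left_hom R X Y"
  shows "inj_on f (carrier X) \<longleftrightarrow> a_kernel X Y f = {\<zero>\<^sub>X}"
proof
  assume inj: "inj_on f (carrier X)"
  have z: "f \<zero>\<^sub>X = \<zero>\<^sub>Y" "\<zero>\<^sub>X \<in> carrier X"
    using lh_zero_zero[OF assms(3,1,2)] ag_zero[OF lm_ag[OF assms(1)]] by auto
  have "x = \<zero>\<^sub>X" if "x \<in> carrier X" "f x = \<zero>\<^sub>Y" for x
    using inj_onD[OF inj _ that(1) z(2)] that(2) z(1) by simp
  then show "a_kernel X Y f = {\<zero>\<^sub>X}"
    using z unfolding a_kernel_eq by blast
next
  assume *: "a_kernel X Y f = {\<zero>\<^sub>X}"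
  show "inj_on f (carrier X)"
  proof (rule inj_onI)
    fix x y assume xy: "x \<in> carrier X" "y \<in> carrier X" "f x = f y"
    then have "x \<ominus>\<^sub>X y \<in> a_kernel X Y f"
      using assms by (simp add: a_kernel_eq lm lh_diff ag_diff_self lh_closed)
    then show "x = y" using * xy assms by (simp add: ag_diff_eq_zero lm_ag)
  qed
qed

section \<open>Transport of a module structure along a map\<close>

text \<open>The structure is read back through a chosen preimage, and \<open>c\<close> need not be
  injective. An injective \<open>c\<close> gives a copy of \<open>X\<close> in another type; a
  \<open>c\<close> that is constant exactly on the cosets of a submodule gives the quotient. Copies
  and quotients of modules below are made this way.\<close>

definition push :: "('b => 'd) => ('a, 'b, 'f) module_scheme => ('a, 'd) module" where
  "push c X = (let g = inv_into (carrier X) c in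
     \<lparr>carrier = c ` carrier X, mult = undefined, one = undefined, ring.zero = c \<zero>\<^sub>X,
      add = (\<lambda>x y. c (g x \<oplus>\<^sub>X g y)), smult = (\<lambda>a x. c (a \<odot>\<^sub>X g x))\<rparr>)"

lemma push_carrier': "carrier (push c X) = c ` carrier X"
  by (simp add: push_def Let_def)

lemma push_zero': "\<zero>\<^sub>(push c X) = c \<zero>\<^sub>X"
  by (simp add: push_def Let_def)

text \<open>The preimage chosen for \<open>c x\<close> differs from \<open>x\<close> by an element
  of \<open>N\<close>, and \<open>N\<close> absorbs such errors under addition and scalars; so
  \<open>c\<close> is linear and the module laws are inherited.\<close>

lemma push_quotient:
  assumes X: "left_module R X" and N: "submod R X N"
    and c: "\<And>x y. x \<in> carrier X ==> y \<in> carrier X ==> c x = c y \<longleftrightarrow> x \<ominus>\<^sub>X y \<in> N"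
  shows lmod_push: "left_module R (push c X)"
    and push_hom: "c \<in> left_hom R X (push c X)"
    and push_carrier: "carrier (push c X) = c ` carrier X"
    and push_zero: "\<zero>\<^sub>(push c X) = c \<zero>\<^sub>X"
    and push_kernel: "a_kernel X (push c X) c = N"
proof -
  let ?g = "inv_into (carrier X) c"
  have g: "?g (c x) \<in> carrier X" "c (?g (c x)) = c x" if "x \<in> carrier X" for x
    using that by (auto intro: inv_into_into f_inv_into_f)
  have gN: "?g (c x) \<ominus>\<^sub>X x \<in> N" if "x \<in> carrier X" for x
    using g[OF that] that by (intro iffD1[OF c])
  have a: "c x \<oplus>\<^sub>(push c X) c y = c (x \<oplus>\<^sub>X y)" if "x \<in> carrier X" "y \<in> carrier X" for x y
  proof -
    have "(?g (c x) \<ominus>\<^sub>X x) \<oplus>\<^sub>X (?g (c y) \<ominus>\<^sub>X y) \<in> N"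
      using gN that submod_add[OF N] by blast
    then have "c (?g (c x) \<oplus>\<^sub>X ?g (c y)) = c (x \<oplus>\<^sub>X y)"
      using that g(1) lm_ag[OF X] by (intro iffD2[OF c]) (simp_all add: ag_add_diff_add ag_closed)
    then show ?thesis by (simp add: push_def Let_def)
  qed
  have s: "r \<odot>\<^sub>(push c X) c x = c (r \<odot>\<^sub>X x)" if "r \<in> carrier R" "x \<in> carrier X" for r x
  proof -
    have "r \<odot>\<^sub>X (?g (c x) \<ominus>\<^sub>X x) \<in> N" using gN submod_smult[OF N] that by blast
    then have "c (r \<odot>\<^sub>X ?g (c x)) = c (r \<odot>\<^sub>X x)"
      using that g(1) X by (intro iffD2[OF c]) (simp_all add: lm_closed lm_smult_diff)
    then show ?thesis by (simp add: push_def Let_def)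
  qed
  show car: "carrier (push c X) = c ` carrier X" and z: "\<zero>\<^sub>(push c X) = c \<zero>\<^sub>X"
    by (simp_all add: push_def Let_def)
  show "c \<in> left_hom R X (push c X)"
    using a s by (intro left_homI) (auto simp: car)
  show "a_kernel X (push c X) c = N"
    using c[OF _ ag_zero] lm_ag[OF X] submod_sub[OF N] by (auto simp: a_kernel_eq z ag_diff_zero)
  show "left_module R (push c X)"
  proof (intro left_moduleI abelian_groupI', unfold car z)
    show "ring R" using X by (rule lm_ring)
  next
    fix x assume "x \<in> c ` carrier X"
    then obtain u where "u \<in> carrier X" "x = c u" by auto
    then show "\<exists>y\<in>c ` carrier X. y \<oplus>\<^sub>(push c X) x = c \<zero>\<^sub>X"
      using X by (intro bexI[of _ "c (\<ominus>\<^sub>X u)"]) (simp_all add: a lm ag_l_neg)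
  qed (use X in \<open>auto simp: a s lm lm_l_distr lm_r_distr lm_assoc lm_one ag_assoc ag_comm ag_lcomm ag_l_zero ag_r_zero ring_rules[OF lm_ring[OF X]]\<close>)
qed

text \<open>The case of the zero submodule. Nothing is collapsed, so the inverse relabelling is
  linear as well.\<close>

lemma push_inj:
  assumes X: "left_module R X" and c: "inj_on c (carrier X)"
  shows lmod_push_inj: "left_module R (push c X)"
    and push_hom_inj: "c \<in> left_hom R X (push c X)"
    and push_inv_hom: "inv_into (carrier X) c \<in> left_hom R (push c X) X"
proof -
  have c': "c x = c y \<longleftrightarrow> x \<ominus>\<^sub>X y \<in> {\<zero>\<^sub>X}" if "x \<in> carrier X" "y \<in> carrier X" for x y
    using that X c by (auto simp: ag_diff_eq_zero lm_ag inj_on_eq_iff)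
  note p = push_quotient[OF X submod_zero_set[OF X] c']
  show "left_module R (push c X)" "c \<in> left_hom R X (push c X)"
    using p by auto
  show "inv_into (carrier X) c \<in> left_hom R (push c X) X"
  proof (rule left_homI)
    fix x y assume "x \<in> carrier (push c X)" "y \<in> carrier (push c X)"
    then show "inv_into (carrier X) c (x \<oplus>\<^sub>(push c X) y) = inv_into (carrier X) c x \<oplus>\<^sub>X inv_into (carrier X) c y"
      using c X by (auto simp: push_carrier' lh_add[OF p(2), symmetric] inv_into_f_f lm)
  next
    fix r x assume "x \<in> carrier (push c X)" "r \<in> carrier R"
    then show "inv_into (carrier X) c (r \<odot>\<^sub>(push c X) x) = r \<odot>\<^sub>X inv_into (carrier X) c x"
      using c X by (auto simp: push_carrier' lh_smult[OF p(2), symmetric] inv_into_f_f lm)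
  qed (use c in \<open>auto simp: push_carrier'\<close>)
qed

text \<open>A coset is represented by one of its members instead of the set itself, so that a
  quotient stays in the type of \<open>X\<close>. Resolutions need this, because all their terms
  share one type.\<close>

definition coset_rep :: "('a, 'b, 'f) module_scheme => 'b set => 'b => 'b" where
  "coset_rep X N x = (SOME y. y \<in> carrier X \<and> y \<ominus>\<^sub>X x \<in> N)"

text \<open>The condition inside the choice depends on the coset of \<open>x\<close> only, so equal
  cosets make \<open>SOME\<close> pick the same element; conversely a common choice is congruent to
  both.\<close>

lemma coset_rep_eq_iff:
  assumes X: "left_module R X" and N: "submod R X N" and xy: "x \<in> carrier X" "y \<in> carrier X"
  shows "coset_rep X N x = coset_rep X N y \<longleftrightarrow> x \<ominus>\<^sub>X y \<in> N"
proof -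
  have ex: "coset_rep X N x \<in> carrier X \<and> coset_rep X N x \<ominus>\<^sub>X x \<in> N" if "x \<in> carrier X" for x
    unfolding coset_rep_def by (rule someI[of _ x]) (use X N that in \<open>simp add: ag_diff_self lm_ag submod_zero\<close>)
  show ?thesis
  proof
    assume *: "coset_rep X N x = coset_rep X N y"
    have "\<ominus>\<^sub>X (coset_rep X N x \<ominus>\<^sub>X x) \<oplus>\<^sub>X (coset_rep X N x \<ominus>\<^sub>X y) \<in> N"
      using ex[OF xy(1)] ex[OF xy(2)] * by (metis submod_add N submod_neg X)
    then show "x \<ominus>\<^sub>X y \<in> N"
      using ex[OF xy(1)] X xy by (simp add: ag_neg_diff ag_diff_trans lm)
  next
    assume *: "x \<ominus>\<^sub>X y \<in> N"
    have "z \<ominus>\<^sub>X x \<in> N \<longleftrightarrow> z \<ominus>\<^sub>X y \<in> N" if "z \<in> carrier X" for z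
    proof
      assume "z \<ominus>\<^sub>X x \<in> N"
      then have "(z \<ominus>\<^sub>X x) \<oplus>\<^sub>X (x \<ominus>\<^sub>X y) \<in> N" using * by (rule submod_add[OF N])
      then show "z \<ominus>\<^sub>X y \<in> N" using xy that X by (simp add: ag_diff_trans lm_ag)
    next
      assume "z \<ominus>\<^sub>X y \<in> N"
      moreover have "y \<ominus>\<^sub>X x \<in> N" using submod_neg[OF X N *] xy X by (simp add: ag_neg_diff lm_ag)
      ultimately have "(z \<ominus>\<^sub>X y) \<oplus>\<^sub>X (y \<ominus>\<^sub>X x) \<in> N" by (rule submod_add[OF N])
      then show "z \<ominus>\<^sub>X x \<in> N" using xy that X by (simp add: ag_diff_trans lm_ag)
    qed
    then have "(\<lambda>z. z \<in> carrier X \<and> z \<ominus>\<^sub>X x \<in> N) = (\<lambda>z. z \<in> carrier X \<and> z \<ominus>\<^sub>X y \<in> N)" by blast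
    then show "coset_rep X N x = coset_rep X N y" by (simp add: coset_rep_def)
  qed
qed

section \<open>Baer's criterion\<close>

definition left_ideal :: "('a, 'e) ring_scheme => 'a set => bool" where
  "left_ideal R L \<longleftrightarrow> L \<subseteq> carrier R \<and> \<zero>\<^sub>R \<in> L \<and> (\<forall>x\<in>L. \<forall>y\<in>L. x \<oplus>\<^sub>R y \<in> L) \<and>
     (\<forall>a\<in>carrier R. \<forall>x\<in>L. a \<otimes>\<^sub>R x \<in> L)"

definition ideal_hom :: "('a, 'e) ring_scheme => 'a set => ('a, 'b, 'f) module_scheme => ('a => 'b) set" where
  "ideal_hom R L I = {f \<in> L \<rightarrow> carrier I. (\<forall>x\<in>L. \<forall>y\<in>L. f (x \<oplus>\<^sub>R y) = f x \<oplus>\<^sub>I f y) \<and>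
     (\<forall>a\<in>carrier R. \<forall>x\<in>L. f (a \<otimes>\<^sub>R x) = a \<odot>\<^sub>I f x)}"

text \<open>Baer's condition: a map from a left ideal is given by multiplying an element
  \<open>x\<close>. It involves no types besides those of \<open>R\<close> and \<open>I\<close>,
  which frees injectivity from the universe.\<close>

definition baer :: "('a, 'e) ring_scheme => ('a, 'b, 'f) module_scheme => bool" where
  "baer R I \<longleftrightarrow> left_module R I \<and>
     (\<forall>L f. left_ideal R L --> f \<in> ideal_hom R L I --> (\<exists>x\<in>carrier I. \<forall>l\<in>L. f l = l \<odot>\<^sub>I x))"

lemma baerD: "baer R I ==> left_ideal R L ==> f \<in> ideal_hom R L I ==> \<exists>x\<in>carrier I. \<forall>l\<in>L. f l = l \<odot>\<^sub>I x"
  by (auto simp: baer_def)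

lemma baer_left_module: "baer R I ==> left_module R I"
  by (simp add: baer_def)

text \<open>The graphs of the linear partial maps from \<^term>\<open>B\<close> to \<^term>\<open>I\<close> that contain \<^term>\<open>G0\<close>.\<close>

definition partial_graph ::
    "('a, 'e) ring_scheme => ('a, 'b, 'f) module_scheme => ('a, 'i, 'g) module_scheme => ('b \<times> 'i) set
      => ('b \<times> 'i) set => bool" where
  "partial_graph R B I G0 G \<longleftrightarrow> G0 \<subseteq> G \<and> G \<subseteq> carrier B \<times> carrier I \<and>
     (\<forall>b i c j. (b, i) \<in> G --> (c, j) \<in> G --> (b \<oplus>\<^sub>B c, i \<oplus>\<^sub>I j) \<in> G) \<and>
     (\<forall>r\<in>carrier R. \<forall>b i. (b, i) \<in> G --> (r \<odot>\<^sub>B b, r \<odot>\<^sub>I i) \<in> G) \<and>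
     (\<forall>i. (\<zero>\<^sub>B, i) \<in> G --> i = \<zero>\<^sub>I)"

lemma partial_graphD:
  assumes "partial_graph R B I G0 G"
  shows "p \<in> G0 ==> p \<in> G" "(b, i) \<in> G ==> b \<in> carrier B" "(b, i) \<in> G ==> i \<in> carrier I"
    "(b, i) \<in> G ==> (c, j) \<in> G ==> (b \<oplus>\<^sub>B c, i \<oplus>\<^sub>I j) \<in> G"
    "r \<in> carrier R ==> (b, i) \<in> G ==> (r \<odot>\<^sub>B b, r \<odot>\<^sub>I i) \<in> G"
    "(\<zero>\<^sub>B, i) \<in> G ==> i = \<zero>\<^sub>I"
  using assms unfolding partial_graph_def by blast+

text \<open>Any two pairs in the union already lie in a common member of the chain.\<close>

lemma partial_graph_Union:
  assumes "C \<noteq> {}" and "subset.chain {G. partial_graph R B I G0 G} C"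
  shows "partial_graph R B I G0 (\<Union>C)"
proof -
  have C: "partial_graph R B I G0 G" if "G \<in> C" for G
    using assms(2) that by (auto simp: subset.chain_def)
  have chain: "G \<subseteq> H \<or> H \<subseteq> G" if "G \<in> C" "H \<in> C" for G H
    using assms(2) that by (auto simp: subset.chain_def)
  show ?thesis
    unfolding partial_graph_def
  proof (intro conjI allI impI ballI)
    fix b i c j assume "(b, i) \<in> \<Union>C" "(c, j) \<in> \<Union>C"
    then obtain G where "G \<in> C" "(b, i) \<in> G" "(c, j) \<in> G" using chain by blast
    then show "(b \<oplus>\<^sub>B c, i \<oplus>\<^sub>I j) \<in> \<Union>C" using partial_graphD(4)[OF C] by blast
  next
    fix r b i assume "r \<in> carrier R" "(b, i) \<in> \<Union>C"
    then show "(r \<odot>\<^sub>B b, r \<odot>\<^sub>I i) \<in> \<Union>C" using partial_graphD(5)[OF C] by blast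
  next
    show "G0 \<subseteq> \<Union>C" using assms(1) partial_graphD(1)[OF C] by blast
    show "\<Union>C \<subseteq> carrier B \<times> carrier I" using partial_graphD(2)[OF C] partial_graphD(3)[OF C] by fast
  next
    fix i assume "(\<zero>\<^sub>B, i) \<in> \<Union>C"
    then show "i = \<zero>\<^sub>I" using partial_graphD(6)[OF C] by blast
  qed
qed

text \<open>The graph is closed under linear combinations, so it contains zero paired with
  \<open>i - j\<close>, and by the last clause of \<open>partial_graph\<close> only zero lies over
  zero.\<close>

lemma partial_graph_unique:
  assumes B: "left_module R B" and I: "left_module R I" and G: "partial_graph R B I G0 G"
    and i: "(b, i) \<in> G" and j: "(b, j) \<in> G"
  shows "i = j"
proof -
  note car = partial_graphD(2)[OF G i] partial_graphD(3)[OF G i] partial_graphD(3)[OF G j]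
  have one: "\<one>\<^sub>R \<in> carrier R" "\<ominus>\<^sub>R \<one>\<^sub>R \<in> carrier R"
    using lm_ring[OF B] by (simp_all add: ring_rules)
  have "(b \<oplus>\<^sub>B (\<ominus>\<^sub>R \<one>\<^sub>R) \<odot>\<^sub>B b, i \<oplus>\<^sub>I (\<ominus>\<^sub>R \<one>\<^sub>R) \<odot>\<^sub>I j) \<in> G"
    by (intro partial_graphD[OF G] i j one)
  then have "(\<zero>\<^sub>B, i \<ominus>\<^sub>I j) \<in> G"
    using car one lm_ag[OF B] by (simp add: lm_neg_smult[OF B] lm_neg_smult[OF I] lm_one[OF B] lm_one[OF I] ag_r_neg a_minus_def)
  then have "i \<ominus>\<^sub>I j = \<zero>\<^sub>I" by (rule partial_graphD[OF G])
  then show ?thesis using car lm_ag[OF I] by (simp add: ag_diff_eq_zero)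
qed

text \<open>Baer's step. The scalars carrying \<open>b\<close> into the domain of \<open>G\<close>
  form a left ideal \<open>L\<close>, on which \<open>G\<close> induces a linear map
  \<open>\<phi>\<close>. The condition \<open>baer\<close> provides an \<open>x\<close> with
  \<open>\<phi> r = r x\<close>, and this \<open>x\<close> is a consistent value at
  \<open>b\<close>.\<close>

lemma partial_graph_extend:
  assumes B: "left_module R B" and I: "baer R I" and G: "partial_graph R B I G0 G"
    and b: "b \<in> carrier B" and ne: "G \<noteq> {}"
  obtains G' x where "partial_graph R B I G0 G'" "G \<subseteq> G'" "(b, x) \<in> G'"
proof -
  have lmI: "left_module R I" by (rule baer_left_module[OF I])
  note R = lm_ring[OF B] and agB = lm_ag[OF B] and agI = lm_ag[OF lmI]
  note uniq = partial_graph_unique[OF B lmI G]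
  obtain y0 i0 where "(y0, i0) \<in> G" using ne by auto
  then have "(\<zero>\<^sub>R \<odot>\<^sub>B y0, \<zero>\<^sub>R \<odot>\<^sub>I i0) \<in> G"
    using R by (intro partial_graphD(5)[OF G]) (auto simp: ring_rules)
  then have zero: "(\<zero>\<^sub>B, \<zero>\<^sub>I) \<in> G"
    using partial_graphD(2,3)[OF G \<open>(y0, i0) \<in> G\<close>] by (simp add: lm_zero_smult[OF B] lm_zero_smult[OF lmI])
  define L where "L = {r \<in> carrier R. \<exists>i. (r \<odot>\<^sub>B b, i) \<in> G}"
  define \<phi> where "\<phi> = (\<lambda>r. THE i. (r \<odot>\<^sub>B b, i) \<in> G)"
  have \<phi>: "\<phi> r = i" if "(r \<odot>\<^sub>B b, i) \<in> G" for r i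
    unfolding \<phi>_def by (rule the_equality) (use that uniq in blast)+
  have \<phi>': "(r \<odot>\<^sub>B b, \<phi> r) \<in> G" if "r \<in> L" for r
    using that \<phi> by (auto simp: L_def)
  have add: "((r \<oplus>\<^sub>R s) \<odot>\<^sub>B b, \<phi> r \<oplus>\<^sub>I \<phi> s) \<in> G" if "r \<in> L" "s \<in> L" for r s
  proof -
    have rs: "r \<in> carrier R" "s \<in> carrier R" using that by (auto simp: L_def)
    have "(r \<odot>\<^sub>B b \<oplus>\<^sub>B s \<odot>\<^sub>B b, \<phi> r \<oplus>\<^sub>I \<phi> s) \<in> G"
      by (intro partial_graphD[OF G] \<phi>' that)
    then show ?thesis using rs b by (simp add: lm_l_distr[OF B])
  qed
  have mul: "((a \<otimes>\<^sub>R r) \<odot>\<^sub>B b, a \<odot>\<^sub>I \<phi> r) \<in> G" if "a \<in> carrier R" "r \<in> L" for a r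
  proof -
    have r: "r \<in> carrier R" using that by (auto simp: L_def)
    have "(a \<odot>\<^sub>B (r \<odot>\<^sub>B b), a \<odot>\<^sub>I \<phi> r) \<in> G"
      by (intro partial_graphD[OF G] \<phi>' that)
    then show ?thesis using r that b by (simp add: lm_assoc[OF B])
  qed
  have "left_ideal R L"
    unfolding left_ideal_def
  proof (intro conjI ballI)
    show "\<zero>\<^sub>R \<in> L" using zero R b by (auto simp: L_def lm_zero_smult[OF B] ring_rules)
    show "L \<subseteq> carrier R" by (auto simp: L_def)
  next
    fix r s assume "r \<in> L" "s \<in> L"
    then show "r \<oplus>\<^sub>R s \<in> L" using add[of r s] R by (auto simp: L_def ring_rules)
  next
    fix a r assume "a \<in> carrier R" "r \<in> L"
    then show "a \<otimes>\<^sub>R r \<in> L" using mul[of a r] R by (auto simp: L_def ring_rules)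
  qed
  moreover have "\<phi> \<in> ideal_hom R L I"
    using \<phi> add mul partial_graphD(3)[OF G \<phi>'] by (auto simp: ideal_hom_def)
  ultimately obtain x where x: "x \<in> carrier I" "\<And>r. r \<in> L ==> \<phi> r = r \<odot>\<^sub>I x"
    using baerD[OF I] by blast
  define G' where "G' = {(y \<oplus>\<^sub>B r \<odot>\<^sub>B b, i \<oplus>\<^sub>I r \<odot>\<^sub>I x) | y i r. (y, i) \<in> G \<and> r \<in> carrier R}"
  have G'I: "(y \<oplus>\<^sub>B r \<odot>\<^sub>B b, i \<oplus>\<^sub>I r \<odot>\<^sub>I x) \<in> G'" if "(y, i) \<in> G" "r \<in> carrier R" for y i r
    using that by (auto simp: G'_def)
  have sub: "G \<subseteq> G'"
  proof
    fix p assume p: "p \<in> G"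
    obtain y i where yi: "p = (y, i)" by fastforce
    have "(y \<oplus>\<^sub>B \<zero>\<^sub>R \<odot>\<^sub>B b, i \<oplus>\<^sub>I \<zero>\<^sub>R \<odot>\<^sub>I x) \<in> G'"
      using p yi R by (intro G'I) (auto simp: ring_rules)
    then show "p \<in> G'"
      using yi p b x(1) partial_graphD(2,3)[OF G, of y i]
      by (simp add: lm_zero_smult[OF B] lm_zero_smult[OF lmI] ag_r_zero[OF agB] ag_r_zero[OF agI])
  qed
  have "partial_graph R B I G0 G'"
    unfolding partial_graph_def
  proof (intro conjI allI impI ballI)
    show "G0 \<subseteq> G'" using sub partial_graphD(1)[OF G] by blast
    show "G' \<subseteq> carrier B \<times> carrier I"
      using partial_graphD(2,3)[OF G] b x(1) B lmI by (auto simp: G'_def intro!: ag_closed agB agI lm_closed)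
  next
    fix u i v j assume "(u, i) \<in> G'" "(v, j) \<in> G'"
    then obtain y k r z l s where *: "u = y \<oplus>\<^sub>B r \<odot>\<^sub>B b" "i = k \<oplus>\<^sub>I r \<odot>\<^sub>I x" "(y, k) \<in> G" "r \<in> carrier R"
      "v = z \<oplus>\<^sub>B s \<odot>\<^sub>B b" "j = l \<oplus>\<^sub>I s \<odot>\<^sub>I x" "(z, l) \<in> G" "s \<in> carrier R"
      by (auto simp: G'_def)
    have "((y \<oplus>\<^sub>B z) \<oplus>\<^sub>B (r \<oplus>\<^sub>R s) \<odot>\<^sub>B b, (k \<oplus>\<^sub>I l) \<oplus>\<^sub>I (r \<oplus>\<^sub>R s) \<odot>\<^sub>I x) \<in> G'"
      using * R by (intro G'I partial_graphD(4)[OF G]) (auto simp: ring_rules)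
    then show "(u \<oplus>\<^sub>B v, i \<oplus>\<^sub>I j) \<in> G'"
      using * b x(1) partial_graphD(2,3)[OF G *(3)] partial_graphD(2,3)[OF G *(7)]
      by (simp add: lm_l_distr[OF B] lm_l_distr[OF lmI] ag_add4[OF agB] ag_add4[OF agI] lm_closed[OF B] lm_closed[OF lmI])
  next
    fix a u i assume a: "a \<in> carrier R" and "(u, i) \<in> G'"
    then obtain y k r where *: "u = y \<oplus>\<^sub>B r \<odot>\<^sub>B b" "i = k \<oplus>\<^sub>I r \<odot>\<^sub>I x" "(y, k) \<in> G" "r \<in> carrier R"
      by (auto simp: G'_def)
    have "(a \<odot>\<^sub>B y \<oplus>\<^sub>B (a \<otimes>\<^sub>R r) \<odot>\<^sub>B b, a \<odot>\<^sub>I k \<oplus>\<^sub>I (a \<otimes>\<^sub>R r) \<odot>\<^sub>I x) \<in> G'"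
      using * a R by (intro G'I partial_graphD(5)[OF G]) (auto simp: ring_rules)
    then show "(a \<odot>\<^sub>B u, a \<odot>\<^sub>I i) \<in> G'"
      using * a b x(1) partial_graphD(2,3)[OF G *(3)]
      by (simp add: lm_assoc[OF B] lm_assoc[OF lmI] lm_r_distr[OF B] lm_r_distr[OF lmI] lm_closed[OF B] lm_closed[OF lmI])
  next
    \<comment> \<open>Consistency: \<open>y + r b = 0\<close> puts \<open>- r\<close> into
      \<open>L\<close> with \<open>\<phi> (- r) = i\<close>, and then \<open>i = - r x\<close>
      cancels the second summand of \<open>j\<close>.\<close>
    fix j assume "(\<zero>\<^sub>B, j) \<in> G'"
    then obtain y i r where *: "\<zero>\<^sub>B = y \<oplus>\<^sub>B r \<odot>\<^sub>B b" "j = i \<oplus>\<^sub>I r \<odot>\<^sub>I x" "(y, i) \<in> G" "r \<in> carrier R"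
      by (auto simp: G'_def)
    have y: "y \<in> carrier B" "i \<in> carrier I" using *(3) partial_graphD(2,3)[OF G] by auto
    have "r \<odot>\<^sub>B b \<oplus>\<^sub>B y = \<zero>\<^sub>B" using *(1,4) y b by (simp add: ag_comm[OF agB] lm_closed[OF B])
    then have "y = (\<ominus>\<^sub>R r) \<odot>\<^sub>B b"
      using *(4) y b by (simp add: ag_eq_neg[OF agB] lm_closed[OF B] lm_neg_smult[OF B])
    then have "(\<ominus>\<^sub>R r) \<in> L" "\<phi> (\<ominus>\<^sub>R r) = i"
      using *(3,4) \<phi> R by (auto simp: L_def ring_rules)
    then have "i = \<ominus>\<^sub>I (r \<odot>\<^sub>I x)" using x *(4) by (simp add: lm_neg_smult[OF lmI])
    then show "j = \<zero>\<^sub>I" using *(2,4) x(1) by (simp add: ag_l_neg[OF agI] lm_closed[OF lmI])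
  qed
  moreover have "(\<zero>\<^sub>B \<oplus>\<^sub>B \<one>\<^sub>R \<odot>\<^sub>B b, \<zero>\<^sub>I \<oplus>\<^sub>I \<one>\<^sub>R \<odot>\<^sub>I x) \<in> G'"
    using R by (intro G'I zero) (auto simp: ring_rules)
  then have "(b, x) \<in> G'"
    using b x(1) by (simp add: lm_one[OF B] lm_one[OF lmI] ag_l_zero[OF agB] ag_l_zero[OF agI])
  ultimately show ?thesis using that sub by blast
qed

text \<open>Zorn's lemma on the graphs that contain all pairs \<open>(g x, f x)\<close>; a maximal
  one is total by \<open>partial_graph_extend\<close>. The condition on kernels takes the place of
  injectivity of \<open>g\<close>, so that the result applies to differentials too.\<close>

theorem baer_extend:
  assumes I: "baer R I" and A: "left_module R A" and B: "left_module R B"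
    and g: "g \<in> left_hom R A B" and f: "f \<in> left_hom R A I"
    and ker: "\<And>x. x \<in> carrier A ==> g x = \<zero>\<^sub>B ==> f x = \<zero>\<^sub>I"
  obtains h where "h \<in> left_hom R B I" "\<And>x. x \<in> carrier A ==> h (g x) = f x"
proof -
  have lmI: "left_module R I" by (rule baer_left_module[OF I])
  define G0 where "G0 = (\<lambda>x. (g x, f x)) ` carrier A"
  have "partial_graph R B I G0 G0"
    unfolding partial_graph_def
  proof (intro conjI allI impI ballI)
    show "G0 \<subseteq> carrier B \<times> carrier I" using f g by (auto simp: G0_def lh_closed)
  next
    fix b i c j assume "(b, i) \<in> G0" "(c, j) \<in> G0"
    then obtain x y where "b = g x" "i = f x" "c = g y" "j = f y" "x \<in> carrier A" "y \<in> carrier A"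
      by (auto simp: G0_def)
    then show "(b \<oplus>\<^sub>B c, i \<oplus>\<^sub>I j) \<in> G0"
      unfolding G0_def using lm_ag[OF A] by (intro image_eqI[of _ _ "x \<oplus>\<^sub>A y"])
        (simp_all add: lh_add[OF f] lh_add[OF g] ag_closed)
  next
    fix r b i assume "r \<in> carrier R" "(b, i) \<in> G0"
    then obtain x where "b = g x" "i = f x" "x \<in> carrier A" by (auto simp: G0_def)
    then show "(r \<odot>\<^sub>B b, r \<odot>\<^sub>I i) \<in> G0"
      unfolding G0_def using A \<open>r \<in> carrier R\<close> by (intro image_eqI[of _ _ "r \<odot>\<^sub>A x"])
        (simp_all add: lh_smult[OF f] lh_smult[OF g] lm_closed)
  qed (use ker in \<open>auto simp: G0_def\<close>)
  then have "{G. partial_graph R B I G0 G} \<noteq> {}" by auto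
  moreover have "\<Union>C \<in> {G. partial_graph R B I G0 G}"
    if "C \<noteq> {}" "subset.chain {G. partial_graph R B I G0 G} C" for C
    using partial_graph_Union[OF that] by simp
  ultimately have "\<exists>G\<in>{G. partial_graph R B I G0 G}. \<forall>G'\<in>{G. partial_graph R B I G0 G}. G \<subseteq> G' --> G' = G"
    by (rule subset_Zorn_nonempty)
  then obtain G where G: "partial_graph R B I G0 G"
    and max: "\<And>G'. partial_graph R B I G0 G' ==> G \<subseteq> G' ==> G' = G" by blast
  have "(g \<zero>\<^sub>A, f \<zero>\<^sub>A) \<in> G0" using lm_ag[OF A] by (auto simp: G0_def ag_zero)
  then have "G \<noteq> {}" using partial_graphD(1)[OF G] by blast
  then have total: "\<exists>i. (b, i) \<in> G" if "b \<in> carrier B" for b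
    using partial_graph_extend[OF B I G that] max by metis
  define h where "h = (\<lambda>b. THE i. (b, i) \<in> G)"
  have h: "h b = i" if "(b, i) \<in> G" for b i
    unfolding h_def by (rule the_equality) (use that partial_graph_unique[OF B lmI G] in blast)+
  have h': "(b, h b) \<in> G" if "b \<in> carrier B" for b using total[OF that] h by auto
  have "h \<in> left_hom R B I"
    by (rule left_homI) (auto intro!: h partial_graphD(4,5)[OF G] intro: h' partial_graphD(3)[OF G])
  moreover have "h (g x) = f x" if "x \<in> carrier A" for x
    using that by (intro h partial_graphD(1)[OF G]) (auto simp: G0_def)
  ultimately show ?thesis using that by blast
qed

section \<open>Cardinality of the universe\<close>

text \<open>Lists over any type are infinitely many, so a pair of lists can be coded by one list;
  this turns a family of members of the universe indexed by lists into a single member. In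
  cardinals, \<open>\<kappa> ^ \<lambda> \<le> \<kappa>\<close>.\<close>

lemma univ_embed_pow: "\<exists>J :: ('r list => ('r, 'p) univ) => ('r, 'p) univ. inj J"
proof -
  have "infinite (UNIV :: 'r list set)" by (rule infinite_UNIV_listI)
  then have "|(UNIV :: 'r list set) \<times> (UNIV :: 'r list set)| =o |UNIV :: 'r list set|"
    by (rule card_of_Times_same_infinite)
  then obtain q :: "'r list \<times> 'r list => 'r list" where q: "inj q"
    by (auto simp: card_of_ordIso[symmetric] bij_betw_def)
  let ?J = "\<lambda>F l. if l \<in> range q then F (fst (inv_into UNIV q l)) (snd (inv_into UNIV q l)) else None :: 'p option"
  have "inj ?J"
  proof (rule injI)
    fix F G :: "'r list => ('r, 'p) univ" assume *: "?J F = ?J G"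
    have "F a b = G a b" for a b
      using fun_cong[OF *, of "q (a, b)"] q by simp
    then show "F = G" by blast
  qed
  then show ?thesis by blast
qed

lemma univ_embed_base: "\<exists>f :: 'p => ('r, 'p) univ. inj f"
  by (intro exI[of _ "\<lambda>p l. Some p"]) (auto simp: inj_def fun_eq_iff)

lemma univ_embed_list_scalar: "\<exists>f :: 'r list => ('r, 'p) univ. inj f"
proof -
  have "inj (\<lambda>l l'. if l' = l then Some (undefined :: 'p) else None :: 'p option)"
    by (rule injI) (metis option.distinct(1))
  then show ?thesis by blast
qed

lemma univ_embed_scalar: "\<exists>f :: 'r => ('r, 'p) univ. inj f"
proof -
  obtain f :: "'r list => ('r, 'p) univ" where "inj f" using univ_embed_list_scalar by blast
  then have "inj (\<lambda>r. f [r])" by (auto simp: inj_def)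
  then show ?thesis by blast
qed

lemma infinite_univ: "infinite (UNIV :: ('r, 'p) univ set)"
proof -
  obtain f :: "'r list => ('r, 'p) univ" where "inj f" using univ_embed_list_scalar by blast
  then show ?thesis using infinite_UNIV_listI[where 'a = 'r] by (meson finite_imageD finite_subset subset_UNIV)
qed

lemma univ_embed_prod:
  assumes "inj (f :: 'a => ('r, 'p) univ)" and "inj (g :: 'b => ('r, 'p) univ)"
  shows "\<exists>h :: 'a \<times> 'b => ('r, 'p) univ. inj h"
proof -
  have "|(UNIV :: ('r, 'p) univ set) \<times> (UNIV :: ('r, 'p) univ set)| =o |UNIV :: ('r, 'p) univ set|"
    by (rule card_of_Times_same_infinite[OF infinite_univ])
  then obtain q :: "('r, 'p) univ \<times> ('r, 'p) univ => ('r, 'p) univ" where q: "inj q"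
    by (auto simp: card_of_ordIso[symmetric] bij_betw_def)
  have "inj (\<lambda>x. q (f (fst x), g (snd x)))"
    by (rule injI) (simp add: inj_eq[OF q] inj_eq[OF assms(1)] inj_eq[OF assms(2)] prod_eq_iff)
  then show ?thesis by blast
qed

lemma univ_embed_list:
  assumes "inj (f :: 'a => ('r, 'p) univ)"
  shows "\<exists>h :: 'a list => ('r, 'p) univ. inj h"
proof -
  have "|lists (UNIV :: ('r, 'p) univ set)| =o |UNIV :: ('r, 'p) univ set|"
    by (rule card_of_lists_infinite[OF infinite_univ])
  then obtain q :: "('r, 'p) univ list => ('r, 'p) univ" where "bij_betw q (lists UNIV) UNIV"
    using card_of_ordIso by blast
  then have q: "inj q" unfolding lists_UNIV by (rule bij_betw_imp_inj_on)
  have "inj (\<lambda>x. q (map f x))"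
    using inj_compose[OF q, of "map f"] assms by (simp add: comp_def)
  then show ?thesis by blast
qed

lemma univ_embed_countable:
  "\<exists>f :: 'a :: countable => ('r, 'p) univ. inj f"
proof -
  obtain g :: "nat => ('r, 'p) univ" where "inj g"
    using infinite_univ infinite_countable_subset by blast
  then have "inj (\<lambda>x :: 'a. g (to_nat x))"
    using inj_compose[of g "to_nat :: 'a => nat"] by (simp add: comp_def)
  then show ?thesis by blast
qed

text \<open>The values at singleton lists recover \<open>F\<close>. Through
  \<open>univ_embed_pow\<close>, modules of functions on the ring, such as coinduced ones, stay
  inside the universe.\<close>

lemma univ_embed_fun:
  assumes "inj (f :: 'a => ('r, 'p) univ)"
  shows "\<exists>h :: ('r => 'a) => ('r, 'p) univ. inj h"
proof -
  obtain J :: "('r list => ('r, 'p) univ) => ('r, 'p) univ" where J: "inj J"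
    using univ_embed_pow by blast
  have "inj (\<lambda>F. J (\<lambda>l. f (F (hd l))))"
  proof (rule injI)
    fix F G assume "J (\<lambda>l. f (F (hd l))) = J (\<lambda>l. f (G (hd l)))"
    then have "(\<lambda>l. f (F (hd l))) = (\<lambda>l. f (G (hd l)))" using J by (simp add: inj_eq)
    then have "f (F (hd [r])) = f (G (hd [r]))" for r by metis
    then show "F = G" using assms by (auto simp: inj_eq)
  qed
  then show ?thesis by blast
qed

text \<open>Lists that do not come from \<open>'r\<close> are sent to \<open>None\<close>, and the
  values on the image of \<open>map i\<close> recover the function. Serves to carry a resolution
  over one ring into the universe that belongs to another.\<close>

lemma univ_embed_univ:
  assumes i: "inj (i :: 'r => 's)" and j: "inj (j :: 'x => 't)"
  shows "\<exists>f :: ('r, 'x) univ => ('s, 't) univ. inj f"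
proof -
  have mi: "inj (map i)" using i by simp
  let ?F = "\<lambda>f l. if l \<in> range (map i) then map_option j (f (inv_into UNIV (map i) l)) else None"
  have "inj ?F"
  proof (rule injI)
    fix f g :: "('r, 'x) univ" assume *: "?F f = ?F g"
    have "f l = g l" for l
      using fun_cong[OF *, of "map i l"] mi j by (auto simp: inv_f_f[OF mi] option.inj_map inj_eq[OF option.inj_map[OF j]])
    then show "f = g" by blast
  qed
  then show ?thesis by blast
qed

section \<open>Injective modules\<close>

lemma ring_r_one: "ring R ==> x \<in> carrier R ==> x \<otimes>\<^sub>R \<one>\<^sub>R = x"
  by (simp add: ring_def monoid.r_one)

lemma ring_bimodule_simps [simp]:
  "carrier (ring_bimodule S f g) = carrier S" "\<zero>\<^sub>(ring_bimodule S f g) = \<zero>\<^sub>S"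
  "x \<oplus>\<^sub>(ring_bimodule S f g) y = x \<oplus>\<^sub>S y" "r \<odot>\<^sub>(ring_bimodule S f g) x = f r \<otimes>\<^sub>S x"
  "x \<odot>\<^sub>r\<^sub>(ring_bimodule S f g) c = x \<otimes>\<^sub>S g c"
  by (simp_all add: ring_bimodule_def)

lemma agrp_ring_bimodule:
  assumes "ring S" shows "abelian_group (ring_bimodule S f g)"
proof -
  note ag = ring_ag[OF assms]
  show ?thesis
    by (rule abelian_groupI') (auto simp: ag_closed[OF ag] ag_zero[OF ag] ag_assoc[OF ag] ag_l_zero[OF ag]
       intro: ag_comm[OF ag] ag_l_neg[OF ag] ag_inv[OF ag])
qed

lemma lmod_regular:
  assumes R: "ring R" shows "left_module R (ring_bimodule R id g)"
  by (rule left_moduleI) (use R in \<open>auto simp: agrp_ring_bimodule ring_rules\<close>)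

lemma submod_regular: "submod R (ring_bimodule R id g) L \<longleftrightarrow> left_ideal R L"
  by (auto simp: submod_def left_ideal_def)

lemma ideal_hom_left_hom:
  "f \<in> ideal_hom R L I \<longleftrightarrow> f \<in> left_hom R ((ring_bimodule R id g)\<lparr>carrier := L\<rparr>) I"
  by (auto simp: ideal_hom_def left_hom_def)

text \<open>The definition tests modules in the universe only, so the ideal and the ring are first
  copied into it along an injection \<open>c\<close> of the scalars; the extended map is then
  evaluated at one.\<close>

lemma injective_module_baer:
  fixes I :: "('r, 'i, 'f) module_scheme"
  assumes I: "injective_module R I"
  shows "baer R I"
  unfolding baer_def
proof (intro conjI allI impI)
  show lmI: "left_module R I" using I by (simp add: injective_module_def)
  have R: "ring R" using lmI by (rule lm_ring)
  fix L f assume L: "left_ideal R L" and f: "f \<in> ideal_hom R L I"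
  obtain c :: "'r => ('r, 'i) univ" where c: "inj c" using univ_embed_scalar by blast
  let ?B = "ring_bimodule R id id" and ?A = "(ring_bimodule R id id)\<lparr>carrier := L\<rparr>"
  have B: "left_module R ?B" using R by (rule lmod_regular)
  have A: "left_module R ?A" using L B by (simp add: lmod_sub submod_regular)
  have LR: "L \<subseteq> carrier R" using L by (simp add: left_ideal_def)
  have cA: "inj_on c (carrier ?A)" and cB: "inj_on c (carrier ?B)" using c by (auto intro: inj_on_subset)
  note pA = push_inj[OF A cA] and pB = push_inj[OF B cB]
  let ?d = "inv_into (carrier ?A) c"
  have "(\<lambda>x. x) \<in> left_hom R ?A ?B"
    using LR by (intro lh_sub_dom lh_id) auto
  then have g: "(\<lambda>x. c (?d x)) \<in> left_hom R (push c ?A) (push c ?B)"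
    using lh_comp[OF lh_comp[OF pA(3)] pB(2), of "\<lambda>x. x"] by simp
  have d: "?d (c x) = x" if "x \<in> L" for x using that cA by (simp add: inv_into_f_f)
  have inj: "inj_on (\<lambda>x. c (?d x)) (carrier (push c ?A))"
    using d by (auto simp: inj_on_def push_carrier')
  have f': "(\<lambda>x. f (?d x)) \<in> left_hom R (push c ?A) I"
    using f pA(3) lh_comp by (fastforce simp: ideal_hom_left_hom[of _ _ _ _ id])
  obtain h where h: "h \<in> left_hom R (push c ?B) I" "\<And>x. x \<in> carrier (push c ?A) ==> h (c (?d x)) = f (?d x)"
    using I[unfolded injective_module_def, THEN conjunct2, rule_format, OF pA(1) pB(1) g inj f'] by auto
  have hc: "(\<lambda>x. h (c x)) \<in> left_hom R ?B I" by (rule lh_comp[OF pB(2) h(1)])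
  show "\<exists>x\<in>carrier I. \<forall>l\<in>L. f l = l \<odot>\<^sub>I x"
  proof (intro bexI[of _ "h (c \<one>\<^sub>R)"] ballI)
    fix l assume l: "l \<in> L"
    then have lR: "l \<in> carrier R" "\<one>\<^sub>R \<in> carrier R" using LR R by (auto simp: ring_rules)
    have "f l = h (c l)" using h(2)[of "c l"] l d by (simp add: push_carrier')
    also have "\<dots> = h (c (l \<otimes>\<^sub>R \<one>\<^sub>R))" using lR R by (simp add: ring_r_one)
    also have "\<dots> = l \<odot>\<^sub>I h (c \<one>\<^sub>R)" using lh_smult[OF hc, of l "\<one>\<^sub>R"] lR by simp
    finally show "f l = l \<odot>\<^sub>I h (c \<one>\<^sub>R)" .
  next
    show "h (c \<one>\<^sub>R) \<in> carrier I" using lh_closed[OF hc, of "\<one>\<^sub>R"] R by (simp add: ring_rules)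
  qed
qed

text \<open>The converse is \<open>baer_extend\<close>, whose modules may have any types; hence the
  universe no longer limits the maps that an injective module extends.\<close>

lemma injective_module_iff_baer:
  fixes I :: "('r, 'i, 'f) module_scheme"
  shows "injective_module R I \<longleftrightarrow> baer R I"
proof
  assume I: "baer R I"
  show "injective_module R I"
    unfolding injective_module_def
  proof (intro conjI allI impI)
    fix A B :: "('r, ('r, 'i) univ) module" and g f
    assume A: "left_module R A" and B: "left_module R B" and g: "g \<in> left_hom R A B"
      and inj: "inj_on g (carrier A)" and f: "f \<in> left_hom R A I"
    have "f x = \<zero>\<^sub>I" if "x \<in> carrier A" "g x = \<zero>\<^sub>B" for x
    proof -
      have "x \<in> a_kernel A B g" using that by (simp add: a_kernel_eq)
      then have "x = \<zero>\<^sub>A" using lh_inj_iff[OF A B g] inj by simp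
      then show ?thesis using lh_zero_zero[OF f A] I by (simp add: baer_left_module)
    qed
    then obtain h where "h \<in> left_hom R B I" "\<And>x. x \<in> carrier A ==> h (g x) = f x"
      using baer_extend[OF I A B g f] by blast
    then show "\<exists>h\<in>left_hom R B I. \<forall>x\<in>carrier A. h (g x) = f x" by blast
  qed (use I baer_left_module in blast)
qed (rule injective_module_baer)

section \<open>Modules of homomorphisms\<close>

lemma hom_module_simps [simp]:
  "carrier (hom_module R B X) = left_hom R B X \<inter> extensional (carrier B)"
  "\<zero>\<^sub>(hom_module R B X) = (\<lambda>b\<in>carrier B. \<zero>\<^sub>X)"
  "f \<oplus>\<^sub>(hom_module R B X) g = (\<lambda>b\<in>carrier B. f b \<oplus>\<^sub>X g b)"
  "s \<odot>\<^sub>(hom_module R B X) f = (\<lambda>b\<in>carrier B. f (b \<odot>\<^sub>r\<^sub>B s))"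
  by (simp_all add: hom_module_def)

lemma lh_restrict:
  "left_module R B ==> restrict f (carrier B) \<in> left_hom R B X \<longleftrightarrow> f \<in> left_hom R B X"
  by (auto simp: left_hom_def lm Pi_iff)

lemma is_bimoduleD:
  assumes "is_bimodule S R M"
  shows "left_module S M" "right_module R M"
    "a \<in> carrier S ==> x \<in> carrier M ==> b \<in> carrier R ==>
       (a \<odot>\<^sub>M x) \<odot>\<^sub>r\<^sub>M b = a \<odot>\<^sub>M (x \<odot>\<^sub>r\<^sub>M b)"
  using assms by (auto simp: is_bimodule_def)

lemma lh_rsmult:
  assumes "is_bimodule R S B" "f \<in> left_hom R B X" "s \<in> carrier S"
  shows "(\<lambda>b. f (b \<odot>\<^sub>r\<^sub>B s)) \<in> left_hom R B X"
proof -
  note B = is_bimoduleD[OF assms(1)]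
  have "(\<lambda>b. b \<odot>\<^sub>r\<^sub>B s) \<in> left_hom R B B"
    using assms B by (intro left_homI) (simp_all add: rm_closed rm_l_distr)
  then show ?thesis using lh_comp assms(2) by blast
qed

lemma lmod_hom_module:
  assumes B: "is_bimodule R S B" and X: "left_module R X"
  shows "left_module S (hom_module R B X)"
proof -
  note lB = is_bimoduleD(1)[OF B] and rB = is_bimoduleD(2)[OF B]
  note agB = lm_ag[OF lB] and agX = lm_ag[OF X]
  note r = lh_restrict[OF lB]
  show ?thesis
  proof (rule left_moduleI)
    show "ring S" using rB by (rule rm_ring)
    show "abelian_group (hom_module R B X)"
    proof (rule abelian_groupI')
      fix f assume "f \<in> carrier (hom_module R B X)"
      then have f: "f \<in> left_hom R B X" by simp
      have "(\<lambda>b. \<zero>\<^sub>X \<ominus>\<^sub>X f b) \<in> left_hom R B X"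
        using lh_minus[OF lh_zero[OF X] f X] .
      then show "\<exists>g\<in>carrier (hom_module R B X). g \<oplus>\<^sub>(hom_module R B X) f = \<zero>\<^sub>(hom_module R B X)"
        using f agX
        by (intro bexI[of _ "\<lambda>b\<in>carrier B. \<zero>\<^sub>X \<ominus>\<^sub>X f b"])
          (auto simp: r lh_closed ag_diff_add ag_zero cong: restrict_cong)
    qed (auto simp: r lh_closed ag_zero[OF agX] ag_closed[OF agX] ag_assoc[OF agX] ag_l_zero[OF agX]
        ag_comm[OF agX] ag_lcomm[OF agX] ag_r_zero[OF agX] extensional_def fun_eq_iff lh_plus[OF _ _ X] lh_zero[OF X])
  next
    fix a f assume "a \<in> carrier S" "f \<in> carrier (hom_module R B X)"
    then show "a \<odot>\<^sub>(hom_module R B X) f \<in> carrier (hom_module R B X)"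
      by (simp add: r lh_rsmult[OF B])
  qed (use rB in \<open>auto simp: fun_eq_iff extensional_def rm_closed rm_r_distr rm_l_distr rm_assoc rm_one lh_add\<close>)
qed

lemma ring_hom_id: "id \<in> ring_hom R R"
  by (auto intro!: ring_hom_memI)

lemma ring_bimodule_bimodule:
  assumes "ring R" "ring S" "ring T" "f \<in> ring_hom R S" "g \<in> ring_hom T S"
  shows "is_bimodule R T (ring_bimodule S f g)"
proof -
  note ag = agrp_ring_bimodule[OF assms(2)]
  show ?thesis
    unfolding is_bimodule_def
  proof (intro conjI ballI)
    show "left_module R (ring_bimodule S f g)"
      by (rule left_moduleI) (use assms ag ring_hom_memE[OF assms(4)] in \<open>auto simp: ring_rules\<close>)
    show "right_module T (ring_bimodule S f g)"
      by (rule right_moduleI)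
        (use assms ag ring_hom_memE[OF assms(5)] in \<open>auto simp: ring_rules ring_r_one\<close>)
  qed (use assms ring_hom_memE[OF assms(4)] ring_hom_memE[OF assms(5)] in \<open>auto simp: ring_rules\<close>)
qed

text \<open>Evaluation at one turns maps over \<open>S\<close> into the coinduced module into maps
  over \<open>R\<close> into \<open>I\<close>. The map \<open>l \<mapsto> \<phi> l 1\<close> is
  extended from \<open>L\<close> to all of \<open>S\<close>, and the extension, as an element of the
  coinduced module, represents \<open>\<phi>\<close>.\<close>

lemma coinduced_baer:
  assumes I: "baer R I" and S: "ring S" and f: "f \<in> ring_hom R S"
  shows "baer S (hom_module R (ring_bimodule S f id) I)"
  unfolding baer_def
proof (intro conjI allI impI)
  let ?B = "ring_bimodule S f id" and ?H = "hom_module R (ring_bimodule S f id) I"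
  have lmI: "left_module R I" using I by (rule baer_left_module)
  have R: "ring R" using lmI by (rule lm_ring)
  have B: "is_bimodule R S ?B" by (intro ring_bimodule_bimodule R S f ring_hom_id)
  show "left_module S ?H" using B lmI by (rule lmod_hom_module)
  fix L \<phi> assume L: "left_ideal S L" and \<phi>: "\<phi> \<in> ideal_hom S L ?H"
  have one: "\<one>\<^sub>S \<in> carrier S" using S by (simp add: ring_rules)
  have LS: "l \<in> carrier S" if "l \<in> L" for l using L that by (auto simp: left_ideal_def)
  have \<phi>h: "\<phi> l \<in> left_hom R ?B I" if "l \<in> L" for l using \<phi> that by (auto simp: ideal_hom_def)
  have \<phi>s: "\<phi> (s \<otimes>\<^sub>S l) t = \<phi> l (t \<otimes>\<^sub>S s)" if "l \<in> L" "s \<in> carrier S" "t \<in> carrier S" for l s t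
    using \<phi> that by (auto simp: ideal_hom_def)
  let ?A = "?B\<lparr>carrier := L\<rparr>"
  have LB: "submod R ?B L"
    using L ring_hom_closed[OF f] by (auto simp: submod_def left_ideal_def)
  have lmB: "left_module R ?B" using is_bimoduleD(1)[OF B] .
  have A: "left_module R ?A" using lmB LB by (rule lmod_sub)
  have \<psi>: "(\<lambda>l. \<phi> l \<one>\<^sub>S) \<in> left_hom R ?A I"
  proof (rule left_homI)
    fix x assume "x \<in> carrier ?A"
    then show "\<phi> x \<one>\<^sub>S \<in> carrier I" using \<phi>h[of x] one by (auto dest: lh_closed)
  next
    fix x y assume "x \<in> carrier ?A" "y \<in> carrier ?A"
    then show "\<phi> (x \<oplus>\<^sub>?A y) \<one>\<^sub>S = \<phi> x \<one>\<^sub>S \<oplus>\<^sub>I \<phi> y \<one>\<^sub>S"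
      using \<phi> one by (auto simp: ideal_hom_def)
  next
    fix r x assume rx: "r \<in> carrier R" "x \<in> carrier ?A"
    then have "\<phi> (f r \<otimes>\<^sub>S x) \<one>\<^sub>S = \<phi> x (f r \<otimes>\<^sub>S \<one>\<^sub>S)"
      using \<phi>s[of x "f r" "\<one>\<^sub>S"] one ring_hom_closed[OF f] S by (simp add: ring_rules ring_r_one)
    also have "\<dots> = r \<odot>\<^sub>I \<phi> x \<one>\<^sub>S"
      using lh_smult[OF \<phi>h, of x r "\<one>\<^sub>S"] rx one by simp
    finally show "\<phi> (r \<odot>\<^sub>?A x) \<one>\<^sub>S = r \<odot>\<^sub>I \<phi> x \<one>\<^sub>S" by simp
  qed
  have incl: "(\<lambda>x. x) \<in> left_hom R ?A ?B"
    using LS by (intro lh_sub_dom lh_id) auto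
  have "\<phi> x \<one>\<^sub>S = \<zero>\<^sub>I" if "x \<in> carrier ?A" "x = \<zero>\<^sub>?B" for x
    using lh_zero_zero[OF \<psi> A lmI] that by simp
  then obtain h where h: "h \<in> left_hom R ?B I" "\<And>l. l \<in> carrier ?A ==> h l = \<phi> l \<one>\<^sub>S"
    using baer_extend[OF I A lmB incl \<psi>] by auto
  show "\<exists>x\<in>carrier ?H. \<forall>l\<in>L. \<phi> l = l \<odot>\<^sub>?H x"
  proof (intro bexI[of _ "restrict h (carrier S)"] ballI)
    show "restrict h (carrier S) \<in> carrier ?H"
      using lh_restrict[OF lmB, of h I] h by simp
    fix l assume l: "l \<in> L"
    show "\<phi> l = l \<odot>\<^sub>?H restrict h (carrier S)"
    proof (rule extensionalityI[of _ "carrier S"])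
      show "\<phi> l \<in> extensional (carrier S)" using \<phi> l by (auto simp: ideal_hom_def)
      show "l \<odot>\<^sub>?H restrict h (carrier S) \<in> extensional (carrier S)" by simp
      fix s assume s: "s \<in> carrier S"
      have sl: "s \<otimes>\<^sub>S l \<in> L" using L l s by (auto simp: left_ideal_def)
      have "\<phi> l s = \<phi> (s \<otimes>\<^sub>S l) \<one>\<^sub>S" using \<phi>s[OF l s one] S s by (simp add: ring_rules)
      then show "\<phi> l s = (l \<odot>\<^sub>?H restrict h (carrier S)) s"
        using h(2)[of "s \<otimes>\<^sub>S l"] sl s LS[OF sl] by simp
    qed
  qed
qed

lemma baer_retract:
  assumes I: "baer R I" and J: "left_module R J" and i: "i \<in> left_hom R J I" and p: "p \<in> left_hom R I J"
    and pi: "\<And>x. x \<in> carrier J ==> p (i x) = x"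
  shows "baer R J"
  unfolding baer_def
proof (intro conjI allI impI)
  fix L f assume L: "left_ideal R L" and f: "f \<in> ideal_hom R L J"
  have fJ: "f l \<in> carrier J" if "l \<in> L" for l using f that by (auto simp: ideal_hom_def)
  have LR: "l \<in> carrier R" if "l \<in> L" for l using L that by (auto simp: left_ideal_def)
  have "(\<lambda>l. i (f l)) \<in> ideal_hom R L I"
    using f lh_closed[OF i] lh_add[OF i] lh_smult[OF i] by (auto simp: ideal_hom_def Pi_iff)
  then obtain x where x: "x \<in> carrier I" "\<And>l. l \<in> L ==> i (f l) = l \<odot>\<^sub>I x"
    using baerD[OF I L] by blast
  have "f l = l \<odot>\<^sub>J p x" if "l \<in> L" for l
    using x(2)[OF that] pi[OF fJ[OF that]] lh_smult[OF p LR[OF that] x(1)] by simp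
  then show "\<exists>x\<in>carrier J. \<forall>l\<in>L. f l = l \<odot>\<^sub>J x"
    using lh_closed[OF p x(1)] by blast
qed (rule J)

lemma baer_push:
  assumes "baer R I" and c: "inj_on c (carrier I)"
  shows "baer R (push c I)"
proof -
  note p = push_inj[OF baer_left_module[OF assms(1)] c]
  show ?thesis
    by (rule baer_retract[OF assms(1) p(1,3,2)]) (auto simp: push_carrier' f_inv_into_f)
qed

section \<open>Abelian groups as modules over the integers\<close>

definition ZZ :: "int ring" where
  "ZZ = \<lparr>carrier = UNIV, mult = (*), one = 1, ring.zero = 0, add = (+)\<rparr>"

lemma ZZ_simps [simp]:
  "carrier ZZ = UNIV" "a \<otimes>\<^sub>ZZ b = a * b" "\<one>\<^sub>ZZ = 1" "\<zero>\<^sub>ZZ = 0" "a \<oplus>\<^sub>ZZ b = a + b"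
  by (simp_all add: ZZ_def)

lemma ring_ZZ: "ring ZZ"
proof (rule ringI)
  show "abelian_group ZZ"
    by (rule abelian_groupI') (auto intro: exI[of _ "- _"])
  show "monoid ZZ" by (rule monoidI) auto
qed (auto simp: algebra_simps)

text \<open>Nonnegative multiples are treated by induction, negative ones by moving the sign from
  the scalar to the vector.\<close>

lemma lh_ZZ:
  assumes X: "left_module ZZ X" and Y: "left_module ZZ Y"
  shows "left_hom ZZ X Y = ahom X Y"
proof (intro equalityI subsetI)
  fix f assume f: "f \<in> ahom X Y"
  note agX = lm_ag[OF X] and agY = lm_ag[OF Y]
  have nat: "f (int k \<odot>\<^sub>X x) = int k \<odot>\<^sub>Y f x" if "x \<in> carrier X" for k x
  proof (induction k)
    case 0
    show ?case using that lm_zero_smult[OF X that] lm_zero_smult[OF Y ahom_closed[OF f that]] ahom_zero[OF f agX agY] by simp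
  next
    case (Suc k)
    have "int (Suc k) \<odot>\<^sub>X x = x \<oplus>\<^sub>X int k \<odot>\<^sub>X x"
      using lm_l_distr[OF X, of 1 "int k" x] lm_one[OF X] that by simp
    moreover have "int (Suc k) \<odot>\<^sub>Y f x = f x \<oplus>\<^sub>Y int k \<odot>\<^sub>Y f x"
      using lm_l_distr[OF Y, of 1 "int k" "f x"] lm_one[OF Y] ahom_closed[OF f that] by simp
    ultimately show ?case
      using Suc that lm_closed[OF X, of "int k" x] by (simp add: ahom_add[OF f])
  qed
  have "f (k \<odot>\<^sub>X x) = k \<odot>\<^sub>Y f x" if x: "x \<in> carrier X" for k x
  proof (cases "k \<ge> 0")
    case True
    then show ?thesis using nat[OF x, of "nat k"] by simp
  next
    case False
    let ?y = "\<ominus>\<^sub>X x"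
    have inv: "\<ominus>\<^sub>ZZ k = - k" for k
      by (rule ag_eq_neg[OF ring_ag[OF ring_ZZ], symmetric]) auto
    have "k \<odot>\<^sub>X x = (- k) \<odot>\<^sub>X ?y"
      using lm_neg_smult[OF X, of k x] lm_smult_neg[OF X, of "- k" x] lm_neg_smult[OF X, of "-k" x] x
      by (simp add: inv)
    moreover have "k \<odot>\<^sub>Y f x = (- k) \<odot>\<^sub>Y f ?y"
      using lm_neg_smult[OF Y, of k "f x"] lm_smult_neg[OF Y, of "- k" "f x"] lm_neg_smult[OF Y, of "-k" "f x"]
        x ahom_closed[OF f x]
      by (simp add: inv ahom_neg[OF f agX agY])
    moreover have "?y \<in> carrier X" using x agX by (simp add: ag_inv)
    ultimately show ?thesis using nat[of ?y "nat (- k)"] False by simp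
  qed
  then show "f \<in> left_hom ZZ X Y" using f by (simp add: lh_iff)
qed (rule lh_ahom)

text \<open>An abelian group with integer multiples on the left and an action \<open>act\<close> on
  the right; forming \<open>hom_module ZZ\<close> out of it turns \<open>act\<close> into a left
  action on characters.\<close>

definition zbimodule :: "('b => 'c => 'b) => ('b, 'e) ring_scheme => (int, 'c, 'b) bimodule" where
  "zbimodule act A = \<lparr>carrier = carrier A, mult = undefined, one = undefined, ring.zero = \<zero>\<^sub>A, add = add A,
     smult = (\<lambda>k x. add_pow A k x), rsmult = act\<rparr>"

lemma zbimodule_simps [simp]:
  "carrier (zbimodule act A) = carrier A" "\<zero>\<^sub>(zbimodule act A) = \<zero>\<^sub>A"
  "x \<oplus>\<^sub>(zbimodule act A) y = x \<oplus>\<^sub>A y" "k \<odot>\<^sub>(zbimodule act A) x = [k] \<cdot>\<^bsub>A\<^esub> x"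
  "x \<odot>\<^sub>r\<^sub>(zbimodule act A) r = act x r"
  by (simp_all add: zbimodule_def)

lemma lmod_zbimodule:
  assumes A: "abelian_group A"
  shows "left_module ZZ (zbimodule act A)"
proof -
  interpret abelian_group A by fact
  have ag: "abelian_group (zbimodule act A)"
    by (rule abelian_groupI') (auto simp: a_assoc intro: a_comm l_neg a_inv_closed)
  show ?thesis
    by (rule left_moduleI) (use ag add.int_pow_mult[of _ _] add.int_pow_pow in
      \<open>auto simp: ring_ZZ add.int_pow_distrib add.int_pow_closed mult.commute\<close>)
qed

lemma ahom_zbimodule [simp]:
  "ahom (zbimodule act A) Y = ahom A Y" "ahom X (zbimodule act A) = ahom X A"
  by (auto simp: ahom_def)

lemma lh_zbimodule:
  "abelian_group A ==> left_module ZZ Y ==> left_hom ZZ (zbimodule act A) Y = ahom A Y"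
  using lh_ZZ[OF lmod_zbimodule] by fastforce

lemma zbimodule_bimodule:
  assumes ag: "abelian_group A" and A: "right_module R (zbimodule act A)"
  shows "is_bimodule ZZ R (zbimodule act A)"
  unfolding is_bimodule_def
proof (intro conjI ballI)
  note lz = lmod_zbimodule[OF ag, of act]
  show "left_module ZZ (zbimodule act A)" by (rule lz)
  show "right_module R (zbimodule act A)" by (rule A)
  fix k x r assume *: "x \<in> carrier (zbimodule act A)" "r \<in> carrier R"
  then have "(\<lambda>x. act x r) \<in> ahom (zbimodule act A) (zbimodule act A)"
    using rm_closed[OF A, of r] rm_l_distr[OF A, of r] by (intro ahomI) auto
  then have "(\<lambda>x. act x r) \<in> left_hom ZZ (zbimodule act A) (zbimodule act A)"
    using lh_ZZ[OF lz lz] by blast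
  then show "(k \<odot>\<^sub>(zbimodule act A) x) \<odot>\<^sub>r\<^sub>(zbimodule act A) r = k \<odot>\<^sub>(zbimodule act A) (x \<odot>\<^sub>r\<^sub>(zbimodule act A) r)"
    using * lh_smult[of "\<lambda>x. act x r" ZZ "zbimodule act A" "zbimodule act A" k x] by simp
qed

text \<open>The least positive element \<open>n\<close> divides all of \<open>J\<close> by division
  with remainder, so every multiple of \<open>Gcd J\<close> is a multiple of \<open>n\<close> and
  lies in \<open>J\<close>. The zero subgroup is the case \<open>m = 0\<close>.\<close>

lemma int_subgroup_principal:
  assumes "0 \<in> J" "\<And>x y. x \<in> J ==> y \<in> J ==> x + y \<in> J" "\<And>k x. x \<in> J ==> k * x \<in> (J :: int set)"
  obtains m where "m \<ge> 0" "J = {k. m dvd k}"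
proof -
  have "J = {k. Gcd J dvd k}"
  proof (intro equalityI subsetI)
    fix k assume "k \<in> {k. Gcd J dvd k}"
    then have k: "Gcd J dvd k" by simp
    show "k \<in> J"
    proof (cases "J \<subseteq> {0}")
      case True
      then have "Gcd J = 0" by (simp add: Gcd_0_iff)
      then have "k = 0" using k by (metis dvd_0_left)
      then show ?thesis using assms(1) by simp
    next
      case False
      then obtain x where x: "x \<in> J" "x \<noteq> 0" by auto
      define n where "n = (LEAST n. n > 0 \<and> int n \<in> J)"
      have "\<bar>x\<bar> \<in> J" by (metis abs_sgn mult.commute assms(3) x(1))
      then have "int (nat \<bar>x\<bar>) \<in> J" by simp
      then have n: "n > 0 \<and> int n \<in> J"
        unfolding n_def by (rule LeastI[of "\<lambda>n. n > 0 \<and> int n \<in> J" "nat \<bar>x\<bar>", OF conjI, rotated]) (use x in auto)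
      have min: "n \<le> k" if "k > 0" "int k \<in> J" for k
        unfolding n_def by (rule Least_le) (use that in auto)
      have dv: "int n dvd y" if "y \<in> J" for y
      proof (rule ccontr)
        assume *: "\<not> int n dvd y"
        have "y + (- (y div int n)) * int n \<in> J" using assms(2,3) that n by blast
        then have m: "y mod int n \<in> J" by (simp add: minus_div_mult_eq_mod)
        have r: "0 \<le> y mod int n" "y mod int n < int n" using n by auto
        have "y mod int n \<noteq> 0" using * by (simp add: dvd_eq_mod_eq_0)
        then have "n \<le> nat (y mod int n)" using r m by (intro min) auto
        then show False using r by linarith
      qed
      have "int n dvd Gcd J" using dv by (rule Gcd_greatest)
      then have "int n dvd k" using k by (rule dvd_trans)
      then show ?thesis using assms(3) n by (auto elim!: dvdE simp: mult.commute)
    qed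
  qed (auto intro: Gcd_dvd)
  then show ?thesis using that[of "Gcd J"] by auto
qed

text \<open>Ideals of the integers are principal, so a map is fixed by its value at a generator
  \<open>m\<close>, and dividing this value by \<open>m\<close> represents the map; for
  \<open>m = 0\<close> zero does.\<close>

lemma divisible_baer:
  assumes D: "left_module ZZ D"
    and div: "\<And>k x. x \<in> carrier D ==> k \<noteq> 0 ==> \<exists>y\<in>carrier D. k \<odot>\<^sub>D y = x"
  shows "baer ZZ D"
  unfolding baer_def
proof (intro conjI allI impI)
  fix L f assume L: "left_ideal ZZ L" and f: "f \<in> ideal_hom ZZ L D"
  obtain m where m: "m \<ge> 0" "L = {k. m dvd k}"
    using int_subgroup_principal[of L] L by (auto simp: left_ideal_def)
  have fm: "f m \<in> carrier D" "f (k * m) = k \<odot>\<^sub>D f m" for k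
    using f m by (auto simp: ideal_hom_def)
  obtain y where y: "y \<in> carrier D" "m \<noteq> 0 ==> m \<odot>\<^sub>D y = f m" "m = 0 ==> y = \<zero>\<^sub>D"
    using div[OF fm(1), of m] lm_ag[OF D] by (cases "m = 0") (auto intro: ag_zero)
  have "f l = l \<odot>\<^sub>D y" if l: "l \<in> L" for l
  proof (cases "m = 0")
    case True
    then have "l = 0 * m" using l m by auto
    then have "f l = 0 \<odot>\<^sub>D f m" using fm(2)[of 0] by simp
    then show ?thesis using True lm_zero_smult[OF D] fm(1) y(1) \<open>l = 0 * m\<close> by simp
  next
    case False
    have "m dvd l" using l m by simp
    then obtain k where k: "l = k * m" by (metis dvdE mult.commute)
    then show ?thesis using fm y False lm_assoc[OF D, of k m y] by simp
  qed
  then show "\<exists>x\<in>carrier D. \<forall>l\<in>L. f l = l \<odot>\<^sub>D x" using y(1) by blast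
qed (rule D)

lemma divisible_quotient:
  assumes X: "left_module ZZ X" and Q: "left_module ZZ Q" and q: "q \<in> left_hom ZZ X Q"
    and surj: "q ` carrier X = carrier Q"
    and div: "\<And>k x. x \<in> carrier X ==> k \<noteq> 0 ==> \<exists>y\<in>carrier X. k \<odot>\<^sub>X y = x"
  shows "baer ZZ Q"
proof (rule divisible_baer[OF Q])
  fix k :: int and x assume "x \<in> carrier Q" "k \<noteq> 0"
  then obtain u where u: "u \<in> carrier X" "x = q u" using surj by blast
  then obtain y where "y \<in> carrier X" "k \<odot>\<^sub>X y = u" using div \<open>k \<noteq> 0\<close> by blast
  then show "\<exists>y\<in>carrier Q. k \<odot>\<^sub>Q y = x"
    using u lh_closed[OF q] lh_smult[OF q, of k y] by (intro bexI[of _ "q y"]) auto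
qed

subsection \<open>The group of rationals modulo the integers\<close>

definition rat_module :: "(int, rat) module" where
  "rat_module = \<lparr>carrier = UNIV, mult = undefined, one = undefined, ring.zero = 0, add = (+),
     smult = (\<lambda>k x. of_int k * x)\<rparr>"

lemma rat_module_simps [simp]:
  "carrier rat_module = UNIV" "\<zero>\<^sub>rat_module = 0" "x \<oplus>\<^sub>rat_module y = x + y"
  "k \<odot>\<^sub>(rat_module) x = of_int k * x"
  by (simp_all add: rat_module_def)

lemma lmod_rat: "left_module ZZ rat_module"
proof (rule left_moduleI)
  show "abelian_group rat_module" by (rule abelian_groupI') (auto intro: exI[of _ "- _"])
qed (auto simp: ring_ZZ algebra_simps)

text \<open>The elements are chosen representatives of cosets, so a character takes its values in
  the type \<open>rat\<close>.\<close>

definition QZ :: "(int, rat) module" where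
  "QZ = push (coset_rep rat_module \<int>) rat_module"

lemma submod_Ints: "submod ZZ rat_module \<int>"
  by (auto simp: submod_def)

lemmas QZ_push = push_quotient[OF lmod_rat submod_Ints coset_rep_eq_iff[OF lmod_rat submod_Ints], folded QZ_def]

lemma QZ_baer: "baer ZZ QZ"
proof (rule divisible_quotient[OF lmod_rat QZ_push(1,2)])
  show "coset_rep rat_module \<int> ` carrier rat_module = carrier QZ"
    using QZ_push(3) by simp
  fix k :: int and x assume "k \<noteq> 0"
  then show "\<exists>y\<in>carrier rat_module. k \<odot>\<^sub>(rat_module) y = x"
    by (intro bexI[of _ "x / of_int k"]) auto
qed

lemma lmod_QZ: "left_module ZZ QZ"
  by (rule baer_left_module[OF QZ_baer])

lemma agrp_QZ: "abelian_group QZ"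
  by (rule lm_ag[OF lmod_QZ])

text \<open>Groups become modules over \<open>ZZ\<close> through \<open>zbimodule\<close>, with the
  identity as action of \<open>unit\<close> on the right, and Baer's criterion over
  \<open>ZZ\<close> extends the map.\<close>

lemma ahom_extend:
  assumes D: "baer ZZ D" and A: "abelian_group A" and B: "abelian_group B" and g: "g \<in> ahom A B"
    and f: "f \<in> ahom A D" and ker: "\<And>x. x \<in> carrier A ==> g x = \<zero>\<^sub>B ==> f x = \<zero>\<^sub>D"
  obtains h where "h \<in> ahom B D" "\<And>x. x \<in> carrier A ==> h (g x) = f x"
proof -
  note lA = lmod_zbimodule[OF A, of "\<lambda>x (_::unit). x"] and lB = lmod_zbimodule[OF B, of "\<lambda>x (_::unit). x"] and lD = baer_left_module[OF D]
  have "g \<in> left_hom ZZ (zbimodule (\<lambda>x (_::unit). x) A) (zbimodule (\<lambda>x (_::unit). x) B)" "f \<in> left_hom ZZ (zbimodule (\<lambda>x (_::unit). x) A) D"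
    using g f lh_ZZ[OF lA lB] lh_ZZ[OF lA lD] by auto
  then obtain h where "h \<in> left_hom ZZ (zbimodule (\<lambda>x (_::unit). x) B) D" "\<And>x. x \<in> carrier A ==> h (g x) = f x"
    using baer_extend[OF D lA lB, of g f] ker by auto
  then show ?thesis using that lh_ZZ[OF lB lD] by auto
qed

text \<open>A character is first defined on the cyclic group generated by \<open>a\<close>, as a map
  on the integers that kills the annihilator \<open>J\<close> of \<open>a\<close>, and is then
  extended by injectivity of Q/Z.\<close>

lemma QZ_cogenerator:
  assumes A: "abelian_group A" and a: "a \<in> carrier A" "a \<noteq> \<zero>\<^sub>A"
  obtains \<chi> where "\<chi> \<in> ahom A QZ" "\<chi> a \<noteq> \<zero>\<^sub>QZ"
proof -
  note lA = lmod_zbimodule[OF A, of "\<lambda>x (_::unit). x"]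
  interpret abelian_group A by fact
  define J where "J = {k :: int. [k] \<cdot>\<^bsub>A\<^esub> a = \<zero>\<^sub>A}"
  have sm: "[k] \<cdot>\<^bsub>A\<^esub> a = k \<odot>\<^sub>(zbimodule (\<lambda>x (_::unit). x) A) a" for k :: int by simp
  have aA: "a \<in> carrier (zbimodule (\<lambda>x (_::unit). x) A)" using a by simp
  have "0 \<in> J" using a lm_zero_smult[OF lA aA] by (simp add: J_def)
  moreover have "x + y \<in> J" if "x \<in> J" "y \<in> J" for x y
    using that a lm_l_distr[OF lA, of x y a] by (simp add: J_def)
  moreover have "k * x \<in> J" if "x \<in> J" for k x
    using that a lm_assoc[OF lA, of k x a] lm_smult_zero[OF lA, of k] by (simp add: J_def)
  ultimately obtain m where m: "m \<ge> 0" "J = {k. m dvd k}"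
    by (rule int_subgroup_principal)
  have "1 \<notin> J" using a lm_one[OF lA aA] by (simp add: J_def)
  then have m1: "m \<noteq> 1" using m by auto
  \<comment> \<open>The intended value at \<open>a\<close>. Order \<open>m\<close> forces a value
    killed by \<open>m\<close>, and \<open>1 / m\<close> is not an integer because
    \<open>m \<noteq> 1\<close>; for infinite order, \<open>m = 0\<close>, any non-integer would
    do.\<close>
  define q :: rat where "q = (if m = 0 then 1/2 else 1 / of_int m)"
  have qJ: "of_int k * q \<in> \<int>" if "k \<in> J" for k
  proof (cases "m = 0")
    case True
    then show ?thesis using that m by auto
  next
    case False
    then show ?thesis using that m by (auto simp: q_def elim!: dvdE)
  qed
  have qn: "q \<notin> \<int>"
  proof
    assume "q \<in> \<int>"
    then obtain z where z: "q = of_int z" by (elim Ints_cases)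
    define m' where "m' = (if m = 0 then 2 else m)"
    have m': "m' \<ge> 2" using m m1 by (auto simp: m'_def)
    have "q = 1 / of_int m'" by (simp add: q_def m'_def)
    then have "(of_int (z * m') :: rat) = of_int 1" using z m' by (simp add: field_simps)
    then have "z * m' = 1" by (simp only: of_int_eq_iff)
    then have "m' dvd 1" by (metis dvd_triv_right)
    then show False using m' zdvd_imp_le[of m' 1] by simp
  qed
  let ?c = "coset_rep rat_module \<int>"
  have f: "(\<lambda>k. ?c (of_int k * q)) \<in> ahom ZZ QZ"
    by (rule ahomI)
      (simp_all add: lh_closed[OF QZ_push(2)] lh_add[OF QZ_push(2), symmetric] distrib_right)
  have g: "(\<lambda>k. [k] \<cdot>\<^bsub>A\<^esub> a) \<in> ahom ZZ A"
    unfolding sm using lm_scalar_ahom[OF lA aA] by simp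
  have k0: "?c x = \<zero>\<^sub>QZ \<longleftrightarrow> x \<in> \<int>" for x
    using QZ_push(5) by (auto simp: a_kernel_eq)
  have "?c (of_int k * q) = \<zero>\<^sub>QZ" if "[k] \<cdot>\<^bsub>A\<^esub> a = \<zero>\<^sub>A" for k :: int
    using qJ[of k] that by (simp add: k0 J_def)
  then obtain h where h: "h \<in> ahom A QZ" "\<And>k :: int. h ([k] \<cdot>\<^bsub>A\<^esub> a) = ?c (of_int k * q)"
    using ahom_extend[OF QZ_baer ring_ag[OF ring_ZZ] A g f] by auto
  have "h a = ?c q" using h(2)[of 1] lm_one[OF lA aA] by simp
  then show ?thesis using that[OF h(1)] k0 qn by simp
qed

section \<open>Enough injectives\<close>

text \<open>A function with finitely many values other than \<open>z\<close> is recovered from its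
  graph over these places, and a finite graph is coded by a list.\<close>

lemma finsupp_embed:
  fixes z :: 'b
  assumes "inj (f :: 'a => ('r, 'p) univ)" and "inj (g :: 'b => ('r, 'p) univ)"
  shows "\<exists>e :: ('a => 'b) => ('r, 'p) univ. inj_on e {h. finite {x. h x \<noteq> z}}"
proof -
  obtain p :: "'a \<times> 'b => ('r, 'p) univ" where "inj p" using univ_embed_prod[OF assms] by blast
  then obtain q :: "('a \<times> 'b) list => ('r, 'p) univ" where q: "inj q" using univ_embed_list by blast
  define L where "L = (\<lambda>h :: 'a => 'b. SOME ps. set ps = (\<lambda>x. (x, h x)) ` {x. h x \<noteq> z})"
  have L: "set (L h) = (\<lambda>x. (x, h x)) ` {x. h x \<noteq> z}" if "finite {x. h x \<noteq> z}" for h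
    unfolding L_def by (rule someI_ex) (use that in \<open>auto intro: finite_list\<close>)
  have "inj_on (\<lambda>h. q (L h)) {h. finite {x. h x \<noteq> z}}"
  proof (rule inj_onI)
    fix h h' assume *: "h \<in> {h. finite {x. h x \<noteq> z}}" "h' \<in> {h. finite {x. h x \<noteq> z}}" "q (L h) = q (L h')"
    then have "L h = L h'" using q by (simp add: inj_eq)
    moreover have "set (L h) = (\<lambda>x. (x, h x)) ` {x. h x \<noteq> z}" "set (L h') = (\<lambda>x. (x, h' x)) ` {x. h' x \<noteq> z}"
      using L * by blast+
    ultimately have eq: "(\<lambda>x. (x, h x)) ` {x. h x \<noteq> z} = (\<lambda>x. (x, h' x)) ` {x. h' x \<noteq> z}" by metis
    show "h = h'"
    proof
      fix x
      have "h x \<noteq> z ==> h' x = h x" using eq by (auto simp: set_eq_iff image_iff)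
      moreover have "h' x \<noteq> z ==> h' x = h x" using eq by (auto simp: set_eq_iff image_iff)
      ultimately show "h x = h' x" by metis
    qed
  qed
  then show ?thesis by blast
qed

text \<open>The rational vector space on the type \<open>'y\<close>: a divisible group into which
  the free abelian group on any subset embeds.\<close>

definition finsupp_rat :: "(int, 'y => rat) module" where
  "finsupp_rat = \<lparr>carrier = {h. finite {x. h x \<noteq> 0}}, mult = undefined, one = undefined,
     ring.zero = (\<lambda>x. 0), add = (\<lambda>g h x. g x + h x), smult = (\<lambda>k h x. of_int k * h x)\<rparr>"

lemma finsupp_rat_simps [simp]:
  "carrier finsupp_rat = {h. finite {x. h x \<noteq> 0}}" "\<zero>\<^sub>finsupp_rat = (\<lambda>x. 0)"
  "g \<oplus>\<^sub>finsupp_rat h = (\<lambda>x. g x + h x)" "k \<odot>\<^sub>finsupp_rat h = (\<lambda>x. of_int k * h x)"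
  by (simp_all add: finsupp_rat_def)

lemma lmod_finsupp_rat: "left_module ZZ finsupp_rat"
proof -
  have add: "finite {x. g x + h x \<noteq> 0}" if "finite {x. g x \<noteq> 0}" "finite {x. h x \<noteq> 0}" for g h :: "'y => rat"
    by (rule finite_subset[OF _ finite_UnI[OF that]]) auto
  have "abelian_group (finsupp_rat :: (int, 'y => rat) module)"
  proof (rule abelian_groupI')
    fix x assume "x \<in> carrier (finsupp_rat :: (int, 'y => rat) module)"
    then show "\<exists>y\<in>carrier finsupp_rat. y \<oplus>\<^sub>finsupp_rat x = \<zero>\<^sub>finsupp_rat"
      by (intro bexI[of _ "\<lambda>u. - x u"]) auto
  qed (auto simp: add algebra_simps)
  then show ?thesis
    by (intro left_moduleI) (auto simp: ring_ZZ algebra_simps intro: finite_subset)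
qed

lemma finsupp_rat_diff [simp]:
  assumes "finite {x. g x \<noteq> 0}" "finite {x. h x \<noteq> 0}"
  shows "g \<ominus>\<^sub>finsupp_rat h = (\<lambda>x. g x - h x)"
proof -
  have "\<ominus>\<^sub>finsupp_rat h = (\<lambda>x. - h x)"
    by (rule ag_eq_neg[OF lm_ag[OF lmod_finsupp_rat], symmetric]) (use assms in auto)
  then show ?thesis by (simp add: a_minus_def)
qed

text \<open>Write \<open>Y\<close> as the free abelian group on its carrier modulo the relations
  \<open>K\<close>, and enlarge the free group to a rational vector space: the quotient by the same
  \<open>K\<close> is divisible and contains \<open>Y\<close>. Finite supports keep the result
  within the universe.\<close>

lemma divisible_hull:
  fixes Y :: "('y, 'e) ring_scheme"
  assumes Y: "abelian_group Y" and f: "inj (f :: 'y => ('r, 'x) univ)"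
  shows "\<exists>(D :: (int, ('r, 'x) univ) module) \<epsilon>. baer ZZ D \<and> \<epsilon> \<in> ahom Y D \<and>
    (\<forall>y\<in>carrier Y. \<epsilon> y = \<zero>\<^sub>D --> y = \<zero>\<^sub>Y)"
proof -
  interpret Y: abelian_group Y by fact
  note V = lmod_finsupp_rat
  \<comment> \<open>\<open>h\<close> is the canonical surjection of the free abelian group onto
    \<open>Y\<close>, sending each basis element to itself; \<open>\<iota>\<close> below reads
    integer coefficients as rational ones.\<close>
  obtain h where h: "h \<in> hom (free_Abelian_group (carrier Y)) (add_monoid Y)"
    and hf: "\<And>y. y \<in> carrier Y ==> h (frag_of y) = y"
    using comm_group.free_Abelian_group_universal[OF Y.a_comm_group, of id "carrier Y"] by auto
  have h_add: "h (a + b) = h a \<oplus>\<^sub>Y h b"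
    if "Poly_Mapping.keys a \<subseteq> carrier Y" "Poly_Mapping.keys b \<subseteq> carrier Y" for a b
    using hom_mult[OF h, of a b] that by simp
  have h_closed: "h a \<in> carrier Y" if "Poly_Mapping.keys a \<subseteq> carrier Y" for a
    using h that by (auto simp: hom_def)
  have h_zero: "h 0 = \<zero>\<^sub>Y"
    using h_add[of 0 0] h_closed[of 0] by simp
  have h_neg: "h (- a) = \<ominus>\<^sub>Y h a" if "Poly_Mapping.keys a \<subseteq> carrier Y" for a
    using h_add[of a "- a"] that h_closed[of a] h_closed[of "- a"] h_zero by (simp add: ag_eq_neg[OF Y])
  define \<iota> where "\<iota> = (\<lambda>(c :: 'y \<Rightarrow>\<^sub>0 int) y. rat_of_int (Poly_Mapping.lookup c y))"
  have \<iota>V: "finite {y. \<iota> c y \<noteq> 0}" for c by (simp add: \<iota>_def)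
  have \<iota>_inj: "c = d" if "\<iota> c = \<iota> d" for c d
    using that by (auto simp: \<iota>_def fun_eq_iff intro: poly_mapping_eqI)
  have \<iota>_add: "\<iota> (c + d) = (\<lambda>y. \<iota> c y + \<iota> d y)" and \<iota>_diff: "\<iota> (c - d) = (\<lambda>y. \<iota> c y - \<iota> d y)" for c d
    by (auto simp: \<iota>_def lookup_add lookup_minus)
  define K where "K = \<iota> ` {c. Poly_Mapping.keys c \<subseteq> carrier Y \<and> h c = \<zero>\<^sub>Y}"
  have KE: thesis if "g \<in> K" "\<And>c. Poly_Mapping.keys c \<subseteq> carrier Y ==> h c = \<zero>\<^sub>Y ==> g = \<iota> c ==> thesis" for g thesis
    using that unfolding K_def by auto
  have KI: "\<iota> c \<in> K" if "Poly_Mapping.keys c \<subseteq> carrier Y" "h c = \<zero>\<^sub>Y" for c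
    using that unfolding K_def by auto
  have Kadd: "g \<oplus>\<^sub>finsupp_rat g' \<in> K" if gg: "g \<in> K" "g' \<in> K" for g g'
  proof -
    obtain c where c: "Poly_Mapping.keys c \<subseteq> carrier Y" "h c = \<zero>\<^sub>Y" "g = \<iota> c"
      by (rule KE[OF gg(1)])
    obtain d where d: "Poly_Mapping.keys d \<subseteq> carrier Y" "h d = \<zero>\<^sub>Y" "g' = \<iota> d"
      by (rule KE[OF gg(2)])
    note cd = c d
    moreover have "Poly_Mapping.keys (c + d) \<subseteq> carrier Y" using cd Poly_Mapping.keys_add[of c d] by blast
    ultimately have "\<iota> (c + d) \<in> K" using Y by (intro KI) (simp_all add: h_add ag_l_zero ag_zero)
    then show ?thesis using cd by (simp add: \<iota>_add)
  qed
  have K0: "(\<lambda>y. 0) \<in> K"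
    using h_zero by (auto simp: K_def \<iota>_def intro!: image_eqI[of _ _ 0])
  have Kneg: "(\<lambda>y. - g y) \<in> K" if g: "g \<in> K" for g
  proof -
    obtain c where c: "Poly_Mapping.keys c \<subseteq> carrier Y" "h c = \<zero>\<^sub>Y" "g = \<iota> c" by (rule KE[OF g])
    then have "\<iota> (- c) \<in> K" by (intro KI) (simp_all add: h_neg ag_neg_zero[OF Y])
    moreover have "\<iota> (- c) = (\<lambda>y. - g y)" using c(3) by (simp add: \<iota>_def)
    ultimately show ?thesis by simp
  qed
  have Ksm: "(\<lambda>y. of_int k * g y) \<in> K" if "g \<in> K" for k g
  proof -
    have nat: "(\<lambda>y. of_int (int n) * g y) \<in> K" if "g \<in> K" for n g
    proof (induction n)
      case (Suc n)
      then show ?case using Kadd[OF that Suc] by (simp add: algebra_simps)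
    qed (use K0 in simp)
    show ?thesis
    proof (cases "k \<ge> 0")
      case True
      then show ?thesis using nat[OF that, of "nat k"] by simp
    next
      case False
      then show ?thesis using nat[OF Kneg[OF that], of "nat (- k)"] by simp
    qed
  qed
  have K: "submod ZZ finsupp_rat K"
    using Kadd K0 Ksm \<iota>V by (auto simp: submod_def K_def)
  obtain e :: "('y => rat) => ('r, 'x) univ" where e: "inj_on e {h. finite {y. h y \<noteq> 0}}"
    using finsupp_embed[OF f, of _ "0 :: rat"] univ_embed_countable by blast
  define c where "c = (\<lambda>g. e (coset_rep finsupp_rat K g))"
  have cr: "coset_rep finsupp_rat K g \<in> carrier finsupp_rat" if "g \<in> carrier finsupp_rat" for g
    unfolding coset_rep_def
    by (rule someI2[of _ g]) (use that K V K0 in \<open>auto simp: submod_zero ag_diff_self[OF lm_ag[OF V]] simp del: finsupp_rat_diff\<close>)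
  have c: "c x = c y \<longleftrightarrow> x \<ominus>\<^sub>finsupp_rat y \<in> K" if "x \<in> carrier finsupp_rat" "y \<in> carrier finsupp_rat" for x y
    using coset_rep_eq_iff[OF V K that] inj_on_eq_iff[OF e, of "coset_rep finsupp_rat K x" "coset_rep finsupp_rat K y"]
      cr[OF that(1)] cr[OF that(2)] by (simp add: c_def)
  note p = push_quotient[OF V K c]
  let ?D = "push c finsupp_rat"
  have D: "baer ZZ ?D"
  proof (rule divisible_quotient[OF V p(1,2) p(3)[symmetric]])
    fix k :: int and x :: "'y => rat" assume "x \<in> carrier finsupp_rat" "k \<noteq> 0"
    then show "\<exists>y\<in>carrier finsupp_rat. k \<odot>\<^sub>finsupp_rat y = x"
      by (intro bexI[of _ "\<lambda>u. x u / of_int k"]) auto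
  qed
  let ?\<epsilon> = "\<lambda>y. c (\<iota> (frag_of y))"
  have ck: "c g = \<zero>\<^sub>?D \<longleftrightarrow> g \<in> K" if "finite {y. g y \<noteq> 0}" for g
    using p(5) that by (auto simp: a_kernel_eq)
  have "?\<epsilon> \<in> ahom Y ?D"
  proof (rule ahomI)
    fix x assume "x \<in> carrier Y" then show "?\<epsilon> x \<in> carrier ?D" using p(3) \<iota>V by auto
  next
    fix x y assume xy: "x \<in> carrier Y" "y \<in> carrier Y"
    let ?d = "frag_of (x \<oplus>\<^sub>Y y) - (frag_of x + frag_of y)"
    have keys: "Poly_Mapping.keys (frag_of x + frag_of y) \<subseteq> carrier Y" "Poly_Mapping.keys (- (frag_of x + frag_of y)) \<subseteq> carrier Y"
      using xy Poly_Mapping.keys_add[of "frag_of x" "frag_of y"] by (auto simp del: minus_add_distrib)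
    then have kd: "Poly_Mapping.keys ?d \<subseteq> carrier Y"
      using xy keys_diff[of "frag_of (x \<oplus>\<^sub>Y y)" "frag_of x + frag_of y"] by auto
    have "h ?d = \<zero>\<^sub>Y"
      using h_add[of "frag_of (x \<oplus>\<^sub>Y y)" "- (frag_of x + frag_of y)"] keys xy h_neg[OF keys(1)]
        h_add[of "frag_of x" "frag_of y"]
      by (simp add: hf Y.r_neg del: minus_add_distrib)
    then have "\<iota> ?d \<in> K" using kd by (auto simp: K_def)
    then have "\<iota> (frag_of (x \<oplus>\<^sub>Y y)) \<ominus>\<^sub>finsupp_rat \<iota> (frag_of x + frag_of y) \<in> K"
      using \<iota>V[of "frag_of (x \<oplus>\<^sub>Y y)"] \<iota>V[of "frag_of x + frag_of y"] unfolding \<iota>_diff by simp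
    then have "?\<epsilon> (x \<oplus>\<^sub>Y y) = c (\<iota> (frag_of x + frag_of y))"
      using c \<iota>V by auto
    also have "\<dots> = ?\<epsilon> x \<oplus>\<^sub>?D ?\<epsilon> y"
      using lh_add[OF p(2), of "\<iota> (frag_of x)" "\<iota> (frag_of y)"] \<iota>V by (simp add: \<iota>_add)
    finally show "?\<epsilon> (x \<oplus>\<^sub>Y y) = ?\<epsilon> x \<oplus>\<^sub>?D ?\<epsilon> y" .
  qed
  moreover have "y = \<zero>\<^sub>Y" if y: "y \<in> carrier Y" "?\<epsilon> y = \<zero>\<^sub>?D" for y
  proof -
    have "\<iota> (frag_of y) \<in> K" using ck[OF \<iota>V] y by blast
    then have "h (frag_of y) = \<zero>\<^sub>Y" by (rule KE) (metis \<iota>_inj)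
    then show ?thesis using hf y by simp
  qed
  ultimately show ?thesis using D by blast
qed

lemma int_scalar_hom:
  assumes R: "ring R" shows "(\<lambda>k :: int. add_pow R k \<one>\<^sub>R) \<in> ring_hom ZZ R"
proof -
  interpret ring R by fact
  have one: "\<one>\<^sub>R \<in> carrier R" by simp
  show ?thesis
  proof (rule ring_hom_memI)
    fix x y :: int
    have cl: "add_pow R y \<one>\<^sub>R \<in> carrier R" using add.int_pow_closed[OF one] by simp
    then have "add_pow R x \<one>\<^sub>R \<otimes>\<^sub>R add_pow R y \<one>\<^sub>R = add_pow R x (add_pow R y \<one>\<^sub>R)"
      using add_pow_ldistr_int[OF one cl, of x] by simp
    also have "\<dots> = add_pow R (x * y) \<one>\<^sub>R"
      using add.int_pow_pow[OF one] by (simp add: mult.commute)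
    finally show "add_pow R (x \<otimes>\<^sub>ZZ y) \<one>\<^sub>R = add_pow R x \<one>\<^sub>R \<otimes>\<^sub>R add_pow R y \<one>\<^sub>R" by simp
  next
    fix x y :: int
    show "add_pow R (x \<oplus>\<^sub>ZZ y) \<one>\<^sub>R = add_pow R x \<one>\<^sub>R \<oplus>\<^sub>R add_pow R y \<one>\<^sub>R"
      using add.int_pow_mult[OF one, of x y] by simp
  qed (use add.int_pow_closed[OF one] one in \<open>auto simp: add.int_pow_1\<close>)
qed

text \<open>A divisible group \<open>D\<close> containing \<open>Y\<close> is coinduced from the
  integers to \<open>R\<close>, which makes it injective over \<open>R\<close>. The element
  \<open>y\<close> goes to the map \<open>s \<mapsto> \<epsilon> (s y)\<close>, and evaluation at
  one shows that nothing is lost. Functions on \<open>'r\<close> fit into the universe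
  again.\<close>

lemma enough_injectives:
  fixes Y :: "('r, 'y, 'f) module_scheme"
  assumes Y: "left_module R Y" and f: "inj (f :: 'y => ('r, 'x) univ)"
  shows "\<exists>(I :: ('r, ('r, 'x) univ) module) e. baer R I \<and> e \<in> left_hom R Y I \<and> inj_on e (carrier Y)"
proof -
  have R: "ring R" using Y by (rule lm_ring)
  note agY = lm_ag[OF Y]
  obtain D :: "(int, ('r, 'x) univ) module" and \<epsilon> where D: "baer ZZ D" and \<epsilon>: "\<epsilon> \<in> ahom Y D"
    and ker: "\<And>y. y \<in> carrier Y ==> \<epsilon> y = \<zero>\<^sub>D ==> y = \<zero>\<^sub>Y"
    using divisible_hull[OF agY f] by blast
  note lD = baer_left_module[OF D]
  let ?B = "ring_bimodule R (\<lambda>k :: int. add_pow R k \<one>\<^sub>R) id"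
  let ?H = "hom_module ZZ ?B D"
  have H: "baer R ?H" by (rule coinduced_baer[OF D R int_scalar_hom[OF R]])
  have bB: "is_bimodule ZZ R ?B"
    by (intro ring_bimodule_bimodule ring_ZZ R int_scalar_hom[OF R] ring_hom_id)
  note lB = is_bimoduleD(1)[OF bB]
  have hB: "left_hom ZZ ?B D = ahom ?B D" by (rule lh_ZZ[OF lB lD])
  have R1: "\<one>\<^sub>R \<in> carrier R" using R by (simp add: ring_rules)
  define e where "e = (\<lambda>y. \<lambda>s\<in>carrier R. \<epsilon> (s \<odot>\<^sub>Y y))"
  have eh: "e y \<in> carrier ?H" if y: "y \<in> carrier Y" for y
  proof -
    have "(\<lambda>s. \<epsilon> (s \<odot>\<^sub>Y y)) \<in> ahom R D"
      by (rule ahom_comp[OF lm_scalar_ahom[OF Y y] \<epsilon>])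
    then have "(\<lambda>s. \<epsilon> (s \<odot>\<^sub>Y y)) \<in> left_hom ZZ ?B D" by (simp add: hB ahom_def)
    then show ?thesis using lh_restrict[OF lB, of "\<lambda>s. \<epsilon> (s \<odot>\<^sub>Y y)" D] by (simp add: e_def)
  qed
  have e: "e \<in> left_hom R Y ?H"
  proof (rule left_homI)
    fix x y assume "x \<in> carrier Y" "y \<in> carrier Y"
    then show "e (x \<oplus>\<^sub>Y y) = e x \<oplus>\<^sub>?H e y"
      using Y by (auto simp: e_def fun_eq_iff lm_r_distr ahom_add[OF \<epsilon>] lm_closed)
  next
    fix r x assume "r \<in> carrier R" "x \<in> carrier Y"
    then show "e (r \<odot>\<^sub>Y x) = r \<odot>\<^sub>?H e x"
      using Y R by (auto simp: e_def fun_eq_iff lm_assoc ring_rules)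
  qed (rule eh)
  have "inj_on e (carrier Y)"
  proof (subst lh_inj_iff[OF Y baer_left_module[OF H] e], intro equalityI subsetI)
    fix y assume "y \<in> a_kernel Y ?H e"
    then have y: "y \<in> carrier Y" "e y = \<zero>\<^sub>?H" by (auto simp: a_kernel_eq)
    have "e y \<one>\<^sub>R = \<zero>\<^sub>?H \<one>\<^sub>R" using y(2) by (rule fun_cong)
    then have "\<epsilon> y = \<zero>\<^sub>D" using R1 y(1) Y by (simp add: e_def lm_one)
    then show "y \<in> {\<zero>\<^sub>Y}" using ker y by simp
  qed (use lh_zero_zero[OF e Y baer_left_module[OF H]] agY in \<open>auto simp: a_kernel_eq ag_zero\<close>)
  moreover
  obtain c :: "('r => ('r, 'x) univ) => ('r, 'x) univ" where c: "inj c"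
    using univ_embed_fun[OF inj_on_id] by blast
  have cH: "inj_on c (carrier ?H)" using c by (auto intro: inj_on_subset)
  have "baer R (push c ?H)" by (rule baer_push[OF H cH])
  moreover have "(\<lambda>y. c (e y)) \<in> left_hom R Y (push c ?H)"
    by (rule lh_comp[OF e push_inj(2)[OF baer_left_module[OF H] cH]])
  moreover have "inj_on (\<lambda>y. c (e y)) (carrier Y)" if "inj_on e (carrier Y)"
    using comp_inj_on[OF that inj_on_subset[OF c]] by (simp add: comp_def)
  ultimately show ?thesis by blast
qed

text \<open>Iterates \<open>enough_injectives\<close> on cosyzygies. Existence matters because Ext
  is defined through a choice of such a resolution.\<close>

lemma injective_resolution_exists:
  fixes X :: "('r, 'x, 'f) module_scheme"
  assumes X: "left_module R X"
  shows "\<exists>(I :: nat => ('r, ('r, 'x) univ) module) d e. right_resolution R X I d e \<and> (\<forall>i. injective_module R (I i))"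
proof -
  obtain c0 :: "'x => ('r, 'x) univ" where c0: "inj c0" using univ_embed_base by blast
  have c0X: "inj_on c0 (carrier X)" using c0 by (auto intro: inj_on_subset)
  note p0 = push_inj[OF X c0X]
  have "\<forall>C :: ('r, ('r, 'x) univ) module. \<exists>(I :: ('r, ('r, 'x) univ) module) e. left_module R C -->
      baer R I \<and> e \<in> left_hom R C I \<and> inj_on e (carrier C)"
    using enough_injectives[OF _ inj_on_id] by blast
  then obtain J :: "('r, ('r, 'x) univ) module => ('r, ('r, 'x) univ) module" and e
    where J: "\<And>C. left_module R C ==> baer R (J C)" "\<And>C. left_module R C ==> e C \<in> left_hom R C (J C)"
      "\<And>C. left_module R C ==> inj_on (e C) (carrier C)" by metis
  define q where "q = (\<lambda>C. coset_rep (J C) (e C ` carrier C))"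
  \<comment> \<open>\<open>C i\<close> is the i-th cosyzygy, with \<open>C 0\<close> a copy of
    \<open>X\<close> in the universe. Representatives keep each quotient in the same type, which
    makes the recursion possible.\<close>
  define C where "C = rec_nat (push c0 X) (\<lambda>_ C. push (q C) (J C))"
  have C0: "C 0 = push c0 X" and CS: "C (Suc i) = push (q (C i)) (J (C i))" for i
    by (simp_all add: C_def)
  have sm: "submod R (J C) (e C ` carrier C)" if "left_module R C" for C
    using submod_image[OF that baer_left_module[OF J(1)[OF that]] J(2)[OF that]] .
  have pq: "left_module R (push (q C) (J C))" "q C \<in> left_hom R (J C) (push (q C) (J C))"
    "a_kernel (J C) (push (q C) (J C)) (q C) = e C ` carrier C" if C: "left_module R C" for C
  proof -
    note l = baer_left_module[OF J(1)[OF C]]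
    have c: "q C x = q C y \<longleftrightarrow> x \<ominus>\<^sub>(J C) y \<in> e C ` carrier C" if "x \<in> carrier (J C)" "y \<in> carrier (J C)" for x y
      unfolding q_def by (rule coset_rep_eq_iff[OF l sm[OF C] that])
    show "left_module R (push (q C) (J C))" "q C \<in> left_hom R (J C) (push (q C) (J C))"
      "a_kernel (J C) (push (q C) (J C)) (q C) = e C ` carrier C"
      using push_quotient[OF l sm[OF C] c] by blast+
  qed
  have lC: "left_module R (C i)" for i
  proof (induction i)
    case 0 show ?case unfolding C0 by (rule p0)
  next
    case (Suc i) then show ?case unfolding CS by (rule pq(1))
  qed
  have lJ: "left_module R (J (C i))" for i using baer_left_module[OF J(1)[OF lC]] .
  have qh: "q (C i) \<in> left_hom R (J (C i)) (C (Suc i))" for i unfolding CS by (rule pq(2)[OF lC])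
  have qs: "q (C i) ` carrier (J (C i)) = carrier (C (Suc i))" for i by (simp add: CS push_carrier')
  have qk: "a_kernel (J (C i)) (C (Suc i)) (q (C i)) = e (C i) ` carrier (C i)" for i
    unfolding CS by (rule pq(3)[OF lC])
  let ?I = "\<lambda>i. J (C i)" and ?d = "\<lambda>i x. e (C (Suc i)) (q (C i) x)" and ?e = "\<lambda>x. e (C 0) (c0 x)"
  have dh: "?d i \<in> left_hom R (?I i) (?I (Suc i))" for i
    by (rule lh_comp[OF qh J(2)[OF lC]])
  have ez: "e (C i) y = \<zero>\<^sub>(J (C i)) \<longleftrightarrow> y = \<zero>\<^sub>(C i)" if "y \<in> carrier (C i)" for i y
    using lh_inj_iff[OF lC lJ J(2)[OF lC]] J(3)[OF lC, of i] that by (auto simp: a_kernel_eq)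
  have kd: "a_kernel (?I i) (?I (Suc i)) (?d i) = e (C i) ` carrier (C i)" for i
  proof -
    have "a_kernel (?I i) (?I (Suc i)) (?d i) = a_kernel (J (C i)) (C (Suc i)) (q (C i))"
      using ez lh_closed[OF qh] by (auto simp: a_kernel_eq)
    then show ?thesis using qk by simp
  qed
  have "right_resolution R X ?I ?d ?e"
    unfolding right_resolution_def
  proof (intro conjI allI)
    show "?e \<in> left_hom R X (?I 0)"
      by (rule lh_comp[OF _ J(2)[OF lC]]) (simp add: C0 p0)
    show "inj_on ?e (carrier X)"
      using J(3)[OF lC, of 0] c0X by (auto simp: inj_on_def C0 push_carrier')
    show "?e ` carrier X = a_kernel (?I 0) (?I 1) (?d 0)"
      using kd[of 0] by (simp add: C0 push_carrier' image_image)
    fix i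
    show "?d i ` carrier (?I i) = a_kernel (?I (Suc i)) (?I (Suc (Suc i))) (?d (Suc i))"
    proof -
      have "?d i ` carrier (?I i) = e (C (Suc i)) ` (q (C i) ` carrier (J (C i)))"
        by (simp only: image_image)
      then show ?thesis by (simp only: qs kd)
    qed
  qed (use lJ dh in auto)
  moreover have "injective_module R (?I i)" for i
    using J(1)[OF lC] by (simp add: injective_module_iff_baer)
  ultimately show ?thesis by blast
qed

section \<open>Free and projective modules\<close>

text \<open>Coordinates off \<open>B\<close> are forced to zero, so that the basis may be a set such
  as \<open>carrier Y\<close> in place of a whole type.\<close>

definition free_module :: "('r, 'e) ring_scheme => 'b set => ('r, 'b => 'r) module" where
  "free_module R B =
    \<lparr>carrier = {u. (\<forall>y. u y \<in> carrier R) \<and> (\<forall>y. y \<notin> B --> u y = \<zero>\<^sub>R) \<and> finite {y. u y \<noteq> \<zero>\<^sub>R}},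
     mult = undefined, one = undefined, ring.zero = (\<lambda>y. \<zero>\<^sub>R),
     add = (\<lambda>u v y. u y \<oplus>\<^sub>R v y), smult = (\<lambda>a u y. a \<otimes>\<^sub>R u y)\<rparr>"

lemma free_module_simps [simp]:
  "carrier (free_module R B) = {u. (\<forall>y. u y \<in> carrier R) \<and> (\<forall>y. y \<notin> B --> u y = \<zero>\<^sub>R) \<and> finite {y. u y \<noteq> \<zero>\<^sub>R}}"
  "\<zero>\<^sub>(free_module R B) = (\<lambda>y. \<zero>\<^sub>R)" "u \<oplus>\<^sub>(free_module R B) v = (\<lambda>y. u y \<oplus>\<^sub>R v y)"
  "a \<odot>\<^sub>(free_module R B) u = (\<lambda>y. a \<otimes>\<^sub>R u y)"
  by (simp_all add: free_module_def)

lemma lmod_free: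
  fixes R :: "('a, 'e) ring_scheme" and B :: "'b set"
  assumes R: "ring R" shows "left_module R (free_module R B)"
proof -
  interpret ring R by fact
  have add: "finite {y. u y \<oplus>\<^sub>R v y \<noteq> \<zero>\<^sub>R}" if "finite {y. u y \<noteq> \<zero>\<^sub>R}" "finite {y. v y \<noteq> \<zero>\<^sub>R}" for u v :: "'b => 'a"
    by (rule finite_subset[OF _ finite_UnI[OF that]]) auto
  have mul: "finite {y. a \<otimes>\<^sub>R u y \<noteq> \<zero>\<^sub>R}" if "finite {y. u y \<noteq> \<zero>\<^sub>R}" "a \<in> carrier R" for u :: "'b => 'a" and a
    by (rule finite_subset[OF _ that(1)]) (use that in auto)
  have neg: "finite {y. \<ominus>\<^sub>R u y \<noteq> \<zero>\<^sub>R}" if "finite {y. u y \<noteq> \<zero>\<^sub>R}" for u :: "'b => 'a"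
    by (rule finite_subset[OF _ that]) auto
  have "abelian_group (free_module R B)"
  proof (rule abelian_groupI')
    fix u assume "u \<in> carrier (free_module R B)"
    then show "\<exists>v\<in>carrier (free_module R B). v \<oplus>\<^sub>(free_module R B) u = \<zero>\<^sub>(free_module R B)"
      by (intro bexI[of _ "\<lambda>y. \<ominus>\<^sub>R u y"]) (auto simp: neg l_neg)
  qed (auto simp: add a_ac)
  then show ?thesis
    by (intro left_moduleI) (auto simp: R add mul l_distr r_distr m_assoc)
qed

definition delta :: "('r, 'e) ring_scheme => 'b => 'b => 'r" where
  "delta R b = (\<lambda>y. if y = b then \<one>\<^sub>R else \<zero>\<^sub>R)"

lemma delta_closed: "ring R ==> b \<in> B ==> delta R b \<in> carrier (free_module R B)"
  by (auto simp: delta_def ring_rules)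

text \<open>Induction on a finite set that contains the support, splitting off one multiple of a
  basis vector at a time.\<close>

lemma free_hom_eq:
  assumes R: "ring R" and f: "f \<in> left_hom R (free_module R B) Y" and g: "g \<in> left_hom R (free_module R B) Y"
    and Y: "left_module R Y"
    and fg: "\<And>b. b \<in> B ==> f (delta R b) = g (delta R b)" and u: "u \<in> carrier (free_module R B)"
  shows "f u = g u"
proof -
  let ?F = "free_module R B"
  note F = lmod_free[OF R, of B]
  interpret ring R by fact
  have "\<forall>u\<in>carrier ?F. {y. u y \<noteq> \<zero>\<^sub>R} \<subseteq> A --> f u = g u" if "finite A" for A
    using that
  proof (induction A)
    case empty
    have "f u = g u" if "{y. u y \<noteq> \<zero>\<^sub>R} \<subseteq> {}" for u
    proof -
      have "u = \<zero>\<^sub>?F" using that by auto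
      then show ?thesis using lh_zero_zero[OF f F Y] lh_zero_zero[OF g F Y] by simp
    qed
    then show ?case by blast
  next
    case (insert b A)
    show ?case
    proof (intro ballI impI)
      fix u assume u: "u \<in> carrier ?F" "{y. u y \<noteq> \<zero>\<^sub>R} \<subseteq> insert b A"
      show "f u = g u"
      proof (cases "b \<in> B")
        case False
        then have "{y. u y \<noteq> \<zero>\<^sub>R} \<subseteq> A" using u by auto
        then show ?thesis using insert.IH u by blast
      next
        case True
        let ?v = "u(b := \<zero>\<^sub>R)" and ?d = "u b \<odot>\<^sub>?F delta R b"
        have v: "?v \<in> carrier ?F" "{y. ?v y \<noteq> \<zero>\<^sub>R} \<subseteq> A"
          using u by (auto intro: finite_subset[of _ "{y. u y \<noteq> \<zero>\<^sub>R}"])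
        have d: "delta R b \<in> carrier ?F" by (rule delta_closed[OF R True])
        have ub: "u b \<in> carrier R" using u by simp
        have dc: "?d \<in> carrier ?F" by (rule lm_closed[OF F ub d])
        have "u = ?d \<oplus>\<^sub>?F ?v" using u by (auto simp: delta_def fun_eq_iff)
        moreover have "f (?d \<oplus>\<^sub>?F ?v) = g (?d \<oplus>\<^sub>?F ?v)"
          using insert.IH v fg[OF True]
          by (simp only: lh_add[OF f dc v(1)] lh_add[OF g dc v(1)]
            lh_smult[OF f ub d] lh_smult[OF g ub d])
        ultimately show ?thesis by simp
      qed
    qed
  qed
  then show ?thesis using u by auto
qed

lemma ahom_finsum:
  assumes f: "f \<in> ahom G H" and G: "abelian_group G" and H: "abelian_group H"
    and A: "finite A" "u \<in> A \<rightarrow> carrier G"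
  shows "f (finsum G u A) = finsum H (\<lambda>a. f (u a)) A"
proof -
  interpret G: abelian_group G by fact
  interpret H: abelian_group H by fact
  show ?thesis
    using A
  proof (induction A)
    case (insert a A)
    then show ?case
      using ahom_closed[OF f] by (simp add: Pi_iff ahom_add[OF f] G.finsum_insert H.finsum_insert)
  qed (simp add: ahom_zero[OF f G H])
qed

lemma free_hom_exists:
  assumes Y: "left_module R Y" and \<phi>: "\<phi> \<in> B \<rightarrow> carrier Y"
  obtains h where "h \<in> left_hom R (free_module R B) Y" "\<And>b. b \<in> B ==> h (delta R b) = \<phi> b"
proof -
  have R: "ring R" using Y by (rule lm_ring)
  interpret R: ring R by fact
  interpret Y: abelian_group Y using Y by (rule lm_ag)
  let ?F = "free_module R B"
  define h where "h = (\<lambda>u. finsum Y (\<lambda>y. u y \<odot>\<^sub>Y \<phi> y) {y. u y \<noteq> \<zero>\<^sub>R})"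
  \<comment> \<open>The sum may be taken over any larger finite subset of \<open>B\<close>, so that
    \<open>u\<close>, \<open>v\<close> and their sum can be compared over one index set.\<close>
  have h: "h u = finsum Y (\<lambda>y. u y \<odot>\<^sub>Y \<phi> y) A" if "u \<in> carrier ?F" "finite A" "{y. u y \<noteq> \<zero>\<^sub>R} \<subseteq> A" "A \<subseteq> B" for u A
    unfolding h_def using that \<phi> lm_closed[OF Y] lm_zero_smult[OF Y]
    by (intro Y.add.finprod_mono_neutral_cong_left) (auto simp: Pi_iff subset_iff)
  have supp: "{y. u y \<noteq> \<zero>\<^sub>R} \<subseteq> B" "finite {y. u y \<noteq> \<zero>\<^sub>R}" if "u \<in> carrier ?F" for u using that by auto
  have closed: "(\<lambda>y. u y \<odot>\<^sub>Y \<phi> y) \<in> A \<rightarrow> carrier Y" if "u \<in> carrier ?F" "A \<subseteq> B" for u A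
    using that \<phi> lm_closed[OF Y] by (auto simp: Pi_iff subset_iff)
  have "h \<in> left_hom R ?F Y"
  proof (rule left_homI)
    fix u assume "u \<in> carrier ?F"
    then show "h u \<in> carrier Y"
      unfolding h_def using closed[of u] supp by (intro Y.finsum_closed) blast
  next
    fix u v assume u: "u \<in> carrier ?F" and v: "v \<in> carrier ?F"
    let ?A = "{y. u y \<noteq> \<zero>\<^sub>R} \<union> {y. v y \<noteq> \<zero>\<^sub>R}"
    have A: "finite ?A" "?A \<subseteq> B" using supp[OF u] supp[OF v] by auto
    have uv: "u \<oplus>\<^sub>?F v \<in> carrier ?F" using lmod_free[OF R, of B] u v by (metis lm_ag ag_closed)
    have "h (u \<oplus>\<^sub>?F v) = finsum Y (\<lambda>y. (u \<oplus>\<^sub>?F v) y \<odot>\<^sub>Y \<phi> y) ?A"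
      by (rule h[OF uv A(1) _ A(2)]) auto
    also have "\<dots> = finsum Y (\<lambda>y. u y \<odot>\<^sub>Y \<phi> y \<oplus>\<^sub>Y v y \<odot>\<^sub>Y \<phi> y) ?A"
      using u v A closed[OF u] closed[OF v] \<phi> lm_closed[OF Y]
      by (intro Y.finsum_cong) (auto simp: simp_implies_def lm_l_distr[OF Y] Pi_iff subset_iff)
    also have "\<dots> = h u \<oplus>\<^sub>Y h v"
      using h[OF u A(1) _ A(2)] h[OF v A(1) _ A(2)] Y.finsum_addf[OF closed[OF u A(2)] closed[OF v A(2)]] by simp
    finally show "h (u \<oplus>\<^sub>?F v) = h u \<oplus>\<^sub>Y h v" .
  next
    fix a u assume a: "a \<in> carrier R" and u: "u \<in> carrier ?F"
    let ?A = "{y. u y \<noteq> \<zero>\<^sub>R}"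
    note A = supp[OF u]
    have au: "a \<odot>\<^sub>?F u \<in> carrier ?F" by (rule lm_closed[OF lmod_free[OF R] a u])
    have "h (a \<odot>\<^sub>?F u) = finsum Y (\<lambda>y. (a \<odot>\<^sub>?F u) y \<odot>\<^sub>Y \<phi> y) ?A"
      using a by (intro h[OF au A(2) _ A(1)]) auto
    also have "\<dots> = finsum Y (\<lambda>y. a \<odot>\<^sub>Y (u y \<odot>\<^sub>Y \<phi> y)) ?A"
      using a u A closed[OF u A(1)] \<phi> lm_closed[OF Y]
      by (intro Y.finsum_cong) (auto simp: simp_implies_def lm_assoc[OF Y] Pi_iff subset_iff)
    also have "\<dots> = a \<odot>\<^sub>Y h u"
      using ahom_finsum[OF lm_smult_ahom[OF Y a] Y.abelian_group_axioms Y.abelian_group_axioms A(2) closed[OF u A(1)]]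
      by (simp add: h_def)
    finally show "h (a \<odot>\<^sub>?F u) = a \<odot>\<^sub>Y h u" .
  qed
  moreover have "h (delta R b) = \<phi> b" if b: "b \<in> B" for b
  proof -
    have "h (delta R b) = finsum Y (\<lambda>y. delta R b y \<odot>\<^sub>Y \<phi> y) {b}"
      by (rule h[OF delta_closed[OF R b]]) (use b in \<open>auto simp: delta_def\<close>)
    also have "\<dots> = \<phi> b" using \<phi> b lm_one[OF Y] by (auto simp: delta_def Pi_iff)
    finally show ?thesis .
  qed
  ultimately show ?thesis using that by blast
qed

lemma free_lift:
  assumes B: "left_module R B" and C: "left_module R C" and g: "g \<in> left_hom R B C"
    and f: "f \<in> left_hom R (free_module R S) C" and fg: "\<And>b. b \<in> S ==> f (delta R b) \<in> g ` carrier B"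
  obtains h where "h \<in> left_hom R (free_module R S) B" "\<And>u. u \<in> carrier (free_module R S) ==> g (h u) = f u"
proof -
  have "\<forall>b\<in>S. \<exists>y. y \<in> carrier B \<and> g y = f (delta R b)" using fg by (metis imageE)
  then obtain \<phi> where \<phi>: "\<And>b. b \<in> S ==> \<phi> b \<in> carrier B \<and> g (\<phi> b) = f (delta R b)" by metis
  then obtain h where h: "h \<in> left_hom R (free_module R S) B" "\<And>b. b \<in> S ==> h (delta R b) = \<phi> b"
    using free_hom_exists[OF B, of \<phi> S] by auto
  have "g (h u) = f u" if "u \<in> carrier (free_module R S)" for u
    by (rule free_hom_eq[OF lm_ring[OF B] lh_comp[OF h(1) g] f C _ that]) (use h \<phi> in auto)
  then show ?thesis using that h by blast
qed

lemma free_cover: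
  assumes Y: "left_module R Y"
  obtains p where "p \<in> left_hom R (free_module R (carrier Y)) Y" "p ` carrier (free_module R (carrier Y)) = carrier Y"
proof -
  obtain p where p: "p \<in> left_hom R (free_module R (carrier Y)) Y" "\<And>b. b \<in> carrier Y ==> p (delta R b) = b"
    using free_hom_exists[OF Y, of "\<lambda>x. x" "carrier Y"] by auto
  have "y \<in> p ` carrier (free_module R (carrier Y))" if "y \<in> carrier Y" for y
    using p(2)[OF that] delta_closed[OF lm_ring[OF Y] that] by (metis imageI)
  then show ?thesis using that[OF p(1)] lh_closed[OF p(1)] by blast
qed

lemma free_module_embed:
  assumes "inj (f :: 'b => ('r, 'p) univ)"
  shows "\<exists>e :: ('b => 'r) => ('r, 'p) univ. inj_on e (carrier (free_module R B))"
proof -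
  obtain g :: "'r => ('r, 'p) univ" where g: "inj g" using univ_embed_scalar by blast
  obtain e :: "('b => 'r) => ('r, 'p) univ" where "inj_on e {h. finite {x. h x \<noteq> \<zero>\<^sub>R}}"
    using finsupp_embed[OF assms g] by blast
  then have "inj_on e (carrier (free_module R B))" by (rule inj_on_subset) auto
  then show ?thesis by blast
qed

text \<open>The definition lifts inside the universe only. It is applied to a copy of the free
  module on \<open>carrier P\<close>, to split the free cover of \<open>P\<close>; a map out of
  \<open>P\<close> is then lifted to modules of any type through the free module. Comparing images,
  in place of asking \<open>g\<close> to be onto, suits the differentials of exact
  sequences.\<close>

theorem projective_lift:
  fixes P :: "('r, 'p, 'f) module_scheme"
  assumes P: "projective_module R P" and B: "left_module R B" and C: "left_module R C"
    and g: "g \<in> left_hom R B C" and f: "f \<in> left_hom R P C" and fg: "f ` carrier P \<subseteq> g ` carrier B"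
  obtains h where "h \<in> left_hom R P B" "\<And>x. x \<in> carrier P ==> g (h x) = f x"
proof -
  have lP: "left_module R P" using P by (simp add: projective_module_def)
  have R: "ring R" using lP by (rule lm_ring)
  let ?F = "free_module R (carrier P)"
  note lF = lmod_free[OF R, of "carrier P"]
  obtain c :: "'p => ('r, 'p) univ" where c: "inj c" using univ_embed_base by blast
  obtain e :: "('p => 'r) => ('r, 'p) univ" where e: "inj_on e (carrier ?F)"
    using free_module_embed[OF c] by blast
  have cP: "inj_on c (carrier P)" using c by (auto intro: inj_on_subset)
  note pc = push_inj[OF lP cP] and pe = push_inj[OF lF e]
  obtain p where p: "p \<in> left_hom R ?F P" "p ` carrier ?F = carrier P"
    using free_cover[OF lP] by blast
  let ?d = "inv_into (carrier ?F) e"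
  have d: "?d (e u) = u" if "u \<in> carrier ?F" for u using e that by (rule inv_into_f_f)
  have q: "(\<lambda>x. c (p (?d x))) \<in> left_hom R (push e ?F) (push c P)"
    by (rule lh_comp[OF lh_comp[OF pe(3) p(1)] pc(2)])
  have qs: "(\<lambda>x. c (p (?d x))) ` carrier (push e ?F) = carrier (push c P)"
  proof -
    have "(\<lambda>x. c (p (?d x))) ` carrier (push e ?F) = (\<lambda>u. c (p u)) ` carrier ?F"
      unfolding push_carrier' image_image using d by (intro image_cong) auto
    also have "\<dots> = c ` (p ` carrier ?F)" by (simp only: image_image)
    finally show ?thesis by (simp only: p(2) push_carrier')
  qed
  from P[unfolded projective_module_def, THEN conjunct2, rule_format, OF pe(1) pc(1) q qs pc(2)]
  obtain s where s: "s \<in> left_hom R P (push e ?F)" "\<And>x. x \<in> carrier P ==> c (p (?d (s x))) = c x" by auto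
  have s': "(\<lambda>x. ?d (s x)) \<in> left_hom R P ?F" by (rule lh_comp[OF s(1) pe(3)])
  have ps: "p (?d (s x)) = x" if "x \<in> carrier P" for x using s(2)[OF that] c by (simp add: inj_eq)
  have fp: "(\<lambda>u. f (p u)) \<in> left_hom R ?F C" by (rule lh_comp[OF p(1) f])
  have "f (p (delta R b)) \<in> g ` carrier B" if "b \<in> carrier P" for b
    using fg lh_closed[OF p(1) delta_closed[OF R that]] by blast
  then obtain h where h: "h \<in> left_hom R ?F B" "\<And>u. u \<in> carrier ?F ==> g (h u) = f (p u)"
    using free_lift[OF B C g fp] by blast
  have "g (h (?d (s x))) = f x" if "x \<in> carrier P" for x
    using h(2)[OF lh_closed[OF s' that]] ps[OF that] by simp
  then show ?thesis using that[OF lh_comp[OF s' h(1)]] by blast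
qed

lemma projective_retract:
  fixes Q :: "('r, 'q, 'g) module_scheme"
  assumes P: "projective_module R P" and Q: "left_module R Q"
    and i: "i \<in> left_hom R Q P" and p: "p \<in> left_hom R P Q" and pi: "\<And>x. x \<in> carrier Q ==> p (i x) = x"
  shows "projective_module R Q"
  unfolding projective_module_def
proof (intro conjI allI impI Q)
  fix B C :: "('r, ('r, 'q) univ) module" and g f
  assume B: "left_module R B" and C: "left_module R C" and g: "g \<in> left_hom R B C"
    and gs: "g ` carrier B = carrier C" and f: "f \<in> left_hom R Q C"
  have fp: "(\<lambda>x. f (p x)) \<in> left_hom R P C" by (rule lh_comp[OF p f])
  have "(\<lambda>x. f (p x)) ` carrier P \<subseteq> g ` carrier B" using lh_closed[OF fp] gs by blast
  from projective_lift[OF P B C g fp this]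
  obtain h where h: "h \<in> left_hom R P B" "\<And>x. x \<in> carrier P ==> g (h x) = f (p x)" by blast
  show "\<exists>h\<in>left_hom R Q B. \<forall>x\<in>carrier Q. g (h x) = f x"
    using lh_comp[OF i h(1)] h(2) lh_closed[OF i] pi by (intro bexI[of _ "\<lambda>x. h (i x)"]) auto
qed

text \<open>The copy inherits the lifting property from \<open>free_lift\<close>, which holds for
  modules of any type.\<close>

lemma projective_free:
  fixes e :: "('b => 'r) => 'q"
  assumes R: "ring R" and e: "inj_on e (carrier (free_module R S))"
  shows "projective_module R (push e (free_module R S))"
  unfolding projective_module_def
proof (intro conjI allI impI)
  note lF = lmod_free[OF R, of S]
  note pe = push_inj[OF lF e]
  show "left_module R (push e (free_module R S))" by (rule pe)
  fix B C :: "('r, ('r, 'q) univ) module" and g f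
  assume B: "left_module R B" and C: "left_module R C" and g: "g \<in> left_hom R B C"
    and gs: "g ` carrier B = carrier C" and f: "f \<in> left_hom R (push e (free_module R S)) C"
  have fe: "(\<lambda>u. f (e u)) \<in> left_hom R (free_module R S) C" by (rule lh_comp[OF pe(2) f])
  have "f (e (delta R b)) \<in> g ` carrier B" if "b \<in> S" for b
    using lh_closed[OF fe delta_closed[OF R that]] gs by simp
  then obtain h where h: "h \<in> left_hom R (free_module R S) B"
    "\<And>u. u \<in> carrier (free_module R S) ==> g (h u) = f (e u)"
    using free_lift[OF B C g fe] by blast
  have "g (h (inv_into (carrier (free_module R S)) e x)) = f x" if x: "x \<in> carrier (push e (free_module R S))" for x
    using h(2)[OF lh_closed[OF pe(3) x]] x by (simp only: push_carrier' f_inv_into_f)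
  then show "\<exists>h\<in>left_hom R (push e (free_module R S)) B. \<forall>x\<in>carrier (push e (free_module R S)). g (h x) = f x"
    by (intro bexI[OF _ lh_comp[OF pe(3) h(1)]] ballI)
qed

lemma enough_projectives:
  fixes Y :: "('r, ('r, 'x) univ) module"
  assumes Y: "left_module R Y"
  shows "\<exists>(P :: ('r, ('r, 'x) univ) module) p. projective_module R P \<and> p \<in> left_hom R P Y \<and>
    p ` carrier P = carrier Y"
proof -
  have R: "ring R" using Y by (rule lm_ring)
  let ?F = "free_module R (carrier Y)"
  obtain e :: "(('r, 'x) univ => 'r) => ('r, 'x) univ" where e: "inj_on e (carrier ?F)"
    using free_module_embed[OF inj_on_id] by blast
  obtain p where p: "p \<in> left_hom R ?F Y" "p ` carrier ?F = carrier Y"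
    using free_cover[OF Y] by blast
  note pe = push_inj[OF lmod_free[OF R] e]
  have "(\<lambda>x. p (inv_into (carrier ?F) e x)) \<in> left_hom R (push e ?F) Y"
    by (rule lh_comp[OF pe(3) p(1)])
  moreover have "(\<lambda>x. p (inv_into (carrier ?F) e x)) ` carrier (push e ?F) = carrier Y"
  proof -
    have "(\<lambda>x. p (inv_into (carrier ?F) e x)) ` carrier (push e ?F) = p ` carrier ?F"
      unfolding push_carrier' image_image using inv_into_f_f[OF e] by (intro image_cong) auto
    then show ?thesis by (simp only: p(2))
  qed
  ultimately show ?thesis using projective_free[OF R e] by blast
qed

text \<open>Iterates \<open>enough_projectives\<close> on syzygies. Tor refers to a chosen
  resolution, so one has to exist.\<close>

lemma projective_resolution_exists:
  fixes X :: "('r, 'x, 'f) module_scheme"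
  assumes X: "left_module R X"
  shows "\<exists>(P :: nat => ('r, ('r, 'x) univ) module) d e. left_resolution R X P d e \<and> (\<forall>i. projective_module R (P i))"
proof -
  obtain c0 :: "'x => ('r, 'x) univ" where c0: "inj c0" using univ_embed_base by blast
  have c0X: "inj_on c0 (carrier X)" using c0 by (auto intro: inj_on_subset)
  note p0 = push_inj[OF X c0X]
  have "\<forall>K :: ('r, ('r, 'x) univ) module. \<exists>(P :: ('r, ('r, 'x) univ) module) p. left_module R K -->
      projective_module R P \<and> p \<in> left_hom R P K \<and> p ` carrier P = carrier K"
    using enough_projectives by blast
  then obtain Q :: "('r, ('r, 'x) univ) module => ('r, ('r, 'x) univ) module" and p
    where Q: "\<And>K. left_module R K ==> projective_module R (Q K)" "\<And>K. left_module R K ==> p K \<in> left_hom R (Q K) K"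
      "\<And>K. left_module R K ==> p K ` carrier (Q K) = carrier K" by metis
  have lQ: "left_module R (Q K)" if "left_module R K" for K
    using Q(1)[OF that] by (simp add: projective_module_def)
  \<comment> \<open>\<open>K i\<close> is the i-th syzygy, \<open>K 0\<close> being a copy of
    \<open>X\<close>; later ones are kernels and keep the structure of the projective module around
    them, with a smaller carrier.\<close>
  define K where "K = rec_nat (push c0 X) (\<lambda>_ K. (Q K)\<lparr>carrier := a_kernel (Q K) K (p K)\<rparr>)"
  have K0: "K 0 = push c0 X" and KS: "K (Suc i) = (Q (K i))\<lparr>carrier := a_kernel (Q (K i)) (K i) (p (K i))\<rparr>" for i
    by (simp_all add: K_def)
  have lK: "left_module R (K i)" for i
  proof (induction i)
    case 0 show ?case unfolding K0 by (rule p0)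
  next
    case (Suc i) show ?case unfolding KS
      by (rule lmod_sub[OF lQ[OF Suc] submod_kernel[OF lQ[OF Suc] Suc Q(2)[OF Suc]]])
  qed
  \<comment> \<open>The cover of the next syzygy, read with values in the projective module around
    that syzygy, is the differential.\<close>
  let ?P = "\<lambda>i. Q (K i)" and ?d = "\<lambda>i. p (K (Suc i))" and ?e = "\<lambda>x. inv_into (carrier X) c0 (p (K 0) x)"
  have KP: "carrier (K (Suc i)) \<subseteq> carrier (Q (K i))" for i by (auto simp: KS a_kernel_eq)
  have dh: "?d i \<in> left_hom R (?P (Suc i)) (?P i)" for i
    using Q(2)[OF lK, of "Suc i"] lh_from_sub[of "?d i" R "?P (Suc i)" _ "?P i"] KP[of i] by (simp add: KS a_kernel_eq)
  have di: "?d i ` carrier (?P (Suc i)) = a_kernel (Q (K i)) (K i) (p (K i))" for i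
    using Q(3)[OF lK, of "Suc i"] by (simp add: KS)
  have "left_resolution R X ?P ?d ?e"
    unfolding left_resolution_def
  proof (intro conjI allI)
    have pK0: "p (K 0) \<in> left_hom R (Q (K 0)) (push c0 X)" using Q(2)[OF lK, of 0] by (simp add: K0)
    show "?e \<in> left_hom R (?P 0) X" by (rule lh_comp[OF pK0 p0(3)])
    have ps: "p (K 0) ` carrier (Q (K 0)) = c0 ` carrier X" using Q(3)[OF lK, of 0] by (simp add: K0 push_carrier')
    have "?e ` carrier (?P 0) = inv_into (carrier X) c0 ` (p (K 0) ` carrier (Q (K 0)))" by (simp only: image_image)
    also have "\<dots> = carrier X" using inv_into_f_f[OF c0X] by (simp add: ps image_image)
    finally show "?e ` carrier (?P 0) = carrier X" .
    have "inv_into (carrier X) c0 y = \<zero>\<^sub>X \<longleftrightarrow> y = \<zero>\<^sub>(K 0)" if "y \<in> carrier (K 0)" for y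
      using that c0X lm_ag[OF X] inv_into_f_f[OF c0X] by (auto simp: K0 push_carrier' push_zero' ag_zero)
    then have "a_kernel (?P 0) X ?e = a_kernel (Q (K 0)) (K 0) (p (K 0))"
      using lh_closed[OF Q(2)[OF lK]] by (auto simp: a_kernel_eq)
    then show "?d 0 ` carrier (?P 1) = a_kernel (?P 0) X ?e" using di[of 0] by simp
    fix i
    show "?d (Suc i) ` carrier (?P (Suc (Suc i))) = a_kernel (?P (Suc i)) (?P i) (?d i)"
      using di[of "Suc i"] by (simp add: KS a_kernel_eq)
  qed (use lQ lK dh in auto)
  then show ?thesis using Q(1)[OF lK] by blast
qed

section \<open>Comparison of resolutions\<close>

lemma left_resolutionD:
  assumes "left_resolution R X P d e"
  shows "left_module R (P i)" "e \<in> left_hom R (P 0) X" "d i \<in> left_hom R (P (Suc i)) (P i)"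
    "e ` carrier (P 0) = carrier X"
    "x \<in> carrier (P 0) ==> e x = \<zero>\<^sub>X \<longleftrightarrow> x \<in> d 0 ` carrier (P 1)"
    "x \<in> carrier (P (Suc i)) ==> d i x = \<zero>\<^sub>(P i) \<longleftrightarrow> x \<in> d (Suc i) ` carrier (P (Suc (Suc i)))"
  using assms by (auto simp: left_resolution_def a_kernel_eq)

lemma right_resolutionD:
  assumes "right_resolution R X I d e"
  shows "left_module R (I i)" "e \<in> left_hom R X (I 0)" "d i \<in> left_hom R (I i) (I (Suc i))"
    "inj_on e (carrier X)"
    "x \<in> carrier (I 0) ==> d 0 x = \<zero>\<^sub>(I 1) \<longleftrightarrow> x \<in> e ` carrier X"
    "x \<in> carrier (I (Suc i)) ==> d (Suc i) x = \<zero>\<^sub>(I (Suc (Suc i))) \<longleftrightarrow> x \<in> d i ` carrier (I i)"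
  using assms by (auto simp: right_resolution_def a_kernel_eq)

text \<open>The image of \<^term>\<open>d k\<close> is a direct summand of \<^term>\<open>P k\<close>, the map \<^term>\<open>t\<close> being a projection onto it.\<close>

definition psplit ::
    "('r, 'e) ring_scheme => (nat => ('r, 'u, 'f) module_scheme) => (nat => 'u => 'u) => nat => bool" where
  "psplit R P d k \<longleftrightarrow> (\<exists>t\<in>left_hom R (P k) (P k).
     (\<forall>x\<in>carrier (P k). t x \<in> d k ` carrier (P (Suc k))) \<and> (\<forall>y\<in>carrier (P (Suc k)). t (d k y) = d k y))"

text \<open>Dually, the kernel of \<^term>\<open>d k\<close> is a direct summand.\<close>

definition isplit ::
    "('r, 'e) ring_scheme => (nat => ('r, 'u, 'f) module_scheme) => (nat => 'u => 'u) => nat => bool" where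
  "isplit R I d k \<longleftrightarrow> (\<exists>t\<in>left_hom R (I k) (I k).
     (\<forall>x\<in>carrier (I k). d k (t x) = \<zero>\<^sub>(I (Suc k))) \<and>
     (\<forall>x\<in>carrier (I k). d k x = \<zero>\<^sub>(I (Suc k)) --> t x = x))"

text \<open>Chain maps \<^term>\<open>f\<close> and \<^term>\<open>g\<close> over the identity of \<^term>\<open>X\<close> are built degree by degree. The map
  \<^term>\<open>\<sigma>\<close> keeps track of the homotopy: it takes values in the boundaries and agrees with
  \<^term>\<open>id - f \<circ> g\<close> on them.\<close>

lemma projective_comparison:
  fixes P :: "nat => ('r, 'u) module" and Q :: "nat => ('r, 'v) module"
  assumes X: "left_module R X"
    and P: "left_resolution R X P d e" "\<And>i. projective_module R (P i)"
    and Q: "left_resolution R X Q d' e'" "\<And>i. projective_module R (Q i)"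
  shows "\<exists>f g \<sigma>. f \<in> left_hom R (Q k) (P k) \<and> g \<in> left_hom R (P k) (Q k) \<and> \<sigma> \<in> left_hom R (P k) (P k) \<and>
    (\<forall>y\<in>carrier (Q (Suc k)). f (d' k y) \<in> d k ` carrier (P (Suc k))) \<and>
    (\<forall>y\<in>carrier (P (Suc k)). g (d k y) \<in> d' k ` carrier (Q (Suc k))) \<and>
    (\<forall>x\<in>carrier (P k). \<sigma> x \<in> d k ` carrier (P (Suc k))) \<and>
    (\<forall>y\<in>carrier (P (Suc k)). \<sigma> (d k y) = d k y \<ominus>\<^sub>(P k) f (g (d k y)))"
proof (induction k)
  note p = left_resolutionD[OF P(1)] and q = left_resolutionD[OF Q(1)]
  case 0
  obtain f where f: "f \<in> left_hom R (Q 0) (P 0)" "\<And>x. x \<in> carrier (Q 0) ==> e (f x) = e' x"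
    using projective_lift[OF Q(2) p(1) X p(2) q(2)] p(4) q(4) by blast
  obtain g where g: "g \<in> left_hom R (P 0) (Q 0)" "\<And>x. x \<in> carrier (P 0) ==> e' (g x) = e x"
    using projective_lift[OF P(2) q(1) X q(2) p(2)] p(4) q(4) by blast
  have dP: "d 0 y \<in> carrier (P 0) \<and> e (d 0 y) = \<zero>\<^sub>X" if "y \<in> carrier (P (Suc 0))" for y
    using p(5)[of "d 0 y"] lh_closed[OF p(3) that] that by auto
  have dQ: "d' 0 y \<in> carrier (Q 0) \<and> e' (d' 0 y) = \<zero>\<^sub>X" if "y \<in> carrier (Q (Suc 0))" for y
    using q(5)[of "d' 0 y"] lh_closed[OF q(3) that] that by auto
  let ?\<sigma> = "\<lambda>x. x \<ominus>\<^sub>(P 0) f (g x)"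
  have \<sigma>: "?\<sigma> \<in> left_hom R (P 0) (P 0)"
    by (rule lh_minus[OF lh_id lh_comp[OF g(1) f(1)] p(1)])
  have e\<sigma>: "e (?\<sigma> x) = \<zero>\<^sub>X" if x: "x \<in> carrier (P 0)" for x
    using lh_diff[OF p(2) p(1) X x lh_closed[OF f(1) lh_closed[OF g(1) x]]]
      f(2)[OF lh_closed[OF g(1) x]] g(2)[OF x] ag_diff_self[OF lm_ag[OF X] lh_closed[OF p(2) x]] by simp
  have "f (d' 0 y) \<in> d 0 ` carrier (P (Suc 0))" if y: "y \<in> carrier (Q (Suc 0))" for y
    using p(5)[OF lh_closed[OF f(1)], of "d' 0 y"] f(2)[of "d' 0 y"] dQ[OF y] by simp
  moreover have "g (d 0 y) \<in> d' 0 ` carrier (Q (Suc 0))" if y: "y \<in> carrier (P (Suc 0))" for y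
    using q(5)[OF lh_closed[OF g(1)], of "d 0 y"] g(2)[of "d 0 y"] dP[OF y] by simp
  moreover have "?\<sigma> x \<in> d 0 ` carrier (P (Suc 0))" if x: "x \<in> carrier (P 0)" for x
    using p(5)[OF lh_closed[OF \<sigma> x]] e\<sigma>[OF x] by simp
  ultimately show ?case using f(1) g(1) \<sigma> by blast
next
  note p = left_resolutionD[OF P(1)] and q = left_resolutionD[OF Q(1)]
  case (Suc k)
  then obtain f g \<sigma> where f: "f \<in> left_hom R (Q k) (P k)" and g: "g \<in> left_hom R (P k) (Q k)"
    and \<sigma>: "\<sigma> \<in> left_hom R (P k) (P k)"
    and fd: "\<And>y. y \<in> carrier (Q (Suc k)) ==> f (d' k y) \<in> d k ` carrier (P (Suc k))"
    and gd: "\<And>y. y \<in> carrier (P (Suc k)) ==> g (d k y) \<in> d' k ` carrier (Q (Suc k))"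
    and \<sigma>d: "\<And>x. x \<in> carrier (P k) ==> \<sigma> x \<in> d k ` carrier (P (Suc k))"
    and \<sigma>eq: "\<And>y. y \<in> carrier (P (Suc k)) ==> \<sigma> (d k y) = d k y \<ominus>\<^sub>(P k) f (g (d k y))" by blast
  obtain f' where f': "f' \<in> left_hom R (Q (Suc k)) (P (Suc k))" "\<And>x. x \<in> carrier (Q (Suc k)) ==> d k (f' x) = f (d' k x)"
    using projective_lift[OF Q(2) p(1) p(1) p(3) lh_comp[OF q(3) f]] fd by blast
  obtain g' where g': "g' \<in> left_hom R (P (Suc k)) (Q (Suc k))" "\<And>x. x \<in> carrier (P (Suc k)) ==> d' k (g' x) = g (d k x)"
    using projective_lift[OF P(2) q(1) q(1) q(3) lh_comp[OF p(3) g]] gd by blast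
  \<comment> \<open>The homotopy: \<open>\<sigma>\<close> takes values in the boundaries, so it
    lifts along \<open>d k\<close>.\<close>
  obtain h where h: "h \<in> left_hom R (P k) (P (Suc k))" "\<And>x. x \<in> carrier (P k) ==> d k (h x) = \<sigma> x"
    using projective_lift[OF P(2) p(1) p(1) p(3) \<sigma>] \<sigma>d by blast
  have dP: "d (Suc k) y \<in> carrier (P (Suc k)) \<and> d k (d (Suc k) y) = \<zero>\<^sub>(P k)" if "y \<in> carrier (P (Suc (Suc k)))" for y
    using p(6)[of "d (Suc k) y"] lh_closed[OF p(3) that] that by auto
  have dQ: "d' (Suc k) y \<in> carrier (Q (Suc k)) \<and> d' k (d' (Suc k) y) = \<zero>\<^sub>(Q k)" if "y \<in> carrier (Q (Suc (Suc k)))" for y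
    using q(6)[of "d' (Suc k) y"] lh_closed[OF q(3) that] that by auto
  let ?\<tau> = "\<lambda>x. x \<ominus>\<^sub>(P (Suc k)) f' (g' x)"
  \<comment> \<open>Subtracting \<open>h \<circ> d k\<close> makes the values cycles, hence
    boundaries by exactness; on boundaries the subtracted term vanishes, so the agreement with
    \<open>id - f' \<circ> g'\<close> survives there.\<close>
  let ?\<sigma> = "\<lambda>x. ?\<tau> x \<ominus>\<^sub>(P (Suc k)) h (d k x)"
  have \<tau>: "?\<tau> \<in> left_hom R (P (Suc k)) (P (Suc k))"
    by (rule lh_minus[OF lh_id lh_comp[OF g'(1) f'(1)] p(1)])
  have \<sigma>': "?\<sigma> \<in> left_hom R (P (Suc k)) (P (Suc k))"
    by (rule lh_minus[OF \<tau> lh_comp[OF p(3) h(1)] p(1)])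
  have d\<sigma>: "d k (?\<sigma> x) = \<zero>\<^sub>(P k)" if x: "x \<in> carrier (P (Suc k))" for x
  proof -
    have "d k (?\<tau> x) = d k x \<ominus>\<^sub>(P k) f (g (d k x))"
      using lh_diff[OF p(3) p(1) p(1) x lh_closed[OF f'(1) lh_closed[OF g'(1) x]]]
        f'(2)[OF lh_closed[OF g'(1) x]] g'(2)[OF x] by simp
    also have "\<dots> = d k (h (d k x))" using \<sigma>eq[OF x] h(2)[OF lh_closed[OF p(3) x]] by simp
    finally show ?thesis
      using lh_diff[OF p(3) p(1) p(1) lh_closed[OF \<tau> x] lh_closed[OF h(1) lh_closed[OF p(3) x]]]
        ag_diff_self[OF lm_ag[OF p(1)] lh_closed[OF p(3) lh_closed[OF h(1) lh_closed[OF p(3) x]]]]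
      by simp
  qed
  have "f' (d' (Suc k) y) \<in> d (Suc k) ` carrier (P (Suc (Suc k)))" if y: "y \<in> carrier (Q (Suc (Suc k)))" for y
    using p(6)[OF lh_closed[OF f'(1)], of "d' (Suc k) y"] f'(2)[of "d' (Suc k) y"] dQ[OF y]
      lh_zero_zero[OF f q(1) p(1)] by simp
  moreover have "g' (d (Suc k) y) \<in> d' (Suc k) ` carrier (Q (Suc (Suc k)))" if y: "y \<in> carrier (P (Suc (Suc k)))" for y
    using q(6)[OF lh_closed[OF g'(1)], of "d (Suc k) y"] g'(2)[of "d (Suc k) y"] dP[OF y]
      lh_zero_zero[OF g p(1) q(1)] by simp
  moreover have "?\<sigma> x \<in> d (Suc k) ` carrier (P (Suc (Suc k)))" if x: "x \<in> carrier (P (Suc k))" for x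
    using p(6)[OF lh_closed[OF \<sigma>' x]] d\<sigma>[OF x] by simp
  moreover have "?\<sigma> (d (Suc k) y) = ?\<tau> (d (Suc k) y)" if y: "y \<in> carrier (P (Suc (Suc k)))" for y
    using dP[OF y] lh_zero_zero[OF h(1) p(1) p(1)] ag_diff_zero[OF lm_ag[OF p(1)] lh_closed[OF \<tau>, of "d (Suc k) y"]]
    by simp
  ultimately show ?case using f'(1) g'(1) \<sigma>' by blast
qed

section \<open>Projective dimension read off from one resolution\<close>

definition pd_le :: "('r, 'e) ring_scheme => ('r, 'x, 'f) module_scheme => nat => bool" where
  "pd_le R X k \<longleftrightarrow> (\<exists>(P :: nat => ('r, ('r, 'x) univ) module) d e.
       left_resolution R X P d e \<and> (\<forall>i. projective_module R (P i)) \<and>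
       (\<forall>i>k. carrier (P i) = {\<zero>\<^sub>(P i)}))"

text \<open>Equality of dimensions reduces to an equivalence for each single \<open>k\<close>, the
  infinite case included.\<close>

lemma pd_eq: "pd R X = Inf {enat k | k. pd_le R X k}"
  by (simp add: pd_def pd_le_def)

text \<open>If some projective resolution vanishes beyond \<open>k\<close>, comparison with it gives
  \<open>g (d k y) = 0\<close>, so \<open>\<sigma>\<close> is the identity on boundaries and
  projects onto them. Conversely the kernel of a projection \<open>t\<close> is a complement of the
  boundaries in \<open>P k\<close>, and the resolution can be cut off there.\<close>

lemma pd_le_iff_psplit:
  fixes P :: "nat => ('r, ('r, 'x) univ) module" and X :: "('r, 'x, 'f) module_scheme"
  assumes X: "left_module R X" and P: "left_resolution R X P d e" "\<And>i. projective_module R (P i)"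
  shows "pd_le R X k \<longleftrightarrow> psplit R P d k"
proof
  note p = left_resolutionD[OF P(1)]
  assume "pd_le R X k"
  then obtain Q :: "nat => ('r, ('r, 'x) univ) module" and d' e'
    where Q: "left_resolution R X Q d' e'" "\<And>i. projective_module R (Q i)" "carrier (Q (Suc k)) = {\<zero>\<^sub>(Q (Suc k))}"
    by (auto simp: pd_le_def)
  note q = left_resolutionD[OF Q(1)]
  from projective_comparison[OF X P Q(1,2), of k]
  obtain f g \<sigma> where f: "f \<in> left_hom R (Q k) (P k)" and \<sigma>: "\<sigma> \<in> left_hom R (P k) (P k)"
    and gd: "\<And>y. y \<in> carrier (P (Suc k)) ==> g (d k y) \<in> d' k ` carrier (Q (Suc k))"
    and \<sigma>d: "\<And>x. x \<in> carrier (P k) ==> \<sigma> x \<in> d k ` carrier (P (Suc k))"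
    and \<sigma>eq: "\<And>y. y \<in> carrier (P (Suc k)) ==> \<sigma> (d k y) = d k y \<ominus>\<^sub>(P k) f (g (d k y))" by blast
  have "\<sigma> (d k y) = d k y" if y: "y \<in> carrier (P (Suc k))" for y
  proof -
    have "g (d k y) = \<zero>\<^sub>(Q k)" using gd[OF y] Q(3) lh_zero_zero[OF q(3) q(1) q(1)] by auto
    then show ?thesis using \<sigma>eq[OF y] lh_zero_zero[OF f q(1) p(1)]
      ag_diff_zero[OF lm_ag[OF p(1)] lh_closed[OF p(3) y]] by simp
  qed
  then show "psplit R P d k" using \<sigma> \<sigma>d by (auto simp: psplit_def)
next
  note p = left_resolutionD[OF P(1)]
  note agP = lm_ag[OF p(1)]
  assume "psplit R P d k"
  then obtain t where t: "t \<in> left_hom R (P k) (P k)"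
    and td: "\<And>x. x \<in> carrier (P k) ==> t x \<in> d k ` carrier (P (Suc k))"
    and tid: "\<And>y. y \<in> carrier (P (Suc k)) ==> t (d k y) = d k y" by (auto simp: psplit_def)
  \<comment> \<open>The resolution cut off at \<open>k\<close>: unchanged below, the complement of
    the boundaries in degree \<open>k\<close>, zero beyond.\<close>
  define C where "C = (\<lambda>i. if i < k then carrier (P i) else if i = k then a_kernel (P k) (P k) t else {\<zero>\<^sub>(P i)})"
  define P' where "P' = (\<lambda>i. (P i)\<lparr>carrier := C i\<rparr>)"
  have Csub: "C i \<subseteq> carrier (P i)" for i by (auto simp: C_def a_kernel_eq ag_zero[OF agP])
  have sC: "submod R (P i) (C i)" for i
    using submod_carrier[OF p(1)] submod_kernel[OF p(1) p(1) t] submod_zero_set[OF p(1)] by (simp add: C_def)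
  have lP': "left_module R (P' i)" for i
    unfolding P'_def by (rule lmod_sub[OF p(1) sC])
  let ?r = "\<lambda>x. x \<ominus>\<^sub>(P k) t x"
  have rh: "?r \<in> left_hom R (P k) (P k)" by (rule lh_minus[OF lh_id t p(1)])
  have rC: "?r x \<in> C k" if x: "x \<in> carrier (P k)" for x
  proof -
    have "t (t x) = t x" using td[OF x] tid by auto
    then have "t (?r x) = \<zero>\<^sub>(P k)"
      using lh_diff[OF t p(1) p(1) x lh_closed[OF t x]] ag_diff_self[OF agP lh_closed[OF t x]] by simp
    then show ?thesis using lh_closed[OF rh x] by (simp add: C_def a_kernel_eq)
  qed
  have CkI: "x = \<zero>\<^sub>(P k)" if "x \<in> C k" "x \<in> d k ` carrier (P (Suc k))" for x
    using that tid by (auto simp: C_def a_kernel_eq)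
  \<comment> \<open>Every exactness condition in positive degree, and the one at \<open>P 0\<close>,
    follows from this identity: the new image is the part of the old one that lies in
    \<open>C i\<close>.\<close>
  have imC: "d i ` C (Suc i) = d i ` carrier (P (Suc i)) \<inter> C i" for i
  proof -
    consider "Suc i < k" | "Suc i = k" | "i = k" | "i > k" by linarith
    then show ?thesis
    proof cases
      case 1
      then show ?thesis using lh_closed[OF p(3)[of i]] by (auto simp: C_def)
    next
      case 2
      \<comment> \<open>Replacing \<open>x\<close> by \<open>x - t x\<close> stays within
        \<open>C k\<close> and does not change the image, since \<open>t x\<close> is a
        boundary.\<close>
      have "d i x \<in> d i ` C (Suc i)" if x: "x \<in> carrier (P (Suc i))" for x
      proof -
        have x': "x \<in> carrier (P k)" using x 2 by simp
        have "t x \<in> d (Suc i) ` carrier (P (Suc (Suc i)))" "t x \<in> carrier (P (Suc i))"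
          using td[OF x'] lh_closed[OF t x'] 2 by auto
        then have "d i (t x) = \<zero>\<^sub>(P i)" using p(6) by blast
        then have "d i (?r x) = d i x"
          using lh_diff[OF p(3) p(1) p(1) x \<open>t x \<in> carrier (P (Suc i))\<close>]
            ag_diff_zero[OF agP lh_closed[OF p(3) x]] 2 by simp
        then show ?thesis using rC[OF x'] 2 by (metis imageI)
      qed
      moreover have "C i = carrier (P i)" using 2 by (simp add: C_def)
      ultimately show ?thesis using Csub[of "Suc i"] lh_closed[OF p(3)[of i]] by auto
    next
      case 3
      have "d k ` C (Suc k) = {\<zero>\<^sub>(P k)}" using lh_zero_zero[OF p(3) p(1) p(1)] by (simp add: C_def)
      moreover have "\<zero>\<^sub>(P k) \<in> d k ` carrier (P (Suc k)) \<inter> C k"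
        by (rule IntI[OF submod_zero[OF submod_image[OF p(1) p(1) p(3)]] submod_zero[OF sC]])
      moreover have "d k ` carrier (P (Suc k)) \<inter> C k \<subseteq> {\<zero>\<^sub>(P k)}"
        by (rule subsetI, elim IntE) (simp add: CkI)
      ultimately have "d k ` carrier (P (Suc k)) \<inter> C k = {\<zero>\<^sub>(P k)}" "d k ` C (Suc k) = {\<zero>\<^sub>(P k)}"
        by (simp_all only: subset_singleton_iff) (metis empty_iff)
      then show ?thesis using 3 by simp
    next
      case 4
      have "d i ` C (Suc i) = {\<zero>\<^sub>(P i)}" using 4 lh_zero_zero[OF p(3) p(1) p(1)] by (simp add: C_def)
      moreover have "\<zero>\<^sub>(P i) \<in> d i ` carrier (P (Suc i))"
        by (rule submod_zero[OF submod_image[OF p(1) p(1) p(3)]])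
      ultimately show ?thesis using 4 by (auto simp: C_def)
    qed
  qed
  have "left_resolution R X P' d e"
    unfolding left_resolution_def
  proof (intro conjI allI)
    show "left_module R (P' i)" for i by (rule lP')
    show "e \<in> left_hom R (P' 0) X" unfolding P'_def by (rule lh_sub_dom[OF p(2) Csub])
    show "d i \<in> left_hom R (P' (Suc i)) (P' i)" for i
      unfolding P'_def by (rule lh_into_sub[OF lh_sub_dom[OF p(3) Csub]]) (use imC[of i] in auto)
    show "e ` carrier (P' 0) = carrier X"
    proof (cases "k = 0")
      case True
      have "e x \<in> e ` C 0" if x: "x \<in> carrier (P 0)" for x
      proof -
        have x': "x \<in> carrier (P k)" using x True by simp
        have "e (t x) = \<zero>\<^sub>X" using p(5)[of "t x"] td[OF x'] lh_closed[OF t x'] True by simp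
        then have "e (?r x) = e x"
          using lh_diff[OF p(2) p(1) X x, of "t x"] lh_closed[OF t x'] True
            ag_diff_zero[OF lm_ag[OF X] lh_closed[OF p(2) x]] by simp
        then show ?thesis using rC[OF x'] True by (metis imageI)
      qed
      then have "carrier X \<subseteq> e ` C 0" using p(4) by (metis image_subsetI)
      moreover have "e ` C 0 \<subseteq> carrier X" using image_mono[OF Csub[of 0], of e] p(4) by simp
      ultimately show ?thesis by (simp add: P'_def)
    qed (use p(4) in \<open>simp add: P'_def C_def\<close>)
    show "d 0 ` carrier (P' 1) = a_kernel (P' 0) X e"
      using imC[of 0] p(5) Csub[of 0] by (auto simp: P'_def a_kernel_eq)
    show "d (Suc i) ` carrier (P' (Suc (Suc i))) = a_kernel (P' (Suc i)) (P' i) (d i)" for i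
      using imC[of "Suc i"] p(6) Csub[of "Suc i"] by (auto simp: P'_def a_kernel_eq)
  qed
  moreover have "projective_module R (P' i)" for i
  proof -
    consider "i < k" | "i = k" | "i > k" by linarith
    then show ?thesis
    proof cases
      case 1
      then have "P' i = P i" by (simp add: P'_def C_def)
      then show ?thesis using P(2) by simp
    next
      case 2
      have "(\<lambda>x. x) \<in> left_hom R (P' k) (P k)"
        unfolding P'_def by (rule lh_sub_dom[OF lh_id Csub])
      moreover have "?r \<in> left_hom R (P k) (P' k)"
        unfolding P'_def by (rule lh_into_sub[OF rh]) (use rC in auto)
      moreover have "?r x = x" if "x \<in> carrier (P' k)" for x
        using that ag_diff_zero[OF agP] by (auto simp: P'_def C_def a_kernel_eq)
      ultimately show ?thesis using projective_retract[OF P(2) lP', of "\<lambda>x. x" k k ?r] 2 by simp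
    next
      case 3
      have "(\<lambda>x. x) \<in> left_hom R (P' i) (P i)"
        unfolding P'_def by (rule lh_sub_dom[OF lh_id Csub])
      moreover have "(\<lambda>x. \<zero>\<^sub>(P i)) \<in> left_hom R (P i) (P' i)"
        unfolding P'_def by (rule lh_into_sub[OF lh_zero[OF p(1)]]) (use 3 in \<open>auto simp: C_def\<close>)
      ultimately show ?thesis
        by (rule projective_retract[OF P(2) lP']) (use 3 in \<open>auto simp: P'_def C_def\<close>)
    qed
  qed
  moreover have "carrier (P' i) = {\<zero>\<^sub>(P' i)}" if "i > k" for i using that by (simp add: P'_def C_def)
  ultimately show "pd_le R X k" unfolding pd_le_def by blast
qed

text \<open>The dual of \<open>projective_comparison\<close>: maps are extended along differentials
  by \<open>baer_extend\<close>, which asks only that kernels be respected. Here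
  \<open>\<sigma>\<close> kills cycles, and differs from \<open>id - f \<circ> g\<close> by
  cycles.\<close>

lemma injective_comparison:
  fixes I :: "nat => ('r, 'u) module" and J :: "nat => ('r, 'v) module"
  assumes X: "left_module R X"
    and I: "right_resolution R X I d e" "\<And>i. baer R (I i)"
    and J: "right_resolution R X J d' e'" "\<And>i. baer R (J i)"
  shows "\<exists>f g \<sigma>. f \<in> left_hom R (J k) (I k) \<and> g \<in> left_hom R (I k) (J k) \<and> \<sigma> \<in> left_hom R (I k) (I k) \<and>
    (\<forall>x\<in>carrier (J k). d' k x = \<zero>\<^sub>(J (Suc k)) --> d k (f x) = \<zero>\<^sub>(I (Suc k))) \<and>
    (\<forall>x\<in>carrier (I k). d k x = \<zero>\<^sub>(I (Suc k)) --> d' k (g x) = \<zero>\<^sub>(J (Suc k))) \<and>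
    (\<forall>x\<in>carrier (I k). d k x = \<zero>\<^sub>(I (Suc k)) --> \<sigma> x = \<zero>\<^sub>(I k)) \<and>
    (\<forall>x\<in>carrier (I k). d k (\<sigma> x) = d k (x \<ominus>\<^sub>(I k) f (g x)))"
proof (induction k)
  note p = right_resolutionD[OF I(1)] and q = right_resolutionD[OF J(1)]
  case 0
  have e0: "x = \<zero>\<^sub>X" if "x \<in> carrier X" "e x = \<zero>\<^sub>(I 0)" for x
    using lh_inj_iff[OF X p(1) p(2)] p(4) that by (auto simp: a_kernel_eq)
  have e'0: "x = \<zero>\<^sub>X" if "x \<in> carrier X" "e' x = \<zero>\<^sub>(J 0)" for x
    using lh_inj_iff[OF X q(1) q(2)] q(4) that by (auto simp: a_kernel_eq)
  obtain f where f: "f \<in> left_hom R (J 0) (I 0)" "\<And>x. x \<in> carrier X ==> f (e' x) = e x"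
    using baer_extend[OF I(2) X q(1) q(2) p(2)] e'0 lh_zero_zero[OF p(2) X p(1)] by metis
  obtain g where g: "g \<in> left_hom R (I 0) (J 0)" "\<And>x. x \<in> carrier X ==> g (e x) = e' x"
    using baer_extend[OF J(2) X p(1) p(2) q(2)] e0 lh_zero_zero[OF q(2) X q(1)] by metis
  let ?\<sigma> = "\<lambda>x. x \<ominus>\<^sub>(I 0) f (g x)"
  have \<sigma>: "?\<sigma> \<in> left_hom R (I 0) (I 0)"
    by (rule lh_minus[OF lh_id lh_comp[OF g(1) f(1)] p(1)])
  have "d 0 (f x) = \<zero>\<^sub>(I (Suc 0))" if "x \<in> carrier (J 0)" "d' 0 x = \<zero>\<^sub>(J (Suc 0))" for x
    using q(5)[OF that(1)] that p(5)[OF lh_closed[OF f(1) that(1)]] f(2) by auto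
  moreover have "d' 0 (g x) = \<zero>\<^sub>(J (Suc 0))" if "x \<in> carrier (I 0)" "d 0 x = \<zero>\<^sub>(I (Suc 0))" for x
    using p(5)[OF that(1)] that q(5)[OF lh_closed[OF g(1) that(1)]] g(2) by auto
  moreover have "?\<sigma> x = \<zero>\<^sub>(I 0)" if "x \<in> carrier (I 0)" "d 0 x = \<zero>\<^sub>(I (Suc 0))" for x
    using p(5)[OF that(1)] that f(2) g(2) ag_diff_self[OF lm_ag[OF p(1)] that(1)] by auto
  ultimately show ?case using f(1) g(1) \<sigma> by blast
next
  note p = right_resolutionD[OF I(1)] and q = right_resolutionD[OF J(1)]
  case (Suc k)
  then obtain f g \<sigma> where f: "f \<in> left_hom R (J k) (I k)" and g: "g \<in> left_hom R (I k) (J k)"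
    and \<sigma>: "\<sigma> \<in> left_hom R (I k) (I k)"
    and fd: "\<And>x. x \<in> carrier (J k) ==> d' k x = \<zero>\<^sub>(J (Suc k)) ==> d k (f x) = \<zero>\<^sub>(I (Suc k))"
    and gd: "\<And>x. x \<in> carrier (I k) ==> d k x = \<zero>\<^sub>(I (Suc k)) ==> d' k (g x) = \<zero>\<^sub>(J (Suc k))"
    and \<sigma>d: "\<And>x. x \<in> carrier (I k) ==> d k x = \<zero>\<^sub>(I (Suc k)) ==> \<sigma> x = \<zero>\<^sub>(I k)"
    and \<sigma>eq: "\<And>x. x \<in> carrier (I k) ==> d k (\<sigma> x) = d k (x \<ominus>\<^sub>(I k) f (g x))" by blast
  obtain f' where f': "f' \<in> left_hom R (J (Suc k)) (I (Suc k))" "\<And>x. x \<in> carrier (J k) ==> f' (d' k x) = d k (f x)"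
    using baer_extend[OF I(2) q(1) q(1) q(3) lh_comp[OF f p(3)]] fd by blast
  obtain g' where g': "g' \<in> left_hom R (I (Suc k)) (J (Suc k))" "\<And>x. x \<in> carrier (I k) ==> g' (d k x) = d' k (g x)"
    using baer_extend[OF J(2) p(1) p(1) p(3) lh_comp[OF g q(3)]] gd by blast
  \<comment> \<open>\<open>\<sigma>\<close> vanishes on the kernel of \<open>d k\<close>, so it
    factors through \<open>d k\<close>; the factor is the homotopy.\<close>
  obtain h where h: "h \<in> left_hom R (I (Suc k)) (I k)" "\<And>x. x \<in> carrier (I k) ==> h (d k x) = \<sigma> x"
    using baer_extend[OF I(2) p(1) p(1) p(3) \<sigma>] \<sigma>d by blast
  let ?\<tau> = "\<lambda>x. x \<ominus>\<^sub>(I (Suc k)) f' (g' x)"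
  let ?\<sigma> = "\<lambda>x. ?\<tau> x \<ominus>\<^sub>(I (Suc k)) d k (h x)"
  have \<tau>: "?\<tau> \<in> left_hom R (I (Suc k)) (I (Suc k))"
    by (rule lh_minus[OF lh_id lh_comp[OF g'(1) f'(1)] p(1)])
  have \<sigma>': "?\<sigma> \<in> left_hom R (I (Suc k)) (I (Suc k))"
    by (rule lh_minus[OF \<tau> lh_comp[OF h(1) p(3)] p(1)])
  have dd: "d (Suc k) (d k x) = \<zero>\<^sub>(I (Suc (Suc k)))" if "x \<in> carrier (I k)" for x
    using p(6)[OF lh_closed[OF p(3) that]] that by simp
  have dd': "d' (Suc k) (d' k x) = \<zero>\<^sub>(J (Suc (Suc k)))" if "x \<in> carrier (J k)" for x
    using q(6)[OF lh_closed[OF q(3) that]] that by simp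
  have "d (Suc k) (f' x) = \<zero>\<^sub>(I (Suc (Suc k)))" if x: "x \<in> carrier (J (Suc k))" "d' (Suc k) x = \<zero>\<^sub>(J (Suc (Suc k)))" for x
  proof -
    obtain y where y: "y \<in> carrier (J k)" "x = d' k y" using q(6)[OF x(1)] x(2) by auto
    show ?thesis using f'(2)[OF y(1)] dd[OF lh_closed[OF f y(1)]] y(2) by simp
  qed
  moreover have "d' (Suc k) (g' x) = \<zero>\<^sub>(J (Suc (Suc k)))" if x: "x \<in> carrier (I (Suc k))" "d (Suc k) x = \<zero>\<^sub>(I (Suc (Suc k)))" for x
  proof -
    obtain y where y: "y \<in> carrier (I k)" "x = d k y" using p(6)[OF x(1)] x(2) by auto
    show ?thesis using g'(2)[OF y(1)] dd'[OF lh_closed[OF g y(1)]] y(2) by simp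
  qed
  moreover have "?\<sigma> x = \<zero>\<^sub>(I (Suc k))" if x: "x \<in> carrier (I (Suc k))" "d (Suc k) x = \<zero>\<^sub>(I (Suc (Suc k)))" for x
  proof -
    obtain y where y: "y \<in> carrier (I k)" "x = d k y" using p(6)[OF x(1)] x(2) by auto
    note gy = lh_closed[OF g y(1)]
    have "f' (g' x) = d k (f (g y))" using y g'(2)[OF y(1)] f'(2)[OF gy] by simp
    then have "?\<tau> x = d k (y \<ominus>\<^sub>(I k) f (g y))"
      using lh_diff[OF p(3) p(1) p(1) y(1) lh_closed[OF f gy]] y(2) by simp
    then have "?\<tau> x = d k (h x)" using \<sigma>eq[OF y(1)] h(2)[OF y(1)] y(2) by simp
    then show ?thesis
      using ag_diff_self[OF lm_ag[OF p(1)] lh_closed[OF p(3) lh_closed[OF h(1) that(1)]]] by simp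
  qed
  moreover have "d (Suc k) (?\<sigma> x) = d (Suc k) (?\<tau> x)" if x: "x \<in> carrier (I (Suc k))" for x
    using lh_diff[OF p(3) p(1) p(1) lh_closed[OF \<tau> x] lh_closed[OF p(3) lh_closed[OF h(1) x]]]
      dd[OF lh_closed[OF h(1) x]] ag_diff_zero[OF lm_ag[OF p(1)] lh_closed[OF p(3) lh_closed[OF \<tau> x]]]
    by simp
  ultimately show ?case using f'(1) g'(1) \<sigma>' by blast
qed

text \<open>As \<open>J (Suc k)\<close> is zero, \<open>d k\<close> kills \<open>f (g x)\<close>; so
  \<open>id - \<sigma>\<close> takes values in cycles and fixes them. The element types of
  \<open>I\<close> and \<open>J\<close> are free, which admits resolutions by character
  modules.\<close>

lemma finite_injective_isplit:
  fixes I :: "nat => ('r, 'u) module" and J :: "nat => ('r, 'v) module"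
  assumes X: "left_module R X"
    and I: "right_resolution R X I d e" "\<And>i. baer R (I i)"
    and J: "right_resolution R X J d' e'" "\<And>i. baer R (J i)"
    and fin: "carrier (J (Suc k)) = {\<zero>\<^sub>(J (Suc k))}"
  shows "isplit R I d k"
proof -
  note p = right_resolutionD[OF I(1)] and q = right_resolutionD[OF J(1)]
  from injective_comparison[OF X I J, of k]
  obtain f g \<sigma> where f: "f \<in> left_hom R (J k) (I k)" and g: "g \<in> left_hom R (I k) (J k)"
    and \<sigma>: "\<sigma> \<in> left_hom R (I k) (I k)"
    and fd: "\<And>x. x \<in> carrier (J k) ==> d' k x = \<zero>\<^sub>(J (Suc k)) ==> d k (f x) = \<zero>\<^sub>(I (Suc k))"
    and \<sigma>d: "\<And>x. x \<in> carrier (I k) ==> d k x = \<zero>\<^sub>(I (Suc k)) ==> \<sigma> x = \<zero>\<^sub>(I k)"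
    and \<sigma>eq: "\<And>x. x \<in> carrier (I k) ==> d k (\<sigma> x) = d k (x \<ominus>\<^sub>(I k) f (g x))" by blast
  have "d k (x \<ominus>\<^sub>(I k) \<sigma> x) = \<zero>\<^sub>(I (Suc k))" if x: "x \<in> carrier (I k)" for x
  proof -
    note gx = lh_closed[OF g x] and dx = lh_closed[OF p(3) x]
    have "d' k (g x) = \<zero>\<^sub>(J (Suc k))" using lh_closed[OF q(3) gx] fin by simp
    then have "d k (f (g x)) = \<zero>\<^sub>(I (Suc k))" using fd gx by blast
    then have "d k (\<sigma> x) = d k x"
      using \<sigma>eq[OF x] lh_diff[OF p(3) p(1) p(1) x lh_closed[OF f gx]] ag_diff_zero[OF lm_ag[OF p(1)] dx] by simp
    then show ?thesis
      using lh_diff[OF p(3) p(1) p(1) x lh_closed[OF \<sigma> x]] ag_diff_self[OF lm_ag[OF p(1)] dx] by simp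
  qed
  moreover have "x \<ominus>\<^sub>(I k) \<sigma> x = x" if "x \<in> carrier (I k)" "d k x = \<zero>\<^sub>(I (Suc k))" for x
    using \<sigma>d[OF that] ag_diff_zero[OF lm_ag[OF p(1)] that(1)] by simp
  ultimately have "(\<forall>x\<in>carrier (I k). d k (x \<ominus>\<^sub>(I k) \<sigma> x) = \<zero>\<^sub>(I (Suc k))) \<and>
      (\<forall>x\<in>carrier (I k). d k x = \<zero>\<^sub>(I (Suc k)) --> x \<ominus>\<^sub>(I k) \<sigma> x = x)" by blast
  then show ?thesis
    unfolding isplit_def by (rule bexI[OF _ lh_minus[OF lh_id \<sigma> p(1)]])
qed

section \<open>Injective dimension read off from one resolution\<close>

definition injd_le :: "('r, 'e) ring_scheme => ('r, 'x, 'f) module_scheme => nat => bool" where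
  "injd_le R X k \<longleftrightarrow> (\<exists>(I :: nat => ('r, ('r, 'x) univ) module) d e.
       right_resolution R X I d e \<and> (\<forall>i. injective_module R (I i)) \<and>
       (\<forall>i>k. carrier (I i) = {\<zero>\<^sub>(I i)}))"

lemma injd_eq: "injd R X = Inf {enat k | k. injd_le R X k}"
  by (simp add: injd_def injd_le_def)

text \<open>For the converse, the kernel of \<open>d k\<close> is a summand of \<open>I k\<close>,
  hence injective; putting it in the place of \<open>I k\<close> ends the resolution in degree
  \<open>k\<close>.\<close>

lemma injd_le_iff_isplit:
  fixes I :: "nat => ('r, ('r, 'x) univ) module" and X :: "('r, 'x, 'f) module_scheme"
  assumes X: "left_module R X" and I: "right_resolution R X I d e" "\<And>i. baer R (I i)"
  shows "injd_le R X k \<longleftrightarrow> isplit R I d k"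
proof
  assume "injd_le R X k"
  then show "isplit R I d k"
    unfolding injd_le_def injective_module_iff_baer using finite_injective_isplit[OF X I] by blast
next
  note p = right_resolutionD[OF I(1)]
  note agI = lm_ag[OF p(1)]
  assume "isplit R I d k"
  then obtain t where t: "t \<in> left_hom R (I k) (I k)"
    and td: "\<And>x. x \<in> carrier (I k) ==> d k (t x) = \<zero>\<^sub>(I (Suc k))"
    and tid: "\<And>x. x \<in> carrier (I k) ==> d k x = \<zero>\<^sub>(I (Suc k)) ==> t x = x" by (auto simp: isplit_def)
  define K where "K = (\<lambda>i. a_kernel (I i) (I (Suc i)) (d i))"
  define C where "C = (\<lambda>i. if i < k then carrier (I i) else if i = k then K k else {\<zero>\<^sub>(I i)})"
  define I' where "I' = (\<lambda>i. (I i)\<lparr>carrier := C i\<rparr>)"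
  have Csub: "C i \<subseteq> carrier (I i)" for i by (auto simp: C_def K_def a_kernel_eq ag_zero[OF agI])
  have sC: "submod R (I i) (C i)" for i
    using submod_carrier[OF p(1)] submod_kernel[OF p(1) p(1) p(3)] submod_zero_set[OF p(1)] by (simp add: C_def K_def)
  have lI': "left_module R (I' i)" for i
    unfolding I'_def by (rule lmod_sub[OF p(1) sC])
  have dK: "d i ` carrier (I i) = K (Suc i)" for i
    using p(6) lh_closed[OF p(3)[of i]] by (auto simp: K_def a_kernel_eq)
  \<comment> \<open>\<open>K (Suc i)\<close> is the old image, so this identity together with
    \<open>KC\<close> gives exactness of the shortened sequence in every positive degree.\<close>
  have imC: "d i ` C i = K (Suc i) \<inter> C (Suc i)" for i
  proof -
    consider "Suc i < k" | "Suc i = k" | "i = k" | "i > k" by linarith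
    then show ?thesis
    proof cases
      case 1
      then show ?thesis using dK[of i] by (auto simp: C_def K_def a_kernel_eq)
    next
      case 2
      then show ?thesis using dK[of i] by (auto simp: C_def)
    next
      case 3
      have "d k ` K k = {\<zero>\<^sub>(I (Suc k))}"
        using lh_zero_zero[OF p(3) p(1) p(1)] ag_zero[OF agI, of k] by (auto simp: K_def a_kernel_eq)
      moreover have "\<zero>\<^sub>(I (Suc k)) \<in> K (Suc k)"
        using submod_zero[OF submod_kernel[OF p(1) p(1) p(3)]] by (simp add: K_def)
      ultimately show ?thesis using 3 by (auto simp: C_def)
    next
      case 4
      have "\<zero>\<^sub>(I (Suc i)) \<in> K (Suc i)"
        using submod_zero[OF submod_kernel[OF p(1) p(1) p(3)]] by (simp add: K_def)
      then show ?thesis using 4 lh_zero_zero[OF p(3) p(1) p(1)] by (auto simp: C_def)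
    qed
  qed
  have KC: "a_kernel (I' i) (I' (Suc i)) (d i) = K i \<inter> C i" for i
    using Csub[of i] by (auto simp: I'_def K_def a_kernel_eq)
  have eK: "e ` carrier X = K 0" using p(5) lh_closed[OF p(2)] by (auto simp: K_def a_kernel_eq)
  have K0C: "K 0 \<subseteq> C 0" by (auto simp: C_def K_def a_kernel_eq)
  have "right_resolution R X I' d e"
    unfolding right_resolution_def
  proof (intro conjI allI)
    show "left_module R (I' i)" for i by (rule lI')
    show "e \<in> left_hom R X (I' 0)" unfolding I'_def
      by (rule lh_into_sub[OF p(2)]) (use eK K0C in blast)
    show "d i \<in> left_hom R (I' i) (I' (Suc i))" for i
      unfolding I'_def by (rule lh_into_sub[OF lh_sub_dom[OF p(3) Csub]]) (use imC[of i] in auto)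
    show "inj_on e (carrier X)" by (rule p(4))
    show "e ` carrier X = a_kernel (I' 0) (I' 1) (d 0)" using KC[of 0] eK K0C by auto
    show "d i ` carrier (I' i) = a_kernel (I' (Suc i)) (I' (Suc (Suc i))) (d (Suc i))" for i
      using KC[of "Suc i"] imC[of i] by (simp add: I'_def)
  qed
  moreover have "baer R (I' i)" for i
  proof -
    have incl: "(\<lambda>x. x) \<in> left_hom R (I' i) (I i)"
      unfolding I'_def by (rule lh_sub_dom[OF lh_id Csub])
    consider "i < k" | "i = k" | "i > k" by linarith
    then show ?thesis
    proof cases
      case 1
      then have "I' i = I i" by (simp add: I'_def C_def)
      then show ?thesis using I(2) by simp
    next
      case 2
      have "t \<in> left_hom R (I i) (I' i)"
        unfolding I'_def 2 by (rule lh_into_sub[OF t])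
          (use td lh_closed[OF t] in \<open>auto simp: C_def K_def a_kernel_eq\<close>)
      then show ?thesis
        by (rule baer_retract[OF I(2) lI' incl]) (use tid 2 in \<open>auto simp: I'_def C_def K_def a_kernel_eq\<close>)
    next
      case 3
      have "(\<lambda>x. \<zero>\<^sub>(I i)) \<in> left_hom R (I i) (I' i)"
        unfolding I'_def by (rule lh_into_sub[OF lh_zero[OF p(1)]]) (use 3 in \<open>auto simp: C_def\<close>)
      then show ?thesis
        by (rule baer_retract[OF I(2) lI' incl]) (use 3 in \<open>auto simp: I'_def C_def\<close>)
    qed
  qed
  moreover have "carrier (I' i) = {\<zero>\<^sub>(I' i)}" if "i > k" for i using that by (simp add: I'_def C_def)
  ultimately show "injd_le R X k" unfolding injd_le_def injective_module_iff_baer by blast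
qed

section \<open>Tensor products\<close>

definition balanced ::
    "('r, 'e) ring_scheme => ('s, 'r, 'n, 'f) bimodule_scheme => ('r, 'x, 'g) module_scheme
      => ('z, 'h) ring_scheme => ('n => 'x => 'z) => bool" where
  "balanced R N X G \<phi> \<longleftrightarrow>
     (\<forall>a\<in>carrier N. \<forall>x\<in>carrier X. \<phi> a x \<in> carrier G) \<and>
     (\<forall>a\<in>carrier N. \<forall>b\<in>carrier N. \<forall>x\<in>carrier X. \<phi> (a \<oplus>\<^sub>N b) x = \<phi> a x \<oplus>\<^sub>G \<phi> b x) \<and>
     (\<forall>a\<in>carrier N. \<forall>x\<in>carrier X. \<forall>y\<in>carrier X. \<phi> a (x \<oplus>\<^sub>X y) = \<phi> a x \<oplus>\<^sub>G \<phi> a y) \<and>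
     (\<forall>a\<in>carrier N. \<forall>r\<in>carrier R. \<forall>x\<in>carrier X. \<phi> (a \<odot>\<^sub>r\<^sub>N r) x = \<phi> a (r \<odot>\<^sub>X x))"

lemma balancedD:
  assumes "balanced R N X G \<phi>"
  shows "a \<in> carrier N ==> x \<in> carrier X ==> \<phi> a x \<in> carrier G"
    "a \<in> carrier N ==> b \<in> carrier N ==> x \<in> carrier X ==> \<phi> (a \<oplus>\<^sub>N b) x = \<phi> a x \<oplus>\<^sub>G \<phi> b x"
    "a \<in> carrier N ==> x \<in> carrier X ==> y \<in> carrier X ==> \<phi> a (x \<oplus>\<^sub>X y) = \<phi> a x \<oplus>\<^sub>G \<phi> a y"
    "a \<in> carrier N ==> r \<in> carrier R ==> x \<in> carrier X ==> \<phi> (a \<odot>\<^sub>r\<^sub>N r) x = \<phi> a (r \<odot>\<^sub>X x)"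
  using assms by (auto simp: balanced_def)

lemma balancedI:
  assumes "\<And>a x. a \<in> carrier N ==> x \<in> carrier X ==> \<phi> a x \<in> carrier G"
    "\<And>a b x. a \<in> carrier N ==> b \<in> carrier N ==> x \<in> carrier X ==> \<phi> (a \<oplus>\<^sub>N b) x = \<phi> a x \<oplus>\<^sub>G \<phi> b x"
    "\<And>a x y. a \<in> carrier N ==> x \<in> carrier X ==> y \<in> carrier X ==> \<phi> a (x \<oplus>\<^sub>X y) = \<phi> a x \<oplus>\<^sub>G \<phi> a y"
    "\<And>a r x. a \<in> carrier N ==> r \<in> carrier R ==> x \<in> carrier X ==> \<phi> (a \<odot>\<^sub>r\<^sub>N r) x = \<phi> a (r \<odot>\<^sub>X x)"
  shows "balanced R N X G \<phi>"
  using assms by (auto simp: balanced_def)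

lemma balanced_ahom_l: "balanced R N X G \<phi> ==> x \<in> carrier X ==> (\<lambda>a. \<phi> a x) \<in> ahom N G"
  by (auto intro: ahomI dest: balancedD)

lemma balanced_ahom_r: "balanced R N X G \<phi> ==> a \<in> carrier N ==> \<phi> a \<in> ahom X G"
  by (rule ahomI) (simp_all add: balancedD)

lemma balanced_comp:
  assumes "balanced R N X G \<phi>" "h \<in> ahom G H"
  shows "balanced R N X H (\<lambda>a x. h (\<phi> a x))"
  using assms by (intro balancedI) (simp_all add: ahom_closed balancedD ahom_add)

definition tensor_pure ::
    "('r, 'e) ring_scheme => ('s, 'r, 'n, 'f) bimodule_scheme => ('r, 'x, 'g) module_scheme
      => 'n => 'x => ('n \<times> 'x \<Rightarrow>\<^sub>0 int) set" where
  "tensor_pure R N X a x = tensor_class R N X (frag_of (a, x))"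

context
  fixes R :: "('r, 'e) ring_scheme" and N :: "('s, 'r, 'n, 'f) bimodule_scheme"
    and X :: "('r, 'x, 'g) module_scheme"
  assumes N: "right_module R N" and X: "left_module R X"
begin

definition tensor_gens :: "('n \<times> 'x \<Rightarrow>\<^sub>0 int) set" where
  "tensor_gens =
      {frag_of (a \<oplus>\<^sub>N b, x) - frag_of (a, x) - frag_of (b, x) | a b x.
         a \<in> carrier N \<and> b \<in> carrier N \<and> x \<in> carrier X} \<union>
      {frag_of (a, x \<oplus>\<^sub>X y) - frag_of (a, x) - frag_of (a, y) | a x y.
         a \<in> carrier N \<and> x \<in> carrier X \<and> y \<in> carrier X} \<union>
      {frag_of (a \<odot>\<^sub>r\<^sub>N r, x) - frag_of (a, r \<odot>\<^sub>X x) | a r x.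
         a \<in> carrier N \<and> r \<in> carrier R \<and> x \<in> carrier X}"

lemma tensor_rel_gens: "tensor_rel R N X = generate (free_Abelian_group (carrier N \<times> carrier X)) tensor_gens"
  by (simp add: tensor_rel_def tensor_gens_def)

lemma tensor_gens_cases:
  assumes "g \<in> tensor_gens"
  obtains a b x where "g = frag_of (a \<oplus>\<^sub>N b, x) - frag_of (a, x) - frag_of (b, x)" "a \<in> carrier N" "b \<in> carrier N" "x \<in> carrier X"
    | a x y where "g = frag_of (a, x \<oplus>\<^sub>X y) - frag_of (a, x) - frag_of (a, y)" "a \<in> carrier N" "x \<in> carrier X" "y \<in> carrier X"
    | a r x where "g = frag_of (a \<odot>\<^sub>r\<^sub>N r, x) - frag_of (a, r \<odot>\<^sub>X x)" "a \<in> carrier N" "r \<in> carrier R" "x \<in> carrier X"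
  using assms unfolding tensor_gens_def by blast

lemma keys_diff_sub:
  "Poly_Mapping.keys (a :: 'k \<Rightarrow>\<^sub>0 int) \<subseteq> S ==> Poly_Mapping.keys b \<subseteq> S ==> Poly_Mapping.keys (a - b) \<subseteq> S"
  using keys_diff[of a b] by blast

lemma keys_add_sub:
  "Poly_Mapping.keys (a :: 'k \<Rightarrow>\<^sub>0 int) \<subseteq> S ==> Poly_Mapping.keys b \<subseteq> S ==> Poly_Mapping.keys (a + b) \<subseteq> S"
  using Poly_Mapping.keys_add[of a b] by blast

lemma tensor_gens_sub: "tensor_gens \<subseteq> carrier (free_Abelian_group (carrier N \<times> carrier X))"
proof -
  have "Poly_Mapping.keys g \<subseteq> carrier N \<times> carrier X" if g: "g \<in> tensor_gens" for g
    using g by (cases rule: tensor_gens_cases)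
      (simp_all add: keys_diff_sub rm_closed[OF N] lm_closed[OF X] ag_closed[OF rm_ag[OF N]] ag_closed[OF lm_ag[OF X]])
  then show ?thesis by auto
qed

lemma tensor_rel_closed:
  shows "0 \<in> tensor_rel R N X"
    and "u \<in> tensor_rel R N X ==> v \<in> tensor_rel R N X ==> u + v \<in> tensor_rel R N X"
    and "u \<in> tensor_rel R N X ==> - u \<in> tensor_rel R N X"
    and "u \<in> tensor_rel R N X ==> Poly_Mapping.keys u \<subseteq> carrier N \<times> carrier X"
    and "u \<in> tensor_gens ==> u \<in> tensor_rel R N X"
proof -
  let ?F = "free_Abelian_group (carrier N \<times> carrier X)"
  show "0 \<in> tensor_rel R N X"
    using generate.one[of ?F tensor_gens] by (simp add: tensor_rel_gens)
  show "u + v \<in> tensor_rel R N X" if "u \<in> tensor_rel R N X" "v \<in> tensor_rel R N X"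
    using generate.eng[of u ?F tensor_gens v] that by (simp add: tensor_rel_gens)
  show k: "Poly_Mapping.keys u \<subseteq> carrier N \<times> carrier X" if "u \<in> tensor_rel R N X" for u
  proof -
    have "u \<in> carrier ?F"
      using subsetD[OF group.generate_incl[OF group_free_Abelian_group tensor_gens_sub]] that by (simp only: tensor_rel_gens)
    then show ?thesis by simp
  qed
  show "- u \<in> tensor_rel R N X" if "u \<in> tensor_rel R N X"
    using group.generate_m_inv_closed[OF group_free_Abelian_group tensor_gens_sub, of u] that k[OF that]
    by (simp add: tensor_rel_gens)
  show "u \<in> tensor_gens ==> u \<in> tensor_rel R N X"
    using generate.incl[of u tensor_gens ?F] by (simp add: tensor_rel_gens)
qed

lemma tensor_class_def': "tensor_class R N X u = {r + u | r. r \<in> tensor_rel R N X}"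
  by (auto simp: tensor_class_def r_coset_def)

lemma tensor_class_eq_iff: "tensor_class R N X u = tensor_class R N X v \<longleftrightarrow> u - v \<in> tensor_rel R N X"
proof
  assume "tensor_class R N X u = tensor_class R N X v"
  moreover have "u \<in> tensor_class R N X u" using tensor_rel_closed(1) by (force simp: tensor_class_def')
  ultimately obtain r where "u = r + v" "r \<in> tensor_rel R N X" by (auto simp: tensor_class_def')
  then show "u - v \<in> tensor_rel R N X" by simp
next
  assume *: "u - v \<in> tensor_rel R N X"
  have sub: "tensor_class R N X u \<subseteq> tensor_class R N X v" if "u - v \<in> tensor_rel R N X" for u v
  proof
    fix w assume "w \<in> tensor_class R N X u"
    then obtain r where r: "w = r + u" "r \<in> tensor_rel R N X" by (auto simp: tensor_class_def')
    have "r + (u - v) \<in> tensor_rel R N X" using r that tensor_rel_closed(2) by blast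
    moreover have "w = (r + (u - v)) + v" using r by simp
    ultimately show "w \<in> tensor_class R N X v" unfolding tensor_class_def' by blast
  qed
  have "v - u \<in> tensor_rel R N X" using tensor_rel_closed(3)[OF *] by simp
  then show "tensor_class R N X u = tensor_class R N X v" using sub[OF *] sub by blast
qed

lemma tensor_module_carrier:
  "carrier (tensor_module R N X) = tensor_class R N X ` {u. Poly_Mapping.keys u \<subseteq> carrier N \<times> carrier X}"
  by (auto simp: tensor_module_def Let_def FactGroup_def RCOSETS_def tensor_class_def)

lemma tensor_module_zero: "\<zero>\<^sub>(tensor_module R N X) = tensor_class R N X 0"
  using tensor_rel_closed(1) by (auto simp: tensor_module_def Let_def FactGroup_def tensor_class_def')

lemma tensor_module_add:
  "tensor_class R N X u \<oplus>\<^sub>(tensor_module R N X) tensor_class R N X v = tensor_class R N X (u + v)"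
proof -
  have "tensor_class R N X u \<oplus>\<^sub>(tensor_module R N X) tensor_class R N X v =
      {a + b | a b. a \<in> tensor_class R N X u \<and> b \<in> tensor_class R N X v}"
    by (auto simp: tensor_module_def Let_def FactGroup_def set_mult_def)
  also have "\<dots> = tensor_class R N X (u + v)"
  proof (intro equalityI subsetI)
    fix w assume "w \<in> {a + b | a b. a \<in> tensor_class R N X u \<and> b \<in> tensor_class R N X v}"
    then obtain r s where "w = (r + u) + (s + v)" "r \<in> tensor_rel R N X" "s \<in> tensor_rel R N X"
      by (auto simp: tensor_class_def')
    then have "w = (r + s) + (u + v)" "r + s \<in> tensor_rel R N X" using tensor_rel_closed(2) by auto
    then show "w \<in> tensor_class R N X (u + v)" unfolding tensor_class_def' by blast
  next
    fix w assume "w \<in> tensor_class R N X (u + v)"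
    then obtain r where r: "w = r + (u + v)" "r \<in> tensor_rel R N X" by (auto simp: tensor_class_def')
    then have "w = (r + u) + (0 + v)" by simp
    then show "w \<in> {a + b | a b. a \<in> tensor_class R N X u \<and> b \<in> tensor_class R N X v}"
      using r tensor_rel_closed(1) unfolding tensor_class_def' by blast
  qed
  finally show ?thesis .
qed

lemma agrp_tensor: "abelian_group (tensor_module R N X)"
proof (rule abelian_groupI')
  fix c assume "c \<in> carrier (tensor_module R N X)"
  then obtain u where u: "Poly_Mapping.keys u \<subseteq> carrier N \<times> carrier X" "c = tensor_class R N X u"
    by (auto simp: tensor_module_carrier)
  then show "\<exists>b\<in>carrier (tensor_module R N X). b \<oplus>\<^sub>(tensor_module R N X) c = \<zero>\<^sub>(tensor_module R N X)"
    by (intro bexI[of _ "tensor_class R N X (- u)"]) (auto simp: tensor_module_carrier tensor_module_add tensor_module_zero)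
qed (auto simp: tensor_module_carrier tensor_module_add tensor_module_zero algebra_simps keys_add_sub)

lemma tensor_module_neg:
  assumes "Poly_Mapping.keys u \<subseteq> carrier N \<times> carrier X"
  shows "\<ominus>\<^sub>(tensor_module R N X) tensor_class R N X u = tensor_class R N X (- u)"
  by (rule ag_eq_neg[OF agrp_tensor, symmetric])
    (use assms in \<open>auto simp: tensor_module_carrier tensor_module_add tensor_module_zero\<close>)

lemma tensor_module_diff:
  assumes "Poly_Mapping.keys u \<subseteq> carrier N \<times> carrier X" "Poly_Mapping.keys v \<subseteq> carrier N \<times> carrier X"
  shows "tensor_class R N X u \<ominus>\<^sub>(tensor_module R N X) tensor_class R N X v = tensor_class R N X (u - v)"
  using tensor_module_neg[OF assms(2)] by (simp add: a_minus_def tensor_module_add)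

lemma tensor_pure_balanced: "balanced R N X (tensor_module R N X) (tensor_pure R N X)"
proof (rule balancedI)
  fix a x assume "a \<in> carrier N" "x \<in> carrier X"
  then show "tensor_pure R N X a x \<in> carrier (tensor_module R N X)"
    by (auto simp: tensor_module_carrier tensor_pure_def)
next
  fix a b x assume *: "a \<in> carrier N" "b \<in> carrier N" "x \<in> carrier X"
  have "frag_of (a \<oplus>\<^sub>N b, x) - frag_of (a, x) - frag_of (b, x) \<in> tensor_rel R N X"
    by (rule tensor_rel_closed(5)) (use * in \<open>auto simp: tensor_gens_def\<close>)
  then show "tensor_pure R N X (a \<oplus>\<^sub>N b) x = tensor_pure R N X a x \<oplus>\<^sub>(tensor_module R N X) tensor_pure R N X b x"
    by (simp add: tensor_pure_def tensor_module_add tensor_class_eq_iff diff_diff_eq)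
next
  fix a x y assume *: "a \<in> carrier N" "x \<in> carrier X" "y \<in> carrier X"
  have "frag_of (a, x \<oplus>\<^sub>X y) - frag_of (a, x) - frag_of (a, y) \<in> tensor_rel R N X"
    by (rule tensor_rel_closed(5)) (use * in \<open>auto simp: tensor_gens_def\<close>)
  then show "tensor_pure R N X a (x \<oplus>\<^sub>X y) = tensor_pure R N X a x \<oplus>\<^sub>(tensor_module R N X) tensor_pure R N X a y"
    by (simp add: tensor_pure_def tensor_module_add tensor_class_eq_iff diff_diff_eq)
next
  fix a r x assume *: "a \<in> carrier N" "r \<in> carrier R" "x \<in> carrier X"
  have "frag_of (a \<odot>\<^sub>r\<^sub>N r, x) - frag_of (a, r \<odot>\<^sub>X x) \<in> tensor_rel R N X"
    by (rule tensor_rel_closed(5)) (use * in \<open>auto simp: tensor_gens_def\<close>)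
  then show "tensor_pure R N X (a \<odot>\<^sub>r\<^sub>N r) x = tensor_pure R N X a (r \<odot>\<^sub>X x)"
    by (simp add: tensor_pure_def tensor_class_eq_iff)
qed

text \<open>\<open>frag_induction\<close> builds elements of the free abelian group by differences,
  so closure under differences is what is asked; zero arises as the difference of a pure tensor with
  itself.\<close>

lemma tensor_generated:
  assumes pure: "\<And>a x. a \<in> carrier N ==> x \<in> carrier X ==> tensor_pure R N X a x \<in> A"
    and diff: "\<And>u v. u \<in> A ==> v \<in> A ==> u \<in> carrier (tensor_module R N X) ==> v \<in> carrier (tensor_module R N X) ==>
      u \<ominus>\<^sub>(tensor_module R N X) v \<in> A"
  shows "carrier (tensor_module R N X) \<subseteq> A"
proof -
  have n: "\<zero>\<^sub>N \<in> carrier N" "\<zero>\<^sub>X \<in> carrier X" using rm_ag[OF N] lm_ag[OF X] by (auto intro: ag_zero)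
  have "tensor_class R N X u \<in> A \<and> Poly_Mapping.keys u \<subseteq> carrier N \<times> carrier X"
    if "Poly_Mapping.keys u \<subseteq> carrier N \<times> carrier X" for u
    using that
  proof (induction u rule: frag_induction)
    case zero
    let ?p = "tensor_pure R N X \<zero>\<^sub>N \<zero>\<^sub>X"
    have "?p \<in> carrier (tensor_module R N X)" using balancedD(1)[OF tensor_pure_balanced n] .
    then have "?p \<ominus>\<^sub>(tensor_module R N X) ?p \<in> A" using diff pure[OF n] by blast
    then show ?case
      using ag_diff_self[OF agrp_tensor] balancedD(1)[OF tensor_pure_balanced n] by (simp add: tensor_module_zero)
  next
    case (one p) then show ?case using pure by (cases p) (auto simp: tensor_pure_def)
  next
    case (diff a b)
    then have "tensor_class R N X a \<ominus>\<^sub>(tensor_module R N X) tensor_class R N X b \<in> A"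
      by (intro assms(2)) (auto simp: tensor_module_carrier)
    then show ?case using diff keys_diff_sub[of a "carrier N \<times> carrier X" b] by (simp add: tensor_module_diff)
  qed
  then show ?thesis by (auto simp: tensor_module_carrier)
qed

text \<open>Extend \<open>\<phi>\<close> to the free abelian group, check that the three kinds of
  relations are killed, and evaluate at any representative of a coset.\<close>

lemma tensor_universal:
  assumes G: "abelian_group G" and \<phi>: "balanced R N X G \<phi>"
  obtains h where "h \<in> ahom (tensor_module R N X) G"
    "\<And>a x. a \<in> carrier N ==> x \<in> carrier X ==> h (tensor_pure R N X a x) = \<phi> a x"
proof -
  interpret G: abelian_group G by fact
  let ?F = "free_Abelian_group (carrier N \<times> carrier X)"
  have "(\<lambda>(a, x). \<phi> a x) ` (carrier N \<times> carrier X) \<subseteq> carrier (add_monoid G)"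
    using balancedD(1)[OF \<phi>] by auto
  from comm_group.free_Abelian_group_universal[OF G.a_comm_group this]
  obtain h where h: "h \<in> hom ?F (add_monoid G)"
    and hf': "\<And>p. p \<in> carrier N \<times> carrier X ==> h (frag_of p) = (\<lambda>(a, x). \<phi> a x) p" by blast
  have hf: "h (frag_of (a, x)) = \<phi> a x" if "a \<in> carrier N" "x \<in> carrier X" for a x
    using hf'[of "(a, x)"] that by simp
  have h_add: "h (u + v) = h u \<oplus>\<^sub>G h v"
    if "Poly_Mapping.keys u \<subseteq> carrier N \<times> carrier X" "Poly_Mapping.keys v \<subseteq> carrier N \<times> carrier X" for u v
    using hom_mult[OF h, of u v] that by simp
  have h_closed: "h u \<in> carrier G" if "Poly_Mapping.keys u \<subseteq> carrier N \<times> carrier X" for u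
    using h that by (auto simp: hom_def)
  have h_zero: "h 0 = \<zero>\<^sub>G" using h_add[of 0 0] h_closed[of 0] by simp
  have h_neg: "h (- u) = \<ominus>\<^sub>G h u" if "Poly_Mapping.keys u \<subseteq> carrier N \<times> carrier X" for u
    using h_add[of u "- u"] that h_closed[of u] h_closed[of "- u"] h_zero by (simp add: ag_eq_neg[OF G])
  have h_diff: "h (u - v) = h u \<ominus>\<^sub>G h v"
    if "Poly_Mapping.keys u \<subseteq> carrier N \<times> carrier X" "Poly_Mapping.keys v \<subseteq> carrier N \<times> carrier X" for u v
    using h_add[of u "- v"] h_neg[OF that(2)] that by (simp add: a_minus_def)
  note cl = rm_closed[OF N] lm_closed[OF X] ag_closed[OF rm_ag[OF N]] ag_closed[OF lm_ag[OF X]]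
  have gens: "h g = \<zero>\<^sub>G" if g: "g \<in> tensor_gens" for g
  proof -
    from g show ?thesis
    proof (cases rule: tensor_gens_cases)
      case 1
      then show ?thesis
        by (simp add: h_diff keys_diff_sub cl hf balancedD[OF \<phi>] ag_diff_self[OF G] G.minus_eq G.a_assoc G.r_neg1 G.r_neg G.minus_add G.a_comm,
          (simp add: balancedD[OF \<phi>] G.a_ac G.r_neg1 G.r_neg2 G.r_neg G.l_neg)?)
    next
      case 2
      then show ?thesis
        by (simp add: h_diff keys_diff_sub cl hf balancedD[OF \<phi>] ag_diff_self[OF G] G.minus_eq G.a_assoc G.r_neg1 G.r_neg G.minus_add G.a_comm,
          (simp add: balancedD[OF \<phi>] G.a_ac G.r_neg1 G.r_neg2 G.r_neg G.l_neg)?)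
    next
      case 3
      then show ?thesis
        by (simp add: h_diff cl hf balancedD(4)[OF \<phi>] balancedD(1)[OF \<phi>] ag_diff_self[OF G])
    qed
  qed
  have rel: "h u = \<zero>\<^sub>G" if "u \<in> tensor_rel R N X" for u
  proof -
    have "u \<in> generate ?F tensor_gens" using that by (simp add: tensor_rel_gens)
    then show ?thesis
    proof induction
      case one then show ?case by (simp add: h_zero)
    next
      case (incl g) then show ?case by (rule gens)
    next
      case (inv g)
      then have "Poly_Mapping.keys g \<subseteq> carrier N \<times> carrier X" using subsetD[OF tensor_gens_sub inv] by simp
      then show ?case using gens[OF inv] by (simp add: h_neg)
    next
      case (eng u v)
      then have "Poly_Mapping.keys u \<subseteq> carrier N \<times> carrier X" "Poly_Mapping.keys v \<subseteq> carrier N \<times> carrier X"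
        using tensor_rel_closed(4) by (auto simp: tensor_rel_gens)
      then show ?case using eng by (simp add: h_add)
    qed
  qed
  define k where "k = (\<lambda>c. h (SOME u. Poly_Mapping.keys u \<subseteq> carrier N \<times> carrier X \<and> tensor_class R N X u = c))"
  have k: "k (tensor_class R N X u) = h u" if u: "Poly_Mapping.keys u \<subseteq> carrier N \<times> carrier X" for u
  proof -
    let ?v = "SOME v. Poly_Mapping.keys v \<subseteq> carrier N \<times> carrier X \<and> tensor_class R N X v = tensor_class R N X u"
    have v: "Poly_Mapping.keys ?v \<subseteq> carrier N \<times> carrier X \<and> tensor_class R N X ?v = tensor_class R N X u"
      by (rule someI[of _ u]) (use u in simp)
    then have "h (?v - u) = \<zero>\<^sub>G" by (intro rel) (simp add: tensor_class_eq_iff)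
    then show ?thesis using h_diff[OF v[THEN conjunct1] u] v u h_closed by (simp add: k_def ag_diff_eq_zero[OF G])
  qed
  have "k \<in> ahom (tensor_module R N X) G"
    by (rule ahomI) (auto simp: tensor_module_carrier tensor_module_add k keys_add_sub h_closed h_add)
  moreover have "k (tensor_pure R N X a x) = \<phi> a x" if "a \<in> carrier N" "x \<in> carrier X" for a x
    using that by (simp add: tensor_pure_def k hf)
  ultimately show ?thesis using that by blast
qed

end

text \<open>A tensor product up to isomorphism: \<^term>\<open>\<tau> a x\<close> plays the role of \<open>a \<otimes> x\<close>.\<close>

definition is_tensor ::
    "('r, 'e) ring_scheme => ('s, 'r, 'n, 'f) bimodule_scheme => ('r, 'x, 'g) module_scheme
      => ('z, 'h) ring_scheme => ('n => 'x => 'z) => bool" where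
  "is_tensor R N X Z \<tau> \<longleftrightarrow> right_module R N \<and> left_module R X \<and> abelian_group Z \<and> balanced R N X Z \<tau> \<and>
     (\<forall>A. (\<forall>a\<in>carrier N. \<forall>x\<in>carrier X. \<tau> a x \<in> A) -->
       (\<forall>u\<in>A \<inter> carrier Z. \<forall>v\<in>A \<inter> carrier Z. u \<ominus>\<^sub>Z v \<in> A) --> carrier Z \<subseteq> A) \<and>
     (\<exists>\<kappa>. \<kappa> \<in> ahom Z (tensor_module R N X :: ('s, _) module) \<and> (\<forall>a\<in>carrier N. \<forall>x\<in>carrier X. \<kappa> (\<tau> a x) = tensor_pure R N X a x))"

lemma is_tensorD:
  assumes "is_tensor R N X Z \<tau>"
  shows "right_module R N" "left_module R X" "abelian_group Z" "balanced R N X Z \<tau>"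
  using assms by (auto simp: is_tensor_def)

lemma is_tensor_hom:
  fixes N :: "('s, 'r, 'n, 'f) bimodule_scheme"
  assumes "is_tensor R N X Z \<tau>"
  obtains \<kappa> where "\<kappa> \<in> ahom Z (tensor_module R N X :: ('s, _) module)"
    "\<And>a x. a \<in> carrier N ==> x \<in> carrier X ==> \<kappa> (\<tau> a x) = tensor_pure R N X a x"
  using assms unfolding is_tensor_def by (elim conjE exE) auto

lemma is_tensor_generated:
  assumes "is_tensor R N X Z \<tau>" "\<And>a x. a \<in> carrier N ==> x \<in> carrier X ==> \<tau> a x \<in> A"
    "\<And>u v. u \<in> A ==> v \<in> A ==> u \<in> carrier Z ==> v \<in> carrier Z ==> u \<ominus>\<^sub>Z v \<in> A"
  shows "carrier Z \<subseteq> A"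
proof -
  have "(\<forall>a\<in>carrier N. \<forall>x\<in>carrier X. \<tau> a x \<in> A) -->
       (\<forall>u\<in>A \<inter> carrier Z. \<forall>v\<in>A \<inter> carrier Z. u \<ominus>\<^sub>Z v \<in> A) --> carrier Z \<subseteq> A"
    using assms(1) unfolding is_tensor_def by blast
  then show ?thesis using assms(2,3) by blast
qed

lemma is_tensor_tensor_module:
  fixes N :: "('s, 'r, 'n, 'f) bimodule_scheme"
  assumes "right_module R N" "left_module R X"
  shows "is_tensor R N X (tensor_module R N X) (tensor_pure R N X)"
proof -
  have "(\<lambda>x. x) \<in> ahom (tensor_module R N X) (tensor_module R N X :: ('s, _) module)"
    by (rule ahomI) (auto simp: tensor_module_def Let_def)
  then show ?thesis
    unfolding is_tensor_def
    using assms agrp_tensor[OF assms] tensor_pure_balanced[OF assms]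
    by (intro conjI allI impI tensor_generated[OF assms] exI[of _ "\<lambda>x. x"]) auto
qed

text \<open>The comparison map to the concrete tensor product brings the universal property
  over.\<close>

lemma is_tensor_universal:
  fixes N :: "('s, 'r, 'n, 'f) bimodule_scheme"
  assumes Z: "is_tensor R N X Z \<tau>" and G: "abelian_group G" and \<phi>: "balanced R N X G \<phi>"
  obtains h where "h \<in> ahom Z G" "\<And>a x. a \<in> carrier N ==> x \<in> carrier X ==> h (\<tau> a x) = \<phi> a x"
proof -
  note z = is_tensorD[OF Z]
  obtain \<kappa> where \<kappa>: "\<kappa> \<in> ahom Z (tensor_module R N X :: ('s, _) module)"
    "\<And>a x. a \<in> carrier N ==> x \<in> carrier X ==> \<kappa> (\<tau> a x) = tensor_pure R N X a x"
    using is_tensor_hom[OF Z] by metis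
  obtain h where h: "h \<in> ahom (tensor_module R N X :: ('s, _) module) G"
    "\<And>a x. a \<in> carrier N ==> x \<in> carrier X ==> h (tensor_pure R N X a x) = \<phi> a x"
    by (rule tensor_universal[OF z(1,2) G \<phi>]) (rule that, assumption, simp)
  have "(\<lambda>z. h (\<kappa> z)) \<in> ahom Z G" by (rule ahom_comp[OF \<kappa>(1)]) (use h in \<open>auto simp: ahom_def tensor_module_def Let_def\<close>)
  then show ?thesis using that[of "\<lambda>z. h (\<kappa> z)"] h(2) \<kappa>(2) by simp
qed

text \<open>The equalizer of two additive maps is closed under differences and contains the pure
  tensors, hence is everything. Identities on tensor products below are checked on pure tensors in
  this way.\<close>

lemma is_tensor_eq:
  assumes Z: "is_tensor R N X Z \<tau>" and G: "abelian_group G" and h: "h \<in> ahom Z G" and h': "h' \<in> ahom Z G"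
    and eq: "\<And>a x. a \<in> carrier N ==> x \<in> carrier X ==> h (\<tau> a x) = h' (\<tau> a x)" and z: "z \<in> carrier Z"
  shows "h z = h' z"
proof -
  have "carrier Z \<subseteq> {z. h z = h' z}"
    by (rule is_tensor_generated[OF Z]) (use eq in \<open>auto simp: ahom_diff[OF h is_tensorD(3)[OF Z] G] ahom_diff[OF h' is_tensorD(3)[OF Z] G]\<close>)
  then show ?thesis using z by blast
qed

lemma is_tensor_iso:
  fixes N :: "('s, 'r, 'n, 'f) bimodule_scheme"
  assumes Z: "is_tensor R N X Z \<tau>" and W: "abelian_group W" and f: "f \<in> ahom Z W" and g: "g \<in> ahom W Z"
    and fg: "\<And>w. w \<in> carrier W ==> f (g w) = w" and gf: "\<And>z. z \<in> carrier Z ==> g (f z) = z"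
  shows "is_tensor R N X W (\<lambda>a x. f (\<tau> a x))"
proof -
  note z = is_tensorD[OF Z]
  obtain \<kappa> where \<kappa>: "\<kappa> \<in> ahom Z (tensor_module R N X :: ('s, _) module)"
    "\<And>a x. a \<in> carrier N ==> x \<in> carrier X ==> \<kappa> (\<tau> a x) = tensor_pure R N X a x"
    using is_tensor_hom[OF Z] by metis
  show ?thesis
    unfolding is_tensor_def
  proof (intro conjI allI impI z W balanced_comp[OF z(4) f])
    fix A assume *: "\<forall>a\<in>carrier N. \<forall>x\<in>carrier X. f (\<tau> a x) \<in> A" "\<forall>u\<in>A \<inter> carrier W. \<forall>v\<in>A \<inter> carrier W. u \<ominus>\<^sub>W v \<in> A"
    have "carrier Z \<subseteq> {z. f z \<in> A}"
      by (rule is_tensor_generated[OF Z]) (use * ahom_closed[OF f] in \<open>auto simp: ahom_diff[OF f z(3) W]\<close>)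
    then show "carrier W \<subseteq> A" using fg ahom_closed[OF g] by (metis mem_Collect_eq subset_iff)
  next
    show "\<exists>\<kappa>. \<kappa> \<in> ahom W (tensor_module R N X) \<and> (\<forall>a\<in>carrier N. \<forall>x\<in>carrier X. \<kappa> (f (\<tau> a x)) = tensor_pure R N X a x)"
      using ahom_comp[OF g \<kappa>(1)] \<kappa>(2) gf balancedD(1)[OF z(4)] by (intro exI[of _ "\<lambda>w. \<kappa> (g w)"]) auto
  qed
qed

lemma is_tensor_bilinear_eq_zero:
  assumes Z: "is_tensor R N X Z \<tau>"
  shows "x \<in> carrier X ==> \<tau> \<zero>\<^sub>N x = \<zero>\<^sub>Z" "a \<in> carrier N ==> \<tau> a \<zero>\<^sub>X = \<zero>\<^sub>Z"
proof -
  note z = is_tensorD[OF Z]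
  show "\<tau> \<zero>\<^sub>N x = \<zero>\<^sub>Z" if "x \<in> carrier X"
    by (rule ahom_zero[OF balanced_ahom_l[OF z(4) that] rm_ag[OF z(1)] z(3)])
  show "\<tau> a \<zero>\<^sub>X = \<zero>\<^sub>Z" if "a \<in> carrier N"
    by (rule ahom_zero[OF balanced_ahom_r[OF z(4) that] lm_ag[OF z(2)] z(3)])
qed

section \<open>Functoriality of the tensor product\<close>

lemma balanced_map:
  assumes f: "f \<in> ahom N' N" "\<And>a r. a \<in> carrier N' ==> r \<in> carrier R ==> f (a \<odot>\<^sub>r\<^sub>N' r) = f a \<odot>\<^sub>r\<^sub>N r"
    and g: "g \<in> left_hom R X' X" and \<tau>: "balanced R N X Z \<tau>"
  shows "balanced R N' X' Z (\<lambda>a x. \<tau> (f a) (g x))"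
  using assms by (intro balancedI) (simp_all add: ahom_closed ahom_add lh_closed lh_add lh_smult balancedD)

text \<open>\<open>tensor_map\<close> takes \<open>the_elem\<close> of the images of all members of
  a coset, so these have to coincide. The map \<open>h\<close> from the universal property agrees
  with \<open>frag_extend\<close> on every representative, which leaves a single value.\<close>

lemma tensor_map_props:
  assumes N': "right_module R N'" and X': "left_module R X'" and N: "right_module R N" and X: "left_module R X"
    and f: "f \<in> ahom N' N" "\<And>a r. a \<in> carrier N' ==> r \<in> carrier R ==> f (a \<odot>\<^sub>r\<^sub>N' r) = f a \<odot>\<^sub>r\<^sub>N r"
    and g: "g \<in> left_hom R X' X"
  shows "tensor_map R N X f g \<in> ahom (tensor_module R N' X') (tensor_module R N X)" (is ?A)
    and "a \<in> carrier N' ==> x \<in> carrier X' ==>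
      tensor_map R N X f g (tensor_pure R N' X' a x) = tensor_pure R N X (f a) (g x)"
proof -
  let ?T = "tensor_module R N X" and ?T' = "tensor_module R N' X'"
  note ag = agrp_tensor[OF N X] and ag' = agrp_tensor[OF N' X']
  have "balanced R N' X' ?T (\<lambda>a x. tensor_pure R N X (f a) (g x))"
    by (rule balanced_map[OF f g tensor_pure_balanced[OF N X]])
  then obtain h where h: "h \<in> ahom ?T' ?T"
    "\<And>a x. a \<in> carrier N' ==> x \<in> carrier X' ==> h (tensor_pure R N' X' a x) = tensor_pure R N X (f a) (g x)"
    by (rule tensor_universal[OF N' X' ag]) (rule that, assumption, simp)
  let ?F = "frag_extend (\<lambda>(a, x). frag_of (f a, g x))"
  \<comment> \<open>The bounds on keys are carried along because differences of classes can be
    formed only within the free group, in the source as well as in the target.\<close>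
  have hu: "h (tensor_class R N' X' u) = tensor_class R N X (?F u) \<and> Poly_Mapping.keys u \<subseteq> carrier N' \<times> carrier X' \<and>
      Poly_Mapping.keys (?F u) \<subseteq> carrier N \<times> carrier X"
    if "Poly_Mapping.keys u \<subseteq> carrier N' \<times> carrier X'" for u
    using that
  proof (induction u rule: frag_induction)
    case zero
    then show ?case using ahom_zero[OF h(1) ag' ag] by (simp add: tensor_module_zero[OF N X] tensor_module_zero[OF N' X'])
  next
    case (one p)
    then obtain a x where "p = (a, x)" "a \<in> carrier N'" "x \<in> carrier X'" by auto
    then show ?case using h(2)[of a x] ahom_closed[OF f(1)] lh_closed[OF g] by (simp add: tensor_pure_def)
  next
    case (diff u v)
    have c: "tensor_class R N' X' u \<in> carrier ?T'" "tensor_class R N' X' v \<in> carrier ?T'"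
      using diff by (auto simp: tensor_module_carrier[OF N' X'])
    have "h (tensor_class R N' X' (u - v)) = h (tensor_class R N' X' u \<ominus>\<^sub>?T' tensor_class R N' X' v)"
      using diff by (simp add: tensor_module_diff[OF N' X'])
    also have "\<dots> = tensor_class R N X (?F u) \<ominus>\<^sub>?T tensor_class R N X (?F v)"
      using diff ahom_diff[OF h(1) ag' ag c] by simp
    also have "\<dots> = tensor_class R N X (?F (u - v))"
      using diff by (simp add: tensor_module_diff[OF N X] frag_extend_diff)
    finally show ?case using diff by (simp add: frag_extend_diff keys_diff_sub[OF N X])
  qed
  have eq: "tensor_map R N X f g c = h c" if c: "c \<in> carrier ?T'" for c
  proof -
    obtain u where u: "Poly_Mapping.keys u \<subseteq> carrier N' \<times> carrier X'" "c = tensor_class R N' X' u"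
      using c by (auto simp: tensor_module_carrier[OF N' X'])
    have "(\<lambda>u. tensor_class R N X (?F u)) ` c = {h c}"
    proof (intro equalityI subsetI)
      fix z assume "z \<in> (\<lambda>u. tensor_class R N X (?F u)) ` c"
      then obtain r where r: "r \<in> tensor_rel R N' X'" "z = tensor_class R N X (?F (r + u))"
        using u by (auto simp: tensor_class_def'[OF N' X'])
      have k: "Poly_Mapping.keys (r + u) \<subseteq> carrier N' \<times> carrier X'"
        using u(1) tensor_rel_closed(4)[OF N' X' r(1)] keys_add_sub[OF N X] by blast
      have "tensor_class R N' X' (r + u) = c" using u r by (simp add: tensor_class_eq_iff[OF N' X'])
      then show "z \<in> {h c}" using hu[OF k] r by simp
    next
      fix z assume "z \<in> {h c}"
      moreover have "u \<in> c" using u tensor_rel_closed(1)[OF N' X'] by (force simp: tensor_class_def'[OF N' X'])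
      ultimately show "z \<in> (\<lambda>u. tensor_class R N X (?F u)) ` c" using hu[OF u(1)] u(2) by auto
    qed
    then show ?thesis by (simp add: tensor_map_def)
  qed
  show ?A
    using h(1) eq ag' by (auto simp: ahom_def ag_closed)
  show "tensor_map R N X f g (tensor_pure R N' X' a x) = tensor_pure R N X (f a) (g x)"
    if "a \<in> carrier N'" "x \<in> carrier X'"
    using eq[OF balancedD(1)[OF tensor_pure_balanced[OF N' X'] that]] h(2)[OF that] by simp
qed

lemma tensor_module_smult: "s \<odot>\<^sub>(tensor_module R N X) c = tensor_map R N X (smult N s) id c"
  by (simp add: tensor_module_def Let_def)

lemma lh_id': "id \<in> left_hom R X X"
  by (auto simp: left_hom_def)

lemma tensor_smult_props:
  assumes N: "is_bimodule S R N" and X: "left_module R X" and s: "s \<in> carrier S"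
  shows "smult (tensor_module R N X) s \<in> ahom (tensor_module R N X) (tensor_module R N X)"
    "a \<in> carrier N ==> x \<in> carrier X ==>
      s \<odot>\<^sub>(tensor_module R N X) tensor_pure R N X a x = tensor_pure R N X (s \<odot>\<^sub>N a) x"
proof -
  note n = is_bimoduleD[OF N]
  have eq: "smult (tensor_module R N X) s = tensor_map R N X (smult N s) id"
    by (rule ext) (simp add: tensor_module_smult)
  have sr: "s \<odot>\<^sub>N (a \<odot>\<^sub>r\<^sub>N r) = s \<odot>\<^sub>N a \<odot>\<^sub>r\<^sub>N r" if "a \<in> carrier N" "r \<in> carrier R" for a r
    using n(3)[OF s that] by simp
  note p = tensor_map_props[OF n(2) X n(2) X lm_smult_ahom[OF n(1) s] sr lh_id']
  show "smult (tensor_module R N X) s \<in> ahom (tensor_module R N X) (tensor_module R N X)"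
    unfolding eq by (rule p(1))
  show "s \<odot>\<^sub>(tensor_module R N X) tensor_pure R N X a x = tensor_pure R N X (s \<odot>\<^sub>N a) x"
    if "a \<in> carrier N" "x \<in> carrier X"
    using p(2)[OF _ _ that] by (simp add: tensor_module_smult)
qed

text \<open>The laws that involve scalars compare additive maps in \<open>u\<close>, so they reduce
  to pure tensors, where they are laws of \<open>N\<close>.\<close>

lemma lmod_is_tensor:
  assumes Z: "is_tensor R N X Z \<tau>" and S: "ring S" and N: "left_module S N"
    and sm: "\<And>s. s \<in> carrier S ==> smult Z s \<in> ahom Z Z"
    and pure: "\<And>s a x. s \<in> carrier S ==> a \<in> carrier N ==> x \<in> carrier X ==> s \<odot>\<^sub>Z \<tau> a x = \<tau> (s \<odot>\<^sub>N a) x"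
  shows "left_module S Z"
proof (rule left_moduleI)
  note z = is_tensorD[OF Z] and agS = ring_ag[OF S]
  note b = balancedD[OF z(4)]
  show "ring S" "abelian_group Z" by fact+
  fix s u assume s: "s \<in> carrier S" and u: "u \<in> carrier Z"
  show "s \<odot>\<^sub>Z u \<in> carrier Z" using ahom_closed[OF sm[OF s] u] .
  show "s \<odot>\<^sub>Z (u \<oplus>\<^sub>Z v) = s \<odot>\<^sub>Z u \<oplus>\<^sub>Z s \<odot>\<^sub>Z v" if "v \<in> carrier Z" for v
    using ahom_add[OF sm[OF s] u that] .
  fix t assume t: "t \<in> carrier S"
  have st: "s \<oplus>\<^sub>S t \<in> carrier S" "s \<otimes>\<^sub>S t \<in> carrier S" using s t S by (auto simp: ring_rules)
  show "(s \<oplus>\<^sub>S t) \<odot>\<^sub>Z u = s \<odot>\<^sub>Z u \<oplus>\<^sub>Z t \<odot>\<^sub>Z u"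
    by (rule is_tensor_eq[OF Z z(3) sm[OF st(1)] ahom_plus[OF sm[OF s] sm[OF t] z(3)] _ u])
      (simp add: pure s t st lm_l_distr[OF N] b lm_closed[OF N])
  show "(s \<otimes>\<^sub>S t) \<odot>\<^sub>Z u = s \<odot>\<^sub>Z (t \<odot>\<^sub>Z u)"
    by (rule is_tensor_eq[OF Z z(3) sm[OF st(2)] ahom_comp[OF sm[OF t] sm[OF s]] _ u])
      (simp add: pure s t st lm_assoc[OF N] lm_closed[OF N])
next
  note z = is_tensorD[OF Z]
  fix u assume u: "u \<in> carrier Z"
  have one: "\<one>\<^sub>S \<in> carrier S" using S by (simp add: ring_rules)
  have "(\<lambda>u. u) \<in> ahom Z Z" by (rule ahomI) auto
  then show "\<one>\<^sub>S \<odot>\<^sub>Z u = u"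
    by (rule is_tensor_eq[OF Z z(3) sm[OF one] _ _ u]) (simp add: pure one lm_one[OF N])
qed

lemma lmod_tensor_module:
  assumes N: "is_bimodule S R N" and X: "left_module R X"
  shows "left_module S (tensor_module R N X)"
  by (rule lmod_is_tensor[OF is_tensor_tensor_module[OF is_bimoduleD(2)[OF N] X]
        lm_ring[OF is_bimoduleD(1)[OF N]] is_bimoduleD(1)[OF N]])
    (simp_all add: tensor_smult_props[OF N X])

section \<open>Tensor powers\<close>

lemma agrp_transfer:
  assumes G: "abelian_group G" and "carrier H = carrier G" "\<zero>\<^sub>H = \<zero>\<^sub>G"
    and "\<And>x y. x \<oplus>\<^sub>H y = x \<oplus>\<^sub>G y"
  shows "abelian_group H"
proof (rule abelian_groupI', unfold assms)
  show "\<exists>y\<in>carrier G. y \<oplus>\<^sub>G x = \<zero>\<^sub>G" if "x \<in> carrier G" for x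
    using ag_inv[OF G that] ag_l_neg[OF G that] by blast
  show "x \<oplus>\<^sub>G y = y \<oplus>\<^sub>G x" if "x \<in> carrier G" "y \<in> carrier G" for x y
    by (rule ag_comm[OF G that])
qed (simp_all add: ag_closed[OF G] ag_zero[OF G] ag_assoc[OF G] ag_l_zero[OF G])

lemma tensor_bimodule_simps [simp]:
  "carrier (tensor_bimodule R N X) = carrier (tensor_module R N X)"
  "\<zero>\<^sub>(tensor_bimodule R N X) = \<zero>\<^sub>(tensor_module R N X)"
  "u \<oplus>\<^sub>(tensor_bimodule R N X) v = u \<oplus>\<^sub>(tensor_module R N X) v"
  "s \<odot>\<^sub>(tensor_bimodule R N X) u = s \<odot>\<^sub>(tensor_module R N X) u"
  "u \<odot>\<^sub>r\<^sub>(tensor_bimodule R N X) t = tensor_map R N X id (\<lambda>x. x \<odot>\<^sub>r\<^sub>X t) u"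
  by (simp_all add: tensor_bimodule_def module.defs)

lemma rsmult_left_hom: "is_bimodule S T X ==> t \<in> carrier T ==> (\<lambda>x. x \<odot>\<^sub>r\<^sub>X t) \<in> left_hom S X X"
  by (intro left_homI) (auto simp: is_bimodule_def rm_closed rm_l_distr)

lemma tensor_rsmult_props:
  assumes N: "right_module R N" and X: "is_bimodule R T X" and t: "t \<in> carrier T"
  shows "(\<lambda>u. u \<odot>\<^sub>r\<^sub>(tensor_bimodule R N X) t) \<in> ahom (tensor_module R N X) (tensor_module R N X)"
    "a \<in> carrier N ==> x \<in> carrier X ==>
      tensor_pure R N X a x \<odot>\<^sub>r\<^sub>(tensor_bimodule R N X) t = tensor_pure R N X a (x \<odot>\<^sub>r\<^sub>X t)"
proof -
  note x = is_bimoduleD(1)[OF X]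
  have i: "id \<in> ahom N N" by (auto intro: ahomI)
  have i': "id (a \<odot>\<^sub>r\<^sub>N r) = id a \<odot>\<^sub>r\<^sub>N r" for a r by simp
  note p = tensor_map_props[OF N x N x i i' rsmult_left_hom[OF X t]]
  show "(\<lambda>u. u \<odot>\<^sub>r\<^sub>(tensor_bimodule R N X) t) \<in> ahom (tensor_module R N X) (tensor_module R N X)"
    unfolding tensor_bimodule_simps by (rule p(1))
  show "tensor_pure R N X a x \<odot>\<^sub>r\<^sub>(tensor_bimodule R N X) t = tensor_pure R N X a (x \<odot>\<^sub>r\<^sub>X t)"
    if "a \<in> carrier N" "x \<in> carrier X"
    by (simp only: tensor_bimodule_simps p(2)[OF that] id_apply)
qed

lemma tensor_bimodule_bimodule:
  assumes N: "is_bimodule S R N" and X: "is_bimodule R T X"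
  shows "is_bimodule S T (tensor_bimodule R N X)"
proof -
  let ?Z = "tensor_bimodule R N X" and ?T = "tensor_module R N X"
  note n = is_bimoduleD[OF N] and x = is_bimoduleD[OF X]
  note it = is_tensor_tensor_module[OF n(2) x(1)]
  note ag = is_tensorD(3)[OF it] and b = is_tensorD(4)[OF it]
  note l = lmod_tensor_module[OF N x(1)]
  note ls = tensor_smult_props[OF N x(1)] and rs = tensor_rsmult_props[OF n(2) X]
  have agZ: "abelian_group ?Z" by (rule agrp_transfer[OF ag]) simp_all
  have lZ: "left_module S ?Z"
    by (rule left_moduleI) (use l agZ in \<open>auto simp: lm_ring lm_closed lm_l_distr lm_r_distr lm_assoc lm_one\<close>)
  have rZ: "right_module T ?Z"
  proof (rule right_moduleI)
    show "ring T" using x(2) by (rule rm_ring)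
    show "abelian_group ?Z" by (rule agZ)
  next
    fix t u assume t: "t \<in> carrier T" and "u \<in> carrier ?Z"
    then have u: "u \<in> carrier ?T" by simp
    show "u \<odot>\<^sub>r\<^sub>?Z t \<in> carrier ?Z" using ahom_closed[OF rs(1)[OF t] u] by simp
    show "(u \<oplus>\<^sub>?Z v) \<odot>\<^sub>r\<^sub>?Z t = u \<odot>\<^sub>r\<^sub>?Z t \<oplus>\<^sub>?Z v \<odot>\<^sub>r\<^sub>?Z t" if "v \<in> carrier ?Z" for v
      using ahom_add[OF rs(1)[OF t] u, of v] that by simp
    fix s assume s: "s \<in> carrier T"
    have st: "s \<oplus>\<^sub>T t \<in> carrier T" "t \<otimes>\<^sub>T s \<in> carrier T" "t \<oplus>\<^sub>T s \<in> carrier T"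
      using s t rm_ring[OF x(2)] by (auto simp: ring_rules)
    have "u \<odot>\<^sub>r\<^sub>?Z (t \<oplus>\<^sub>T s) = u \<odot>\<^sub>r\<^sub>?Z t \<oplus>\<^sub>?T u \<odot>\<^sub>r\<^sub>?Z s"
      by (rule is_tensor_eq[OF it ag rs(1)[OF st(3)] ahom_plus[OF rs(1)[OF t] rs(1)[OF s] ag] _ u])
        (simp add: rs(2) s t st rm_r_distr[OF x(2)] balancedD[OF b] rm_closed[OF x(2)] del: tensor_bimodule_simps)
    then show "u \<odot>\<^sub>r\<^sub>?Z (t \<oplus>\<^sub>T s) = u \<odot>\<^sub>r\<^sub>?Z t \<oplus>\<^sub>?Z u \<odot>\<^sub>r\<^sub>?Z s" by simp
    show "u \<odot>\<^sub>r\<^sub>?Z (t \<otimes>\<^sub>T s) = (u \<odot>\<^sub>r\<^sub>?Z t) \<odot>\<^sub>r\<^sub>?Z s"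
      by (rule is_tensor_eq[OF it ag rs(1)[OF st(2)] ahom_comp[OF rs(1)[OF t] rs(1)[OF s]] _ u])
        (simp add: rs(2) s t st rm_assoc[OF x(2)] rm_closed[OF x(2)] del: tensor_bimodule_simps)
  next
    fix u assume "u \<in> carrier ?Z"
    then have u: "u \<in> carrier ?T" by simp
    have one: "\<one>\<^sub>T \<in> carrier T" using rm_ring[OF x(2)] by (simp add: ring_rules)
    have "(\<lambda>u. u) \<in> ahom ?T ?T" by (rule ahomI) auto
    then show "u \<odot>\<^sub>r\<^sub>?Z \<one>\<^sub>T = u"
      by (rule is_tensor_eq[OF it ag rs(1)[OF one] _ _ u]) (simp add: rs(2) one rm_one[OF x(2)] del: tensor_bimodule_simps)
  qed
  show ?thesis
    unfolding is_bimodule_def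
  proof (intro conjI ballI lZ rZ)
    fix s u t assume s: "s \<in> carrier S" and "u \<in> carrier ?Z" and t: "t \<in> carrier T"
    then have u: "u \<in> carrier ?T" by simp
    have "(s \<odot>\<^sub>?T u) \<odot>\<^sub>r\<^sub>?Z t = s \<odot>\<^sub>?T (u \<odot>\<^sub>r\<^sub>?Z t)"
      by (rule is_tensor_eq[OF it ag ahom_comp[OF ls(1)[OF s] rs(1)[OF t]] ahom_comp[OF rs(1)[OF t] ls(1)[OF s]] _ u])
        (simp add: rs(2) ls(2) s t lm_closed[OF n(1)] rm_closed[OF x(2)] del: tensor_bimodule_simps)
    then show "(s \<odot>\<^sub>?Z u) \<odot>\<^sub>r\<^sub>?Z t = s \<odot>\<^sub>?Z (u \<odot>\<^sub>r\<^sub>?Z t)" by simp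
  qed
qed

lemma relabel_props:
  assumes B: "is_bimodule S T B" and f: "inj_on f (carrier B)"
  shows relabel_carrier: "carrier (relabel f B) = f ` carrier B"
    and relabel_zero: "\<zero>\<^sub>(relabel f B) = f \<zero>\<^sub>B"
    and relabel_add: "x \<in> carrier B ==> y \<in> carrier B ==> f x \<oplus>\<^sub>(relabel f B) f y = f (x \<oplus>\<^sub>B y)"
    and relabel_smult: "x \<in> carrier B ==> s \<odot>\<^sub>(relabel f B) f x = f (s \<odot>\<^sub>B x)"
    and relabel_rsmult: "x \<in> carrier B ==> f x \<odot>\<^sub>r\<^sub>(relabel f B) t = f (x \<odot>\<^sub>r\<^sub>B t)"
    and relabel_bimodule: "is_bimodule S T (relabel f B)"
proof -
  note b = is_bimoduleD[OF B]
  show c: "carrier (relabel f B) = f ` carrier B" and z: "\<zero>\<^sub>(relabel f B) = f \<zero>\<^sub>B"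
    by (simp_all add: relabel_def Let_def)
  show a: "f x \<oplus>\<^sub>(relabel f B) f y = f (x \<oplus>\<^sub>B y)" if "x \<in> carrier B" "y \<in> carrier B" for x y
    using that f by (simp add: relabel_def Let_def)
  show s: "s \<odot>\<^sub>(relabel f B) f x = f (s \<odot>\<^sub>B x)" if "x \<in> carrier B" for s x
    using that f by (simp add: relabel_def Let_def)
  show r: "f x \<odot>\<^sub>r\<^sub>(relabel f B) t = f (x \<odot>\<^sub>r\<^sub>B t)" if "x \<in> carrier B" for t x
    using that f by (simp add: relabel_def Let_def)
  note ag = lm_ag[OF b(1)]
  have agR: "abelian_group (relabel f B)"
  proof (rule abelian_groupI')
    fix u assume "u \<in> carrier (relabel f B)"
    then obtain x where "x \<in> carrier B" "u = f x" by (auto simp: c)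
    then show "\<exists>y\<in>carrier (relabel f B). y \<oplus>\<^sub>(relabel f B) u = \<zero>\<^sub>(relabel f B)"
      by (intro bexI[of _ "f (\<ominus>\<^sub>B x)"]) (auto simp: c z a ag_inv[OF ag] ag_l_neg[OF ag])
  qed (auto simp: c z a ag_closed[OF ag] ag_zero[OF ag] ag_assoc[OF ag] ag_l_zero[OF ag] ag_comm[OF ag] ag_lcomm[OF ag] ag_r_zero[OF ag])
  show "is_bimodule S T (relabel f B)"
    unfolding is_bimodule_def
  proof (intro conjI)
    show "left_module S (relabel f B)"
      by (rule left_moduleI) (use b agR in \<open>auto simp: c a s lm_ring lm_closed lm_l_distr lm_r_distr lm_assoc lm_one ag_closed[OF ag] ring_rules[OF lm_ring[OF b(1)]]\<close>)
    show "right_module T (relabel f B)"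
      by (rule right_moduleI) (use b agR in \<open>auto simp: c a r rm_ring rm_closed rm_l_distr rm_r_distr rm_assoc rm_one ag_closed[OF ag] ring_rules[OF rm_ring[OF b(2)]]\<close>)
  qed (use b in \<open>auto simp: c s r lm_closed rm_closed\<close>)
qed

text \<open>The choice inside \<open>tensor_code\<close> without the constructor
  \<open>Formal\<close>: one finite sum of pure tensors per element. It also serves to embed tensor
  products into a universe.\<close>

definition tensor_list ::
    "('r, 'e) ring_scheme => ('s, 'r, 'n, 'f) bimodule_scheme => ('r, 'x, 'g) module_scheme
      => ('n \<times> 'x \<Rightarrow>\<^sub>0 int) set => ('n \<times> 'x) list" where
  "tensor_list R N X c = (SOME ps.
     set ps \<subseteq> carrier N \<times> carrier X \<and> tensor_class R N X (sum_list (map frag_of ps)) = c)"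

lemma keys_sum_list_frag: "Poly_Mapping.keys (sum_list (map frag_of ps) :: 'k \<Rightarrow>\<^sub>0 int) \<subseteq> set ps"
proof (induction ps)
  case (Cons p ps)
  then show ?case using Poly_Mapping.keys_add[of "frag_of p" "sum_list (map frag_of ps)"] by auto
qed simp

text \<open>Every element is a sum without signs: a negative sign is absorbed into the first factor
  of a pure tensor, so lists of pairs are enough.\<close>

lemma tensor_list_props:
  assumes N: "right_module R N" and X: "left_module R X" and c: "c \<in> carrier (tensor_module R N X)"
  shows "set (tensor_list R N X c) \<subseteq> carrier N \<times> carrier X"
    and "tensor_class R N X (sum_list (map frag_of (tensor_list R N X c))) = c"
proof -
  let ?cl = "tensor_class R N X" and ?T = "tensor_module R N X"
  note ag = agrp_tensor[OF N X] and b = tensor_pure_balanced[OF N X]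
  let ?fs = "\<lambda>ps. sum_list (map frag_of ps) :: _ \<Rightarrow>\<^sub>0 int"
  have k: "Poly_Mapping.keys (?fs ps) \<subseteq> carrier N \<times> carrier X" if "set ps \<subseteq> carrier N \<times> carrier X" for ps
    using keys_sum_list_frag[of ps] that by blast
  have neg: "\<exists>qs. set qs \<subseteq> carrier N \<times> carrier X \<and> ?cl (?fs qs) = \<ominus>\<^sub>?T ?cl (?fs ps)" if "set ps \<subseteq> carrier N \<times> carrier X" for ps
    using that
  proof (induction ps)
    case Nil
    show ?case by (rule exI[of _ "[]"]) (simp add: tensor_module_neg[OF N X])
  next
    case (Cons p ps)
    then obtain qs where qs: "set qs \<subseteq> carrier N \<times> carrier X" "?cl (?fs qs) = \<ominus>\<^sub>?T ?cl (?fs ps)" by auto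
    obtain a x where p: "p = (a, x)" "a \<in> carrier N" "x \<in> carrier X" using Cons by auto
    have na: "\<ominus>\<^sub>N a \<in> carrier N" using p rm_ag[OF N] by (simp add: ag_inv)
    have cp: "?cl (frag_of p) \<in> carrier ?T" "?cl (?fs ps) \<in> carrier ?T"
      using p Cons k[of ps] by (auto simp: tensor_module_carrier[OF N X])
    have "?cl (frag_of (\<ominus>\<^sub>N a, x)) = \<ominus>\<^sub>?T ?cl (frag_of p)"
      using ahom_neg[OF balanced_ahom_l[OF b p(3)] rm_ag[OF N] ag p(2)] p by (simp add: tensor_pure_def)
    then have "?cl (?fs ((\<ominus>\<^sub>N a, x) # qs)) = \<ominus>\<^sub>?T ?cl (?fs (p # ps))"
      using qs cp by (simp add: tensor_module_add[OF N X, symmetric] ag_neg_add[OF ag])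
    then show ?case using qs na p by (intro exI[of _ "(\<ominus>\<^sub>N a, x) # qs"]) auto
  qed
  have "carrier ?T \<subseteq> {c. \<exists>ps. set ps \<subseteq> carrier N \<times> carrier X \<and> ?cl (?fs ps) = c}"
  proof (rule tensor_generated[OF N X])
    fix a x assume "a \<in> carrier N" "x \<in> carrier X"
    then show "tensor_pure R N X a x \<in> {c. \<exists>ps. set ps \<subseteq> carrier N \<times> carrier X \<and> ?cl (?fs ps) = c}"
      by (auto simp: tensor_pure_def intro!: exI[of _ "[(a, x)]"])
  next
    fix u v assume "u \<in> {c. \<exists>ps. set ps \<subseteq> carrier N \<times> carrier X \<and> ?cl (?fs ps) = c}"
      "v \<in> {c. \<exists>ps. set ps \<subseteq> carrier N \<times> carrier X \<and> ?cl (?fs ps) = c}"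
    then obtain ps qs where ps: "set ps \<subseteq> carrier N \<times> carrier X" "?cl (?fs ps) = u"
      and qs: "set qs \<subseteq> carrier N \<times> carrier X" "?cl (?fs qs) = v" by auto
    obtain rs where rs: "set rs \<subseteq> carrier N \<times> carrier X" "?cl (?fs rs) = \<ominus>\<^sub>?T v" using neg[OF qs(1)] qs(2) by auto
    have "?cl (?fs (ps @ rs)) = u \<ominus>\<^sub>?T v"
      using ps rs by (simp add: a_minus_def tensor_module_add[OF N X, symmetric])
    then show "u \<ominus>\<^sub>?T v \<in> {c. \<exists>ps. set ps \<subseteq> carrier N \<times> carrier X \<and> ?cl (?fs ps) = c}"
      using ps rs by (auto intro!: exI[of _ "ps @ rs"])
  qed
  then have "\<exists>ps. set ps \<subseteq> carrier N \<times> carrier X \<and> ?cl (?fs ps) = c" using c by blast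
  then have "set (tensor_list R N X c) \<subseteq> carrier N \<times> carrier X \<and> ?cl (?fs (tensor_list R N X c)) = c"
    unfolding tensor_list_def by (rule someI_ex)
  then show "set (tensor_list R N X c) \<subseteq> carrier N \<times> carrier X" "?cl (?fs (tensor_list R N X c)) = c" by auto
qed

lemma tensor_list_inj:
  assumes N: "right_module R N" and X: "left_module R X"
  shows "inj_on (tensor_list R N X) (carrier (tensor_module R N X))"
  by (rule inj_onI) (metis tensor_list_props(2)[OF N X])

lemma tensor_code_eq: "tensor_code R M N c = Formal (tensor_list R M N c)"
  by (simp add: tensor_code_def tensor_list_def)

declare tensor_power.simps [simp del] tensor_mult.simps [simp del] tensor_cons.simps [simp del]

locale tensor_powers =
  fixes R :: "'r ring" and M :: "('r, 'r, 'm) bimodule"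
  assumes R: "ring R" and M: "is_bimodule R R M"
begin

abbreviation TP :: "nat => ('r, 'r, ('r, 'm) tens) bimodule" where "TP \<equiv> tensor_power R M"

lemmas Ml = is_bimoduleD(1)[OF M] and Mr = is_bimoduleD(2)[OF M]

lemma reg: "is_bimodule R R (ring_bimodule R id id)"
  by (intro ring_bimodule_bimodule R ring_hom_id)

lemma tensor_code_inj:
  "left_module R N ==> inj_on (tensor_code R M N) (carrier (tensor_bimodule R M N))"
  using tensor_list_inj[OF Mr, of N] by (auto simp: inj_on_def tensor_code_eq)

lemma TP_bimodule: "is_bimodule R R (TP i)"
proof (induction i rule: induct_nat_012)
  case 0
  show ?case using relabel_bimodule[OF reg, of Scalar] by (simp add: inj_on_def tensor_power.simps)
next
  case 1
  show ?case using relabel_bimodule[OF M, of Vector] by (simp add: inj_on_def tensor_power.simps)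
next
  case (ge2 i)
  show ?case
    unfolding tensor_power.simps
    by (rule relabel_bimodule[OF tensor_bimodule_bimodule[OF M ge2(2)] tensor_code_inj[OF is_bimoduleD(1)[OF ge2(2)]]])
qed

lemmas TPl = is_bimoduleD(1)[OF TP_bimodule] and TPr = is_bimoduleD(2)[OF TP_bimodule]
  and TPlr = is_bimoduleD(3)[OF TP_bimodule]
lemmas TPag = lm_ag[OF TPl]

lemma TP_0:
  shows TP0_carrier: "carrier (TP 0) = Scalar ` carrier R"
    and TP0_zero: "\<zero>\<^sub>(TP 0) = Scalar \<zero>\<^sub>R"
    and TP0_add: "r \<in> carrier R ==> s \<in> carrier R ==> Scalar r \<oplus>\<^sub>(TP 0) Scalar s = Scalar (r \<oplus>\<^sub>R s)"
    and TP0_smult: "r \<in> carrier R ==> s \<odot>\<^sub>(TP 0) Scalar r = Scalar (s \<otimes>\<^sub>R r)"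
    and TP0_rsmult: "r \<in> carrier R ==> Scalar r \<odot>\<^sub>r\<^sub>(TP 0) s = Scalar (r \<otimes>\<^sub>R s)"
proof -
  have i: "inj_on Scalar (carrier (ring_bimodule R id id))" by (simp add: inj_on_def)
  note p = relabel_props[OF reg i]
  show "carrier (TP 0) = Scalar ` carrier R" "\<zero>\<^sub>(TP 0) = Scalar \<zero>\<^sub>R" using p(1,2) by (simp_all add: tensor_power.simps)
  show "r \<in> carrier R ==> s \<in> carrier R ==> Scalar r \<oplus>\<^sub>(TP 0) Scalar s = Scalar (r \<oplus>\<^sub>R s)"
    using p(3)[of r s] by (simp add: tensor_power.simps)
  show "r \<in> carrier R ==> s \<odot>\<^sub>(TP 0) Scalar r = Scalar (s \<otimes>\<^sub>R r)" using p(4)[of r s] by (simp add: tensor_power.simps)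
  show "r \<in> carrier R ==> Scalar r \<odot>\<^sub>r\<^sub>(TP 0) s = Scalar (r \<otimes>\<^sub>R s)" using p(5)[of r s] by (simp add: tensor_power.simps)
qed

lemma TP_1:
  shows TP1_carrier: "carrier (TP 1) = Vector ` carrier M"
    and TP1_add: "x \<in> carrier M ==> y \<in> carrier M ==> Vector x \<oplus>\<^sub>(TP 1) Vector y = Vector (x \<oplus>\<^sub>M y)"
    and TP1_smult: "x \<in> carrier M ==> s \<odot>\<^sub>(TP 1) Vector x = Vector (s \<odot>\<^sub>M x)"
    and TP1_rsmult: "x \<in> carrier M ==> Vector x \<odot>\<^sub>r\<^sub>(TP 1) s = Vector (x \<odot>\<^sub>r\<^sub>M s)"
proof -
  have i: "inj_on Vector (carrier M)" by (simp add: inj_on_def)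
  note p = relabel_props[OF M i]
  show "carrier (TP 1) = Vector ` carrier M" using p(1) by (simp add: tensor_power.simps)
  show "x \<in> carrier M ==> y \<in> carrier M ==> Vector x \<oplus>\<^sub>(TP 1) Vector y = Vector (x \<oplus>\<^sub>M y)"
    using p(3)[of x y] by (simp add: tensor_power.simps)
  show "x \<in> carrier M ==> s \<odot>\<^sub>(TP 1) Vector x = Vector (s \<odot>\<^sub>M x)" using p(4)[of x s] by (simp add: tensor_power.simps)
  show "x \<in> carrier M ==> Vector x \<odot>\<^sub>r\<^sub>(TP 1) s = Vector (x \<odot>\<^sub>r\<^sub>M s)" using p(5)[of x s] by (simp add: tensor_power.simps)
qed

lemma TP_Suc:
  assumes "i > 0"
  shows "carrier (TP (Suc i)) = tensor_code R M (TP i) ` carrier (tensor_module R M (TP i))"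
    and "u \<in> carrier (tensor_module R M (TP i)) ==> v \<in> carrier (tensor_module R M (TP i)) ==>
      tensor_code R M (TP i) u \<oplus>\<^sub>(TP (Suc i)) tensor_code R M (TP i) v = tensor_code R M (TP i) (u \<oplus>\<^sub>(tensor_module R M (TP i)) v)"
    and "u \<in> carrier (tensor_module R M (TP i)) ==>
      s \<odot>\<^sub>(TP (Suc i)) tensor_code R M (TP i) u = tensor_code R M (TP i) (s \<odot>\<^sub>(tensor_module R M (TP i)) u)"
    and "u \<in> carrier (tensor_module R M (TP i)) ==>
      tensor_code R M (TP i) u \<odot>\<^sub>r\<^sub>(TP (Suc i)) s = tensor_code R M (TP i) (u \<odot>\<^sub>r\<^sub>(tensor_bimodule R M (TP i)) s)"
proof -
  obtain j where i: "i = Suc j" using assms by (cases i) auto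
  note p = relabel_props[OF tensor_bimodule_bimodule[OF M TP_bimodule[of i]] tensor_code_inj[OF TPl[of i]]]
  show "carrier (TP (Suc i)) = tensor_code R M (TP i) ` carrier (tensor_module R M (TP i))"
    using p(1) by (simp add: i tensor_power.simps)
  show "u \<in> carrier (tensor_module R M (TP i)) ==> v \<in> carrier (tensor_module R M (TP i)) ==>
      tensor_code R M (TP i) u \<oplus>\<^sub>(TP (Suc i)) tensor_code R M (TP i) v = tensor_code R M (TP i) (u \<oplus>\<^sub>(tensor_module R M (TP i)) v)"
    using p(3)[of u v] by (simp add: i tensor_power.simps)
  show "u \<in> carrier (tensor_module R M (TP i)) ==>
      s \<odot>\<^sub>(TP (Suc i)) tensor_code R M (TP i) u = tensor_code R M (TP i) (s \<odot>\<^sub>(tensor_module R M (TP i)) u)"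
    using p(4)[of u s] by (simp add: i tensor_power.simps)
  show "u \<in> carrier (tensor_module R M (TP i)) ==>
      tensor_code R M (TP i) u \<odot>\<^sub>r\<^sub>(TP (Suc i)) s = tensor_code R M (TP i) (u \<odot>\<^sub>r\<^sub>(tensor_bimodule R M (TP i)) s)"
    using p(5)[of u s] by (simp add: i tensor_power.simps)
qed

lemma tensor_cons_Suc:
  "i > 0 ==> tensor_cons R M i m y = tensor_code R M (TP i) (tensor_pure R M (TP i) m y)"
  by (cases i) (simp_all add: tensor_pure_def tensor_cons.simps)

lemma tensor_code_ahom:
  assumes "i > 0"
  shows "tensor_code R M (TP i) \<in> ahom (tensor_module R M (TP i)) (TP (Suc i))"
  by (rule ahomI) (simp_all add: TP_Suc[OF assms])

text \<open>For positive \<open>i\<close> this is the construction itself. For \<open>i = 0\<close>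
  the first power is a copy of \<open>M\<close>, compared with the tensor product by
  \<open>m \<mapsto> m \<otimes> 1\<close>. Treating both alike permits uniform induction on tensor
  degrees.\<close>

lemma cons_is_tensor: "is_tensor R M (TP i) (TP (Suc i)) (tensor_cons R M i)"
proof (cases "i = 0")
  case True
  have one: "\<one>\<^sub>R \<in> carrier R" using R by (simp add: ring_rules)
  note b = tensor_pure_balanced[OF Mr TPl[of 0]]
  have bal: "balanced R M (TP 0) (TP 1) (tensor_cons R M 0)"
    by (rule balancedI) (use Mr R in \<open>auto simp: TP0_carrier TP1_carrier TP1_add TP0_add TP0_smult tensor_cons.simps rm_closed
        rm_l_distr rm_r_distr rm_assoc simp del: One_nat_def\<close>)
  have V1: "Vector m = tensor_cons R M 0 m (Scalar \<one>\<^sub>R)" if "m \<in> carrier M" for m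
    using that Mr by (simp add: rm_one tensor_cons.simps)
  let ?\<kappa> = "\<lambda>z. tensor_pure R M (TP 0) (the_vector z) (Scalar \<one>\<^sub>R)"
  have S1: "Scalar \<one>\<^sub>R \<in> carrier (TP 0)" using one by (simp add: TP0_carrier)
  have \<kappa>: "?\<kappa> \<in> ahom (TP 1) (tensor_module R M (TP 0))"
    by (rule ahomI) (use S1 in \<open>auto simp: TP1_carrier TP1_add balancedD[OF b] simp del: One_nat_def\<close>)
  have \<kappa>p: "?\<kappa> (tensor_cons R M 0 m y) = tensor_pure R M (TP 0) m y" if m: "m \<in> carrier M" and y: "y \<in> carrier (TP 0)" for m y
  proof -
    obtain r where r: "r \<in> carrier R" "y = Scalar r" using y by (auto simp: TP0_carrier)
    have "?\<kappa> (tensor_cons R M 0 m y) = tensor_pure R M (TP 0) m (r \<odot>\<^sub>(TP 0) Scalar \<one>\<^sub>R)"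
      using balancedD(4)[OF b m r(1) S1] r by (simp add: tensor_cons.simps)
    then show ?thesis using r one R by (simp add: TP0_smult ring_r_one)
  qed
  have "is_tensor R M (TP 0) (TP 1) (tensor_cons R M 0)"
    unfolding is_tensor_def
  proof (intro conjI allI impI Mr TPl TPag bal)
    fix A assume A: "\<forall>a\<in>carrier M. \<forall>x\<in>carrier (TP 0). tensor_cons R M 0 a x \<in> A"
    show "carrier (TP 1) \<subseteq> A"
    proof
      fix z assume "z \<in> carrier (TP 1)"
      then obtain m where "m \<in> carrier M" "z = Vector m" by (auto simp: TP1_carrier simp del: One_nat_def)
      then show "z \<in> A" using A S1 V1 by metis
    qed
  qed (use \<kappa> \<kappa>p in blast)
  then show ?thesis using True by simp
next
  case False
  then have i: "i > 0" by simp
  let ?T = "tensor_module R M (TP i)" and ?c = "tensor_code R M (TP i)"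
  have inj: "inj_on ?c (carrier ?T)" using tensor_code_inj[OF TPl[of i]] by simp
  have g: "inv_into (carrier ?T) ?c \<in> ahom (TP (Suc i)) ?T"
    by (rule ahomI) (use inj agrp_tensor[OF Mr TPl[of i]] in
        \<open>auto simp: TP_Suc(1,2)[OF i] inv_into_f_f ag_closed\<close>)
  have "is_tensor R M (TP i) (TP (Suc i)) (\<lambda>a x. ?c (tensor_pure R M (TP i) a x))"
    by (rule is_tensor_iso[OF is_tensor_tensor_module[OF Mr TPl] TPag tensor_code_ahom[OF i] g])
      (use inj in \<open>auto simp: TP_Suc(1)[OF i] f_inv_into_f inv_into_f_f\<close>)
  moreover have "tensor_cons R M i = (\<lambda>a x. ?c (tensor_pure R M (TP i) a x))"
    by (intro ext) (rule tensor_cons_Suc[OF i])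
  ultimately show ?thesis by simp
qed

lemmas cons_balanced = is_tensorD(4)[OF cons_is_tensor]
lemmas cons_closed = balancedD(1)[OF cons_balanced]

lemma cons_smult:
  assumes m: "m \<in> carrier M" and y: "y \<in> carrier (TP i)" and r: "r \<in> carrier R"
  shows "tensor_cons R M i (r \<odot>\<^sub>M m) y = r \<odot>\<^sub>(TP (Suc i)) tensor_cons R M i m y"
proof (cases "i = 0")
  case True
  then obtain s where s: "s \<in> carrier R" "y = Scalar s" using y by (auto simp: TP0_carrier)
  then have "tensor_cons R M 0 (r \<odot>\<^sub>M m) y = Vector (r \<odot>\<^sub>M (m \<odot>\<^sub>r\<^sub>M s))"
    using is_bimoduleD(3)[OF M r m s(1)] by (simp add: tensor_cons.simps)
  also have "\<dots> = r \<odot>\<^sub>(TP 1) Vector (m \<odot>\<^sub>r\<^sub>M s)"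
    using rm_closed[OF Mr s(1) m] TP1_smult by simp
  finally show ?thesis using True s by (simp add: tensor_cons.simps)
next
  case False
  then have i: "i > 0" by simp
  note b = tensor_pure_balanced[OF Mr TPl[of i]]
  show ?thesis
    using tensor_smult_props(2)[OF M TPl[of i] r m y] TP_Suc(3)[OF i balancedD(1)[OF b m y]]
    by (simp add: tensor_cons_Suc[OF i])
qed

lemma cons_rsmult:
  assumes m: "m \<in> carrier M" and y: "y \<in> carrier (TP i)" and r: "r \<in> carrier R"
  shows "tensor_cons R M i m (y \<odot>\<^sub>r\<^sub>(TP i) r) = tensor_cons R M i m y \<odot>\<^sub>r\<^sub>(TP (Suc i)) r"
proof (cases "i = 0")
  case True
  then obtain s where s: "s \<in> carrier R" "y = Scalar s" using y by (auto simp: TP0_carrier)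
  have "tensor_cons R M 0 m (y \<odot>\<^sub>r\<^sub>(TP 0) r) = Vector ((m \<odot>\<^sub>r\<^sub>M s) \<odot>\<^sub>r\<^sub>M r)"
    using s rm_assoc[OF Mr s(1) r m] by (simp add: TP0_rsmult tensor_cons.simps)
  also have "\<dots> = Vector (m \<odot>\<^sub>r\<^sub>M s) \<odot>\<^sub>r\<^sub>(TP 1) r"
    using rm_closed[OF Mr s(1) m] TP1_rsmult by simp
  finally show ?thesis using True s by (simp add: tensor_cons.simps)
next
  case False
  then have i: "i > 0" by simp
  note b = tensor_pure_balanced[OF Mr TPl[of i]]
  show ?thesis
    using tensor_rsmult_props(2)[OF Mr TP_bimodule[of i] r m y] TP_Suc(4)[OF i balancedD(1)[OF b m y]]
    by (simp add: tensor_cons_Suc[OF i])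
qed

subsection \<open>Multiplication of tensors\<close>

text \<open>Folding over any list of pairs computes the induced map \<open>h\<close>, so the value
  does not depend on the list chosen to represent an element.\<close>

lemma foldr_tensor:
  assumes h: "h \<in> ahom (tensor_module R N X) G" and N: "right_module R N" and X: "left_module R X"
    and G: "abelian_group G"
    and \<phi>: "\<And>a x. a \<in> carrier N ==> x \<in> carrier X ==> h (tensor_pure R N X a x) = \<phi> a x"
    and ps: "set ps \<subseteq> carrier N \<times> carrier X"
  shows "foldr (\<lambda>(a, x) s. \<phi> a x \<oplus>\<^sub>G s) ps \<zero>\<^sub>G = h (tensor_class R N X (sum_list (map frag_of ps)))"
  using ps
proof (induction ps)
  case Nil
  show ?case using ahom_zero[OF h agrp_tensor[OF N X] G] by (simp add: tensor_module_zero[OF N X])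
next
  case (Cons p ps)
  obtain a x where p: "p = (a, x)" "a \<in> carrier N" "x \<in> carrier X" using Cons by auto
  have "tensor_class R N X (frag_of p) \<in> carrier (tensor_module R N X)"
    "tensor_class R N X (sum_list (map frag_of ps)) \<in> carrier (tensor_module R N X)"
    using Cons p keys_sum_list_frag[of ps] by (auto simp: tensor_module_carrier[OF N X])
  then show ?case
    using Cons p \<phi>[OF p(2,3)] by (simp add: tensor_module_add[OF N X, symmetric] ahom_add[OF h] tensor_pure_def)
qed

text \<open>What the induction on \<open>i\<close> carries along: additivity in both arguments, and
  linearity over \<open>R\<close> on the left, which makes the map of the next step
  balanced.\<close>

definition mult_ok :: "nat => nat => bool" where
  "mult_ok i j \<longleftrightarrow>
     (\<forall>y\<in>carrier (TP j). (\<lambda>x. tensor_mult R M i j x y) \<in> ahom (TP i) (TP (i + j))) \<and>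
     (\<forall>x\<in>carrier (TP i). (\<lambda>y. tensor_mult R M i j x y) \<in> ahom (TP j) (TP (i + j))) \<and>
     (\<forall>r\<in>carrier R. \<forall>x\<in>carrier (TP i). \<forall>y\<in>carrier (TP j).
        tensor_mult R M i j (r \<odot>\<^sub>(TP i) x) y = r \<odot>\<^sub>(TP (i + j)) tensor_mult R M i j x y)"

lemma mult_okD:
  assumes "mult_ok i j"
  shows "y \<in> carrier (TP j) ==> (\<lambda>x. tensor_mult R M i j x y) \<in> ahom (TP i) (TP (i + j))"
    "x \<in> carrier (TP i) ==> (\<lambda>y. tensor_mult R M i j x y) \<in> ahom (TP j) (TP (i + j))"
    "r \<in> carrier R ==> x \<in> carrier (TP i) ==> y \<in> carrier (TP j) ==>
        tensor_mult R M i j (r \<odot>\<^sub>(TP i) x) y = r \<odot>\<^sub>(TP (i + j)) tensor_mult R M i j x y"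
  using assms by (auto simp: mult_ok_def)

text \<open>The rule \<open>(m \<otimes> x) \<otimes> y = m \<otimes> (x \<otimes> y)\<close> is
  balanced in \<open>m\<close> and \<open>x\<close>, hence defines an additive \<open>h\<close>; the
  recursive \<open>tensor_mult\<close>, which works on chosen lists, is identified with
  \<open>h\<close>.\<close>

lemma mult_Suc:
  assumes ok: "mult_ok i j" and y: "y \<in> carrier (TP j)"
  shows "(\<lambda>x. tensor_mult R M (Suc i) j x y) \<in> ahom (TP (Suc i)) (TP (Suc (i + j)))"
    and "m \<in> carrier M ==> x \<in> carrier (TP i) ==>
      tensor_mult R M (Suc i) j (tensor_cons R M i m x) y = tensor_cons R M (i + j) m (tensor_mult R M i j x y)"
proof -
  note cb = cons_balanced[of "i + j"]
  note ok = mult_okD[OF ok]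
  let ?\<phi> = "\<lambda>m x. tensor_cons R M (i + j) m (tensor_mult R M i j x y)"
  have cl: "tensor_mult R M i j x y \<in> carrier (TP (i + j))" if "x \<in> carrier (TP i)" for x
    using ahom_closed[OF ok(1)[OF y] that] .
  have \<phi>: "balanced R M (TP i) (TP (Suc (i + j))) ?\<phi>"
    by (rule balancedI) (simp_all add: cl balancedD[OF cb] ahom_add[OF ok(1)[OF y]] ok(3) y)
  obtain h where h: "h \<in> ahom (TP (Suc i)) (TP (Suc (i + j)))"
    "\<And>m x. m \<in> carrier M ==> x \<in> carrier (TP i) ==> h (tensor_cons R M i m x) = ?\<phi> m x"
    by (rule is_tensor_universal[OF cons_is_tensor TPag \<phi>]) (rule that, assumption, simp)
  have eq: "tensor_mult R M (Suc i) j x y = h x" if x: "x \<in> carrier (TP (Suc i))" for x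
  proof (cases "i = 0")
    case True
    \<comment> \<open>Degree one is not given by lists: \<open>Vector m\<close> is first rewritten
      as \<open>m \<otimes> 1\<close>.\<close>
    obtain m where m: "m \<in> carrier M" "x = Vector m" using x True TP1_carrier by auto
    have one: "\<one>\<^sub>R \<in> carrier R" using R by (simp add: ring_rules)
    have S1: "Scalar \<one>\<^sub>R \<in> carrier (TP 0)" using one by (simp add: TP0_carrier)
    have "x = tensor_cons R M i m (Scalar \<one>\<^sub>R)" using m True Mr by (simp add: rm_one tensor_cons.simps)
    then have "h x = ?\<phi> m (Scalar \<one>\<^sub>R)" using h(2)[OF m(1), of "Scalar \<one>\<^sub>R"] S1 True by simp
    then show ?thesis using True m lm_one[OF TPl y] by (simp add: tensor_mult.simps)
  next
    case False
    then obtain i' where i': "i = Suc i'" by (cases i) auto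
    have i: "i > 0" using False by simp
    let ?T = "tensor_module R M (TP i)"
    obtain c where c: "c \<in> carrier ?T" "x = tensor_code R M (TP i) c" using x TP_Suc(1)[OF i] by auto
    have hc: "(\<lambda>c. h (tensor_code R M (TP i) c)) \<in> ahom ?T (TP (Suc (i + j)))"
      by (rule ahom_comp[OF tensor_code_ahom[OF i] h(1)])
    have "h (tensor_code R M (TP i) (tensor_pure R M (TP i) m x)) = ?\<phi> m x" if "m \<in> carrier M" "x \<in> carrier (TP i)" for m x
      using h(2)[OF that] by (simp add: tensor_cons_Suc[OF i])
    from foldr_tensor[OF hc Mr TPl TPag this tensor_list_props(1)[OF Mr TPl c(1)]]
    have "foldr (\<lambda>(a, x) s. ?\<phi> a x \<oplus>\<^sub>(TP (Suc (i + j))) s) (tensor_list R M (TP i) c) \<zero>\<^sub>(TP (Suc (i + j))) = h x"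
      unfolding tensor_list_props(2)[OF Mr TPl c(1)] c(2)[symmetric] .
    then show ?thesis by (simp add: c(2) tensor_code_eq i' tensor_mult.simps)
  qed
  show "(\<lambda>x. tensor_mult R M (Suc i) j x y) \<in> ahom (TP (Suc i)) (TP (Suc (i + j)))"
    using h(1) eq ag_closed[OF TPag] by (auto simp: ahom_def)
  show "tensor_mult R M (Suc i) j (tensor_cons R M i m x) y = ?\<phi> m x" if "m \<in> carrier M" "x \<in> carrier (TP i)"
    using eq[OF cons_closed[OF that]] h(2)[OF that] by simp
qed

lemma mult_ok: "mult_ok i j"
proof (induction i)
  case 0
  have "(\<lambda>x. tensor_mult R M 0 j x y) \<in> ahom (TP 0) (TP j)" if "y \<in> carrier (TP j)" for y
    by (rule ahomI) (use that TPl[of j] in \<open>auto simp: tensor_mult.simps TP0_carrier TP0_add lm_closed lm_l_distr\<close>)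
  moreover have "(\<lambda>y. tensor_mult R M 0 j x y) \<in> ahom (TP j) (TP j)" if "x \<in> carrier (TP 0)" for x
    using that by (auto simp: tensor_mult.simps TP0_carrier intro!: lm_smult_ahom[OF TPl])
  moreover have "tensor_mult R M 0 j (r \<odot>\<^sub>(TP 0) x) y = r \<odot>\<^sub>(TP j) tensor_mult R M 0 j x y"
    if "r \<in> carrier R" "x \<in> carrier (TP 0)" "y \<in> carrier (TP j)" for r x y
    using that TPl[of j] by (auto simp: tensor_mult.simps TP0_carrier TP0_smult lm_assoc)
  ultimately show ?case by (simp add: mult_ok_def)
next
  case (Suc i)
  note ok = mult_okD[OF Suc] and S = mult_Suc[OF Suc] and cb = cons_balanced[of "i + j"]
  have cl: "tensor_mult R M i j x y \<in> carrier (TP (i + j))" if "x \<in> carrier (TP i)" "y \<in> carrier (TP j)" for x y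
    using ahom_closed[OF ok(1)[OF that(2)] that(1)] .
  have "tensor_mult R M (Suc i) j x (y \<oplus>\<^sub>(TP j) y') = tensor_mult R M (Suc i) j x y \<oplus>\<^sub>(TP (Suc (i + j))) tensor_mult R M (Suc i) j x y'"
    if x: "x \<in> carrier (TP (Suc i))" and y: "y \<in> carrier (TP j)" "y' \<in> carrier (TP j)" for x y y'
  proof (rule is_tensor_eq[OF cons_is_tensor TPag S(1) ahom_plus[OF S(1)[OF y(1)] S(1)[OF y(2)] TPag] _ x])
    show yy: "y \<oplus>\<^sub>(TP j) y' \<in> carrier (TP j)" using y TPag by (simp add: ag_closed)
    fix m x assume mx: "m \<in> carrier M" "x \<in> carrier (TP i)"
    show "tensor_mult R M (Suc i) j (tensor_cons R M i m x) (y \<oplus>\<^sub>(TP j) y') =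
       tensor_mult R M (Suc i) j (tensor_cons R M i m x) y \<oplus>\<^sub>(TP (Suc (i + j))) tensor_mult R M (Suc i) j (tensor_cons R M i m x) y'"
      unfolding S(2)[OF yy mx] S(2)[OF y(1) mx] S(2)[OF y(2) mx] ahom_add[OF ok(2)[OF mx(2)] y]
      by (rule balancedD(3)[OF cb mx(1) cl[OF mx(2) y(1)] cl[OF mx(2) y(2)]])
  qed
  moreover have "tensor_mult R M (Suc i) j x y \<in> carrier (TP (Suc (i + j)))" if "x \<in> carrier (TP (Suc i))" "y \<in> carrier (TP j)" for x y
    using ahom_closed[OF S(1)[OF that(2)] that(1)] .
  ultimately have a2: "(\<lambda>y. tensor_mult R M (Suc i) j x y) \<in> ahom (TP j) (TP (Suc (i + j)))" if "x \<in> carrier (TP (Suc i))" for x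
    using that by (intro ahomI)
  have "tensor_mult R M (Suc i) j (r \<odot>\<^sub>(TP (Suc i)) x) y = r \<odot>\<^sub>(TP (Suc (i + j))) tensor_mult R M (Suc i) j x y"
    if r: "r \<in> carrier R" and x: "x \<in> carrier (TP (Suc i))" and y: "y \<in> carrier (TP j)" for r x y
  proof (rule is_tensor_eq[OF cons_is_tensor TPag ahom_comp[OF lm_smult_ahom[OF TPl r] S(1)[OF y]]
        ahom_comp[OF S(1)[OF y] lm_smult_ahom[OF TPl r]] _ x])
    fix m x assume mx: "m \<in> carrier M" "x \<in> carrier (TP i)"
    have rm: "r \<odot>\<^sub>M m \<in> carrier M" using r mx Ml by (simp add: lm_closed)
    show "tensor_mult R M (Suc i) j (r \<odot>\<^sub>(TP (Suc i)) tensor_cons R M i m x) y =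
        r \<odot>\<^sub>(TP (Suc (i + j))) tensor_mult R M (Suc i) j (tensor_cons R M i m x) y"
      unfolding cons_smult[OF mx r, symmetric] S(2)[OF y mx] S(2)[OF y rm mx(2)]
      by (rule cons_smult[OF mx(1) cl[OF mx(2) y] r])
  qed
  then show ?case using S(1) a2 by (simp add: mult_ok_def)
qed

lemmas mult_ahom_l = mult_okD(1)[OF mult_ok] and mult_ahom_r = mult_okD(2)[OF mult_ok]
  and mult_smult = mult_okD(3)[OF mult_ok] and mult_cons = mult_Suc(2)[OF mult_ok]

lemma mult_closed: "x \<in> carrier (TP i) ==> y \<in> carrier (TP j) ==> tensor_mult R M i j x y \<in> carrier (TP (i + j))"
  using ahom_closed[OF mult_ahom_l] .

lemma mult_zero_l: "y \<in> carrier (TP j) ==> tensor_mult R M i j \<zero>\<^sub>(TP i) y = \<zero>\<^sub>(TP (i + j))"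
  using ahom_zero[OF mult_ahom_l TPag TPag] .

lemma mult_zero_r: "x \<in> carrier (TP i) ==> tensor_mult R M i j x \<zero>\<^sub>(TP j) = \<zero>\<^sub>(TP (i + j))"
  using ahom_zero[OF mult_ahom_r TPag TPag] .

text \<open>Induction on the degree of \<open>x\<close>: both sides are additive in
  \<open>x\<close>, so \<open>x\<close> may be taken to be \<open>m \<otimes> x'\<close>, and
  \<open>mult_cons\<close> moves \<open>m\<close> outside. In degree zero it is linearity over
  \<open>R\<close>.\<close>

lemma mult_assoc:
  assumes "x \<in> carrier (TP i)" and y: "y \<in> carrier (TP j)" and z: "z \<in> carrier (TP k)"
  shows "tensor_mult R M (i + j) k (tensor_mult R M i j x y) z = tensor_mult R M i (j + k) x (tensor_mult R M j k y z)"
  using assms(1)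
proof (induction i arbitrary: x)
  case 0
  then show ?case using mult_smult[OF _ y z] by (auto simp: TP0_carrier tensor_mult.simps)
next
  case (Suc i)
  have yz: "tensor_mult R M j k y z \<in> carrier (TP (j + k))" using mult_closed[OF y z] .
  have h1: "(\<lambda>x. tensor_mult R M (Suc i + j) k (tensor_mult R M (Suc i) j x y) z) \<in> ahom (TP (Suc i)) (TP (Suc i + j + k))"
    by (rule ahom_comp[OF mult_ahom_l[OF y] mult_ahom_l[OF z]])
  have h2: "(\<lambda>x. tensor_mult R M (Suc i) (j + k) x (tensor_mult R M j k y z)) \<in> ahom (TP (Suc i)) (TP (Suc i + j + k))"
    using mult_ahom_l[OF yz, of "Suc i"] by (simp only: add.assoc)
  show ?case
  proof (rule is_tensor_eq[OF cons_is_tensor TPag h1 h2 _ Suc.prems])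
    fix m x assume mx: "m \<in> carrier M" "x \<in> carrier (TP i)"
    have "tensor_mult R M (Suc i + j) k (tensor_mult R M (Suc i) j (tensor_cons R M i m x) y) z =
        tensor_mult R M (Suc (i + j)) k (tensor_cons R M (i + j) m (tensor_mult R M i j x y)) z"
      by (simp only: mult_cons[OF y mx] add_Suc)
    also have "\<dots> = tensor_cons R M (i + j + k) m (tensor_mult R M i (j + k) x (tensor_mult R M j k y z))"
      by (simp only: mult_cons[OF z mx(1) mult_closed[OF mx(2) y]] Suc.IH[OF mx(2)])
    also have "\<dots> = tensor_mult R M (Suc i) (j + k) (tensor_cons R M i m x) (tensor_mult R M j k y z)"
      by (simp only: mult_cons[OF yz mx] add.assoc)
    finally show "tensor_mult R M (Suc i + j) k (tensor_mult R M (Suc i) j (tensor_cons R M i m x) y) z =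
      tensor_mult R M (Suc i) (j + k) (tensor_cons R M i m x) (tensor_mult R M j k y z)" .
  qed
qed

text \<open>Induction on the degree as in \<open>mult_assoc\<close>; the right action passes through
  the first factor by \<open>cons_rsmult\<close>.\<close>

lemma mult_scalar_r:
  assumes "x \<in> carrier (TP i)" and r: "r \<in> carrier R"
  shows "tensor_mult R M i 0 x (Scalar r) = x \<odot>\<^sub>r\<^sub>(TP i) r"
  using assms(1)
proof (induction i arbitrary: x)
  case 0
  then show ?case using r by (auto simp: TP0_carrier TP0_smult TP0_rsmult tensor_mult.simps)
next
  case (Suc i)
  have S: "Scalar r \<in> carrier (TP 0)" using r by (simp add: TP0_carrier)
  have h1: "(\<lambda>x. tensor_mult R M (Suc i) 0 x (Scalar r)) \<in> ahom (TP (Suc i)) (TP (Suc i))"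
    using mult_ahom_l[OF S, of "Suc i"] by (simp only: add_0_right)
  have h2: "(\<lambda>x. x \<odot>\<^sub>r\<^sub>(TP (Suc i)) r) \<in> ahom (TP (Suc i)) (TP (Suc i))"
    by (rule lh_ahom[OF rsmult_left_hom[OF TP_bimodule r]])
  show ?case
  proof (rule is_tensor_eq[OF cons_is_tensor TPag h1 h2 _ Suc.prems])
    fix m x assume mx: "m \<in> carrier M" "x \<in> carrier (TP i)"
    show "tensor_mult R M (Suc i) 0 (tensor_cons R M i m x) (Scalar r) = tensor_cons R M i m x \<odot>\<^sub>r\<^sub>(TP (Suc i)) r"
      by (simp only: mult_cons[OF S mx] Suc.IH[OF mx(2)] cons_rsmult[OF mx r] add_0_right)
  qed
qed

end

section \<open>The ring structure of the n-trivial extension\<close>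

text \<open>Both sides sum \<open>f a b c\<close> over all \<open>a + b + c = k\<close>, grouped by
  \<open>a + b\<close> on the left and by \<open>a\<close> on the right. Induction on
  \<open>k\<close>, splitting off the terms with \<open>a = 0\<close>.\<close>

lemma (in abelian_monoid) finsum_triangle:
  assumes "\<And>a b c. a + b + c = k ==> f a b c \<in> carrier G"
  shows "finsum G (\<lambda>i. finsum G (\<lambda>a. f a (i - a) (k - i)) {..i}) {..k} =
    finsum G (\<lambda>a. finsum G (\<lambda>b. f a b (k - a - b)) {..k - a}) {..(k :: nat)}"
  using assms
proof (induction k arbitrary: f)
  case 0
  then show ?case by simp
next
  case (Suc k)
  \<comment> \<open>The terms with positive \<open>a\<close>, shifted down by one, form an instance
    of the induction hypothesis.\<close>
  let ?f = "\<lambda>a. f (Suc a)"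
  have f: "f a b c \<in> carrier G" if "a + b + c = Suc k" for a b c using Suc.prems that by blast
  have inner: "(\<lambda>a. f a (i - a) (Suc k - i)) \<in> {..i} \<rightarrow> carrier G" if "i \<le> Suc k" for i
    using that by (auto intro!: f)
  have inner': "(\<lambda>a. ?f a (i - a) (k - i)) \<in> {..i} \<rightarrow> carrier G" if "i \<le> k" for i
    using that by (auto intro!: f)
  have "finsum G (\<lambda>i. finsum G (\<lambda>a. f a (i - a) (Suc k - i)) {..i}) {..Suc k} =
      finsum G (\<lambda>i. finsum G (\<lambda>a. f a (Suc i - a) (Suc k - Suc i)) {..Suc i}) {..k} \<oplus> finsum G (\<lambda>a. f a (0 - a) (Suc k - 0)) {..0}"
    using inner by (intro finsum_Suc2) (auto intro!: finsum_closed)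
  also have "finsum G (\<lambda>i. finsum G (\<lambda>a. f a (Suc i - a) (Suc k - Suc i)) {..Suc i}) {..k} =
      finsum G (\<lambda>i. finsum G (\<lambda>a. ?f a (i - a) (k - i)) {..i} \<oplus> f 0 (Suc i) (k - i)) {..k}"
  proof (rule finsum_cong'[OF refl])
    fix i assume i: "i \<in> {..k}"
    have "finsum G (\<lambda>a. f a (Suc i - a) (Suc k - Suc i)) {..Suc i} =
        finsum G (\<lambda>a. f (Suc a) (Suc i - Suc a) (Suc k - Suc i)) {..i} \<oplus> f 0 (Suc i - 0) (Suc k - Suc i)"
      by (rule finsum_Suc2) (use inner[of "Suc i"] i in auto)
    then show "finsum G (\<lambda>a. f a (Suc i - a) (Suc k - Suc i)) {..Suc i} =
        finsum G (\<lambda>a. ?f a (i - a) (k - i)) {..i} \<oplus> f 0 (Suc i) (k - i)" by simp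
  qed (use inner' in \<open>auto intro!: a_closed finsum_closed f\<close>)
  also have "\<dots> = finsum G (\<lambda>i. finsum G (\<lambda>a. ?f a (i - a) (k - i)) {..i}) {..k} \<oplus> finsum G (\<lambda>i. f 0 (Suc i) (k - i)) {..k}"
    using inner' by (intro finsum_addf) (auto intro!: finsum_closed f)
  also have "finsum G (\<lambda>i. finsum G (\<lambda>a. ?f a (i - a) (k - i)) {..i}) {..k} =
      finsum G (\<lambda>a. finsum G (\<lambda>b. ?f a b (k - a - b)) {..k - a}) {..k}"
    by (rule Suc.IH) (auto intro!: f)
  also have "finsum G (\<lambda>a. f a (0 - a) (Suc k - 0)) {..0} = f 0 0 (Suc k)"
    using f[of 0 0 "Suc k"] by simp
  finally have L: "finsum G (\<lambda>i. finsum G (\<lambda>a. f a (i - a) (Suc k - i)) {..i}) {..Suc k} =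
      finsum G (\<lambda>a. finsum G (\<lambda>b. ?f a b (k - a - b)) {..k - a}) {..k} \<oplus> finsum G (\<lambda>i. f 0 (Suc i) (k - i)) {..k} \<oplus> f 0 0 (Suc k)" .
  have i2: "(\<lambda>b. f a b (Suc k - a - b)) \<in> {..Suc k - a} \<rightarrow> carrier G" if "a \<le> Suc k" for a
    using that by (auto intro!: f)
  have "finsum G (\<lambda>a. finsum G (\<lambda>b. f a b (Suc k - a - b)) {..Suc k - a}) {..Suc k} =
      finsum G (\<lambda>a. finsum G (\<lambda>b. f (Suc a) b (Suc k - Suc a - b)) {..Suc k - Suc a}) {..k} \<oplus> finsum G (\<lambda>b. f 0 b (Suc k - 0 - b)) {..Suc k - 0}"
    using i2 by (intro finsum_Suc2) (auto intro!: finsum_closed)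
  also have "finsum G (\<lambda>b. f 0 b (Suc k - 0 - b)) {..Suc k - 0} =
      finsum G (\<lambda>b. f 0 (Suc b) (Suc k - Suc b)) {..k} \<oplus> f 0 0 (Suc k - 0)"
    using i2[of 0] finsum_Suc2[of "\<lambda>b. f 0 b (Suc k - b)" k] by simp
  finally have R: "finsum G (\<lambda>a. finsum G (\<lambda>b. f a b (Suc k - a - b)) {..Suc k - a}) {..Suc k} =
      finsum G (\<lambda>a. finsum G (\<lambda>b. ?f a b (k - a - b)) {..k - a}) {..k} \<oplus> (finsum G (\<lambda>i. f 0 (Suc i) (k - i)) {..k} \<oplus> f 0 0 (Suc k))"
    by simp
  have c: "finsum G (\<lambda>a. finsum G (\<lambda>b. ?f a b (k - a - b)) {..k - a}) {..k} \<in> carrier G"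
    "finsum G (\<lambda>i. f 0 (Suc i) (k - i)) {..k} \<in> carrier G" "f 0 0 (Suc k) \<in> carrier G"
    by (auto intro!: finsum_closed f)
  show ?case unfolding L R using a_assoc[OF c] .
qed

lemma (in abelian_monoid) finsum_single:
  assumes "i \<in> A" "finite A" "f i \<in> carrier G" "\<And>j. j \<in> A ==> j \<noteq> i ==> f j = \<zero>"
  shows "finsum G f A = f i"
proof -
  have "f x \<in> carrier G" if "x \<in> A" for x using assms that by (cases "x = i") auto
  then have "finsum G f {i} = finsum G f A"
    using assms by (intro add.finprod_mono_neutral_cong_left) auto
  then show ?thesis using assms(3) by simp
qed

text \<open>
  The ring \<^term>\<open>S\<close> is the direct sum of the bimodules \<^term>\<open>N k\<close>, with \<^term>\<open>N 0\<close> a copy of \<^term>\<open>R\<close>. The map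
  \<^term>\<open>tr m\<close> cuts off the components of degree at least \<^term>\<open>m\<close>, which replaces finite sums by inductions on \<^term>\<open>m\<close>.
\<close>

locale graded_extension =
  fixes R :: "'r ring" and S :: "'s ring" and \<iota> :: "'r => 's" and \<pi> :: "'s => 'r" and n :: nat
    and N :: "nat => ('r, 'r, 'n) bimodule" and pr :: "nat => 's => 'n" and inn :: "nat => 'n => 's"
    and tr :: "nat => 's => 's" and sc :: "'n => 'r"
  assumes R: "ring R" and S: "ring S" and \<iota>: "\<iota> \<in> ring_hom R S" and \<pi>: "\<pi> \<in> ring_hom S R"
    and \<pi>\<iota>: "r \<in> carrier R ==> \<pi> (\<iota> r) = r"
    and N: "is_bimodule R R (N k)"
    and pr: "k \<le> n ==> pr k \<in> ahom S (N k)"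
    and pr_l: "k \<le> n ==> r \<in> carrier R ==> u \<in> carrier S ==> pr k (\<iota> r \<otimes>\<^sub>S u) = r \<odot>\<^sub>(N k) pr k u"
    and pr_r: "k \<le> n ==> r \<in> carrier R ==> u \<in> carrier S ==> pr k (u \<otimes>\<^sub>S \<iota> r) = pr k u \<odot>\<^sub>r\<^sub>(N k) r"
    and inn: "k \<le> n ==> inn k \<in> ahom (N k) S"
    and inn_l: "k \<le> n ==> r \<in> carrier R ==> y \<in> carrier (N k) ==> inn k (r \<odot>\<^sub>(N k) y) = \<iota> r \<otimes>\<^sub>S inn k y"
    and inn_r: "k \<le> n ==> r \<in> carrier R ==> y \<in> carrier (N k) ==> inn k (y \<odot>\<^sub>r\<^sub>(N k) r) = inn k y \<otimes>\<^sub>S \<iota> r"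
    and tr: "tr m \<in> ahom S S"
    and tr_r: "r \<in> carrier R ==> u \<in> carrier S ==> tr m (u \<otimes>\<^sub>S \<iota> r) = tr m u \<otimes>\<^sub>S \<iota> r"
    and tr_0: "u \<in> carrier S ==> tr 0 u = \<zero>\<^sub>S"
    and tr_n: "u \<in> carrier S ==> tr (Suc n) u = u"
    and tr_Suc: "m \<le> n ==> u \<in> carrier S ==> tr (Suc m) u = tr m u \<oplus>\<^sub>S inn m (pr m u)"
    and sc: "sc \<in> ahom (N 0) R" "bij_betw sc (carrier (N 0)) (carrier R)"
    and sc_l: "r \<in> carrier R ==> y \<in> carrier (N 0) ==> sc (r \<odot>\<^sub>(N 0) y) = r \<otimes>\<^sub>R sc y"
    and sc_r: "r \<in> carrier R ==> y \<in> carrier (N 0) ==> sc (y \<odot>\<^sub>r\<^sub>(N 0) r) = sc y \<otimes>\<^sub>R r"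

section \<open>The n-trivial extension as a graded ring\<close>

context tensor_powers
begin

abbreviation TE :: "nat => (nat => ('r, 'm) tens) ring" where "TE n \<equiv> triv_ext n R M"

lemma TE_simps [simp]:
  "carrier (TE n) = (\<Pi>\<^sub>E k\<in>{..n}. carrier (TP k))"
  "\<zero>\<^sub>(TE n) = (\<lambda>k\<in>{..n}. \<zero>\<^sub>(TP k))"
  "u \<oplus>\<^sub>(TE n) v = (\<lambda>k\<in>{..n}. u k \<oplus>\<^sub>(TP k) v k)"
  "u \<otimes>\<^sub>(TE n) v = (\<lambda>k\<in>{..n}. \<Oplus>\<^bsub>TP k\<^esub>i\<in>{..k}. tensor_mult R M i (k - i) (u i) (v (k - i)))"
  "\<one>\<^sub>(TE n) = scalar_emb n R M \<one>\<^sub>R"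
  by (simp_all add: triv_ext_def)

lemma TE_comp: "u \<in> carrier (TE n) ==> k \<le> n ==> u k \<in> carrier (TP k)"
  by (auto simp: PiE_iff)

lemma TE_eqI: "u \<in> carrier (TE n) ==> v \<in> carrier (TE n) ==> (\<And>k. k \<le> n ==> u k = v k) ==> u = v"
  by (auto intro!: PiE_ext)

lemma mult_terms:
  assumes u: "u \<in> carrier (TE n)" and v: "v \<in> carrier (TE n)" and k: "k \<le> n"
  shows "(\<lambda>i. tensor_mult R M i (k - i) (u i) (v (k - i))) \<in> {..k} \<rightarrow> carrier (TP k)"
proof
  fix i assume i: "i \<in> {..k}"
  have "tensor_mult R M i (k - i) (u i) (v (k - i)) \<in> carrier (TP (i + (k - i)))"
    using i k by (intro mult_closed TE_comp[OF u] TE_comp[OF v]) auto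
  then show "tensor_mult R M i (k - i) (u i) (v (k - i)) \<in> carrier (TP k)" using i by simp
qed

lemma TP_am: "abelian_monoid (TP k)"
  using TPag[of k] by (simp add: abelian_group_def)

lemma TE_mult_closed: "u \<in> carrier (TE n) ==> v \<in> carrier (TE n) ==> u \<otimes>\<^sub>(TE n) v \<in> carrier (TE n)"
  unfolding TE_simps(4) TE_simps(1)[of n] restrict_PiE_iff
  by (intro ballI abelian_monoid.finsum_closed[OF TP_am] mult_terms) (simp_all add: TE_simps(1)[of n])

lemma TE_mult_comp:
  "k \<le> n ==> (u \<otimes>\<^sub>(TE n) v) k = (\<Oplus>\<^bsub>TP k\<^esub>i\<in>{..k}. tensor_mult R M i (k - i) (u i) (v (k - i)))"
  by simp

lemma emb_closed: "r \<in> carrier R ==> scalar_emb n R M r \<in> carrier (TE n)"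
  using ag_zero[OF TPag] by (auto simp: scalar_emb_def TP0_carrier)

lemma emb_comp: "k \<le> n ==> scalar_emb n R M r k = (if k = 0 then Scalar r else \<zero>\<^sub>(TP k))"
  by (simp add: scalar_emb_def)

text \<open>Scalars live in degree zero, so only the summand \<open>i = 0\<close> of the convolution
  survives.\<close>

lemma emb_mult_l:
  assumes r: "r \<in> carrier R" and u: "u \<in> carrier (TE n)" and k: "k \<le> n"
  shows "(scalar_emb n R M r \<otimes>\<^sub>(TE n) u) k = r \<odot>\<^sub>(TP k) u k"
proof -
  have "(\<Oplus>\<^bsub>TP k\<^esub>i\<in>{..k}. tensor_mult R M i (k - i) (scalar_emb n R M r i) (u (k - i))) =
      tensor_mult R M 0 (k - 0) (scalar_emb n R M r 0) (u (k - 0))"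
  proof (rule abelian_monoid.finsum_single[OF TP_am])
    show "tensor_mult R M 0 (k - 0) (scalar_emb n R M r 0) (u (k - 0)) \<in> carrier (TP k)"
      using funcset_mem[OF mult_terms[OF emb_closed[OF r] u k], of 0] by simp
    fix i assume i: "i \<in> {..k}" "i \<noteq> 0"
    have "u (k - i) \<in> carrier (TP (k - i))" using k by (intro TE_comp[OF u]) auto
    then show "tensor_mult R M i (k - i) (scalar_emb n R M r i) (u (k - i)) = \<zero>\<^sub>(TP k)"
      using i k mult_zero_l[of "u (k - i)" "k - i" i] by (simp add: emb_comp)
  qed auto
  then show ?thesis using k by (simp add: emb_comp tensor_mult.simps)
qed

lemma emb_mult_r:
  assumes r: "r \<in> carrier R" and u: "u \<in> carrier (TE n)" and k: "k \<le> n"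
  shows "(u \<otimes>\<^sub>(TE n) scalar_emb n R M r) k = u k \<odot>\<^sub>r\<^sub>(TP k) r"
proof -
  have "(\<Oplus>\<^bsub>TP k\<^esub>i\<in>{..k}. tensor_mult R M i (k - i) (u i) (scalar_emb n R M r (k - i))) =
      tensor_mult R M k (k - k) (u k) (scalar_emb n R M r (k - k))"
  proof (rule abelian_monoid.finsum_single[OF TP_am])
    show "tensor_mult R M k (k - k) (u k) (scalar_emb n R M r (k - k)) \<in> carrier (TP k)"
      using funcset_mem[OF mult_terms[OF u emb_closed[OF r] k], of k] by simp
    fix i assume i: "i \<in> {..k}" "i \<noteq> k"
    have "u i \<in> carrier (TP i)" using k i by (intro TE_comp[OF u]) auto
    then show "tensor_mult R M i (k - i) (u i) (scalar_emb n R M r (k - i)) = \<zero>\<^sub>(TP k)"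
      using i k mult_zero_r[of "u i" i "k - i"] by (simp add: emb_comp)
  qed auto
  then show ?thesis using k mult_scalar_r[OF TE_comp[OF u k] r] by (simp add: emb_comp)
qed

lemma TE_ag: "abelian_group (TE n)"
proof (rule abelian_groupI')
  fix u assume u: "u \<in> carrier (TE n)"
  then show "\<exists>v\<in>carrier (TE n). v \<oplus>\<^sub>(TE n) u = \<zero>\<^sub>(TE n)"
    by (intro bexI[of _ "\<lambda>k\<in>{..n}. \<ominus>\<^sub>(TP k) u k"])
      (auto simp: PiE_iff ag_inv[OF TPag] ag_l_neg[OF TPag] fun_eq_iff)
qed (auto simp: PiE_iff ag_closed[OF TPag] ag_zero[OF TPag] ag_assoc[OF TPag] fun_eq_iff extensional_def
   ag_l_zero[OF TPag] intro: ag_comm[OF TPag])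

text \<open>In degree \<open>k\<close> both sides are sums of triple products over
  \<open>a + b + c = k\<close>, by additivity of \<open>tensor_mult\<close>;
  \<open>finsum_triangle\<close> regroups the sums and \<open>mult_assoc\<close> identifies the
  terms.\<close>

lemma TE_mult_assoc:
  assumes u: "u \<in> carrier (TE n)" and v: "v \<in> carrier (TE n)" and w: "w \<in> carrier (TE n)"
  shows "(u \<otimes>\<^sub>(TE n) v) \<otimes>\<^sub>(TE n) w = u \<otimes>\<^sub>(TE n) (v \<otimes>\<^sub>(TE n) w)"
proof (rule TE_eqI)
  show "(u \<otimes>\<^sub>(TE n) v) \<otimes>\<^sub>(TE n) w \<in> carrier (TE n)" "u \<otimes>\<^sub>(TE n) (v \<otimes>\<^sub>(TE n) w) \<in> carrier (TE n)"
    by (intro TE_mult_closed u v w)+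
  fix k assume k: "k \<le> n"
  interpret T: abelian_monoid "TP k" by (rule TP_am)
  let ?f = "\<lambda>a b c. tensor_mult R M (a + b) c (tensor_mult R M a b (u a) (v b)) (w c)"
  have uvw: "u a \<in> carrier (TP a)" "v a \<in> carrier (TP a)" "w a \<in> carrier (TP a)" if "a \<le> k" for a
    using that k TE_comp[OF u] TE_comp[OF v] TE_comp[OF w] by auto
  have f: "?f a b c \<in> carrier (TP k)" if "a + b + c = k" for a b c
    using mult_closed[OF mult_closed[OF uvw(1)[of a] uvw(2)[of b]] uvw(3)[of c]] that by auto
  have "((u \<otimes>\<^sub>(TE n) v) \<otimes>\<^sub>(TE n) w) k = (\<Oplus>\<^bsub>TP k\<^esub>i\<in>{..k}. \<Oplus>\<^bsub>TP k\<^esub>a\<in>{..i}. ?f a (i - a) (k - i))"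
    unfolding TE_mult_comp[OF k]
  proof (rule T.finsum_cong'[OF refl])
    fix i assume "i \<in> {..k}"
    then have i: "i \<le> k" by simp
    have "tensor_mult R M i (k - i) ((u \<otimes>\<^sub>(TE n) v) i) (w (k - i)) =
        tensor_mult R M i (k - i) (\<Oplus>\<^bsub>TP i\<^esub>a\<in>{..i}. tensor_mult R M a (i - a) (u a) (v (i - a))) (w (k - i))"
      using i k by (simp only: TE_mult_comp[OF order_trans[OF i k]])
    also have "\<dots> = (\<Oplus>\<^bsub>TP (i + (k - i))\<^esub>a\<in>{..i}. tensor_mult R M i (k - i) (tensor_mult R M a (i - a) (u a) (v (i - a))) (w (k - i)))"
      by (rule ahom_finsum[OF mult_ahom_l[OF uvw(3)] TPag TPag])
        (use i k mult_terms[OF u v, of i] in auto)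
    also have "\<dots> = (\<Oplus>\<^bsub>TP k\<^esub>a\<in>{..i}. ?f a (i - a) (k - i))"
    proof -
      have "i + (k - i) = k" using i by simp
      moreover have "?f a (i - a) (k - i) \<in> carrier (TP k)" if "a \<le> i" for a using i that by (intro f) simp
      ultimately show ?thesis by (simp only:) (rule T.finsum_cong'[OF refl], auto)
    qed
    finally show "tensor_mult R M i (k - i) ((u \<otimes>\<^sub>(TE n) v) i) (w (k - i)) = (\<Oplus>\<^bsub>TP k\<^esub>a\<in>{..i}. ?f a (i - a) (k - i))" .
  qed (auto intro!: T.finsum_closed f)
  also have "\<dots> = (\<Oplus>\<^bsub>TP k\<^esub>a\<in>{..k}. \<Oplus>\<^bsub>TP k\<^esub>b\<in>{..k - a}. ?f a b (k - a - b))"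
    by (rule T.finsum_triangle) (rule f)
  also have "\<dots> = (u \<otimes>\<^sub>(TE n) (v \<otimes>\<^sub>(TE n) w)) k"
    unfolding TE_mult_comp[OF k]
  proof (rule T.finsum_cong'[OF refl])
    fix a assume "a \<in> {..k}"
    then have a: "a \<le> k" by simp
    let ?j = "k - a"
    have j: "?j \<le> n" using k by simp
    have "tensor_mult R M a ?j (u a) ((v \<otimes>\<^sub>(TE n) w) ?j) =
        tensor_mult R M a ?j (u a) (\<Oplus>\<^bsub>TP ?j\<^esub>b\<in>{..?j}. tensor_mult R M b (?j - b) (v b) (w (?j - b)))"
      by (simp only: TE_mult_comp[OF j])
    also have "\<dots> = (\<Oplus>\<^bsub>TP (a + ?j)\<^esub>b\<in>{..?j}. tensor_mult R M a ?j (u a) (tensor_mult R M b (?j - b) (v b) (w (?j - b))))"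
      by (rule ahom_finsum[OF mult_ahom_r[OF uvw(1)[OF a]] TPag TPag]) (use mult_terms[OF v w j] in auto)
    also have "\<dots> = (\<Oplus>\<^bsub>TP k\<^esub>b\<in>{..?j}. ?f a b (k - a - b))"
    proof -
      have "tensor_mult R M a ?j (u a) (tensor_mult R M b (?j - b) (v b) (w (?j - b))) = ?f a b (k - a - b)" if b: "b \<le> ?j" for b
      proof -
        have e: "b + (?j - b) = ?j" "b \<le> k" "?j - b \<le> k" using b by auto
        show ?thesis
          using mult_assoc[OF uvw(1)[OF a] uvw(2)[OF e(2)] uvw(3)[OF e(3)]] unfolding e(1) by (rule sym)
      qed
      moreover have "?f a b (k - a - b) \<in> carrier (TP k)" if "b \<le> ?j" for b using a that by (intro f) simp
      moreover have "a + ?j = k" using a by simp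
      ultimately show ?thesis by (simp only:) (rule T.finsum_cong'[OF refl], auto)
    qed
    finally show "(\<Oplus>\<^bsub>TP k\<^esub>b\<in>{..k - a}. ?f a b (k - a - b)) = tensor_mult R M a ?j (u a) ((v \<otimes>\<^sub>(TE n) w) ?j)" by simp
  qed (use mult_terms[OF u TE_mult_closed[OF v w] k] in auto)
  finally show "((u \<otimes>\<^sub>(TE n) v) \<otimes>\<^sub>(TE n) w) k = (u \<otimes>\<^sub>(TE n) (v \<otimes>\<^sub>(TE n) w)) k" .
qed

lemma TE_distr:
  assumes u: "u \<in> carrier (TE n)" and v: "v \<in> carrier (TE n)" and w: "w \<in> carrier (TE n)"
  shows "(u \<oplus>\<^sub>(TE n) v) \<otimes>\<^sub>(TE n) w = (u \<otimes>\<^sub>(TE n) w) \<oplus>\<^sub>(TE n) (v \<otimes>\<^sub>(TE n) w)"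
    and "w \<otimes>\<^sub>(TE n) (u \<oplus>\<^sub>(TE n) v) = (w \<otimes>\<^sub>(TE n) u) \<oplus>\<^sub>(TE n) (w \<otimes>\<^sub>(TE n) v)"
proof -
  have uv: "u \<oplus>\<^sub>(TE n) v \<in> carrier (TE n)" using u v TE_ag by (metis ag_closed)
  note c = TE_comp[OF u] TE_comp[OF v] TE_comp[OF w]
  have comp: "(u \<oplus>\<^sub>(TE n) v) k = u k \<oplus>\<^sub>(TP k) v k" if "k \<le> n" for k u v using that by simp
  show "(u \<oplus>\<^sub>(TE n) v) \<otimes>\<^sub>(TE n) w = (u \<otimes>\<^sub>(TE n) w) \<oplus>\<^sub>(TE n) (v \<otimes>\<^sub>(TE n) w)"
  proof (rule TE_eqI)
    show "(u \<oplus>\<^sub>(TE n) v) \<otimes>\<^sub>(TE n) w \<in> carrier (TE n)" by (rule TE_mult_closed[OF uv w])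
    show "(u \<otimes>\<^sub>(TE n) w) \<oplus>\<^sub>(TE n) (v \<otimes>\<^sub>(TE n) w) \<in> carrier (TE n)"
      by (rule ag_closed[OF TE_ag TE_mult_closed[OF u w] TE_mult_closed[OF v w]])
    fix k assume k: "k \<le> n"
    interpret T: abelian_monoid "TP k" by (rule TP_am)
    have "tensor_mult R M i (k - i) ((u \<oplus>\<^sub>(TE n) v) i) (w (k - i)) =
        tensor_mult R M i (k - i) (u i) (w (k - i)) \<oplus>\<^sub>(TP k) tensor_mult R M i (k - i) (v i) (w (k - i))" if i: "i \<le> k" for i
      using ahom_add[OF mult_ahom_l[OF c(3)[of "k - i"]] c(1)[of i] c(2)[of i]] i k comp[of i u v] by simp
    then show "((u \<oplus>\<^sub>(TE n) v) \<otimes>\<^sub>(TE n) w) k = ((u \<otimes>\<^sub>(TE n) w) \<oplus>\<^sub>(TE n) (v \<otimes>\<^sub>(TE n) w)) k"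
      unfolding comp[OF k] TE_mult_comp[OF k] T.finsum_addf[OF mult_terms[OF u w k] mult_terms[OF v w k], symmetric]
      using mult_terms[OF u w k] mult_terms[OF v w k]
      by (intro T.finsum_cong) (auto simp: simp_implies_def Pi_iff)
  qed
  show "w \<otimes>\<^sub>(TE n) (u \<oplus>\<^sub>(TE n) v) = (w \<otimes>\<^sub>(TE n) u) \<oplus>\<^sub>(TE n) (w \<otimes>\<^sub>(TE n) v)"
  proof (rule TE_eqI)
    show "w \<otimes>\<^sub>(TE n) (u \<oplus>\<^sub>(TE n) v) \<in> carrier (TE n)" by (rule TE_mult_closed[OF w uv])
    show "(w \<otimes>\<^sub>(TE n) u) \<oplus>\<^sub>(TE n) (w \<otimes>\<^sub>(TE n) v) \<in> carrier (TE n)"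
      by (rule ag_closed[OF TE_ag TE_mult_closed[OF w u] TE_mult_closed[OF w v]])
    fix k assume k: "k \<le> n"
    interpret T: abelian_monoid "TP k" by (rule TP_am)
    have "tensor_mult R M i (k - i) (w i) ((u \<oplus>\<^sub>(TE n) v) (k - i)) =
        tensor_mult R M i (k - i) (w i) (u (k - i)) \<oplus>\<^sub>(TP k) tensor_mult R M i (k - i) (w i) (v (k - i))" if i: "i \<le> k" for i
    proof -
      have j: "k - i \<le> n" "i \<le> n" "i + (k - i) = k" using i k by auto
      show ?thesis
        using ahom_add[OF mult_ahom_r[OF c(3)[OF j(2)]] c(1)[OF j(1)] c(2)[OF j(1)]] unfolding comp[OF j(1)] j(3) .
    qed
    then show "(w \<otimes>\<^sub>(TE n) (u \<oplus>\<^sub>(TE n) v)) k = ((w \<otimes>\<^sub>(TE n) u) \<oplus>\<^sub>(TE n) (w \<otimes>\<^sub>(TE n) v)) k"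
      unfolding comp[OF k] TE_mult_comp[OF k] T.finsum_addf[OF mult_terms[OF w u k] mult_terms[OF w v k], symmetric]
      using mult_terms[OF w u k] mult_terms[OF w v k]
      by (intro T.finsum_cong) (auto simp: simp_implies_def Pi_iff)
  qed
qed

lemma TE_ring: "ring (TE n)"
proof (rule ringI)
  have one: "\<one>\<^sub>R \<in> carrier R" using R by (simp add: ring_rules)
  show "abelian_group (TE n)" by (rule TE_ag)
  show "monoid (TE n)"
  proof (rule monoidI)
    show "\<one>\<^sub>(TE n) \<in> carrier (TE n)" unfolding TE_simps(5) by (rule emb_closed[OF one])
    fix u assume u: "u \<in> carrier (TE n)"
    show "\<one>\<^sub>(TE n) \<otimes>\<^sub>(TE n) u = u"
      unfolding TE_simps(5)
      by (rule TE_eqI[OF TE_mult_closed[OF emb_closed[OF one] u] u])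
        (simp only: emb_mult_l[OF one u] lm_one[OF TPl TE_comp[OF u]])
    show "u \<otimes>\<^sub>(TE n) \<one>\<^sub>(TE n) = u"
      unfolding TE_simps(5)
      by (rule TE_eqI[OF TE_mult_closed[OF u emb_closed[OF one]] u])
        (simp only: emb_mult_r[OF one u] rm_one[OF TPr TE_comp[OF u]])
  qed (rule TE_mult_closed TE_mult_assoc; assumption)+
qed (rule TE_distr; assumption)+

lemma emb_ring_hom: "scalar_emb n R M \<in> ring_hom R (TE n)"
proof (rule ring_hom_memI)
  fix r s assume r: "r \<in> carrier R" and s: "s \<in> carrier R"
  have rs: "r \<otimes>\<^sub>R s \<in> carrier R" using r s R by (simp add: ring_rules)
  show "scalar_emb n R M (r \<otimes>\<^sub>R s) = scalar_emb n R M r \<otimes>\<^sub>(TE n) scalar_emb n R M s"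
  proof (rule TE_eqI[OF emb_closed[OF rs] TE_mult_closed[OF emb_closed[OF r] emb_closed[OF s]]])
    fix k assume k: "k \<le> n"
    show "scalar_emb n R M (r \<otimes>\<^sub>R s) k = (scalar_emb n R M r \<otimes>\<^sub>(TE n) scalar_emb n R M s) k"
      unfolding emb_mult_l[OF r emb_closed[OF s] k] using r s k lm_smult_zero[OF TPl r, of k]
      by (simp add: emb_comp TP0_smult)
  qed
  show "scalar_emb n R M (r \<oplus>\<^sub>R s) = scalar_emb n R M r \<oplus>\<^sub>(TE n) scalar_emb n R M s"
    using r s ag_l_zero[OF TPag ag_zero[OF TPag]] by (auto simp: scalar_emb_def fun_eq_iff TP0_add)
qed (simp_all only: emb_closed TE_simps(5))

text \<open>In degree zero the convolution has a single term.\<close>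

lemma proj_ring_hom: "(\<lambda>u. the_scalar (u 0)) \<in> ring_hom (TE n) R"
proof (rule ring_hom_memI)
  have c0: "\<exists>r. r \<in> carrier R \<and> u 0 = Scalar r" if "u \<in> carrier (TE n)" for u
    using TE_comp[OF that, of 0] by (auto simp: TP0_carrier)
  show "the_scalar (u 0) \<in> carrier R" if "u \<in> carrier (TE n)" for u using c0[OF that] by auto
  fix u v assume u: "u \<in> carrier (TE n)" and v: "v \<in> carrier (TE n)"
  obtain r s where rs: "r \<in> carrier R" "u 0 = Scalar r" "s \<in> carrier R" "v 0 = Scalar s"
    using c0[OF u] c0[OF v] by blast
  show "the_scalar ((u \<oplus>\<^sub>(TE n) v) 0) = the_scalar (u 0) \<oplus>\<^sub>R the_scalar (v 0)"
    using rs by (simp add: TP0_add)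
  interpret T: abelian_monoid "TP 0" by (rule TP_am)
  have "r \<otimes>\<^sub>R s \<in> carrier R" using rs R by (simp add: ring_rules)
  then have "Scalar (r \<otimes>\<^sub>R s) \<in> carrier (TP 0)" by (simp add: TP0_carrier)
  then show "the_scalar ((u \<otimes>\<^sub>(TE n) v) 0) = the_scalar (u 0) \<otimes>\<^sub>R the_scalar (v 0)"
    using rs by (simp add: tensor_mult.simps TP0_smult)
qed (simp add: emb_comp)

lemma TP_zero_r: "r \<in> carrier R ==> \<zero>\<^sub>(TP k) \<odot>\<^sub>r\<^sub>(TP k) r = \<zero>\<^sub>(TP k)"
  by (rule ahom_zero[OF lh_ahom[OF rsmult_left_hom[OF TP_bimodule]] TPag TPag])

text \<open>From here on the ring is used only through this interface, the retraction onto
  \<open>R\<close> being the component of degree zero.\<close>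

lemma TE_graded:
  "graded_extension R (TE n) (scalar_emb n R M) (\<lambda>u. the_scalar (u 0)) n TP
     (\<lambda>k u. u k) (\<lambda>k y. \<lambda>j\<in>{..n}. if j = k then y else \<zero>\<^sub>(TP j))
     (\<lambda>m u. \<lambda>j\<in>{..n}. if j < m then u j else \<zero>\<^sub>(TP j)) the_scalar"
proof (rule graded_extension.intro)
  let ?\<iota> = "scalar_emb n R M" and ?in = "\<lambda>k y. \<lambda>j\<in>{..n}. if j = k then y else \<zero>\<^sub>(TP j)"
    and ?tr = "\<lambda>m u. \<lambda>j\<in>{..n}. if j < m then u j else \<zero>\<^sub>(TP j)"
  note z = ag_zero[OF TPag] and zz = ag_l_zero[OF TPag ag_zero[OF TPag]]
  show "ring R" by (rule R)
  show "ring (TE n)" by (rule TE_ring)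
  show "?\<iota> \<in> ring_hom R (TE n)" by (rule emb_ring_hom)
  show "(\<lambda>u. the_scalar (u 0)) \<in> ring_hom (TE n) R" by (rule proj_ring_hom)
  show "the_scalar (?\<iota> r 0) = r" if "r \<in> carrier R" for r by (simp add: emb_comp)
  show "is_bimodule R R (TP k)" for k by (rule TP_bimodule)
  show "(\<lambda>u. u k) \<in> ahom (TE n) (TP k)" if "k \<le> n" for k
    using that by (intro ahomI) auto
  show "(?\<iota> r \<otimes>\<^sub>(TE n) u) k = r \<odot>\<^sub>(TP k) u k" if "k \<le> n" "r \<in> carrier R" "u \<in> carrier (TE n)" for k r u
    by (rule emb_mult_l[OF that(2,3,1)])
  show "(u \<otimes>\<^sub>(TE n) ?\<iota> r) k = u k \<odot>\<^sub>r\<^sub>(TP k) r" if "k \<le> n" "r \<in> carrier R" "u \<in> carrier (TE n)" for k r u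
    by (rule emb_mult_r[OF that(2,3,1)])
  have in_closed: "?in k y \<in> carrier (TE n)" if "y \<in> carrier (TP k)" for k y
    using that z by auto
  have tr_closed: "?tr m u \<in> carrier (TE n)" if "u \<in> carrier (TE n)" for m u
    using that z by auto
  show "?in k \<in> ahom (TP k) (TE n)" if "k \<le> n" for k
    using in_closed zz by (intro ahomI) (auto simp: fun_eq_iff)
  show "?in k (r \<odot>\<^sub>(TP k) y) = ?\<iota> r \<otimes>\<^sub>(TE n) ?in k y" if k: "k \<le> n" and r: "r \<in> carrier R" and y: "y \<in> carrier (TP k)" for k r y
  proof (rule TE_eqI[OF in_closed[OF lm_closed[OF TPl r y]] TE_mult_closed[OF emb_closed[OF r] in_closed[OF y]]])
    fix j assume j: "j \<le> n"
    show "?in k (r \<odot>\<^sub>(TP k) y) j = (?\<iota> r \<otimes>\<^sub>(TE n) ?in k y) j"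
      unfolding emb_mult_l[OF r in_closed[OF y] j] using j lm_smult_zero[OF TPl r] by simp
  qed
  show "?in k (y \<odot>\<^sub>r\<^sub>(TP k) r) = ?in k y \<otimes>\<^sub>(TE n) ?\<iota> r" if k: "k \<le> n" and r: "r \<in> carrier R" and y: "y \<in> carrier (TP k)" for k r y
  proof (rule TE_eqI[OF in_closed[OF rm_closed[OF TPr r y]] TE_mult_closed[OF in_closed[OF y] emb_closed[OF r]]])
    fix j assume j: "j \<le> n"
    show "?in k (y \<odot>\<^sub>r\<^sub>(TP k) r) j = (?in k y \<otimes>\<^sub>(TE n) ?\<iota> r) j"
      unfolding emb_mult_r[OF r in_closed[OF y] j] using j TP_zero_r[OF r] by simp
  qed
  show "?tr m \<in> ahom (TE n) (TE n)" for m
    using tr_closed[of _ m] zz by (intro ahomI) (auto simp: fun_eq_iff)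
  show "?tr m (u \<otimes>\<^sub>(TE n) ?\<iota> r) = ?tr m u \<otimes>\<^sub>(TE n) ?\<iota> r" if r: "r \<in> carrier R" and u: "u \<in> carrier (TE n)" for m r u
  proof (rule TE_eqI[OF tr_closed[OF TE_mult_closed[OF u emb_closed[OF r]]] TE_mult_closed[OF tr_closed[OF u] emb_closed[OF r]]])
    fix j assume j: "j \<le> n"
    show "?tr m (u \<otimes>\<^sub>(TE n) ?\<iota> r) j = (?tr m u \<otimes>\<^sub>(TE n) ?\<iota> r) j"
      unfolding emb_mult_r[OF r tr_closed[OF u] j] using j TP_zero_r[OF r] emb_mult_r[OF r u j]
      by (simp del: TE_simps)
  qed
  show "?tr 0 u = \<zero>\<^sub>(TE n)" for u by simp
  show "?tr (Suc n) u = u" if "u \<in> carrier (TE n)" for u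
    by (rule TE_eqI[OF tr_closed[OF that] that]) simp
  show "?tr (Suc m) u = ?tr m u \<oplus>\<^sub>(TE n) ?in m (u m)" if m: "m \<le> n" and u: "u \<in> carrier (TE n)" for m u
  proof (rule TE_eqI[OF tr_closed[OF u] ag_closed[OF TE_ag tr_closed[OF u] in_closed[OF TE_comp[OF u m]]]])
    fix j assume j: "j \<le> n"
    show "?tr (Suc m) u j = (?tr m u \<oplus>\<^sub>(TE n) ?in m (u m)) j"
      using j zz ag_l_zero[OF TPag TE_comp[OF u j]] ag_r_zero[OF TPag TE_comp[OF u j]] by (cases j m rule: linorder_cases) auto
  qed
  show "the_scalar \<in> ahom (TP 0) R" by (rule ahomI) (auto simp: TP0_carrier TP0_add)
  show "bij_betw the_scalar (carrier (TP 0)) (carrier R)"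
    by (auto simp: bij_betw_def TP0_carrier inj_on_def image_image)
  show "the_scalar (r \<odot>\<^sub>(TP 0) y) = r \<otimes>\<^sub>R the_scalar y" if "r \<in> carrier R" "y \<in> carrier (TP 0)" for r y
    using that by (auto simp: TP0_carrier TP0_smult)
  show "the_scalar (y \<odot>\<^sub>r\<^sub>(TP 0) r) = the_scalar y \<otimes>\<^sub>R r" if "r \<in> carrier R" "y \<in> carrier (TP 0)" for r y
    using that by (auto simp: TP0_carrier TP0_rsmult)
qed

end

section \<open>Transport of resolutions\<close>

text \<open>\<open>isplit\<close> depends on \<open>I k\<close> and the kernel of \<open>d k\<close>
  only, so an isomorphism in degree \<open>k\<close> that matches the kernels carries it over; no
  map in degree \<open>k + 1\<close> enters.\<close>

lemma isplit_iso:
  assumes a: "a \<in> left_hom R (I k) (I' k)" and b: "b \<in> left_hom R (I' k) (I k)"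
    and ab: "\<And>x. x \<in> carrier (I' k) ==> a (b x) = x" and ba: "\<And>x. x \<in> carrier (I k) ==> b (a x) = x"
    and ker: "\<And>x. x \<in> carrier (I k) ==> d k x = \<zero>\<^sub>(I (Suc k)) \<longleftrightarrow> d' k (a x) = \<zero>\<^sub>(I' (Suc k))"
    and s: "isplit R I d k"
  shows "isplit R I' d' k"
proof -
  obtain t where t: "t \<in> left_hom R (I k) (I k)"
    and td: "\<And>x. x \<in> carrier (I k) ==> d k (t x) = \<zero>\<^sub>(I (Suc k))"
    and tid: "\<And>x. x \<in> carrier (I k) ==> d k x = \<zero>\<^sub>(I (Suc k)) ==> t x = x"
    using s unfolding isplit_def by blast
  have h: "(\<lambda>x. a (t (b x))) \<in> left_hom R (I' k) (I' k)"
    by (rule lh_comp[OF lh_comp[OF b t] a])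
  show ?thesis
    unfolding isplit_def
  proof (rule bexI[OF _ h], intro conjI ballI impI)
    fix x assume x: "x \<in> carrier (I' k)"
    note bx = lh_closed[OF b x]
    show "d' k (a (t (b x))) = \<zero>\<^sub>(I' (Suc k))" using ker[OF lh_closed[OF t bx]] td[OF bx] by simp
    assume "d' k x = \<zero>\<^sub>(I' (Suc k))"
    then have "d k (b x) = \<zero>\<^sub>(I (Suc k))" using ker[OF bx] ab[OF x] by simp
    then show "a (t (b x)) = x" using tid[OF bx] ab[OF x] by simp
  qed
qed

text \<open>\<open>psplit\<close> depends on \<open>P k\<close> and the image of \<open>d k\<close>
  inside it only.\<close>

lemma psplit_iso:
  assumes a: "a \<in> left_hom R (P k) (P' k)" and b: "b \<in> left_hom R (P' k) (P k)"
    and ab: "\<And>x. x \<in> carrier (P' k) ==> a (b x) = x"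
    and im: "\<And>x. x \<in> carrier (P k) ==> x \<in> d k ` carrier (P (Suc k)) \<longleftrightarrow> a x \<in> d' k ` carrier (P' (Suc k))"
    and d': "d' k \<in> left_hom R (P' (Suc k)) (P' k)"
    and s: "psplit R P d k"
  shows "psplit R P' d' k"
proof -
  obtain t where t: "t \<in> left_hom R (P k) (P k)"
    and td: "\<And>x. x \<in> carrier (P k) ==> t x \<in> d k ` carrier (P (Suc k))"
    and tid: "\<And>y. y \<in> carrier (P (Suc k)) ==> t (d k y) = d k y"
    using s unfolding psplit_def by blast
  have h: "(\<lambda>x. a (t (b x))) \<in> left_hom R (P' k) (P' k)"
    by (rule lh_comp[OF lh_comp[OF b t] a])
  show ?thesis
    unfolding psplit_def
  proof (rule bexI[OF _ h], intro conjI ballI)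
    fix x assume x: "x \<in> carrier (P' k)"
    note bx = lh_closed[OF b x]
    show "a (t (b x)) \<in> d' k ` carrier (P' (Suc k))" using im[OF lh_closed[OF t bx]] td[OF bx] by simp
  next
    fix y assume y: "y \<in> carrier (P' (Suc k))"
    note dy = lh_closed[OF d' y]
    note bx = lh_closed[OF b dy]
    have "b (d' k y) \<in> d k ` carrier (P (Suc k))" using im[OF bx] ab[OF dy] y by simp
    then have "t (b (d' k y)) = b (d' k y)" using tid by auto
    then show "a (t (b (d' k y))) = d' k y" using ab[OF dy] by simp
  qed
qed

section \<open>Relabelled resolutions\<close>

context
  fixes R :: "('r, 'e) ring_scheme" and X :: "('r, 'x, 'f) module_scheme"
    and J :: "nat => ('r, 'u) module" and d :: "nat => 'u => 'u" and c :: "nat => 'u => 'v"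
  assumes lJ: "\<And>i. left_module R (J i)" and c: "\<And>i. inj_on (c i) (carrier (J i))"
begin

lemmas pJ = push_inj[OF lJ c]

lemma push_inv: "x \<in> carrier (J i) ==> inv_into (carrier (J i)) (c i) (c i x) = x"
  by (rule inv_into_f_f[OF c])

lemma push_inv': "y \<in> carrier (push (c i) (J i)) ==> c i (inv_into (carrier (J i)) (c i) y) = y"
  by (simp add: push_carrier' f_inv_into_f)

lemma push_eq_zero: "x \<in> carrier (J i) ==> c i x = \<zero>\<^sub>(push (c i) (J i)) \<longleftrightarrow> x = \<zero>\<^sub>(J i)"
  using inj_on_eq_iff[OF c] ag_zero[OF lm_ag[OF lJ]] by (simp add: push_zero')

text \<open>The definition of each dimension fixes the element type of the resolutions it admits;
  coinduced resolutions have another element type and are moved there by injections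
  \<open>c i\<close>.\<close>

lemma right_resolution_push:
  assumes J: "right_resolution R X J d e"
  shows "right_resolution R X (\<lambda>i. push (c i) (J i)) (\<lambda>i y. c (Suc i) (d i (inv_into (carrier (J i)) (c i) y))) (\<lambda>x. c 0 (e x))"
proof -
  note p = right_resolutionD[OF J]
  let ?J = "\<lambda>i. push (c i) (J i)" and ?d = "\<lambda>i y. c (Suc i) (d i (inv_into (carrier (J i)) (c i) y))"
  have dh: "?d i \<in> left_hom R (?J i) (?J (Suc i))" for i
    by (rule lh_comp[OF lh_comp[OF pJ(3) p(3)] pJ(2)])
  have dc: "?d i (c i x) = c (Suc i) (d i x)" if "x \<in> carrier (J i)" for i x
    using push_inv[OF that] by simp
  have k: "a_kernel (?J i) (?J (Suc i)) (?d i) = c i ` a_kernel (J i) (J (Suc i)) (d i)" for i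
    using push_eq_zero[OF lh_closed[OF p(3)]] by (auto simp: a_kernel_eq push_carrier' push_inv push_zero')
  show ?thesis
    unfolding right_resolution_def
  proof (intro conjI allI)
    show "left_module R (?J i)" for i by (rule pJ)
    show "(\<lambda>x. c 0 (e x)) \<in> left_hom R X (?J 0)" by (rule lh_comp[OF p(2) pJ(2)])
    show "?d i \<in> left_hom R (?J i) (?J (Suc i))" for i by (rule dh)
    show "inj_on (\<lambda>x. c 0 (e x)) (carrier X)"
      using p(4) c[of 0] lh_closed[OF p(2)] by (auto simp: inj_on_def)
    show "(\<lambda>x. c 0 (e x)) ` carrier X = a_kernel (?J 0) (?J 1) (?d 0)"
      using k[of 0] J unfolding right_resolution_def by (simp add: image_image[symmetric, of "c 0" e])
    fix i
    have "?d i ` carrier (?J i) = c (Suc i) ` (d i ` carrier (J i))"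
      unfolding push_carrier' image_image using dc by (intro image_cong) auto
    also have "d i ` carrier (J i) = a_kernel (J (Suc i)) (J (Suc (Suc i))) (d (Suc i))"
      using J unfolding right_resolution_def by blast
    finally show "?d i ` carrier (?J i) = a_kernel (?J (Suc i)) (?J (Suc (Suc i))) (?d (Suc i))"
      by (simp only: k)
  qed
qed

lemma isplit_push:
  assumes d: "\<And>i. d i \<in> left_hom R (J i) (J (Suc i))"
  shows "isplit R (\<lambda>i. push (c i) (J i)) (\<lambda>i y. c (Suc i) (d i (inv_into (carrier (J i)) (c i) y))) k \<longleftrightarrow> isplit R J d k"
proof
  let ?b = "inv_into (carrier (J k)) (c k)"
  assume "isplit R (\<lambda>i. push (c i) (J i)) (\<lambda>i y. c (Suc i) (d i (inv_into (carrier (J i)) (c i) y))) k"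
  then show "isplit R J d k"
    by (rule isplit_iso[where a = ?b and b = "c k", rotated -1])
      (use pJ push_inv push_inv' push_eq_zero lh_closed[OF d] lh_closed[OF pJ(3)] in auto)
next
  let ?b = "inv_into (carrier (J k)) (c k)"
  assume "isplit R J d k"
  then show "isplit R (\<lambda>i. push (c i) (J i)) (\<lambda>i y. c (Suc i) (d i (inv_into (carrier (J i)) (c i) y))) k"
    by (rule isplit_iso[where b = ?b and a = "c k", rotated -1])
      (use pJ push_inv push_inv' push_eq_zero lh_closed[OF d] in auto)
qed

lemma left_resolution_push:
  assumes X: "left_module R X" and J: "left_resolution R X J d e"
  shows "left_resolution R X (\<lambda>i. push (c i) (J i)) (\<lambda>i y. c i (d i (inv_into (carrier (J (Suc i))) (c (Suc i)) y)))
    (\<lambda>y. e (inv_into (carrier (J 0)) (c 0) y))"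
proof -
  note p = left_resolutionD[OF J]
  let ?J = "\<lambda>i. push (c i) (J i)" and ?d = "\<lambda>i y. c i (d i (inv_into (carrier (J (Suc i))) (c (Suc i)) y))"
    and ?e = "\<lambda>y. e (inv_into (carrier (J 0)) (c 0) y)"
  have dh: "?d i \<in> left_hom R (?J (Suc i)) (?J i)" for i
    by (rule lh_comp[OF lh_comp[OF pJ(3) p(3)] pJ(2)])
  have dc: "?d i (c (Suc i) x) = c i (d i x)" if "x \<in> carrier (J (Suc i))" for i x
    using push_inv[OF that] by simp
  have im: "?d i ` carrier (?J (Suc i)) = c i ` (d i ` carrier (J (Suc i)))" for i
    unfolding push_carrier' image_image using dc by (intro image_cong) auto
  have k: "a_kernel (?J (Suc i)) (?J i) (?d i) = c (Suc i) ` a_kernel (J (Suc i)) (J i) (d i)" for i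
    using push_eq_zero[OF lh_closed[OF p(3)]] by (auto simp: a_kernel_eq push_carrier' push_inv push_zero')
  show ?thesis
    unfolding left_resolution_def
  proof (intro conjI allI)
    show "left_module R (?J i)" for i by (rule pJ)
    show "?e \<in> left_hom R (?J 0) X" by (rule lh_comp[OF pJ(3) p(2)])
    show "?d i \<in> left_hom R (?J (Suc i)) (?J i)" for i by (rule dh)
    show "?e ` carrier (?J 0) = carrier X"
    proof -
      have "?e ` carrier (?J 0) = e ` carrier (J 0)"
        unfolding push_carrier' image_image using push_inv by (intro image_cong) auto
      then show ?thesis using p(4) by simp
    qed
    have "a_kernel (?J 0) X ?e = c 0 ` a_kernel (J 0) X e"
      by (auto simp: a_kernel_eq push_carrier' push_inv)
    then show "?d 0 ` carrier (?J 1) = a_kernel (?J 0) X ?e"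
      using im[of 0] J unfolding left_resolution_def by simp
    fix i
    show "?d (Suc i) ` carrier (?J (Suc (Suc i))) = a_kernel (?J (Suc i)) (?J i) (?d i)"
      using im[of "Suc i"] J unfolding left_resolution_def k by simp
  qed
qed

lemma psplit_push:
  assumes d: "\<And>i. d i \<in> left_hom R (J (Suc i)) (J i)"
  shows "psplit R (\<lambda>i. push (c i) (J i)) (\<lambda>i y. c i (d i (inv_into (carrier (J (Suc i))) (c (Suc i)) y))) k \<longleftrightarrow> psplit R J d k"
proof -
  let ?d = "\<lambda>i y. c i (d i (inv_into (carrier (J (Suc i))) (c (Suc i)) y))"
  have dh: "?d k \<in> left_hom R (push (c (Suc k)) (J (Suc k))) (push (c k) (J k))"
    by (rule lh_comp[OF lh_comp[OF pJ(3) d] pJ(2)])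
  have im: "?d k ` carrier (push (c (Suc k)) (J (Suc k))) = c k ` (d k ` carrier (J (Suc k)))"
    unfolding push_carrier' image_image using push_inv by (intro image_cong) auto
  have dsub: "d k ` carrier (J (Suc k)) \<subseteq> carrier (J k)" using lh_closed[OF d] by blast
  have imc: "x \<in> d k ` carrier (J (Suc k)) \<longleftrightarrow> c k x \<in> ?d k ` carrier (push (c (Suc k)) (J (Suc k)))" if "x \<in> carrier (J k)" for x
    unfolding im using inj_on_image_mem_iff[OF c that dsub] by simp
  show ?thesis
  proof
    assume "psplit R (\<lambda>i. push (c i) (J i)) ?d k"
    then show "psplit R J d k"
    proof (rule psplit_iso[where a = "inv_into (carrier (J k)) (c k)" and b = "c k", rotated -1])
      fix x assume x: "x \<in> carrier (push (c k) (J k))"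
      show "x \<in> ?d k ` carrier (push (c (Suc k)) (J (Suc k))) \<longleftrightarrow> inv_into (carrier (J k)) (c k) x \<in> d k ` carrier (J (Suc k))"
        using imc[OF lh_closed[OF pJ(3) x]] push_inv'[OF x] by simp
    qed (use pJ push_inv d in auto)
  next
    assume "psplit R J d k"
    then show "psplit R (\<lambda>i. push (c i) (J i)) ?d k"
      by (rule psplit_iso[where b = "inv_into (carrier (J k)) (c k)" and a = "c k", rotated -1])
        (use pJ push_inv' dh imc in auto)
  qed
qed

end

section \<open>Coinduction and injective dimension\<close>

lemma compose_left_hom:
  assumes B: "is_bimodule R S B" and g: "g \<in> left_hom R X Y"
  shows "compose (carrier B) g \<in> left_hom S (hom_module R B X) (hom_module R B Y)"
proof (rule left_homI)
  note b = is_bimoduleD[OF B]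
  fix f assume f: "f \<in> carrier (hom_module R B X)"
  then show "compose (carrier B) g f \<in> carrier (hom_module R B Y)"
    using lh_restrict[OF b(1), of "\<lambda>x. g (f x)" Y] lh_comp[of f R B X g Y] g
    by (simp add: compose_def)
  show "compose (carrier B) g (f \<oplus>\<^sub>(hom_module R B X) h) =
      compose (carrier B) g f \<oplus>\<^sub>(hom_module R B Y) compose (carrier B) g h" if "h \<in> carrier (hom_module R B X)" for h
    using f that by (auto simp: compose_def fun_eq_iff lh_closed lh_add[OF g])
  show "compose (carrier B) g (s \<odot>\<^sub>(hom_module R B X) f) = s \<odot>\<^sub>(hom_module R B Y) compose (carrier B) g f"
    if "s \<in> carrier S" for s
    using that b(2) by (auto simp: compose_def fun_eq_iff rm_closed)
qed

text \<open>Exactness of \<open>Hom(N, I)\<close> in degree \<open>i + 1\<close>, stated for plain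
  functions without \<open>extensional\<close> and without the quotient of \<open>Ext\<close>.
  Degree zero is absent because \<open>Hom\<close> is left exact.\<close>

definition hom_exact ::
    "('r, 'e) ring_scheme => ('r, 'n, 'f) module_scheme => (nat => ('r, 'u, 'g) module_scheme) => (nat => 'u => 'u) => nat => bool" where
  "hom_exact R N I d i \<longleftrightarrow> (\<forall>f\<in>left_hom R N (I (Suc i)).
     (\<forall>y\<in>carrier N. d (Suc i) (f y) = \<zero>\<^sub>(I (Suc (Suc i)))) -->
     (\<exists>g\<in>left_hom R N (I i). \<forall>y\<in>carrier N. f y = d i (g y)))"

text \<open>In a trivial quotient the coset of \<open>z\<close> is \<open>B\<close> itself, and it
  contains \<open>z\<close>.\<close>

lemma trivial_quotient:
  assumes G: "abelian_group G" and triv: "trivial_group (G\<lparr>carrier := Z\<rparr> A_Mod B)" and B: "\<zero>\<^sub>G \<in> B"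
    and Z: "Z \<subseteq> carrier G" and z: "z \<in> Z"
  shows "z \<in> B"
proof -
  have "B +>\<^bsub>G\<lparr>carrier := Z\<rparr>\<^esub> z \<in> carrier (G\<lparr>carrier := Z\<rparr> A_Mod B)"
    using z by (auto simp: A_FactGroup_def FactGroup_def RCOSETS_def a_r_coset_def)
  then have "B +>\<^bsub>G\<lparr>carrier := Z\<rparr>\<^esub> z = \<one>\<^sub>(G\<lparr>carrier := Z\<rparr> A_Mod B)"
    using triv by (simp add: trivial_group_def)
  then have "B +>\<^bsub>G\<lparr>carrier := Z\<rparr>\<^esub> z = B" by (simp add: A_FactGroup_def FactGroup_def)
  moreover have "\<zero>\<^sub>G \<oplus>\<^sub>G z \<in> B +>\<^bsub>G\<lparr>carrier := Z\<rparr>\<^esub> z"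
    using B by (auto simp: a_r_coset_def r_coset_def)
  moreover have "\<zero>\<^sub>G \<oplus>\<^sub>G z = z" using z Z G by (auto simp: ag_l_zero)
  ultimately show ?thesis by simp
qed

text \<open>\<open>I\<close> is the very resolution chosen in the definition of \<open>Ext\<close>,
  so the vanishing can be read off literally.\<close>

lemma Ext_hom_exact:
  assumes N: "is_bimodule R T N" and I: "injective_resolution R X = (I, d, e)" and res: "right_resolution R X I d e"
    and triv: "trivial_group (Ext R N X (Suc i))"
  shows "hom_exact R N I d i"
  unfolding hom_exact_def
proof (intro ballI impI)
  note n = is_bimoduleD[OF N] and p = right_resolutionD[OF res]
  fix f assume f: "f \<in> left_hom R N (I (Suc i))" and df: "\<forall>y\<in>carrier N. d (Suc i) (f y) = \<zero>\<^sub>(I (Suc (Suc i)))"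
  let ?C = "\<lambda>i. hom_module R N (I i)" and ?f = "restrict f (carrier N)"
  have lC: "left_module T (?C j)" for j by (rule lmod_hom_module[OF N p(1)])
  have fC: "?f \<in> carrier (?C (Suc i))" using f lh_restrict[OF n(1), of f "I (Suc i)"] by simp
  let ?Z = "a_kernel (?C (Suc i)) (?C (Suc (Suc i))) (compose (carrier N) (d (Suc i)))"
    and ?B = "compose (carrier N) (d i) ` carrier (?C i)"
  have z: "?f \<in> ?Z" using fC df by (auto simp: a_kernel_eq compose_def fun_eq_iff)
  have tr: "trivial_group ((?C (Suc i))\<lparr>carrier := ?Z\<rparr> A_Mod ?B)"
    using triv by (simp add: Ext_def I Let_def)
  have zB: "\<zero>\<^sub>(?C (Suc i)) \<in> ?B"
    by (rule submod_zero[OF submod_image[OF lC lC compose_left_hom[OF N p(3)]]])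
  have sub: "?Z \<subseteq> carrier (?C (Suc i))" by (auto simp: a_kernel_eq)
  have "?f \<in> ?B" by (rule trivial_quotient[OF lm_ag[OF lC] tr zB sub z])
  then obtain g where g: "g \<in> carrier (?C i)" "?f = compose (carrier N) (d i) g" by blast
  have gh: "g \<in> left_hom R N (I i)" using g(1) by simp
  have "f y = d i (g y)" if "y \<in> carrier N" for y
    using fun_cong[OF g(2), of y] that by (simp add: compose_def)
  then show "\<exists>g\<in>left_hom R N (I i). \<forall>y\<in>carrier N. f y = d i (g y)"
    by (intro bexI[OF _ gh] ballI)
qed

section \<open>Coinduced resolutions over the graded extension\<close>

context graded_extension
begin

lemma R1: "\<one>\<^sub>R \<in> carrier R" and S1: "\<one>\<^sub>S \<in> carrier S"
  using R S by (simp_all add: ring_rules)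

lemmas \<iota>_closed = ring_hom_memE(1)[OF \<iota>] and \<iota>_one = ring_hom_memE(4)[OF \<iota>]
lemmas \<pi>_closed = ring_hom_memE(1)[OF \<pi>] and \<pi>_one = ring_hom_memE(4)[OF \<pi>] and \<pi>_mult = ring_hom_memE(2)[OF \<pi>]
  and \<pi>_add = ring_hom_memE(3)[OF \<pi>]

abbreviation "HB \<equiv> ring_bimodule S \<iota> id"
abbreviation "TB \<equiv> ring_bimodule S id \<iota>"

lemma HB: "is_bimodule R S HB"
  by (rule ring_bimodule_bimodule[OF R S S \<iota> ring_hom_id])

lemma TB: "is_bimodule S R TB"
  by (rule ring_bimodule_bimodule[OF S S R ring_hom_id \<iota>])

lemmas HBl = is_bimoduleD(1)[OF HB] and TBl = is_bimoduleD(1)[OF TB] and TBr = is_bimoduleD(2)[OF TB]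
  and Nl = is_bimoduleD(1)[OF N] and Nr = is_bimoduleD(2)[OF N]

abbreviation "H X \<equiv> hom_module R HB X"

lemma H_left_module: "left_module R X ==> left_module S (H X)"
  by (rule lmod_hom_module[OF HB])

text \<open>\<open>N 0\<close> is free of rank one on the element \<open>y0\<close> with
  \<open>sc y0 = 1\<close>, so it suffices to lift \<open>f y0\<close>. This settles the tensor
  power of degree zero, about which the hypotheses on Ext say nothing.\<close>

lemma hom_exact_zero:
  assumes res: "right_resolution R X I d e"
  shows "hom_exact R (N 0) I d i"
  unfolding hom_exact_def
proof (intro ballI impI)
  note p = right_resolutionD[OF res]
  fix f assume f: "f \<in> left_hom R (N 0) (I (Suc i))" and df: "\<forall>y\<in>carrier (N 0). d (Suc i) (f y) = \<zero>\<^sub>(I (Suc (Suc i)))"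
  obtain y0 where y0: "y0 \<in> carrier (N 0)" "sc y0 = \<one>\<^sub>R"
    using sc(2) R1 by (metis bij_betw_imp_surj_on imageE)
  have scl: "sc y \<in> carrier R" if "y \<in> carrier (N 0)" for y using ahom_closed[OF sc(1) that] .
  have y: "y = sc y \<odot>\<^sub>(N 0) y0" if y: "y \<in> carrier (N 0)" for y
  proof (rule inj_onD[OF bij_betw_imp_inj_on[OF sc(2)] _ y])
    show "sc y \<odot>\<^sub>(N 0) y0 \<in> carrier (N 0)" using lm_closed[OF Nl scl[OF y] y0(1)] .
    show "sc y = sc (sc y \<odot>\<^sub>(N 0) y0)" using sc_l[OF scl[OF y] y0(1)] y0(2) scl[OF y] R by (simp add: ring_r_one)
  qed
  obtain w where w: "w \<in> carrier (I i)" "f y0 = d i w"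
    using p(6)[OF lh_closed[OF f y0(1)]] df y0(1) by auto
  have "sc \<in> left_hom R (N 0) (ring_bimodule R id id)"
    using sc(1) sc_l by (simp add: lh_iff ahom_def)
  moreover have "(\<lambda>r. r \<odot>\<^sub>(I i) w) \<in> left_hom R (ring_bimodule R id id) (I i)"
    using p(1)[of i] w(1) by (intro left_homI) (auto simp: lm_closed lm_l_distr lm_assoc)
  ultimately have h: "(\<lambda>y. sc y \<odot>\<^sub>(I i) w) \<in> left_hom R (N 0) (I i)" by (rule lh_comp)
  have "f y = d i (sc y \<odot>\<^sub>(I i) w)" if "y \<in> carrier (N 0)" for y
    using y[OF that] lh_smult[OF f scl[OF that] y0(1)] lh_smult[OF p(3) scl[OF that] w(1)] w(2) by simp
  then show "\<exists>g\<in>left_hom R (N 0) (I i). \<forall>y\<in>carrier (N 0). f y = d i (g y)"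
    by (intro bexI[OF _ h] ballI)
qed

text \<open>Induction over truncations: if \<open>f \<circ> tr m\<close> factors through
  \<open>d i\<close>, adding a factorization of \<open>f\<close> on the component of degree
  \<open>m\<close> gives one for \<open>tr (Suc m)\<close>. At \<open>Suc n\<close> the truncation
  is the identity.\<close>

lemma hom_exact_S:
  assumes res: "right_resolution R X I d e" and ex: "\<And>k. k \<le> n ==> hom_exact R (N k) I d i"
  shows "hom_exact R HB I d i"
  unfolding hom_exact_def
proof (intro ballI impI)
  note p = right_resolutionD[OF res]
  fix f assume f: "f \<in> left_hom R HB (I (Suc i))" and df: "\<forall>u\<in>carrier HB. d (Suc i) (f u) = \<zero>\<^sub>(I (Suc (Suc i)))"
  have inh: "inn k \<in> left_hom R (N k) HB" if "k \<le> n" for k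
    using inn[OF that] inn_l[OF that] by (simp add: lh_iff ahom_def)
  have prh: "pr k \<in> left_hom R HB (N k)" if "k \<le> n" for k
    using pr[OF that] pr_l[OF that] by (simp add: lh_iff ahom_def)
  have "\<exists>G\<in>left_hom R HB (I i). \<forall>u\<in>carrier S. f (tr m u) = d i (G u)" if "m \<le> Suc n" for m
    using that
  proof (induction m)
    case 0
    have "f (tr 0 u) = d i \<zero>\<^sub>(I i)" if "u \<in> carrier S" for u
      using tr_0[OF that] lh_zero_zero[OF f HBl p(1)] lh_zero_zero[OF p(3) p(1) p(1)] by simp
    then show ?case by (intro bexI[OF _ lh_zero[OF p(1)]] ballI)
  next
    case (Suc m)
    then have m: "m \<le> n" by simp
    have "m \<le> Suc n" using m by simp
    from Suc.IH[OF this]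
    obtain G where G: "G \<in> left_hom R HB (I i)" "\<And>u. u \<in> carrier S ==> f (tr m u) = d i (G u)" by blast
    have fin: "(\<lambda>y. f (inn m y)) \<in> left_hom R (N m) (I (Suc i))" by (rule lh_comp[OF inh[OF m] f])
    have "\<forall>y\<in>carrier (N m). d (Suc i) (f (inn m y)) = \<zero>\<^sub>(I (Suc (Suc i)))"
      using df lh_closed[OF inh[OF m]] by simp
    from mp[OF bspec[OF ex[OF m, unfolded hom_exact_def] fin] this]
    obtain g where g: "g \<in> left_hom R (N m) (I i)" "\<And>y. y \<in> carrier (N m) ==> f (inn m y) = d i (g y)" by blast
    note gp = lh_comp[OF prh[OF m] g(1)]
    have "f (tr (Suc m) u) = d i (G u \<oplus>\<^sub>(I i) g (pr m u))" if u: "u \<in> carrier S" for u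
    proof -
      have c: "tr m u \<in> carrier S" "pr m u \<in> carrier (N m)" "inn m (pr m u) \<in> carrier S"
        using ahom_closed[OF tr u] ahom_closed[OF pr[OF m] u] ahom_closed[OF inn[OF m]] by auto
      have "f (tr (Suc m) u) = f (tr m u) \<oplus>\<^sub>(I (Suc i)) f (inn m (pr m u))"
        using tr_Suc[OF m u] lh_add[OF f, of "tr m u" "inn m (pr m u)"] c by simp
      also have "\<dots> = d i (G u \<oplus>\<^sub>(I i) g (pr m u))"
        using G(2)[OF u] g(2)[OF c(2)] lh_add[OF p(3), of "G u" i "g (pr m u)"]
          lh_closed[OF G(1), of u] lh_closed[OF g(1) c(2)] u by simp
      finally show ?thesis .
    qed
    then show ?case by (intro bexI[OF _ lh_plus[OF G(1) gp p(1)]] ballI)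
  qed
  from this[of "Suc n"] tr_n
  show "\<exists>g\<in>left_hom R HB (I i). \<forall>u\<in>carrier HB. f u = d i (g u)" by auto
qed

text \<open>At \<open>H X\<close> and \<open>H (I 0)\<close> exactness is the left exactness of
  \<open>Hom\<close>; in higher degrees it is \<open>hom_exact_S\<close>.\<close>

lemma H_resolution:
  assumes X: "left_module R X" and res: "right_resolution R X I d e"
    and ex: "\<And>i k. k \<le> n ==> hom_exact R (N k) I d i"
  shows "right_resolution S (H X) (\<lambda>i. H (I i)) (\<lambda>i. compose (carrier S) (d i)) (compose (carrier S) e)"
proof -
  note p = right_resolutionD[OF res]
  have c: "compose (carrier S) g \<in> left_hom S (H Y) (H Y')" if "g \<in> left_hom R Y Y'" for g and Y :: "('r, 'y, 'h) module_scheme" and Y' :: "('r, 'y', 'h') module_scheme"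
    using compose_left_hom[OF HB that] by simp
  have e0: "e x = e y \<longleftrightarrow> x = y" if "x \<in> carrier X" "y \<in> carrier X" for x y
    using inj_on_eq_iff[OF p(4) that] .
  have ker: "f \<in> a_kernel (H (I i)) (H (I (Suc i))) (compose (carrier S) (d i)) \<longleftrightarrow>
      f \<in> left_hom R HB (I i) \<inter> extensional (carrier S) \<and> (\<forall>u\<in>carrier S. d i (f u) = \<zero>\<^sub>(I (Suc i)))" for f i
    by (auto simp: a_kernel_eq compose_def fun_eq_iff)
  have ext: "f = compose (carrier S) g h" if "f \<in> extensional (carrier S)" "\<And>u. u \<in> carrier S ==> f u = g (h u)" for f g and h :: "'s => 'q"
    using that by (auto simp: compose_def extensional_def fun_eq_iff)
  show ?thesis
    unfolding right_resolution_def
  proof (intro conjI allI)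
    show "left_module S (H (I i))" for i by (rule H_left_module[OF p(1)])
    show "compose (carrier S) e \<in> left_hom S (H X) (H (I 0))" by (rule c[OF p(2)])
    show "compose (carrier S) (d i) \<in> left_hom S (H (I i)) (H (I (Suc i)))" for i by (rule c[OF p(3)])
    show "inj_on (compose (carrier S) e) (carrier (H X))"
    proof (rule inj_onI)
      fix f g assume fg: "f \<in> carrier (H X)" "g \<in> carrier (H X)" "compose (carrier S) e f = compose (carrier S) e g"
      have "f u = g u" if "u \<in> carrier S" for u
        using fun_cong[OF fg(3), of u] that fg(1,2) e0 lh_closed[of f R HB X u] lh_closed[of g R HB X u]
        by (simp add: compose_def)
      then show "f = g" using fg(1,2) by (auto intro: extensionalityI[of _ "carrier S"])
    qed
    show "compose (carrier S) e ` carrier (H X) = a_kernel (H (I 0)) (H (I 1)) (compose (carrier S) (d 0))"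
    proof (intro equalityI subsetI)
      fix f assume "f \<in> compose (carrier S) e ` carrier (H X)"
      then obtain g where g: "g \<in> carrier (H X)" "f = compose (carrier S) e g" by blast
      have "f \<in> carrier (H (I 0))" using lh_closed[OF c[OF p(2)] g(1)] g(2) by simp
      moreover have "d 0 (f u) = \<zero>\<^sub>(I 1)" if "u \<in> carrier S" for u
        using p(5)[OF lh_closed[OF p(2)], of "g u"] lh_closed[of g R HB X u] g that by (auto simp: compose_def)
      ultimately show "f \<in> a_kernel (H (I 0)) (H (I 1)) (compose (carrier S) (d 0))" using ker[of f 0] by simp
    next
      fix f assume "f \<in> a_kernel (H (I 0)) (H (I 1)) (compose (carrier S) (d 0))"
      then have f: "f \<in> left_hom R HB (I 0)" "f \<in> extensional (carrier S)" "\<And>u. u \<in> carrier S ==> d 0 (f u) = \<zero>\<^sub>(I 1)"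
        using ker[of f 0] by auto
      \<comment> \<open>\<open>f\<close> takes its values in the image of \<open>e\<close>; as
        \<open>e\<close> is injective, pulling the values back is linear.\<close>
      let ?g = "\<lambda>u. inv_into (carrier X) e (f u)"
      have fe: "f u \<in> e ` carrier X" if "u \<in> carrier S" for u
        using p(5)[OF lh_closed[OF f(1)], of u] f(3)[OF that] that by simp
      have gX: "?g u \<in> carrier X" and eg: "e (?g u) = f u" if "u \<in> carrier S" for u
        using fe[OF that] by (auto intro: inv_into_into f_inv_into_f)
      have "?g \<in> left_hom R HB X"
      proof (rule left_homI)
        fix u v assume uv: "u \<in> carrier HB" "v \<in> carrier HB"
        then have s: "u \<oplus>\<^sub>S v \<in> carrier S" using S by (simp add: ring_rules)
        have "e (?g (u \<oplus>\<^sub>S v)) = e (?g u \<oplus>\<^sub>X ?g v)"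
          using eg[OF s] eg[of u] eg[of v] gX[of u] gX[of v] uv lh_add[OF f(1), of u v] lh_add[OF p(2), of "?g u" "?g v"] by simp
        then show "?g (u \<oplus>\<^sub>HB v) = ?g u \<oplus>\<^sub>X ?g v"
          using e0 gX[OF s] gX[of u] gX[of v] uv lm_ag[OF X] by (simp add: ag_closed)
      next
        fix r u assume ru: "r \<in> carrier R" "u \<in> carrier HB"
        then have s: "\<iota> r \<otimes>\<^sub>S u \<in> carrier S" using S \<iota>_closed by (simp add: ring_rules)
        have "e (?g (\<iota> r \<otimes>\<^sub>S u)) = e (r \<odot>\<^sub>X ?g u)"
          using eg[OF s] eg[of u] gX[of u] ru lh_smult[OF f(1), of r u] lh_smult[OF p(2), of r "?g u"] by simp
        then show "?g (r \<odot>\<^sub>HB u) = r \<odot>\<^sub>X ?g u"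
          using e0 gX[OF s] gX[of u] ru lm_closed[OF X] by simp
      qed (use gX in simp)
      then have "restrict ?g (carrier S) \<in> carrier (H X)" using lh_restrict[OF HBl, of ?g X] by simp
      moreover have "f = compose (carrier S) e (restrict ?g (carrier S))"
        by (rule ext[OF f(2)]) (use eg in simp)
      ultimately show "f \<in> compose (carrier S) e ` carrier (H X)" by blast
    qed
    fix i
    show "compose (carrier S) (d i) ` carrier (H (I i)) =
        a_kernel (H (I (Suc i))) (H (I (Suc (Suc i)))) (compose (carrier S) (d (Suc i)))"
    proof (intro equalityI subsetI)
      fix f assume "f \<in> compose (carrier S) (d i) ` carrier (H (I i))"
      then obtain g where g: "g \<in> carrier (H (I i))" "f = compose (carrier S) (d i) g" by blast
      have "f \<in> carrier (H (I (Suc i)))" using lh_closed[OF c[OF p(3)] g(1)] g(2) by simp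
      moreover have "d (Suc i) (f u) = \<zero>\<^sub>(I (Suc (Suc i)))" if "u \<in> carrier S" for u
        using p(6)[OF lh_closed[OF p(3)], of "g u" i] lh_closed[of g R HB "I i" u] g that by (auto simp: compose_def)
      ultimately show "f \<in> a_kernel (H (I (Suc i))) (H (I (Suc (Suc i)))) (compose (carrier S) (d (Suc i)))"
        using ker[of f "Suc i"] by simp
    next
      fix f assume "f \<in> a_kernel (H (I (Suc i))) (H (I (Suc (Suc i)))) (compose (carrier S) (d (Suc i)))"
      then have f: "f \<in> left_hom R HB (I (Suc i))" "f \<in> extensional (carrier S)"
        "\<And>u. u \<in> carrier S ==> d (Suc i) (f u) = \<zero>\<^sub>(I (Suc (Suc i)))"
        using ker[of f "Suc i"] by auto
      obtain g where g: "g \<in> left_hom R HB (I i)" "\<And>u. u \<in> carrier S ==> f u = d i (g u)"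
        using hom_exact_S[OF res ex] f(1,3) unfolding hom_exact_def by (metis ring_bimodule_simps(1))
      have "restrict g (carrier S) \<in> carrier (H (I i))" using lh_restrict[OF HBl, of g "I i"] g(1) by simp
      moreover have "f = compose (carrier S) (d i) (restrict g (carrier S))"
        by (rule ext[OF f(2)]) (use g(2) in simp)
      ultimately show "f \<in> compose (carrier S) (d i) ` carrier (H (I i))" by blast
    qed
  qed
qed

text \<open>A splitting over \<open>R\<close> is composed with each map. Back from \<open>S\<close>,
  embed \<open>I k\<close> into \<open>H (I k)\<close> through \<open>\<pi>\<close>, apply
  \<open>t\<close> and evaluate at one; embedding followed by evaluation is the identity.\<close>

lemma H_isplit_iff:
  assumes lI: "\<And>i. left_module R (I i)" and d: "\<And>i. d i \<in> left_hom R (I i) (I (Suc i))"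
  shows "isplit S (\<lambda>i. H (I i)) (\<lambda>i. compose (carrier S) (d i)) k \<longleftrightarrow> isplit R I d k"
proof
  assume "isplit R I d k"
  then obtain t where t: "t \<in> left_hom R (I k) (I k)"
    and td: "\<And>x. x \<in> carrier (I k) ==> d k (t x) = \<zero>\<^sub>(I (Suc k))"
    and tid: "\<And>x. x \<in> carrier (I k) ==> d k x = \<zero>\<^sub>(I (Suc k)) ==> t x = x"
    unfolding isplit_def by blast
  have h: "compose (carrier S) t \<in> left_hom S (H (I k)) (H (I k))" using compose_left_hom[OF HB t] by simp
  show "isplit S (\<lambda>i. H (I i)) (\<lambda>i. compose (carrier S) (d i)) k"
    unfolding isplit_def
  proof (rule bexI[OF _ h], intro conjI ballI impI)
    fix f assume f: "f \<in> carrier (H (I k))"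
    then have fI: "f u \<in> carrier (I k)" if "u \<in> carrier S" for u using that lh_closed[of f R HB "I k" u] by simp
    show "compose (carrier S) (d k) (compose (carrier S) t f) = \<zero>\<^sub>(H (I (Suc k)))"
      using fI td by (auto simp: compose_def fun_eq_iff)
    assume z: "compose (carrier S) (d k) f = \<zero>\<^sub>(H (I (Suc k)))"
    have "d k (f u) = \<zero>\<^sub>(I (Suc k))" if "u \<in> carrier S" for u
      using fun_cong[OF z, of u] that by (simp add: compose_def)
    then show "compose (carrier S) t f = f"
      using f fI tid by (auto simp: compose_def fun_eq_iff extensional_def)
  qed
next
  assume "isplit S (\<lambda>i. H (I i)) (\<lambda>i. compose (carrier S) (d i)) k"
  then obtain t where t: "t \<in> left_hom S (H (I k)) (H (I k))"
    and td: "\<And>x. x \<in> carrier (H (I k)) ==> compose (carrier S) (d k) (t x) = \<zero>\<^sub>(H (I (Suc k)))"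
    and tid: "\<And>x. x \<in> carrier (H (I k)) ==> compose (carrier S) (d k) x = \<zero>\<^sub>(H (I (Suc k))) ==> t x = x"
    unfolding isplit_def by blast
  \<comment> \<open>\<open>?p x\<close> is the map \<open>R \<rightarrow> I k\<close> determined by
    \<open>x\<close>, composed with \<open>\<pi>\<close>; it is linear over \<open>R\<close> because
    \<open>\<pi>\<close> undoes \<open>\<iota>\<close>.\<close>
  let ?p = "\<lambda>x. \<lambda>s\<in>carrier S. \<pi> s \<odot>\<^sub>(I k) x"
  have pH: "?p x \<in> carrier (H (I k))" if x: "x \<in> carrier (I k)" for x
  proof -
    have "(\<lambda>s. \<pi> s \<odot>\<^sub>(I k) x) \<in> left_hom R HB (I k)"
      using x lI[of k] \<iota>_closed by (intro left_homI)
        (simp_all add: \<pi>_closed lm_closed \<pi>_add lm_l_distr \<pi>_mult \<pi>\<iota> lm_assoc)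
    then show ?thesis using lh_restrict[OF HBl, of "\<lambda>s. \<pi> s \<odot>\<^sub>(I k) x" "I k"] by simp
  qed
  have tH: "t (?p x) \<in> left_hom R HB (I k)" if "x \<in> carrier (I k)" for x
    using lh_closed[OF t pH[OF that]] by simp
  have h: "(\<lambda>x. t (?p x) \<one>\<^sub>S) \<in> left_hom R (I k) (I k)"
  proof (rule left_homI)
    fix x assume x: "x \<in> carrier (I k)"
    show "t (?p x) \<one>\<^sub>S \<in> carrier (I k)" using lh_closed[OF tH[OF x], of "\<one>\<^sub>S"] S1 by simp
    fix y assume y: "y \<in> carrier (I k)"
    have "?p (x \<oplus>\<^sub>(I k) y) = ?p x \<oplus>\<^sub>(H (I k)) ?p y"
      using x y lI[of k] by (auto simp: fun_eq_iff lm_r_distr \<pi>_closed)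
    then have "t (?p (x \<oplus>\<^sub>(I k) y)) = t (?p x) \<oplus>\<^sub>(H (I k)) t (?p y)"
      using lh_add[OF t pH[OF x] pH[OF y]] by (simp only:)
    then show "t (?p (x \<oplus>\<^sub>(I k) y)) \<one>\<^sub>S = t (?p x) \<one>\<^sub>S \<oplus>\<^sub>(I k) t (?p y) \<one>\<^sub>S"
      using S1 by simp
  next
    fix r x assume r: "r \<in> carrier R" and x: "x \<in> carrier (I k)"
    note ir = \<iota>_closed[OF r]
    have "?p (r \<odot>\<^sub>(I k) x) = \<iota> r \<odot>\<^sub>(H (I k)) ?p x"
      using x r ir lI[of k] S by (auto simp: fun_eq_iff lm_assoc[symmetric] \<pi>_closed \<pi>_mult \<pi>\<iota> ring_rules)
    then have "t (?p (r \<odot>\<^sub>(I k) x)) = \<iota> r \<odot>\<^sub>(H (I k)) t (?p x)"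
      using lh_smult[OF t ir pH[OF x]] by (simp only:)
    then have "t (?p (r \<odot>\<^sub>(I k) x)) \<one>\<^sub>S = t (?p x) (\<iota> r \<otimes>\<^sub>S \<one>\<^sub>S)"
      using S1 ir S by (simp add: ring_rules ring_r_one)
    also have "\<dots> = r \<odot>\<^sub>(I k) t (?p x) \<one>\<^sub>S"
      using lh_smult[OF tH[OF x] r, of "\<one>\<^sub>S"] S1 by simp
    finally show "t (?p (r \<odot>\<^sub>(I k) x)) \<one>\<^sub>S = r \<odot>\<^sub>(I k) t (?p x) \<one>\<^sub>S" .
  qed
  have "d k (t (?p x) \<one>\<^sub>S) = \<zero>\<^sub>(I (Suc k))" if "x \<in> carrier (I k)" for x
    using fun_cong[OF td[OF pH[OF that]], of "\<one>\<^sub>S"] S1 by (simp add: compose_def)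
  moreover have "t (?p x) \<one>\<^sub>S = x" if x: "x \<in> carrier (I k)" and z: "d k x = \<zero>\<^sub>(I (Suc k))" for x
  proof -
    have "compose (carrier S) (d k) (?p x) = \<zero>\<^sub>(H (I (Suc k)))"
      using x z lh_smult[OF d \<pi>_closed x] lm_smult_zero[OF lI \<pi>_closed]
      by (auto simp: compose_def fun_eq_iff)
    then have "t (?p x) = ?p x" by (rule tid[OF pH[OF x]])
    then show ?thesis using S1 x lI[of k] by (simp add: \<pi>_one lm_one)
  qed
  ultimately show "isplit R I d k"
    unfolding isplit_def by (intro bexI[OF _ h] conjI ballI impI)
qed

text \<open>Everything is read off from the resolution chosen in the definition of Ext and from its
  relabelled image under \<open>H\<close>. The injection \<open>i0\<close> is one of element types,
  since universes are built from types and not from carriers.\<close>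

theorem H_injd:
  fixes X :: "('r, 'x, 'f) module_scheme" and i0 :: "'r => 's"
  assumes X: "left_module R X" and i0: "inj i0"
    and Ext: "\<And>k j. k \<ge> 1 ==> j \<ge> 1 ==> trivial_group (Ext R (N k) X j)"
  shows "injd S (H X) = injd R X"
proof -
  obtain I d e where Ide: "injective_resolution R X = (I, d, e)" by (cases "injective_resolution R X") auto
  have "case injective_resolution R X of (I, d, e) => right_resolution R X I d e \<and> (\<forall>i. injective_module R (I i))"
    unfolding injective_resolution_def
    by (rule someI_ex) (use injective_resolution_exists[OF X] in auto)
  then have res: "right_resolution R X I d e" and inj: "\<And>i. baer R (I i)"
    by (auto simp: Ide injective_module_iff_baer)
  note p = right_resolutionD[OF res]
  have "hom_exact R (N k) I d i" for i k
  proof (cases k)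
    case 0 then show ?thesis using hom_exact_zero[OF res] by simp
  next
    case (Suc k') then show ?thesis using Ext_hom_exact[OF N Ide res] Ext by simp
  qed
  then have Hres: "right_resolution S (H X) (\<lambda>i. H (I i)) (\<lambda>i. compose (carrier S) (d i)) (compose (carrier S) e)"
    by (rule H_resolution[OF X res])
  have "inj (\<lambda>(x :: 'x) (s :: 's). x)" by (auto simp: inj_def fun_eq_iff)
  then obtain u :: "('r, 'x) univ => ('s, 's => 'x) univ" where "inj u"
    using univ_embed_univ[OF i0] by blast
  then obtain c :: "('s => ('r, 'x) univ) => ('s, 's => 'x) univ" where c: "inj c"
    using univ_embed_fun by blast
  have cI: "inj_on c (carrier (H (I i)))" for i using c by (auto intro: inj_on_subset)
  note lH = H_left_module[OF p(1)]
  have iff: "injd_le S (H X) k \<longleftrightarrow> injd_le R X k" for k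
  proof -
    note r = right_resolution_push[where c = "\<lambda>_. c" and J = "\<lambda>i. H (I i)", OF lH cI Hres]
    have b: "baer S (push c (H (I i)))" for i by (rule baer_push[OF coinduced_baer[OF inj S \<iota>] cI])
    have "injd_le S (H X) k \<longleftrightarrow> isplit S (\<lambda>i. push c (H (I i)))
        (\<lambda>i y. c (compose (carrier S) (d i) (inv_into (carrier (H (I i))) c y))) k"
      by (rule injd_le_iff_isplit[where I = "\<lambda>i. push c (H (I i))", OF H_left_module[OF X] r b])
    also have "\<dots> \<longleftrightarrow> isplit S (\<lambda>i. H (I i)) (\<lambda>i. compose (carrier S) (d i)) k"
      by (rule isplit_push[where c = "\<lambda>_. c" and J = "\<lambda>i. H (I i)", OF lH cI right_resolutionD(3)[OF Hres]])
    also have "\<dots> \<longleftrightarrow> isplit R I d k" by (rule H_isplit_iff[where I = I and d = d, OF p(1,3)])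
    also have "\<dots> \<longleftrightarrow> injd_le R X k" by (rule injd_le_iff_isplit[OF X res inj, symmetric])
    finally show ?thesis .
  qed
  show ?thesis by (simp only: injd_eq iff)
qed

end

section \<open>Induction and projective dimension\<close>

abbreviation tmap ::
    "('r, 'e) ring_scheme => ('s, 'r, 'n, 'f) bimodule_scheme => ('r, 'y, 'g) module_scheme
      => ('x => 'y) => ('n \<times> 'x \<Rightarrow>\<^sub>0 int) set => ('n \<times> 'y \<Rightarrow>\<^sub>0 int) set" where
  "tmap R N Y g \<equiv> tensor_map R N Y id g"

lemma tmap_props:
  assumes N: "right_module R N" and X: "left_module R X" and Y: "left_module R Y" and g: "g \<in> left_hom R X Y"
  shows "tmap R N Y g \<in> ahom (tensor_module R N X) (tensor_module R N Y)"
    and "a \<in> carrier N ==> x \<in> carrier X ==> tmap R N Y g (tensor_pure R N X a x) = tensor_pure R N Y a (g x)"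
proof -
  have i: "id \<in> ahom N N" by (auto intro: ahomI)
  have i': "id (a \<odot>\<^sub>r\<^sub>N r) = id a \<odot>\<^sub>r\<^sub>N r" for a r by simp
  note p = tensor_map_props[OF N X N Y i i' g]
  show "tmap R N Y g \<in> ahom (tensor_module R N X) (tensor_module R N Y)" by (rule p(1))
  show "tmap R N Y g (tensor_pure R N X a x) = tensor_pure R N Y a (g x)" if "a \<in> carrier N" "x \<in> carrier X"
    by (simp only: p(2)[OF that] id_apply)
qed

lemma tmap_left_hom:
  assumes N: "is_bimodule S R N" and X: "left_module R X" and Y: "left_module R Y" and g: "g \<in> left_hom R X Y"
  shows "tmap R N Y g \<in> left_hom S (tensor_module R N X) (tensor_module R N Y)"
  unfolding lh_iff
proof (intro conjI ballI)
  note n = is_bimoduleD[OF N]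
  note t = tmap_props[OF n(2) X Y g]
  show "tmap R N Y g \<in> ahom (tensor_module R N X) (tensor_module R N Y)" by (rule t(1))
  fix s u assume s: "s \<in> carrier S" and u: "u \<in> carrier (tensor_module R N X)"
  note p = tensor_smult_props[OF N X s] and q = tensor_smult_props[OF N Y s]
  show "tmap R N Y g (s \<odot>\<^sub>(tensor_module R N X) u) = s \<odot>\<^sub>(tensor_module R N Y) tmap R N Y g u"
    by (rule is_tensor_eq[OF is_tensor_tensor_module[OF n(2) X] agrp_tensor[OF n(2) Y]
        ahom_comp[OF p(1) t(1)] ahom_comp[OF t(1) q(1)] _ u])
      (simp add: p(2) q(2) t(2) lm_closed[OF n(1) s] lh_closed[OF g])
qed

lemma tmap_comp_zero:
  assumes N: "right_module R N" and X: "left_module R X" and Y: "left_module R Y" and Z: "left_module R Z"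
    and f: "f \<in> left_hom R X Y" and g: "g \<in> left_hom R Y Z" and gf: "\<And>x. x \<in> carrier X ==> g (f x) = \<zero>\<^sub>Z"
    and u: "u \<in> carrier (tensor_module R N X)"
  shows "tmap R N Z g (tmap R N Y f u) = \<zero>\<^sub>(tensor_module R N Z)"
proof -
  note tf = tmap_props[OF N X Y f] and tg = tmap_props[OF N Y Z g]
  note ag = agrp_tensor[OF N Z]
  have z: "(\<lambda>u. \<zero>\<^sub>(tensor_module R N Z)) \<in> ahom (tensor_module R N X) (tensor_module R N Z)"
    by (rule ahomI) (simp_all add: ag_zero[OF ag] ag_l_zero[OF ag])
  show ?thesis
    by (rule is_tensor_eq[OF is_tensor_tensor_module[OF N X] ag ahom_comp[OF tf(1) tg(1)] z _ u])
      (simp add: tf(2) tg(2) lh_closed[OF f] gf is_tensor_bilinear_eq_zero[OF is_tensor_tensor_module[OF N Z]])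
qed

text \<open>Exactness of \<open>N \<otimes> P\<close> in degree \<open>i + 1\<close>, the place of
  \<open>Tor\<close> of index \<open>i + 1\<close>; degree zero is left to right exactness.\<close>

definition tensor_exact ::
    "('r, 'e) ring_scheme => ('s, 'r, 'n, 'f) bimodule_scheme => (nat => ('r, 'u, 'g) module_scheme) => (nat => 'u => 'u) => nat => bool" where
  "tensor_exact R N P d i \<longleftrightarrow> (\<forall>u\<in>carrier (tensor_module R N (P (Suc i))).
     tmap R N (P i) (d i) u = \<zero>\<^sub>(tensor_module R N (P i)) -->
     u \<in> tmap R N (P (Suc i)) (d (Suc i)) ` carrier (tensor_module R N (P (Suc (Suc i)))))"

lemma Tor_tensor_exact:
  assumes N: "is_bimodule T R N" and P: "projective_resolution R X = (P, d, e)" and res: "left_resolution R X P d e"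
    and triv: "trivial_group (Tor R N X (Suc i))"
  shows "tensor_exact R N P d i"
  unfolding tensor_exact_def
proof (intro ballI impI)
  note n = is_bimoduleD[OF N] and p = left_resolutionD[OF res]
  let ?C = "\<lambda>i. tensor_module R N (P i)" and ?D = "\<lambda>i. tmap R N (P i) (d i)"
  fix u assume u: "u \<in> carrier (?C (Suc i))" and du: "?D i u = \<zero>\<^sub>(?C i)"
  let ?Z = "a_kernel (?C (Suc i)) (?C i) (?D i)" and ?B = "?D (Suc i) ` carrier (?C (Suc (Suc i)))"
  have lC: "left_module T (?C j)" for j by (rule lmod_tensor_module[OF N p(1)])
  have z: "u \<in> ?Z" using u du by (simp add: a_kernel_eq)
  have tr: "trivial_group ((?C (Suc i))\<lparr>carrier := ?Z\<rparr> A_Mod ?B)"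
    using triv by (simp add: Tor_def P Let_def)
  have zB: "\<zero>\<^sub>(?C (Suc i)) \<in> ?B"
    by (rule submod_zero[OF submod_image[OF lC lC tmap_left_hom[OF N p(1) p(1) p(3)]]])
  have sub: "?Z \<subseteq> carrier (?C (Suc i))" by (auto simp: a_kernel_eq)
  show "u \<in> ?B" by (rule trivial_quotient[OF lm_ag[OF lC] tr zB sub z])
qed

definition restrict_scalars :: "('r => 's) => ('s, 'y, 'f) module_scheme => ('r, 'y) module" where
  "restrict_scalars f Y = \<lparr>carrier = carrier Y, mult = undefined, one = undefined, ring.zero = \<zero>\<^sub>Y, add = add Y,
     smult = (\<lambda>r y. f r \<odot>\<^sub>Y y)\<rparr>"

lemma restrict_scalars_simps [simp]:
  "carrier (restrict_scalars f Y) = carrier Y" "\<zero>\<^sub>(restrict_scalars f Y) = \<zero>\<^sub>Y"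
  "x \<oplus>\<^sub>(restrict_scalars f Y) y = x \<oplus>\<^sub>Y y" "r \<odot>\<^sub>(restrict_scalars f Y) y = f r \<odot>\<^sub>Y y"
  by (simp_all add: restrict_scalars_def)

lemma lmod_restrict_scalars:
  assumes Y: "left_module S Y" and R: "ring R" and f: "f \<in> ring_hom R S"
  shows "left_module R (restrict_scalars f Y)"
proof -
  have "abelian_group (restrict_scalars f Y)"
    by (rule agrp_transfer[OF lm_ag[OF Y]]) simp_all
  then show ?thesis
    by (intro left_moduleI) (use Y R ring_hom_memE[OF f] in \<open>simp_all add: lm_closed lm_l_distr lm_r_distr lm_assoc lm_one\<close>)
qed

section \<open>Induced resolutions over the graded extension\<close>

context graded_extension
begin

abbreviation "T X \<equiv> tensor_module R TB X"
abbreviation "\<tau> X \<equiv> tensor_pure R TB X"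

lemma T_left_module: "left_module R X ==> left_module S (T X)"
  by (rule lmod_tensor_module[OF TB])

lemma T_is_tensor: "left_module R X ==> is_tensor R TB X (T X) (\<tau> X)"
  by (rule is_tensor_tensor_module[OF TBr])

lemma T_smult:
  "left_module R X ==> s \<in> carrier S ==> u \<in> carrier S ==> x \<in> carrier X ==> s \<odot>\<^sub>(T X) \<tau> X u x = \<tau> X (s \<otimes>\<^sub>S u) x"
  using tensor_smult_props(2)[OF TB, of X s u x] by simp

lemma T_balanced:
  assumes X: "left_module R X"
  shows "u \<in> carrier S ==> x \<in> carrier X ==> \<tau> X u x \<in> carrier (T X)"
    "u \<in> carrier S ==> v \<in> carrier S ==> x \<in> carrier X ==> \<tau> X (u \<oplus>\<^sub>S v) x = \<tau> X u x \<oplus>\<^sub>(T X) \<tau> X v x"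
    "u \<in> carrier S ==> x \<in> carrier X ==> y \<in> carrier X ==> \<tau> X u (x \<oplus>\<^sub>X y) = \<tau> X u x \<oplus>\<^sub>(T X) \<tau> X u y"
    "u \<in> carrier S ==> r \<in> carrier R ==> x \<in> carrier X ==> \<tau> X (u \<otimes>\<^sub>S \<iota> r) x = \<tau> X u (r \<odot>\<^sub>X x)"
  using balancedD[OF tensor_pure_balanced[OF TBr X]] by simp_all

text \<open>The unit of the adjunction between induction along \<open>\<iota>\<close> and
  restriction of scalars.\<close>

lemma \<tau>_one_hom:
  assumes X: "left_module R X"
  shows "\<tau> X \<one>\<^sub>S \<in> left_hom R X (restrict_scalars \<iota> (T X))"
proof (rule left_homI)
  fix r x assume r: "r \<in> carrier R" and x: "x \<in> carrier X"
  have "\<tau> X \<one>\<^sub>S (r \<odot>\<^sub>X x) = \<tau> X (\<iota> r \<otimes>\<^sub>S \<one>\<^sub>S) x"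
    using T_balanced(4)[OF X S1 r x] \<iota>_closed[OF r] S by (simp add: ring_rules ring_r_one)
  then show "\<tau> X \<one>\<^sub>S (r \<odot>\<^sub>X x) = r \<odot>\<^sub>(restrict_scalars \<iota> (T X)) \<tau> X \<one>\<^sub>S x"
    using T_smult[OF X \<iota>_closed[OF r] S1 x] by simp
qed (use T_balanced[OF X] S1 in simp_all)

text \<open>The adjunction itself: \<open>s \<otimes> x \<mapsto> s (g x)\<close> is balanced
  because \<open>g\<close> is linear through \<open>\<iota>\<close>.\<close>

lemma T_universal:
  assumes X: "left_module R X" and Y: "left_module S Y" and g: "g \<in> left_hom R X (restrict_scalars \<iota> Y)"
  obtains h where "h \<in> left_hom S (T X) Y" "\<And>s x. s \<in> carrier S ==> x \<in> carrier X ==> h (\<tau> X s x) = s \<odot>\<^sub>Y g x"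
proof -
  note agY = lm_ag[OF Y] and it = T_is_tensor[OF X]
  have gY: "g x \<in> carrier Y" if "x \<in> carrier X" for x using lh_closed[OF g that] by simp
  have "balanced R TB X Y (\<lambda>s x. s \<odot>\<^sub>Y g x)"
    by (rule balancedI) (use gY lh_add[OF g] lh_smult[OF g] \<iota>_closed in
        \<open>simp_all add: lm_closed[OF Y] lm_l_distr[OF Y] lm_r_distr[OF Y] lm_assoc[OF Y]\<close>)
  from is_tensor_universal[OF it agY this]
  obtain h where h: "h \<in> ahom (T X) Y" and h\<tau>': "\<And>a x. a \<in> carrier TB ==> x \<in> carrier X ==> h (\<tau> X a x) = a \<odot>\<^sub>Y g x" by metis
  have h\<tau>: "h (\<tau> X a x) = a \<odot>\<^sub>Y g x" if "a \<in> carrier S" "x \<in> carrier X" for a x using h\<tau>' that by simp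
  have "h (s \<odot>\<^sub>(T X) u) = s \<odot>\<^sub>Y h u" if s: "s \<in> carrier S" and u: "u \<in> carrier (T X)" for s u
  proof (rule is_tensor_eq[OF it agY ahom_comp[OF tensor_smult_props(1)[OF TB X s] h] ahom_comp[OF h lm_smult_ahom[OF Y s]] _ u])
    fix a x assume a: "a \<in> carrier TB" and x: "x \<in> carrier X"
    then have aS: "a \<in> carrier S" "s \<otimes>\<^sub>S a \<in> carrier S" using s S by (simp_all add: ring_rules)
    show "h (s \<odot>\<^sub>(T X) \<tau> X a x) = s \<odot>\<^sub>Y h (\<tau> X a x)"
      unfolding T_smult[OF X s aS(1) x] h\<tau>[OF aS(2) x] h\<tau>[OF aS(1) x]
      by (rule lm_assoc[OF Y s aS(1) gY[OF x]])
  qed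
  then have "h \<in> left_hom S (T X) Y" using h by (simp add: lh_iff)
  then show ?thesis using that h\<tau> by blast
qed

lemma T_hom_eq:
  assumes X: "left_module R X" and G: "abelian_group G" and h: "h \<in> ahom (T X) G" and h': "h' \<in> ahom (T X) G"
    and eq: "\<And>s x. s \<in> carrier S ==> x \<in> carrier X ==> h (\<tau> X s x) = h' (\<tau> X s x)" and u: "u \<in> carrier (T X)"
  shows "h u = h' u"
  by (rule is_tensor_eq[OF T_is_tensor[OF X] G h h' _ u]) (use eq in simp)

text \<open>The adjunction carries the lifting problem to \<open>R\<close>: lift
  \<open>x \<mapsto> f (1 \<otimes> x)\<close> by \<open>projective_lift\<close>, then extend the
  lift to \<open>T P\<close>.\<close>

lemma T_lift:
  assumes P: "projective_module R P" and B: "left_module S B" and C: "left_module S C" and g: "g \<in> left_hom S B C"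
    and f: "f \<in> left_hom S (T P) C" and fg: "f ` carrier (T P) \<subseteq> g ` carrier B"
  obtains h where "h \<in> left_hom S (T P) B" "\<And>u. u \<in> carrier (T P) ==> g (h u) = f u"
proof -
  have lP: "left_module R P" using P by (simp add: projective_module_def)
  note rB = lmod_restrict_scalars[OF B R \<iota>] and rC = lmod_restrict_scalars[OF C R \<iota>]
  have fh: "f \<in> left_hom R (restrict_scalars \<iota> (T P)) (restrict_scalars \<iota> C)"
    using f \<iota>_closed by (auto simp: left_hom_def)
  have gh: "g \<in> left_hom R (restrict_scalars \<iota> B) (restrict_scalars \<iota> C)"
    using g \<iota>_closed by (auto simp: left_hom_def)
  note f1 = lh_comp[OF \<tau>_one_hom[OF lP] fh]
  have "(\<lambda>x. f (\<tau> P \<one>\<^sub>S x)) ` carrier P \<subseteq> g ` carrier (restrict_scalars \<iota> B)"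
    using fg T_balanced(1)[OF lP S1] by auto
  from projective_lift[OF P rB rC gh f1 this]
  obtain k where k: "k \<in> left_hom R P (restrict_scalars \<iota> B)" "\<And>x. x \<in> carrier P ==> g (k x) = f (\<tau> P \<one>\<^sub>S x)" by metis
  obtain h where h: "h \<in> left_hom S (T P) B" "\<And>s x. s \<in> carrier S ==> x \<in> carrier P ==> h (\<tau> P s x) = s \<odot>\<^sub>B k x"
    using T_universal[OF lP B k(1)] by metis
  have kB: "k x \<in> carrier B" if "x \<in> carrier P" for x using lh_closed[OF k(1) that] by simp
  have "g (h u) = f u" if u: "u \<in> carrier (T P)" for u
  proof (rule T_hom_eq[OF lP lm_ag[OF C] ahom_comp[OF lh_ahom[OF h(1)] lh_ahom[OF g]] lh_ahom[OF f] _ u])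
    fix s x assume s: "s \<in> carrier S" and x: "x \<in> carrier P"
    have "g (h (\<tau> P s x)) = s \<odot>\<^sub>C f (\<tau> P \<one>\<^sub>S x)"
      using h(2)[OF s x] lh_smult[OF g s kB[OF x]] k(2)[OF x] by simp
    also have "\<dots> = f (\<tau> P (s \<otimes>\<^sub>S \<one>\<^sub>S) x)"
      using lh_smult[OF f s T_balanced(1)[OF lP S1 x]] T_smult[OF lP s S1 x] by simp
    finally show "g (h (\<tau> P s x)) = f (\<tau> P s x)" using s S by (simp add: ring_r_one)
  qed
  then show ?thesis using that h(1) by blast
qed

lemma T_projective:
  fixes c :: "('s \<times> 'p \<Rightarrow>\<^sub>0 int) set => 'q" and P :: "('r, 'p, 'f) module_scheme"
  assumes P: "projective_module R P" and c: "inj_on c (carrier (T P))"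
  shows "projective_module S (push c (T P))"
  unfolding projective_module_def
proof (intro conjI allI impI)
  have lP: "left_module R P" using P by (simp add: projective_module_def)
  note pc = push_inj[OF T_left_module[OF lP] c]
  show "left_module S (push c (T P))" by (rule pc)
  fix B C :: "('s, ('s, 'q) univ) module" and g f
  assume B: "left_module S B" and C: "left_module S C" and g: "g \<in> left_hom S B C"
    and gs: "g ` carrier B = carrier C" and f: "f \<in> left_hom S (push c (T P)) C"
  note fc = lh_comp[OF pc(2) f]
  have "(\<lambda>u. f (c u)) ` carrier (T P) \<subseteq> g ` carrier B" using lh_closed[OF fc] gs by blast
  from T_lift[OF P B C g fc this]
  obtain h where h: "h \<in> left_hom S (T P) B" "\<And>u. u \<in> carrier (T P) ==> g (h u) = f (c u)" by metis
  have "g (h (inv_into (carrier (T P)) c x)) = f x" if x: "x \<in> carrier (push c (T P))" for x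
    using h(2)[OF lh_closed[OF pc(3) x]] x by (simp only: push_carrier' f_inv_into_f)
  then show "\<exists>h\<in>left_hom S (push c (T P)) B. \<forall>x\<in>carrier (push c (T P)). g (h x) = f x"
    by (intro bexI[OF _ lh_comp[OF pc(3) h(1)]] ballI)
qed

text \<open>\<open>N 0 \<otimes> P j\<close> is identified with \<open>P j\<close> by
  \<open>\<kappa>\<close>, compatibly with the differentials and with inverse
  \<open>x \<mapsto> y0 \<otimes> x\<close>; so the exactness of \<open>P\<close> carries
  over.\<close>

lemma tensor_exact_zero:
  assumes res: "left_resolution R X P d e"
  shows "tensor_exact R (N 0) P d i"
  unfolding tensor_exact_def
proof (intro ballI impI)
  note p = left_resolutionD[OF res]
  let ?C = "\<lambda>i. tensor_module R (N 0) (P i)" and ?D = "\<lambda>i. tmap R (N 0) (P i) (d i)"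
  let ?p = "\<lambda>i. tensor_pure R (N 0) (P i)"
  fix u assume u: "u \<in> carrier (?C (Suc i))" and du: "?D i u = \<zero>\<^sub>(?C i)"
  have scl: "sc y \<in> carrier R" if "y \<in> carrier (N 0)" for y using ahom_closed[OF sc(1) that] .
  obtain y0 where y0: "y0 \<in> carrier (N 0)" "sc y0 = \<one>\<^sub>R"
    using sc(2) R1 by (metis bij_betw_imp_surj_on imageE)
  have y: "y = y0 \<odot>\<^sub>r\<^sub>(N 0) sc y" if y: "y \<in> carrier (N 0)" for y
  proof (rule inj_onD[OF bij_betw_imp_inj_on[OF sc(2)] _ y])
    show "y0 \<odot>\<^sub>r\<^sub>(N 0) sc y \<in> carrier (N 0)" using rm_closed[OF Nr scl[OF y] y0(1)] .
    show "sc y = sc (y0 \<odot>\<^sub>r\<^sub>(N 0) sc y)" using sc_r[OF scl[OF y] y0(1)] y0(2) scl[OF y] R by (simp add: ring_rules)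
  qed
  have b: "balanced R (N 0) (P j) (P j) (\<lambda>y x. sc y \<odot>\<^sub>(P j) x)" for j
    by (rule balancedI)
      (use p(1)[of j] in \<open>simp_all add: scl lm_closed lm_l_distr lm_r_distr ahom_add[OF sc(1)] sc_r lm_assoc\<close>)
  have "\<forall>j. \<exists>\<kappa>. \<kappa> \<in> ahom (?C j) (P j) \<and> (\<forall>y\<in>carrier (N 0). \<forall>x\<in>carrier (P j). \<kappa> (?p j y x) = sc y \<odot>\<^sub>(P j) x)"
    using is_tensor_universal[OF is_tensor_tensor_module[OF Nr p(1)] lm_ag[OF p(1)] b] by metis
  then obtain \<kappa> where \<kappa>: "\<And>j. \<kappa> j \<in> ahom (?C j) (P j)"
    "\<And>j y x. y \<in> carrier (N 0) ==> x \<in> carrier (P j) ==> \<kappa> j (?p j y x) = sc y \<odot>\<^sub>(P j) x" by metis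
  have inv: "v = ?p j y0 (\<kappa> j v)" if v: "v \<in> carrier (?C j)" for v j
  proof -
    have "(\<lambda>v. v) \<in> ahom (?C j) (?C j)" by (rule ahomI) auto
    moreover have "(\<lambda>v. ?p j y0 (\<kappa> j v)) \<in> ahom (?C j) (?C j)"
      by (rule ahom_comp[OF \<kappa>(1) balanced_ahom_r[OF tensor_pure_balanced[OF Nr p(1)] y0(1)]])
    ultimately show ?thesis
    proof (rule is_tensor_eq[OF is_tensor_tensor_module[OF Nr p(1)] agrp_tensor[OF Nr p(1)] _ _ _ v])
      fix a x assume a: "a \<in> carrier (N 0)" and x: "x \<in> carrier (P j)"
      have "?p j y0 (\<kappa> j (?p j a x)) = ?p j (y0 \<odot>\<^sub>r\<^sub>(N 0) sc a) x"
        unfolding \<kappa>(2)[OF a x] by (rule balancedD(4)[OF tensor_pure_balanced[OF Nr p(1)] y0(1) scl[OF a] x, symmetric])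
      then show "?p j a x = ?p j y0 (\<kappa> j (?p j a x))" using y[OF a] by simp
    qed
  qed
  note Dh = tmap_props[OF Nr p(1) p(1) p(3)]
  have nat: "\<kappa> i (?D i v) = d i (\<kappa> (Suc i) v)" if v: "v \<in> carrier (?C (Suc i))" for v
    by (rule is_tensor_eq[OF is_tensor_tensor_module[OF Nr p(1)] lm_ag[OF p(1)] ahom_comp[OF Dh(1) \<kappa>(1)]
          ahom_comp[OF \<kappa>(1) lh_ahom[OF p(3)]] _ v])
      (simp add: Dh(2) \<kappa>(2) lh_closed[OF p(3)] lh_smult[OF p(3)] scl)
  have "d i (\<kappa> (Suc i) u) = \<zero>\<^sub>(P i)"
    using nat[OF u] du ahom_zero[OF \<kappa>(1) agrp_tensor[OF Nr p(1)] lm_ag[OF p(1)]] by simp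
  then obtain w where w: "w \<in> carrier (P (Suc (Suc i)))" "\<kappa> (Suc i) u = d (Suc i) w"
    using p(6)[OF ahom_closed[OF \<kappa>(1) u]] by auto
  have "u = ?D (Suc i) (?p (Suc (Suc i)) y0 w)"
    using inv[OF u] w Dh(2)[OF y0(1) w(1)] by simp
  moreover have "?p (Suc (Suc i)) y0 w \<in> carrier (?C (Suc (Suc i)))"
    by (rule balancedD(1)[OF tensor_pure_balanced[OF Nr p(1)] y0(1) w(1)])
  ultimately show "u \<in> ?D (Suc i) ` carrier (?C (Suc (Suc i)))" by blast
qed

text \<open>A cycle is shown to be a boundary truncation by truncation: its component of degree
  \<open>m\<close> is a cycle in \<open>N m \<otimes> P\<close>, hence a boundary there, and
  \<open>inn m\<close> carries this boundary back.\<close>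

lemma tensor_exact_S:
  assumes res: "left_resolution R X P d e" and ex: "\<And>k. k \<le> n ==> tensor_exact R (N k) P d i"
  shows "tensor_exact R TB P d i"
  unfolding tensor_exact_def
proof (intro ballI impI)
  note p = left_resolutionD[OF res]
  let ?D = "\<lambda>i. tmap R TB (P i) (d i)"
  fix u assume u: "u \<in> carrier (T (P (Suc i)))" and du: "?D i u = \<zero>\<^sub>(T (P i))"
  note lT = T_left_module[OF p(1)]
  have Dh: "?D j \<in> left_hom S (T (P (Suc j))) (T (P j))" for j by (rule tmap_left_hom[OF TB p(1) p(1) p(3)])
  note Dp = tmap_props[OF TBr p(1) p(1) p(3)]
  let ?B = "?D (Suc i) ` carrier (T (P (Suc (Suc i))))"
  have B: "submod S (T (P (Suc i))) ?B" by (rule submod_image[OF lT lT Dh])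
  let ?tr = "\<lambda>m. tensor_map R TB (P (Suc i)) (tr m) id"
  have trh: "tr m \<in> ahom TB TB" for m using tr by (simp add: ahom_def)
  have tr_r': "tr m (a \<odot>\<^sub>r\<^sub>TB r) = tr m a \<odot>\<^sub>r\<^sub>TB r" if "a \<in> carrier TB" "r \<in> carrier R" for m a r
    using tr_r that by simp
  have trm: "?tr m \<in> ahom (T (P (Suc i))) (T (P (Suc i)))" for m
    by (rule tensor_map_props(1)[OF TBr p(1) TBr p(1) trh tr_r' lh_id'])
  have trp: "?tr m (\<tau> (P (Suc i)) a x) = \<tau> (P (Suc i)) (tr m a) x" if "a \<in> carrier S" "x \<in> carrier (P (Suc i))" for m a x
    by (rule trans[OF tensor_map_props(2)[OF TBr p(1) TBr p(1) trh tr_r' lh_id']]) (use that in \<open>simp_all add: id_def\<close>)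
  have "?tr m u \<in> ?B" if "m \<le> Suc n" for m
    using that
  proof (induction m)
    case 0
    have z: "(\<lambda>u. \<zero>\<^sub>(T (P (Suc i)))) \<in> ahom (T (P (Suc i))) (T (P (Suc i)))"
      by (rule lh_ahom[OF lh_zero[OF lT]])
    have "?tr 0 u = \<zero>\<^sub>(T (P (Suc i)))"
      by (rule T_hom_eq[OF p(1) lm_ag[OF lT] trm z _ u])
        (use is_tensor_bilinear_eq_zero(1)[OF T_is_tensor[OF p(1)]] in \<open>simp add: trp tr_0\<close>)
    then show ?case using submod_zero[OF B] by (simp only:)
  next
    case (Suc m)
    have m: "m \<le> n" using Suc.prems by linarith
    have IH: "?tr m u \<in> ?B" by (rule Suc.IH) (use m in linarith)
    let ?N = "\<lambda>j. tensor_module R (N m) (P j)"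
    have prh: "pr m \<in> ahom TB (N m)" using pr[OF m] by (simp add: ahom_def)
    have prr: "pr m (a \<odot>\<^sub>r\<^sub>TB r) = pr m a \<odot>\<^sub>r\<^sub>(N m) r" if "a \<in> carrier TB" "r \<in> carrier R" for a r
      using pr_r[OF m] that by simp
    have inh: "inn m \<in> ahom (N m) TB" using inn[OF m] by (simp add: ahom_def)
    have inr: "inn m (a \<odot>\<^sub>r\<^sub>(N m) r) = inn m a \<odot>\<^sub>r\<^sub>TB r" if "a \<in> carrier (N m)" "r \<in> carrier R" for a r
      using inn_r[OF m] that by simp
    let ?q = "\<lambda>j. tensor_map R (N m) (P j) (pr m) id" and ?i = "\<lambda>j. tensor_map R TB (P j) (inn m) id"
    have qh: "?q j \<in> ahom (T (P j)) (?N j)" for j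
      by (rule tensor_map_props(1)[OF TBr p(1) Nr p(1) prh prr lh_id'])
    have qp: "?q j (\<tau> (P j) a x) = tensor_pure R (N m) (P j) (pr m a) x" if "a \<in> carrier S" "x \<in> carrier (P j)" for j a x
      by (rule trans[OF tensor_map_props(2)[OF TBr p(1) Nr p(1) prh prr lh_id']]) (use that in \<open>simp_all add: id_def\<close>)
    have ih: "?i j \<in> ahom (?N j) (T (P j))" for j
      by (rule tensor_map_props(1)[OF Nr p(1) TBr p(1) inh inr lh_id'])
    have ip: "?i j (tensor_pure R (N m) (P j) a x) = \<tau> (P j) (inn m a) x" if "a \<in> carrier (N m)" "x \<in> carrier (P j)" for j a x
      by (rule trans[OF tensor_map_props(2)[OF Nr p(1) TBr p(1) inh inr lh_id']]) (use that in \<open>simp_all add: id_def\<close>)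
    note Np = tmap_props[OF Nr[of m] p(1) p(1) p(3)]
    have prc: "pr m a \<in> carrier (N m)" if "a \<in> carrier S" for a using ahom_closed[OF pr[OF m] that] .
    have inc: "inn m a \<in> carrier S" if "a \<in> carrier (N m)" for a using ahom_closed[OF inn[OF m] that] .
    have nq: "tmap R (N m) (P i) (d i) (?q (Suc i) u) = ?q i (?D i u)"
      by (rule T_hom_eq[OF p(1) agrp_tensor[OF Nr p(1)] ahom_comp[OF qh Np(1)] ahom_comp[OF Dp(1) qh] _ u])
        (simp add: qp Np(2) Dp(2) prc lh_closed[OF p(3)])
    then have "tmap R (N m) (P i) (d i) (?q (Suc i) u) = \<zero>\<^sub>(?N i)"
      using du ahom_zero[OF qh lm_ag[OF lT] agrp_tensor[OF Nr p(1)]] by simp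
    then have "?q (Suc i) u \<in> tmap R (N m) (P (Suc i)) (d (Suc i)) ` carrier (?N (Suc (Suc i)))"
      using ex[OF m] ahom_closed[OF qh u] unfolding tensor_exact_def by blast
    then obtain v where v: "v \<in> carrier (?N (Suc (Suc i)))" "?q (Suc i) u = tmap R (N m) (P (Suc i)) (d (Suc i)) v" by blast
    have ni: "?i (Suc i) (tmap R (N m) (P (Suc i)) (d (Suc i)) v) = ?D (Suc i) (?i (Suc (Suc i)) v)"
      by (rule is_tensor_eq[OF is_tensor_tensor_module[OF Nr p(1)] lm_ag[OF lT] ahom_comp[OF Np(1) ih] ahom_comp[OF ih Dp(1)] _ v(1)])
        (simp add: ip Np(2) Dp(2) inc lh_closed[OF p(3)])
    have iq: "?i (Suc i) (?q (Suc i) u) \<in> ?B" using v ni ahom_closed[OF ih v(1)] by auto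
    have "?tr (Suc m) u = ?tr m u \<oplus>\<^sub>(T (P (Suc i))) ?i (Suc i) (?q (Suc i) u)"
      by (rule T_hom_eq[OF p(1) lm_ag[OF lT] trm ahom_plus[OF trm ahom_comp[OF qh ih] lm_ag[OF lT]] _ u])
        (use T_balanced(2)[OF p(1) ahom_closed[OF tr] inc[OF prc]] in \<open>simp add: trp qp ip prc tr_Suc[OF m]\<close>)
    then show ?case using submod_add[OF B IH iq] by (simp only:)
  qed
  from this[OF le_refl] have "?tr (Suc n) u \<in> ?B" .
  moreover have "?tr (Suc n) u = u"
  proof (rule T_hom_eq[OF p(1) lm_ag[OF lT] trm _ _ u])
    show "(\<lambda>u. u) \<in> ahom (T (P (Suc i))) (T (P (Suc i)))" by (rule ahomI) auto
  qed (simp add: trp tr_n)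
  ultimately show "u \<in> ?B" by (simp only:)
qed

text \<open>Sending \<open>s \<otimes> x\<close> to the class of \<open>s \<otimes> y\<close> with
  \<open>e y = x\<close> gives a map from \<open>T X\<close> to the cokernel of \<open>?D\<close>.
  Composed with the map that \<open>e\<close> induces it is the projection onto this cokernel, so
  elements killed by the induced map have class zero.\<close>

lemma T_right_exact:
  assumes X: "left_module R X" and res: "left_resolution R X P d e"
    and u: "u \<in> carrier (T (P 0))" and eu: "tmap R TB X e u = \<zero>\<^sub>(T X)"
  shows "u \<in> tmap R TB (P 0) (d 0) ` carrier (T (P 1))"
proof -
  note p = left_resolutionD[OF res]
  note lT = T_left_module[OF p(1)]
  let ?D = "tmap R TB (P 0) (d 0)" and ?E = "tmap R TB X e"
  let ?B = "?D ` carrier (T (P (Suc 0)))"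
  have Dh: "?D \<in> left_hom S (T (P (Suc 0))) (T (P 0))" by (rule tmap_left_hom[OF TB p(1) p(1) p(3)])
  have B: "submod S (T (P 0)) ?B" by (rule submod_image[OF lT lT Dh])
  note Dp = tmap_props[OF TBr p(1) p(1) p(3)] and Ep = tmap_props[OF TBr p(1) X p(2)]
  let ?c = "coset_rep (T (P 0)) ?B"
  let ?Q = "push ?c (T (P 0))"
  have cc: "?c x = ?c y \<longleftrightarrow> x \<ominus>\<^sub>(T (P 0)) y \<in> ?B" if "x \<in> carrier (T (P 0))" "y \<in> carrier (T (P 0))" for x y
    by (rule coset_rep_eq_iff[OF lT B that])
  have Q: "left_module S ?Q" and ch: "?c \<in> left_hom S (T (P 0)) ?Q" and ck: "a_kernel (T (P 0)) ?Q ?c = ?B"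
    using push_quotient[OF lT B cc] by blast+
  \<comment> \<open>Two preimages of the same element differ by a boundary, so modulo the image of
    \<open>?D\<close> the choice of the preimage does not matter.\<close>
  have eq: "?c (\<tau> (P 0) s x) = ?c (\<tau> (P 0) s y)"
    if s: "s \<in> carrier S" and x: "x \<in> carrier (P 0)" and y: "y \<in> carrier (P 0)" and exy: "e x = e y" for s x y
  proof -
    have xy: "x \<ominus>\<^sub>(P 0) y \<in> carrier (P 0)" using x y lm_ag[OF p(1)] by (simp add: ag_diff)
    have "e (x \<ominus>\<^sub>(P 0) y) = \<zero>\<^sub>X"
      using lh_diff[OF p(2) p(1) X x y] exy ag_diff_self[OF lm_ag[OF X] lh_closed[OF p(2) y]] by simp
    then obtain w where w: "w \<in> carrier (P (Suc 0))" "x \<ominus>\<^sub>(P 0) y = d 0 w" using p(5)[OF xy] by auto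
    have sTB: "s \<in> carrier TB" using s by simp
    have "\<tau> (P 0) s x \<ominus>\<^sub>(T (P 0)) \<tau> (P 0) s y = ?D (\<tau> (P (Suc 0)) s w)"
      using ahom_diff[OF balanced_ahom_r[OF tensor_pure_balanced[OF TBr p(1)] sTB] lm_ag[OF p(1)] lm_ag[OF lT] x y]
        Dp(2)[OF sTB w(1)] w(2) by simp
    then have "\<tau> (P 0) s x \<ominus>\<^sub>(T (P 0)) \<tau> (P 0) s y \<in> ?B" using T_balanced(1)[OF p(1) s w(1)] by simp
    then show ?thesis using cc[OF T_balanced(1)[OF p(1) s x] T_balanced(1)[OF p(1) s y]] by simp
  qed
  let ?x = "inv_into (carrier (P 0)) e"
  have xi: "?x x \<in> carrier (P 0)" "e (?x x) = x" if "x \<in> carrier X" for x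
    using that p(4) by (auto intro: inv_into_into f_inv_into_f)
  note agX = lm_ag[OF X] and agP = lm_ag[OF p(1)]
  have "balanced R TB X ?Q (\<lambda>s x. ?c (\<tau> (P 0) s (?x x)))"
  proof (rule balancedI)
    fix s x assume "s \<in> carrier TB" and x: "x \<in> carrier X"
    then have s: "s \<in> carrier S" by simp
    show "?c (\<tau> (P 0) s (?x x)) \<in> carrier ?Q"
      by (rule lh_closed[OF ch T_balanced(1)[OF p(1) s xi(1)[OF x]]])
    show "?c (\<tau> (P 0) (s \<oplus>\<^sub>TB t) (?x x)) = ?c (\<tau> (P 0) s (?x x)) \<oplus>\<^sub>?Q ?c (\<tau> (P 0) t (?x x))" if "t \<in> carrier TB" for t
      using that s xi(1)[OF x] lh_add[OF ch] by (simp add: T_balanced[OF p(1)])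
    show "?c (\<tau> (P 0) s (?x (x \<oplus>\<^sub>X y))) = ?c (\<tau> (P 0) s (?x x)) \<oplus>\<^sub>?Q ?c (\<tau> (P 0) s (?x y))" if y: "y \<in> carrier X" for y
    proof -
      have "?c (\<tau> (P 0) s (?x (x \<oplus>\<^sub>X y))) = ?c (\<tau> (P 0) s (?x x \<oplus>\<^sub>(P 0) ?x y))"
        using x y by (intro eq[OF s]) (simp_all add: xi ag_closed[OF agX] ag_closed[OF agP] lh_add[OF p(2)])
      then show ?thesis using s xi(1)[OF x] xi(1)[OF y] lh_add[OF ch] by (simp add: T_balanced[OF p(1)])
    qed
    show "?c (\<tau> (P 0) (s \<odot>\<^sub>r\<^sub>TB r) (?x x)) = ?c (\<tau> (P 0) s (?x (r \<odot>\<^sub>X x)))" if r: "r \<in> carrier R" for r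
    proof -
      have "?c (\<tau> (P 0) s (r \<odot>\<^sub>(P 0) ?x x)) = ?c (\<tau> (P 0) s (?x (r \<odot>\<^sub>X x)))"
        using x r by (intro eq[OF s]) (simp_all add: xi lm_closed[OF X] lm_closed[OF p(1)] lh_smult[OF p(2)])
      then show ?thesis using s r xi(1)[OF x] by (simp add: T_balanced(4)[OF p(1)])
    qed
  qed
  from is_tensor_universal[OF T_is_tensor[OF X] lm_ag[OF Q] this]
  obtain h where h: "h \<in> ahom (T X) ?Q" "\<And>a x. a \<in> carrier TB ==> x \<in> carrier X ==> h (\<tau> X a x) = ?c (\<tau> (P 0) a (?x x))" by metis
  have "h (?E u) = ?c u"
  proof (rule T_hom_eq[OF p(1) lm_ag[OF Q] ahom_comp[OF Ep(1) h(1)] lh_ahom[OF ch] _ u])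
    fix s x assume s: "s \<in> carrier S" and x: "x \<in> carrier (P 0)"
    then have sTB: "s \<in> carrier TB" by simp
    note ex = lh_closed[OF p(2) x]
    show "h (?E (\<tau> (P 0) s x)) = ?c (\<tau> (P 0) s x)"
      unfolding Ep(2)[OF sTB x] h(2)[OF sTB ex] by (rule eq[OF s xi(1)[OF ex] x xi(2)[OF ex]])
  qed
  then have "?c u = \<zero>\<^sub>?Q" using eu ahom_zero[OF h(1) lm_ag[OF T_left_module[OF X]] lm_ag[OF Q]] by simp
  then have "u \<in> a_kernel (T (P 0)) ?Q ?c" using u by (simp add: a_kernel_eq)
  then show ?thesis by (simp add: ck)
qed

text \<open>The image of the augmentation is a submodule that contains the pure tensors, hence
  everything; exactness is \<open>T_right_exact\<close> in degree zero and
  \<open>tensor_exact_S\<close> above.\<close>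

lemma T_resolution:
  assumes X: "left_module R X" and res: "left_resolution R X P d e"
    and ex: "\<And>i k. k \<le> n ==> tensor_exact R (N k) P d i"
  shows "left_resolution S (T X) (\<lambda>i. T (P i)) (\<lambda>i. tmap R TB (P i) (d i)) (tmap R TB X e)"
proof -
  note p = left_resolutionD[OF res]
  have Dh: "tmap R TB (P j) (d j) \<in> left_hom S (T (P (Suc j))) (T (P j))" for j by (rule tmap_left_hom[OF TB p(1) p(1) p(3)])
  have Eh: "tmap R TB X e \<in> left_hom S (T (P 0)) (T X)" by (rule tmap_left_hom[OF TB p(1) X p(2)])
  have dd: "d i (d (Suc i) y) = \<zero>\<^sub>(P i)" if "y \<in> carrier (P (Suc (Suc i)))" for i y
    using p(6)[OF lh_closed[OF p(3) that]] that by simp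
  have ed: "e (d 0 y) = \<zero>\<^sub>X" if "y \<in> carrier (P (Suc 0))" for y
    using p(5)[OF lh_closed[OF p(3) that]] that by simp
  show ?thesis
    unfolding left_resolution_def
  proof (intro conjI allI)
    show "left_module S (T (P i))" for i by (rule T_left_module[OF p(1)])
    show "tmap R TB X e \<in> left_hom S (T (P 0)) (T X)" by (rule Eh)
    show "tmap R TB (P i) (d i) \<in> left_hom S (T (P (Suc i))) (T (P i))" for i by (rule Dh)
    show "tmap R TB X e ` carrier (T (P 0)) = carrier (T X)"
    proof
      have im: "submod S (T X) (tmap R TB X e ` carrier (T (P 0)))"
        by (rule submod_image[OF T_left_module[OF p(1)] T_left_module[OF X] Eh])
      show "carrier (T X) \<subseteq> tmap R TB X e ` carrier (T (P 0))"
      proof (rule is_tensor_generated[OF T_is_tensor[OF X]])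
        fix a x assume a: "a \<in> carrier TB" and "x \<in> carrier X"
        then obtain y where y: "y \<in> carrier (P 0)" "x = e y" using p(4) by auto
        have "\<tau> X a x = tmap R TB X e (\<tau> (P 0) a y)" using tmap_props(2)[OF TBr p(1) X p(2) a y(1)] y(2) by simp
        then show "\<tau> X a x \<in> tmap R TB X e ` carrier (T (P 0))" using T_balanced(1)[OF p(1) _ y(1)] a by simp
      qed (rule submod_diff[OF T_left_module[OF X] im])
    qed (use lh_closed[OF Eh] in blast)
    show "tmap R TB (P 0) (d 0) ` carrier (T (P 1)) = a_kernel (T (P 0)) (T X) (tmap R TB X e)"
    proof (intro equalityI subsetI)
      fix u assume "u \<in> tmap R TB (P 0) (d 0) ` carrier (T (P 1))"
      then obtain v where v: "v \<in> carrier (T (P (Suc 0)))" "u = tmap R TB (P 0) (d 0) v" by auto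
      then show "u \<in> a_kernel (T (P 0)) (T X) (tmap R TB X e)"
        using lh_closed[OF Dh v(1)] tmap_comp_zero[OF TBr p(1) p(1) X p(3) p(2) ed v(1)] by (simp add: a_kernel_eq)
    qed (use T_right_exact[OF X res] in \<open>simp add: a_kernel_eq\<close>)
    fix i
    show "tmap R TB (P (Suc i)) (d (Suc i)) ` carrier (T (P (Suc (Suc i)))) =
        a_kernel (T (P (Suc i))) (T (P i)) (tmap R TB (P i) (d i))"
    proof (intro equalityI subsetI)
      fix u assume "u \<in> tmap R TB (P (Suc i)) (d (Suc i)) ` carrier (T (P (Suc (Suc i))))"
      then obtain v where v: "v \<in> carrier (T (P (Suc (Suc i))))" "u = tmap R TB (P (Suc i)) (d (Suc i)) v" by auto
      then show "u \<in> a_kernel (T (P (Suc i))) (T (P i)) (tmap R TB (P i) (d i))"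
        using lh_closed[OF Dh v(1)] tmap_comp_zero[OF TBr p(1) p(1) p(1) p(3) p(3) dd v(1)] by (simp add: a_kernel_eq)
    next
      fix u assume "u \<in> a_kernel (T (P (Suc i))) (T (P i)) (tmap R TB (P i) (d i))"
      then show "u \<in> tmap R TB (P (Suc i)) (d (Suc i)) ` carrier (T (P (Suc (Suc i))))"
        using tensor_exact_S[OF res ex] unfolding tensor_exact_def by (simp add: a_kernel_eq)
    qed
  qed
qed

text \<open>The map \<open>\<pi> \<otimes> id\<close> from \<open>T P\<close> to
  \<open>R \<otimes> P = P\<close>, obtained by extending the identity of \<open>P\<close>, seen as
  a module over \<open>S\<close> through \<open>\<pi>\<close>.\<close>

lemma T_retraction:
  assumes P: "left_module R P"
  obtains \<rho> where "\<rho> \<in> ahom (T P) P" "\<And>s x. s \<in> carrier S ==> x \<in> carrier P ==> \<rho> (\<tau> P s x) = \<pi> s \<odot>\<^sub>P x"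
    "\<And>r u. r \<in> carrier R ==> u \<in> carrier (T P) ==> \<rho> (\<iota> r \<odot>\<^sub>(T P) u) = r \<odot>\<^sub>P \<rho> u"
proof -
  have Y: "left_module S (restrict_scalars \<pi> P)" by (rule lmod_restrict_scalars[OF P S \<pi>])
  have "(\<lambda>x. x) \<in> left_hom R P (restrict_scalars \<iota> (restrict_scalars \<pi> P))"
    by (rule left_homI) (simp_all add: \<pi>\<iota>)
  from T_universal[OF P Y this]
  obtain h where h: "h \<in> left_hom S (T P) (restrict_scalars \<pi> P)"
    and h\<tau>: "\<And>s x. s \<in> carrier S ==> x \<in> carrier P ==> h (\<tau> P s x) = s \<odot>\<^sub>(restrict_scalars \<pi> P) x" by metis
  have "h \<in> ahom (T P) P" using lh_ahom[OF h] by (simp add: ahom_def)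
  moreover have "h (\<iota> r \<odot>\<^sub>(T P) u) = r \<odot>\<^sub>P h u" if "r \<in> carrier R" "u \<in> carrier (T P)" for r u
    using lh_smult[OF h \<iota>_closed[OF that(1)] that(2)] that by (simp add: \<pi>\<iota>)
  ultimately show ?thesis using that h\<tau> by simp
qed

text \<open>On the way back, \<open>t\<close> is placed between
  \<open>x \<mapsto> 1 \<otimes> x\<close> and \<open>\<rho>\<close>, whose composite is the
  identity; both commute with the differentials, so boundaries still go to boundaries.\<close>

lemma T_psplit_iff:
  assumes lP: "\<And>i. left_module R (P i)" and d: "\<And>i. d i \<in> left_hom R (P (Suc i)) (P i)"
  shows "psplit S (\<lambda>i. T (P i)) (\<lambda>i. tmap R TB (P i) (d i)) k \<longleftrightarrow> psplit R P d k"
proof -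
  let ?D = "tmap R TB (P k) (d k)"
  note Dp = tmap_props[OF TBr lP lP d]
  have Dh: "?D \<in> left_hom S (T (P (Suc k))) (T (P k))" by (rule tmap_left_hom[OF TB lP lP d])
  note lT = T_left_module[OF lP]
  have B: "submod S (T (P k)) (?D ` carrier (T (P (Suc k))))" by (rule submod_image[OF lT lT Dh])
  show ?thesis
  proof
    assume "psplit R P d k"
    then obtain t where t: "t \<in> left_hom R (P k) (P k)"
      and td: "\<And>x. x \<in> carrier (P k) ==> t x \<in> d k ` carrier (P (Suc k))"
      and tid: "\<And>y. y \<in> carrier (P (Suc k)) ==> t (d k y) = d k y" unfolding psplit_def by blast
    have th: "tmap R TB (P k) t \<in> left_hom S (T (P k)) (T (P k))" by (rule tmap_left_hom[OF TB lP lP t])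
    note tp = tmap_props[OF TBr lP lP t]
    have im: "carrier (T (P k)) \<subseteq> {u. tmap R TB (P k) t u \<in> ?D ` carrier (T (P (Suc k)))}"
    proof (rule is_tensor_generated[OF T_is_tensor[OF lP]])
      fix a x assume a: "a \<in> carrier TB" and x: "x \<in> carrier (P k)"
      obtain y where y: "y \<in> carrier (P (Suc k))" "t x = d k y" using td[OF x] by blast
      have "tmap R TB (P k) t (\<tau> (P k) a x) = ?D (\<tau> (P (Suc k)) a y)" using tp(2)[OF a x] Dp(2)[OF a y(1)] y(2) by simp
      then show "\<tau> (P k) a x \<in> {u. tmap R TB (P k) t u \<in> ?D ` carrier (T (P (Suc k)))}"
        using T_balanced(1)[OF lP _ y(1)] a by simp
    next
      fix u v assume "u \<in> {u. tmap R TB (P k) t u \<in> ?D ` carrier (T (P (Suc k)))}"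
        "v \<in> {u. tmap R TB (P k) t u \<in> ?D ` carrier (T (P (Suc k)))}" "u \<in> carrier (T (P k))" "v \<in> carrier (T (P k))"
      then show "u \<ominus>\<^sub>(T (P k)) v \<in> {u. tmap R TB (P k) t u \<in> ?D ` carrier (T (P (Suc k)))}"
        using submod_diff[OF lT B] lh_diff[OF th lT lT] by simp
    qed
    have "tmap R TB (P k) t (?D y) = ?D y" if "y \<in> carrier (T (P (Suc k)))" for y
      by (rule T_hom_eq[OF lP lm_ag[OF lT] ahom_comp[OF Dp(1) tp(1)] Dp(1) _ that])
        (simp add: Dp(2) tp(2) tid lh_closed[OF d])
    then show "psplit S (\<lambda>i. T (P i)) (\<lambda>i. tmap R TB (P i) (d i)) k"
      unfolding psplit_def using im by (intro bexI[OF _ th] conjI ballI) auto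
  next
    assume "psplit S (\<lambda>i. T (P i)) (\<lambda>i. tmap R TB (P i) (d i)) k"
    then obtain t where t: "t \<in> left_hom S (T (P k)) (T (P k))"
      and td: "\<And>x. x \<in> carrier (T (P k)) ==> t x \<in> ?D ` carrier (T (P (Suc k)))"
      and tid: "\<And>y. y \<in> carrier (T (P (Suc k))) ==> t (?D y) = ?D y" unfolding psplit_def by blast
    obtain \<rho> where \<rho>: "\<rho> \<in> ahom (T (P k)) (P k)" "\<And>s x. s \<in> carrier S ==> x \<in> carrier (P k) ==> \<rho> (\<tau> (P k) s x) = \<pi> s \<odot>\<^sub>(P k) x"
      "\<And>r u. r \<in> carrier R ==> u \<in> carrier (T (P k)) ==> \<rho> (\<iota> r \<odot>\<^sub>(T (P k)) u) = r \<odot>\<^sub>(P k) \<rho> u"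
      using T_retraction[OF lP] by metis
    obtain \<rho>' where \<rho>': "\<rho>' \<in> ahom (T (P (Suc k))) (P (Suc k))"
      "\<And>s x. s \<in> carrier S ==> x \<in> carrier (P (Suc k)) ==> \<rho>' (\<tau> (P (Suc k)) s x) = \<pi> s \<odot>\<^sub>(P (Suc k)) x"
      using T_retraction[OF lP] by metis
    have nat: "\<rho> (?D y) = d k (\<rho>' y)" if "y \<in> carrier (T (P (Suc k)))" for y
      by (rule T_hom_eq[OF lP lm_ag[OF lP] ahom_comp[OF Dp(1) \<rho>(1)] ahom_comp[OF \<rho>'(1) lh_ahom[OF d]] _ that])
        (simp add: Dp(2) \<rho>(2) \<rho>'(2) lh_closed[OF d] lh_smult[OF d \<pi>_closed])
    have \<rho>h: "\<rho> \<in> left_hom R (restrict_scalars \<iota> (T (P k))) (P k)"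
      using \<rho>(1,3) by (auto simp: lh_iff ahom_def)
    have th: "t \<in> left_hom R (restrict_scalars \<iota> (T (P k))) (restrict_scalars \<iota> (T (P k)))"
      using t \<iota>_closed by (auto simp: left_hom_def)
    have h: "(\<lambda>x. \<rho> (t (\<tau> (P k) \<one>\<^sub>S x))) \<in> left_hom R (P k) (P k)"
      by (rule lh_comp[OF lh_comp[OF \<tau>_one_hom[OF lP] th] \<rho>h])
    show "psplit R P d k"
      unfolding psplit_def
    proof (rule bexI[OF _ h], intro conjI ballI)
      fix x assume x: "x \<in> carrier (P k)"
      obtain y where y: "y \<in> carrier (T (P (Suc k)))" "t (\<tau> (P k) \<one>\<^sub>S x) = ?D y"
        using td[OF T_balanced(1)[OF lP S1 x]] by blast
      show "\<rho> (t (\<tau> (P k) \<one>\<^sub>S x)) \<in> d k ` carrier (P (Suc k))"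
        unfolding y(2) nat[OF y(1)] using ahom_closed[OF \<rho>'(1) y(1)] by simp
    next
      fix y assume y: "y \<in> carrier (P (Suc k))"
      have S1': "\<one>\<^sub>S \<in> carrier TB" using S1 by simp
      note dy = lh_closed[OF d y]
      have "t (\<tau> (P k) \<one>\<^sub>S (d k y)) = \<tau> (P k) \<one>\<^sub>S (d k y)"
        using tid[OF T_balanced(1)[OF lP S1 y]] Dp(2)[OF S1' y] by simp
      then show "\<rho> (t (\<tau> (P k) \<one>\<^sub>S (d k y))) = d k y"
        using \<rho>(2)[OF S1 dy] \<pi>_one lm_one[OF lP dy] by simp
    qed
  qed
qed

text \<open>An element of \<open>T (P i)\<close> is coded by its list of pairs from
  \<open>tensor_list\<close>, and the entries of these pairs are embedded into the universe of
  \<open>T X\<close>.\<close>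

lemma T_embed:
  fixes P :: "nat => ('r, ('r, 'x) univ) module" and i0 :: "'r => 's"
  assumes lP: "\<And>i. left_module R (P i)" and i0: "inj i0"
  shows "\<exists>c :: nat => ('s \<times> ('r, 'x) univ \<Rightarrow>\<^sub>0 int) set => ('s, ('s \<times> 'x \<Rightarrow>\<^sub>0 int) set) univ.
    \<forall>i. inj_on (c i) (carrier (T (P i)))"
proof -
  \<comment> \<open>Any injection of \<open>'x\<close> into the element type of \<open>T X\<close>
    allows the universes to be compared; these singletons are not meant as tensors.\<close>
  have "inj (\<lambda>x :: 'x. {frag_of (undefined :: 's, x)})"
    by (auto simp: inj_def dest!: arg_cong[of _ _ Poly_Mapping.keys])
  then obtain u :: "('r, 'x) univ => ('s, ('s \<times> 'x \<Rightarrow>\<^sub>0 int) set) univ" where u: "inj u"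
    using univ_embed_univ[OF i0] by blast
  obtain v :: "'s => ('s, ('s \<times> 'x \<Rightarrow>\<^sub>0 int) set) univ" where v: "inj v" using univ_embed_scalar by blast
  obtain w :: "'s \<times> ('r, 'x) univ => ('s, ('s \<times> 'x \<Rightarrow>\<^sub>0 int) set) univ" where "inj w"
    using univ_embed_prod[OF v u] by blast
  then obtain z :: "('s \<times> ('r, 'x) univ) list => ('s, ('s \<times> 'x \<Rightarrow>\<^sub>0 int) set) univ" where z: "inj z"
    using univ_embed_list by blast
  have "inj_on (\<lambda>c. z (tensor_list R TB (P i) c)) (carrier (T (P i)))" for i :: nat
    using comp_inj_on[OF tensor_list_inj[OF TBr lP[of i]] inj_on_subset[OF z subset_UNIV]] by (simp add: comp_def)
  then show ?thesis by (intro exI[of _ "\<lambda>i c. z (tensor_list R TB (P i) c)"] allI)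
qed

end

section \<open>Character modules and flatness\<close>

text \<open>The characters of a left module form a right module. It is treated as a left module over
  the opposite ring, so that Baer's criterion and the theory of injective resolutions apply as they
  stand.\<close>

definition op_ring :: "('r, 'e) ring_scheme => 'r ring" where
  "op_ring R = \<lparr>carrier = carrier R, mult = (\<lambda>x y. y \<otimes>\<^sub>R x), one = \<one>\<^sub>R, ring.zero = \<zero>\<^sub>R, add = add R\<rparr>"

lemma op_ring_simps [simp]:
  "carrier (op_ring R) = carrier R" "x \<otimes>\<^sub>(op_ring R) y = y \<otimes>\<^sub>R x" "\<one>\<^sub>(op_ring R) = \<one>\<^sub>R"
  "\<zero>\<^sub>(op_ring R) = \<zero>\<^sub>R" "x \<oplus>\<^sub>(op_ring R) y = x \<oplus>\<^sub>R y"
  by (simp_all add: op_ring_def)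

lemma ring_op_ring:
  assumes R: "ring R" shows "ring (op_ring R)"
proof (rule ringI)
  show "abelian_group (op_ring R)" by (rule agrp_transfer[OF ring_ag[OF R]]) simp_all
  show "monoid (op_ring R)"
    by (rule monoidI) (use R in \<open>simp_all add: ring_rules ring_r_one\<close>)
qed (use R in \<open>simp_all add: ring_rules\<close>)

text \<open>The character module. The scalars of \<open>P\<close> enter \<open>zbimodule\<close> as
  a right action of \<open>op_ring R\<close>, which \<open>hom_module\<close> turns into a left
  action.\<close>

definition dual :: "('r, 'p, 'f) module_scheme => ('r, 'p => rat) module" where
  "dual P = hom_module ZZ (zbimodule (\<lambda>x r. r \<odot>\<^sub>P x) P) QZ"

lemma dual_simps:
  shows dual_zero: "\<zero>\<^sub>(dual P) = (\<lambda>x\<in>carrier P. \<zero>\<^sub>QZ)"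
    and dual_add: "\<phi> \<oplus>\<^sub>(dual P) \<psi> = (\<lambda>x\<in>carrier P. \<phi> x \<oplus>\<^sub>QZ \<psi> x)"
    and dual_smult: "r \<odot>\<^sub>(dual P) \<phi> = (\<lambda>x\<in>carrier P. \<phi> (r \<odot>\<^sub>P x))"
  by (simp_all add: dual_def)

lemma dual_carrier:
  assumes "abelian_group P"
  shows "carrier (dual P) = ahom P QZ \<inter> extensional (carrier P)"
  by (simp add: dual_def lh_zbimodule[OF assms lmod_QZ])

lemma lmod_dual:
  assumes P: "left_module R P" shows "left_module (op_ring R) (dual P)"
  unfolding dual_def
proof (rule lmod_hom_module[OF zbimodule_bimodule lmod_QZ])
  show "abelian_group P" using P by (rule lm_ag)
  show "right_module (op_ring R) (zbimodule (\<lambda>x r. r \<odot>\<^sub>P x) P)"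
    by (rule right_moduleI)
      (use P lm_ag[OF lmod_zbimodule[OF lm_ag[OF P]]] in
        \<open>simp_all add: ring_op_ring lm_ring lm_closed lm_l_distr lm_r_distr lm_assoc lm_one\<close>)
qed

lemma dualI:
  "left_module R P ==> \<phi> \<in> ahom P QZ ==> restrict \<phi> (carrier P) \<in> carrier (dual P)"
  by (auto simp: dual_carrier[OF lm_ag] ahom_def ag_closed[OF lm_ag])

lemma dualD:
  assumes "left_module R P" "\<phi> \<in> carrier (dual P)"
  shows "\<phi> \<in> ahom P QZ" "\<phi> \<in> extensional (carrier P)"
  using assms by (auto simp: dual_carrier[OF lm_ag])

lemma dual_eqI:
  assumes "left_module R P" "\<phi> \<in> carrier (dual P)" "\<psi> \<in> carrier (dual P)" "\<And>x. x \<in> carrier P ==> \<phi> x = \<psi> x"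
  shows "\<phi> = \<psi>"
  using assms by (auto simp: dual_carrier[OF lm_ag] intro: extensionalityI)

definition dmap :: "('p, 'e) ring_scheme => ('p => 'q) => ('q => rat) => 'p => rat" where
  "dmap P f \<phi> = (\<lambda>x\<in>carrier P. \<phi> (f x))"

lemma dmap_apply: "x \<in> carrier P ==> dmap P f \<phi> x = \<phi> (f x)"
  by (simp add: dmap_def)

lemma dmap_hom:
  assumes P: "left_module R P" and Q: "left_module R Q" and f: "f \<in> left_hom R P Q"
  shows "dmap P f \<in> left_hom (op_ring R) (dual Q) (dual P)"
proof (rule left_homI)
  fix \<phi> assume \<phi>: "\<phi> \<in> carrier (dual Q)"
  show "dmap P f \<phi> \<in> carrier (dual P)"
    unfolding dmap_def by (rule dualI[OF P ahom_comp[OF lh_ahom[OF f] dualD(1)[OF Q \<phi>]]])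
  show "dmap P f (\<phi> \<oplus>\<^sub>(dual Q) \<psi>) = dmap P f \<phi> \<oplus>\<^sub>(dual P) dmap P f \<psi>" for \<psi>
    by (auto simp: dmap_def dual_simps fun_eq_iff lh_closed[OF f])
  show "dmap P f (r \<odot>\<^sub>(dual Q) \<phi>) = r \<odot>\<^sub>(dual P) dmap P f \<phi>" if "r \<in> carrier (op_ring R)" for r
    using that P by (auto simp: dmap_def dual_simps fun_eq_iff lh_closed[OF f] lh_smult[OF f] lm_closed)
qed

lemma dmap_eq_zero:
  assumes "left_module R P"
  shows "dmap P f \<phi> = \<zero>\<^sub>(dual P) \<longleftrightarrow> (\<forall>x\<in>carrier P. \<phi> (f x) = \<zero>\<^sub>QZ)"
  by (auto simp: dmap_def dual_zero fun_eq_iff)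

text \<open>Q/Z is injective over the integers, so taking characters reverses arrows and keeps
  exactness.\<close>

lemma dual_resolution:
  fixes R :: "('r, 'e) ring_scheme" and X :: "('r, 'x, 'f) module_scheme" and P :: "nat => ('r, 'u) module"
  assumes X: "left_module R X" and res: "left_resolution R X P d e"
  shows "right_resolution (op_ring R) (dual X) (\<lambda>i. dual (P i)) (\<lambda>i. dmap (P (Suc i)) (d i)) (dmap (P 0) e)"
proof -
  note p = left_resolutionD[OF res]
  have Eh: "dmap (P 0) e \<in> left_hom (op_ring R) (dual X) (dual (P 0))" by (rule dmap_hom[OF p(1) X p(2)])
  have Dh: "dmap (P (Suc i)) (d i) \<in> left_hom (op_ring R) (dual (P i)) (dual (P (Suc i)))" for i
    by (rule dmap_hom[OF p(1) p(1) p(3)])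
  \<comment> \<open>A character that kills the kernel of \<open>f\<close> factors through
    \<open>f\<close>; the inclusions of kernels in images are instances of this.\<close>
  have ex: "\<exists>\<chi>\<in>carrier (dual Q). \<phi> = dmap P' f \<chi>"
    if P': "left_module R P'" and Q: "left_module R Q" and f: "f \<in> left_hom R P' Q" and \<phi>: "\<phi> \<in> carrier (dual P')"
      and ker: "\<And>x. x \<in> carrier P' ==> f x = \<zero>\<^sub>Q ==> \<phi> x = \<zero>\<^sub>QZ"
    for P' :: "('r, 'u) module" and Q :: "('r, 'q, 'h) module_scheme" and f \<phi>
  proof -
    obtain h where h: "h \<in> ahom Q QZ" "\<And>x. x \<in> carrier P' ==> h (f x) = \<phi> x"
      using ahom_extend[OF QZ_baer lm_ag[OF P'] lm_ag[OF Q] lh_ahom[OF f] dualD(1)[OF P' \<phi>] ker] by metis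
    have hc: "restrict h (carrier Q) \<in> carrier (dual Q)" by (rule dualI[OF Q h(1)])
    have "\<phi> = dmap P' f (restrict h (carrier Q))"
      by (rule dual_eqI[OF P' \<phi> lh_closed[OF dmap_hom[OF P' Q f] hc]])
        (simp add: dmap_apply lh_closed[OF f] h(2))
    then show ?thesis using hc by blast
  qed
  have z: "\<chi> \<zero>\<^sub>Q = \<zero>\<^sub>QZ" if "left_module R Q" "\<chi> \<in> carrier (dual Q)" for \<chi> and Q :: "('r, 'q, 'h) module_scheme"
    by (rule ahom_zero[OF dualD(1)[OF that] lm_ag[OF that(1)] agrp_QZ])
  show ?thesis
    unfolding right_resolution_def
  proof (intro conjI allI)
    show "left_module (op_ring R) (dual (P i))" for i by (rule lmod_dual[OF p(1)])
    show "dmap (P 0) e \<in> left_hom (op_ring R) (dual X) (dual (P 0))" by (rule Eh)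
    show "dmap (P (Suc i)) (d i) \<in> left_hom (op_ring R) (dual (P i)) (dual (P (Suc i)))" for i by (rule Dh)
    show "inj_on (dmap (P 0) e) (carrier (dual X))"
    proof (rule inj_onI)
      fix \<phi> \<psi> assume *: "\<phi> \<in> carrier (dual X)" "\<psi> \<in> carrier (dual X)" "dmap (P 0) e \<phi> = dmap (P 0) e \<psi>"
      show "\<phi> = \<psi>"
      proof (rule dual_eqI[OF X *(1,2)])
        fix x assume "x \<in> carrier X"
        then obtain y where "y \<in> carrier (P 0)" "x = e y" using p(4) by auto
        then show "\<phi> x = \<psi> x" using fun_cong[OF *(3), of y] by (simp add: dmap_apply)
      qed
    qed
    show "dmap (P 0) e ` carrier (dual X) = a_kernel (dual (P 0)) (dual (P 1)) (dmap (P (Suc 0)) (d 0))"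
    proof (intro equalityI subsetI)
      fix \<phi> assume "\<phi> \<in> dmap (P 0) e ` carrier (dual X)"
      then obtain \<chi> where \<chi>: "\<chi> \<in> carrier (dual X)" "\<phi> = dmap (P 0) e \<chi>" by blast
      have "\<phi> (d 0 x) = \<zero>\<^sub>QZ" if "x \<in> carrier (P (Suc 0))" for x
        using \<chi> p(5)[OF lh_closed[OF p(3) that]] that lh_closed[OF p(3) that] z[OF X \<chi>(1)] by (simp add: dmap_apply)
      then show "\<phi> \<in> a_kernel (dual (P 0)) (dual (P 1)) (dmap (P (Suc 0)) (d 0))"
        using \<chi> lh_closed[OF Eh \<chi>(1)] by (simp add: a_kernel_eq dmap_eq_zero[OF p(1)])
    next
      fix \<phi> assume "\<phi> \<in> a_kernel (dual (P 0)) (dual (P 1)) (dmap (P (Suc 0)) (d 0))"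
      then have \<phi>: "\<phi> \<in> carrier (dual (P 0))" "\<forall>x\<in>carrier (P (Suc 0)). \<phi> (d 0 x) = \<zero>\<^sub>QZ"
        by (auto simp: a_kernel_eq dmap_eq_zero[OF p(1)])
      then show "\<phi> \<in> dmap (P 0) e ` carrier (dual X)"
        using ex[OF p(1) X p(2) \<phi>(1)] p(5) by auto
    qed
    fix i
    show "dmap (P (Suc i)) (d i) ` carrier (dual (P i)) =
        a_kernel (dual (P (Suc i))) (dual (P (Suc (Suc i)))) (dmap (P (Suc (Suc i))) (d (Suc i)))"
    proof (intro equalityI subsetI)
      fix \<phi> assume "\<phi> \<in> dmap (P (Suc i)) (d i) ` carrier (dual (P i))"
      then obtain \<chi> where \<chi>: "\<chi> \<in> carrier (dual (P i))" "\<phi> = dmap (P (Suc i)) (d i) \<chi>" by blast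
      have "\<phi> (d (Suc i) x) = \<zero>\<^sub>QZ" if "x \<in> carrier (P (Suc (Suc i)))" for x
        using \<chi> p(6)[OF lh_closed[OF p(3) that]] that lh_closed[OF p(3) that] z[OF p(1) \<chi>(1)] by (simp add: dmap_apply)
      then show "\<phi> \<in> a_kernel (dual (P (Suc i))) (dual (P (Suc (Suc i)))) (dmap (P (Suc (Suc i))) (d (Suc i)))"
        using \<chi> lh_closed[OF Dh \<chi>(1)] by (simp add: a_kernel_eq dmap_eq_zero[OF p(1)])
    next
      fix \<phi> assume "\<phi> \<in> a_kernel (dual (P (Suc i))) (dual (P (Suc (Suc i)))) (dmap (P (Suc (Suc i))) (d (Suc i)))"
      then have \<phi>: "\<phi> \<in> carrier (dual (P (Suc i)))" "\<forall>x\<in>carrier (P (Suc (Suc i))). \<phi> (d (Suc i) x) = \<zero>\<^sub>QZ"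
        by (auto simp: a_kernel_eq dmap_eq_zero[OF p(1)])
      then show "\<phi> \<in> dmap (P (Suc i)) (d i) ` carrier (dual (P i))"
        using ex[OF p(1) p(1) p(3) \<phi>(1)] p(6) by auto
    qed
  qed
qed

text \<open>For a right ideal \<^term>\<open>L\<close>, a linear map \<open>L \<rightarrow> P\<^sup>+\<close> is the same as a linear map from \<^term>\<open>P\<close> to the character
  module of \<^term>\<open>L\<close>, which lifts along the restriction from the character module of \<^term>\<open>R\<close>.\<close>

lemma projective_dual_baer:
  fixes R :: "'r ring"
  assumes P: "projective_module R P"
  shows "baer (op_ring R) (dual P)"
  unfolding baer_def
proof (intro conjI allI impI)
  have lP: "left_module R P" using P by (simp add: projective_module_def)
  have R: "ring R" using lP by (rule lm_ring)
  show "left_module (op_ring R) (dual P)" by (rule lmod_dual[OF lP])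
  fix L f assume L: "left_ideal (op_ring R) L" and f: "f \<in> ideal_hom (op_ring R) L (dual P)"
  have LR: "l \<in> carrier R" if "l \<in> L" for l using L that by (auto simp: left_ideal_def)
  have Lr: "l \<otimes>\<^sub>R r \<in> L" if "l \<in> L" "r \<in> carrier R" for l r using L that by (auto simp: left_ideal_def)
  have one: "\<one>\<^sub>R \<in> carrier R" using R by (simp add: ring_rules)
  let ?RL = "R\<lparr>carrier := L\<rparr>"
  have agL: "abelian_group ?RL"
  proof -
    have "submod (op_ring R) (ring_bimodule (op_ring R) id id) L" using L by (simp only: submod_regular)
    from lmod_sub[OF lmod_regular[OF ring_op_ring[OF R]] this]
    have "abelian_group ((ring_bimodule (op_ring R) id id)\<lparr>carrier := L\<rparr>)" by (rule lm_ag)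
    then show ?thesis by (rule agrp_transfer) simp_all
  qed
  let ?zL = "zbimodule (\<lambda>l r. l \<otimes>\<^sub>R r) ?RL" and ?zR = "zbimodule (\<lambda>l r. l \<otimes>\<^sub>R r) R"
  have rL: "right_module R ?zL"
    by (rule right_moduleI) (use R lm_ag[OF lmod_zbimodule[OF agL]] in \<open>simp_all add: Lr LR ring_rules ring_r_one\<close>)
  have rR: "right_module R ?zR"
    by (rule right_moduleI) (use R lm_ag[OF lmod_zbimodule[OF ring_ag[OF R]]] in \<open>simp_all add: ring_rules ring_r_one\<close>)
  let ?A = "hom_module ZZ ?zR QZ" and ?B = "hom_module ZZ ?zL QZ"
  have lA: "left_module R ?A" by (rule lmod_hom_module[OF zbimodule_bimodule[OF ring_ag[OF R] rR] lmod_QZ])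
  have lB: "left_module R ?B" by (rule lmod_hom_module[OF zbimodule_bimodule[OF agL rL] lmod_QZ])
  have cA: "carrier ?A = ahom R QZ \<inter> extensional (carrier R)"
    by (simp add: lh_zbimodule[OF ring_ag[OF R] lmod_QZ])
  have cB: "carrier ?B = ahom ?RL QZ \<inter> extensional L"
    by (simp add: lh_zbimodule[OF agL lmod_QZ])
  have g: "(\<lambda>h. restrict h L) \<in> left_hom R ?A ?B"
  proof (rule left_homI)
    fix h assume "h \<in> carrier ?A"
    then have h: "h \<in> ahom R QZ" unfolding cA by (rule IntD1)
    then have "restrict h L \<in> ahom ?RL QZ" using LR ag_closed[OF agL] by (auto simp: ahom_def)
    then show "restrict h L \<in> carrier ?B" unfolding cB by simp
  qed (auto simp: fun_eq_iff LR Lr)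
  have fP: "f l \<in> carrier (dual P)" if "l \<in> L" for l using f that by (auto simp: ideal_hom_def)
  have fl: "f l \<in> ahom P QZ" if "l \<in> L" for l using dualD(1)[OF lP fP[OF that]] .
  have fr: "f (l \<otimes>\<^sub>R r) x = f l (r \<odot>\<^sub>P x)" if "l \<in> L" "r \<in> carrier R" "x \<in> carrier P" for l r x
    using f that by (simp add: ideal_hom_def dual_smult)
  have fa: "f (l \<oplus>\<^sub>R m) x = f l x \<oplus>\<^sub>QZ f m x" if "l \<in> L" "m \<in> L" "x \<in> carrier P" for l m x
    using f that by (simp add: ideal_hom_def dual_add)
  have k: "(\<lambda>x. \<lambda>l\<in>L. f l x) \<in> left_hom R P ?B"
  proof (rule left_homI)
    fix x assume x: "x \<in> carrier P"
    have "(\<lambda>l\<in>L. f l x) \<in> ahom ?RL QZ"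
      using x ag_closed[OF agL] ahom_closed[OF fl x] fa[OF _ _ x] by (intro ahomI) auto
    then show "(\<lambda>l\<in>L. f l x) \<in> carrier ?B" unfolding cB by simp
    show "(\<lambda>l\<in>L. f l (x \<oplus>\<^sub>P y)) = (\<lambda>l\<in>L. f l x) \<oplus>\<^sub>?B (\<lambda>l\<in>L. f l y)" if "y \<in> carrier P" for y
      using x that by (auto simp: fun_eq_iff ahom_add[OF fl])
    show "(\<lambda>l\<in>L. f l (r \<odot>\<^sub>P x)) = r \<odot>\<^sub>?B (\<lambda>l\<in>L. f l x)" if "r \<in> carrier R" for r
      using x that by (auto simp: fun_eq_iff fr Lr)
  qed
  \<comment> \<open>By injectivity of Q/Z each character of \<open>L\<close> extends to
    \<open>R\<close>; this puts the map inside the image of restriction, as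
    \<open>projective_lift\<close> demands.\<close>
  have "(\<lambda>x. \<lambda>l\<in>L. f l x) ` carrier P \<subseteq> (\<lambda>h. restrict h L) ` carrier ?A"
  proof (rule image_subsetI)
    fix x assume "x \<in> carrier P"
    then have kx: "(\<lambda>l\<in>L. f l x) \<in> ahom ?RL QZ" using lh_closed[OF k] cB by blast
    have i: "(\<lambda>l. l) \<in> ahom ?RL R" by (rule ahomI) (auto simp: LR)
    have "(\<lambda>l\<in>L. f l x) l = \<zero>\<^sub>QZ" if "l \<in> carrier ?RL" "l = \<zero>\<^sub>R" for l
      using ahom_zero[OF kx agL agrp_QZ] that by simp
    then obtain h where h: "h \<in> ahom R QZ" "\<And>l. l \<in> carrier ?RL ==> h l = (\<lambda>l\<in>L. f l x) l"
      using ahom_extend[OF QZ_baer agL ring_ag[OF R] i kx] by metis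
    have "restrict h (carrier R) \<in> carrier ?A"
      unfolding cA using h(1) ag_closed[OF ring_ag[OF R]] by (auto simp: ahom_def)
    moreover have "(\<lambda>l\<in>L. f l x) = restrict (restrict h (carrier R)) L"
      using h(2) LR by (auto simp: fun_eq_iff)
    ultimately show "(\<lambda>l\<in>L. f l x) \<in> (\<lambda>h. restrict h L) ` carrier ?A" by blast
  qed
  from projective_lift[OF P lA lB g k this]
  obtain K where K: "K \<in> left_hom R P ?A" "\<And>x. x \<in> carrier P ==> restrict (K x) L = (\<lambda>l\<in>L. f l x)" by metis
  \<comment> \<open>The lift \<open>K\<close> sends \<open>x\<close> to a character of
    \<open>R\<close>; its value at one is the value at \<open>x\<close> of the character that
    represents \<open>f\<close>.\<close>
  let ?\<psi> = "\<lambda>x\<in>carrier P. K x \<one>\<^sub>R"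
  have KA: "K x \<in> ahom R QZ" if "x \<in> carrier P" for x using lh_closed[OF K(1) that] cA by blast
  have "(\<lambda>x. K x \<one>\<^sub>R) \<in> ahom P QZ"
    using ahom_closed[OF KA one] lh_add[OF K(1)] one by (intro ahomI) auto
  then have \<psi>: "?\<psi> \<in> carrier (dual P)" by (rule dualI[OF lP])
  have "f l = l \<odot>\<^sub>(dual P) ?\<psi>" if l: "l \<in> L" for l
  proof (rule dual_eqI[OF lP fP[OF l]])
    have lo: "l \<in> carrier (op_ring R)" using LR[OF l] by simp
    show "l \<odot>\<^sub>(dual P) ?\<psi> \<in> carrier (dual P)" by (rule lm_closed[OF lmod_dual[OF lP] lo \<psi>])
    fix x assume x: "x \<in> carrier P"
    have "f l x = K x l" using fun_cong[OF K(2)[OF x], of l] l by simp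
    also have "\<dots> = (l \<odot>\<^sub>?A K x) \<one>\<^sub>R" using one LR[OF l] R by (simp add: ring_rules)
    also have "\<dots> = K (l \<odot>\<^sub>P x) \<one>\<^sub>R" using lh_smult[OF K(1) LR[OF l] x] by (simp only:)
    finally show "f l x = (l \<odot>\<^sub>(dual P) ?\<psi>) x" using x LR[OF l] lm_closed[OF lP] by (simp add: dual_smult)
  qed
  then show "\<exists>x\<in>carrier (dual P). \<forall>l\<in>L. f l = l \<odot>\<^sub>(dual P) x" using \<psi> by blast
qed

section \<open>Lambek's criterion: flat modules and injective character modules\<close>

definition right_of :: "('r, 'u, 'f) module_scheme => (unit, 'r, 'u) bimodule" where
  "right_of A = \<lparr>carrier = carrier A, mult = undefined, one = undefined, ring.zero = \<zero>\<^sub>A, add = add A,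
     smult = undefined, rsmult = (\<lambda>x r. r \<odot>\<^sub>A x)\<rparr>"

definition left_of :: "('s, 'r, 'u, 'f) bimodule_scheme => ('r, 'u) module" where
  "left_of A = \<lparr>carrier = carrier A, mult = undefined, one = undefined, ring.zero = \<zero>\<^sub>A, add = add A,
     smult = (\<lambda>r x. x \<odot>\<^sub>r\<^sub>A r)\<rparr>"

lemma right_of_simps [simp]:
  "carrier (right_of A) = carrier A" "\<zero>\<^sub>(right_of A) = \<zero>\<^sub>A" "x \<oplus>\<^sub>(right_of A) y = x \<oplus>\<^sub>A y"
  "x \<odot>\<^sub>r\<^sub>(right_of A) r = r \<odot>\<^sub>A x"
  by (simp_all add: right_of_def)

lemma left_of_simps [simp]:
  "carrier (left_of A) = carrier A" "\<zero>\<^sub>(left_of A) = \<zero>\<^sub>A" "x \<oplus>\<^sub>(left_of A) y = x \<oplus>\<^sub>A y"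
  "r \<odot>\<^sub>(left_of A) x = x \<odot>\<^sub>r\<^sub>A r"
  by (simp_all add: left_of_def)

lemma rmod_right_of:
  assumes R: "ring R" and A: "left_module (op_ring R) A" shows "right_module R (right_of A)"
proof -
  have "abelian_group (right_of A)" by (rule agrp_transfer[OF lm_ag[OF A]]) simp_all
  then show ?thesis
    by (intro right_moduleI)
      (use R lm_closed[OF A] lm_l_distr[OF A] lm_r_distr[OF A] lm_one[OF A] lm_assoc[OF A] in simp_all)
qed

lemma lmod_left_of:
  assumes A: "right_module R A" shows "left_module (op_ring R) (left_of A)"
proof -
  have "abelian_group (left_of A)" by (rule agrp_transfer[OF rm_ag[OF A]]) simp_all
  then show ?thesis
    by (intro left_moduleI) (use A in \<open>simp_all add: ring_op_ring rm_ring rm_closed rm_l_distr rm_r_distr rm_assoc rm_one\<close>)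
qed

text \<open>A linear map from a right ideal \<open>L\<close> to the character module is a character
  of \<open>L \<otimes> P\<close>. Flatness embeds \<open>L \<otimes> P\<close> into
  \<open>R \<otimes> P\<close>, so the character extends, and its values on
  \<open>1 \<otimes> x\<close> represent the map. The relabelling \<open>c\<close> brings
  \<open>L\<close> and \<open>R\<close> into the universe of \<open>flat_module\<close>.\<close>

lemma flat_dual_baer:
  fixes R :: "'r ring" and P :: "('r, 'p, 'f) module_scheme"
  assumes P: "flat_module R P"
  shows "baer (op_ring R) (dual P)"
  unfolding baer_def
proof (intro conjI allI impI)
  have lP: "left_module R P" using P by (simp add: flat_module_def)
  have R: "ring R" using lP by (rule lm_ring)
  show "left_module (op_ring R) (dual P)" by (rule lmod_dual[OF lP])
  fix L f assume L: "left_ideal (op_ring R) L" and f: "f \<in> ideal_hom (op_ring R) L (dual P)"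
  have LR: "l \<in> carrier R" if "l \<in> L" for l using L that by (auto simp: left_ideal_def)
  have one: "\<one>\<^sub>R \<in> carrier R" using R by (simp add: ring_rules)
  obtain c :: "'r => ('r, 'p) univ" where c: "inj c" using univ_embed_scalar by blast
  let ?BR = "ring_bimodule (op_ring R) id id"
  let ?AL = "?BR\<lparr>carrier := L\<rparr>"
  have lB0: "left_module (op_ring R) ?BR" by (rule lmod_regular[OF ring_op_ring[OF R]])
  have sL: "submod (op_ring R) ?BR L" using L by (simp only: submod_regular)
  have lA0: "left_module (op_ring R) ?AL" by (rule lmod_sub[OF lB0 sL])
  have cA: "inj_on c (carrier ?AL)" and cB: "inj_on c (carrier ?BR)" using c by (auto intro: inj_on_subset)
  note pA = push_inj[OF lA0 cA] and pB = push_inj[OF lB0 cB]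
  let ?A = "right_of (push c ?AL)" and ?B = "right_of (push c ?BR)"
  have rA: "right_module R ?A" by (rule rmod_right_of[OF R pA(1)])
  have rB: "right_module R ?B" by (rule rmod_right_of[OF R pB(1)])
  let ?b = "inv_into (carrier ?AL) c"
  have bc: "?b (c l) = l" if "l \<in> L" for l using inv_into_f_f[OF cA, of l] that by simp
  have bL: "?b a \<in> L" and cb: "c (?b a) = a" if "a \<in> carrier ?A" for a
    using that inv_into_into[of a c "carrier ?AL"] f_inv_into_f[of a c "carrier ?AL"] by (simp_all add: push_carrier')
  have fP: "f l \<in> carrier (dual P)" if "l \<in> L" for l using f that by (auto simp: ideal_hom_def)
  have fl: "f l \<in> ahom P QZ" if "l \<in> L" for l using dualD(1)[OF lP fP[OF that]] .
  have bal: "balanced R ?A P QZ (\<lambda>a x. f (?b a) x)"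
  proof (rule balancedI)
    fix a x assume a: "a \<in> carrier ?A" and x: "x \<in> carrier P"
    then have a': "a \<in> carrier (push c ?AL)" by simp
    show "f (?b a) x \<in> carrier QZ" by (rule ahom_closed[OF fl[OF bL[OF a]] x])
    show "f (?b (a \<oplus>\<^sub>?A a2)) x = f (?b a) x \<oplus>\<^sub>QZ f (?b a2) x" if "a2 \<in> carrier ?A" for a2
      using lh_add[OF pA(3) a', of a2] that f bL[OF a] bL[OF that] x by (simp add: ideal_hom_def dual_add)
    show "f (?b a) (x \<oplus>\<^sub>P y) = f (?b a) x \<oplus>\<^sub>QZ f (?b a) y" if "y \<in> carrier P" for y
      by (rule ahom_add[OF fl[OF bL[OF a]] x that])
    show "f (?b (a \<odot>\<^sub>r\<^sub>?A r)) x = f (?b a) (r \<odot>\<^sub>P x)" if r: "r \<in> carrier R" for r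
      using lh_smult[OF pA(3), of r a] a' r f bL[OF a] x by (simp add: ideal_hom_def dual_smult)
  qed
  let ?TA = "tensor_module R ?A P" and ?TB = "tensor_module R ?B P"
  obtain h1 where h1: "h1 \<in> ahom ?TA QZ"
    "\<And>a x. a \<in> carrier ?A ==> x \<in> carrier P ==> h1 (tensor_pure R ?A P a x) = f (?b a) x"
    using tensor_universal[OF rA lP agrp_QZ bal] by metis
  have "(\<lambda>x. x) \<in> left_hom (op_ring R) ?AL ?BR"
    using LR by (intro lh_sub_dom lh_id) auto
  from lh_comp[OF lh_comp[OF pA(3) this] pB(2)]
  have g0: "(\<lambda>a. c (?b a)) \<in> left_hom (op_ring R) (push c ?AL) (push c ?BR)" .
  have ga: "(\<lambda>a. c (?b a)) \<in> ahom ?A ?B" using g0 by (auto simp: ahom_def left_hom_def)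
  have gr: "c (?b (a \<odot>\<^sub>r\<^sub>?A r)) = c (?b a) \<odot>\<^sub>r\<^sub>?B r" if "a \<in> carrier ?A" "r \<in> carrier R" for a r
    using lh_smult[OF g0, of r a] that by simp
  have gR: "(\<lambda>a. c (?b a)) \<in> right_hom R ?A ?B" using ga gr by (simp add: right_hom_def ahom_def)
  have ginj: "inj_on (\<lambda>a. c (?b a)) (carrier ?A)" by (rule inj_onI) (metis cb)
  let ?G = "tensor_map R ?B P (\<lambda>a. c (?b a)) id"
  have Ginj: "inj_on ?G (carrier ?TA)"
    using P[unfolded flat_module_def, THEN conjunct2, rule_format, OF rA rB gR ginj] .
  have Gh: "?G \<in> ahom ?TA ?TB" by (rule tensor_map_props(1)[OF rA lP rB lP ga _ lh_id']) (rule gr)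
  have Gp: "?G (tensor_pure R ?A P a x) = tensor_pure R ?B P (c (?b a)) x" if "a \<in> carrier ?A" "x \<in> carrier P" for a x
    by (rule trans[OF tensor_map_props(2)[OF rA lP rB lP ga _ lh_id']]) (simp_all only: gr that id_apply)
  note agA = agrp_tensor[OF rA lP] and agB = agrp_tensor[OF rB lP]
  have ker: "h1 u = \<zero>\<^sub>QZ" if "u \<in> carrier ?TA" "?G u = \<zero>\<^sub>?TB" for u
  proof -
    have "u = \<zero>\<^sub>?TA" using inj_onD[OF Ginj _ that(1) ag_zero[OF agA]] that(2) ahom_zero[OF Gh agA agB] by simp
    then show ?thesis using ahom_zero[OF h1(1) agA agrp_QZ] by simp
  qed
  have "\<exists>h. h \<in> ahom ?TB QZ \<and> (\<forall>u\<in>carrier ?TA. h (?G u) = h1 u)"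
    by (rule ahom_extend[OF QZ_baer agA agB Gh h1(1)]) (rule ker, assumption+, blast)
  then obtain h2 where h2: "h2 \<in> ahom ?TB QZ" "\<And>u. u \<in> carrier ?TA ==> h2 (?G u) = h1 u" by blast
  note bB = tensor_pure_balanced[OF rB lP] and bA = tensor_pure_balanced[OF rA lP]
  have c1: "c \<one>\<^sub>R \<in> carrier ?B" using one by (simp add: push_carrier')
  let ?\<psi> = "\<lambda>x\<in>carrier P. h2 (tensor_pure R ?B P (c \<one>\<^sub>R) x)"
  have \<psi>: "?\<psi> \<in> carrier (dual P)"
    by (rule dualI[OF lP ahom_comp[OF balanced_ahom_r[OF bB c1] h2(1)]])
  have "f l = l \<odot>\<^sub>(dual P) ?\<psi>" if l: "l \<in> L" for l
  proof (rule dual_eqI[OF lP fP[OF l]])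
    have lo: "l \<in> carrier (op_ring R)" using LR[OF l] by simp
    show "l \<odot>\<^sub>(dual P) ?\<psi> \<in> carrier (dual P)" by (rule lm_closed[OF lmod_dual[OF lP] lo \<psi>])
    fix x assume x: "x \<in> carrier P"
    have clA: "c l \<in> carrier ?A" using l by (simp add: push_carrier')
    have "c \<one>\<^sub>R \<odot>\<^sub>r\<^sub>?B l = c l"
      using lh_smult[OF pB(2) lo, of "\<one>\<^sub>R"] one LR[OF l] R by (simp add: ring_rules)
    then have "tensor_pure R ?B P (c \<one>\<^sub>R) (l \<odot>\<^sub>P x) = tensor_pure R ?B P (c l) x"
      using balancedD(4)[OF bB c1 LR[OF l] x] by simp
    also have "\<dots> = ?G (tensor_pure R ?A P (c l) x)" using Gp[OF clA x] bc[OF l] by simp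
    finally have "h2 (tensor_pure R ?B P (c \<one>\<^sub>R) (l \<odot>\<^sub>P x)) = f l x"
      using h2(2)[OF balancedD(1)[OF bA clA x]] h1(2)[OF clA x] bc[OF l] by simp
    then show "f l x = (l \<odot>\<^sub>(dual P) ?\<psi>) x" using x lm_closed[OF lP LR[OF l] x] by (simp add: dual_smult)
  qed
  then show "\<exists>x\<in>carrier (dual P). \<forall>l\<in>L. f l = l \<odot>\<^sub>(dual P) x" using \<psi> by blast
qed

text \<open>If the induced map killed some \<open>u \<noteq> 0\<close>, a character of
  \<open>A \<otimes> P\<close> would be nonzero at \<open>u\<close>. It amounts to a map from
  \<open>A\<close> to the injective character module, which extends to \<open>B\<close> and so
  yields a character of \<open>B \<otimes> P\<close>; but the pullback of the latter vanishes at
  \<open>u\<close>.\<close>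

lemma dual_baer_flat:
  fixes R :: "'r ring" and P :: "('r, 'p, 'f) module_scheme"
  assumes lP: "left_module R P" and b: "baer (op_ring R) (dual P)"
  shows "flat_module R P"
  unfolding flat_module_def
proof (intro conjI allI impI lP)
  fix A B :: "(unit, 'r, ('r, 'p) univ) bimodule" and g
  assume A: "right_module R A" and B: "right_module R B" and g: "g \<in> right_hom R A B" and inj: "inj_on g (carrier A)"
  have ga: "g \<in> ahom A B" using g by (simp add: right_hom_def ahom_def)
  have gr: "g (a \<odot>\<^sub>r\<^sub>A r) = g a \<odot>\<^sub>r\<^sub>B r" if "a \<in> carrier A" "r \<in> carrier R" for a r
    using g that by (simp add: right_hom_def)
  let ?TA = "tensor_module R A P" and ?TB = "tensor_module R B P" and ?G = "tensor_map R B P g id"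
  note agA = agrp_tensor[OF A lP] and agB = agrp_tensor[OF B lP]
  have Gh: "?G \<in> ahom ?TA ?TB" by (rule tensor_map_props(1)[OF A lP B lP ga _ lh_id']) (rule gr)
  have Gp: "?G (tensor_pure R A P a x) = tensor_pure R B P (g a) x" if "a \<in> carrier A" "x \<in> carrier P" for a x
    by (rule trans[OF tensor_map_props(2)[OF A lP B lP ga _ lh_id']]) (simp_all only: gr that id_apply)
  note lA = lmod_left_of[OF A] and lB = lmod_left_of[OF B]
  have gl: "g \<in> left_hom (op_ring R) (left_of A) (left_of B)"
    using ga gr by (auto simp: left_hom_def ahom_def)
  have g0: "x = \<zero>\<^sub>A" if "x \<in> carrier A" "g x = \<zero>\<^sub>B" for x
    using inj_onD[OF inj _ that(1) ag_zero[OF rm_ag[OF A]]] that(2) ahom_zero[OF ga rm_ag[OF A] rm_ag[OF B]] by simp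
  note bA = tensor_pure_balanced[OF A lP]
  have ker: "u = \<zero>\<^sub>?TA" if u: "u \<in> carrier ?TA" and Gu: "?G u = \<zero>\<^sub>?TB" for u
  proof (rule ccontr)
    assume "u \<noteq> \<zero>\<^sub>?TA"
    then obtain \<chi> where \<chi>: "\<chi> \<in> ahom ?TA QZ" "\<chi> u \<noteq> \<zero>\<^sub>QZ" using QZ_cogenerator[OF agA u] by metis
    let ?k = "\<lambda>a. \<lambda>x\<in>carrier P. \<chi> (tensor_pure R A P a x)"
    have k: "?k \<in> left_hom (op_ring R) (left_of A) (dual P)"
    proof (rule left_homI)
      fix a assume "a \<in> carrier (left_of A)"
      then have a: "a \<in> carrier A" by simp
      show "?k a \<in> carrier (dual P)"
        by (rule dualI[OF lP ahom_comp[OF balanced_ahom_r[OF bA a] \<chi>(1)]])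
      show "?k (a \<oplus>\<^sub>(left_of A) a') = ?k a \<oplus>\<^sub>(dual P) ?k a'" if "a' \<in> carrier (left_of A)" for a'
        using a that by (auto simp: dual_add fun_eq_iff balancedD[OF bA] ahom_add[OF \<chi>(1)])
      show "?k (r \<odot>\<^sub>(left_of A) a) = r \<odot>\<^sub>(dual P) ?k a" if "r \<in> carrier (op_ring R)" for r
        using a that by (auto simp: dual_smult fun_eq_iff balancedD(4)[OF bA] lm_closed[OF lP])
    qed
    have "?k x = \<zero>\<^sub>(dual P)" if "x \<in> carrier (left_of A)" "g x = \<zero>\<^sub>(left_of B)" for x
      using g0[of x] that lh_zero_zero[OF k lA lmod_dual[OF lP]] by simp
    then obtain K where K: "K \<in> left_hom (op_ring R) (left_of B) (dual P)" "\<And>a. a \<in> carrier (left_of A) ==> K (g a) = ?k a"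
      using baer_extend[OF b lA lB gl k] by metis
    have KP: "K y \<in> ahom P QZ" if "y \<in> carrier B" for y
      using dualD(1)[OF lP lh_closed[OF K(1)]] that by simp
    have "balanced R B P QZ K"
    proof (rule balancedI)
      fix y x assume y: "y \<in> carrier B" and x: "x \<in> carrier P"
      show "K y x \<in> carrier QZ" by (rule ahom_closed[OF KP[OF y] x])
      show "K (y \<oplus>\<^sub>B y') x = K y x \<oplus>\<^sub>QZ K y' x" if "y' \<in> carrier B" for y'
        using lh_add[OF K(1), of y y'] y that x by (simp add: dual_add)
      show "K y (x \<oplus>\<^sub>P x') = K y x \<oplus>\<^sub>QZ K y x'" if "x' \<in> carrier P" for x'
        by (rule ahom_add[OF KP[OF y] x that])
      show "K (y \<odot>\<^sub>r\<^sub>B r) x = K y (r \<odot>\<^sub>P x)" if "r \<in> carrier R" for r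
        using lh_smult[OF K(1), of r y] y that x by (simp add: dual_smult)
    qed
    then obtain h where h: "h \<in> ahom ?TB QZ"
      "\<And>y x. y \<in> carrier B ==> x \<in> carrier P ==> h (tensor_pure R B P y x) = K y x"
      using tensor_universal[OF B lP agrp_QZ] by metis
    have "h (?G u) = \<chi> u"
    proof (rule is_tensor_eq[OF is_tensor_tensor_module[OF A lP] agrp_QZ ahom_comp[OF Gh h(1)] \<chi>(1) _ u])
      fix a x assume a: "a \<in> carrier A" and x: "x \<in> carrier P"
      show "h (?G (tensor_pure R A P a x)) = \<chi> (tensor_pure R A P a x)"
        using Gp[OF a x] h(2)[OF ahom_closed[OF ga a] x] K(2)[of a] a x by simp
    qed
    then show False using \<chi>(2) Gu ahom_zero[OF h(1) agB agrp_QZ] by simp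
  qed
  show "inj_on ?G (carrier ?TA)"
  proof (rule inj_onI)
    fix u v assume uv: "u \<in> carrier ?TA" "v \<in> carrier ?TA" "?G u = ?G v"
    have "?G (u \<ominus>\<^sub>?TA v) = \<zero>\<^sub>?TB"
      using ahom_diff[OF Gh agA agB uv(1,2)] uv(3) ag_diff_self[OF agB ahom_closed[OF Gh uv(2)]] by simp
    then have "u \<ominus>\<^sub>?TA v = \<zero>\<^sub>?TA" by (rule ker[OF ag_diff[OF agA uv(1,2)]])
    then show "u = v" using ag_diff_eq_zero[OF agA uv(1,2)] by simp
  qed
qed

section \<open>Flat dimension\<close>

definition fd_le :: "('r, 'e) ring_scheme => ('r, 'x, 'f) module_scheme => nat => bool" where
  "fd_le R X k \<longleftrightarrow> (\<exists>(P :: nat => ('r, ('r, 'x) univ) module) d e.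
       left_resolution R X P d e \<and> (\<forall>i. flat_module R (P i)) \<and>
       (\<forall>i>k. carrier (P i) = {\<zero>\<^sub>(P i)}))"

lemma fd_eq: "fd R X = Inf {enat k | k. fd_le R X k}"
  by (simp add: fd_def fd_le_def)

lemma dual_trivial:
  assumes Z: "left_module R Z" and z: "carrier Z = {\<zero>\<^sub>Z}"
  shows "carrier (dual Z) = {\<zero>\<^sub>(dual Z)}"
proof -
  note zd = ag_zero[OF lm_ag[OF lmod_dual[OF Z]]]
  have "\<phi> = \<zero>\<^sub>(dual Z)" if \<phi>: "\<phi> \<in> carrier (dual Z)" for \<phi>
    by (rule dual_eqI[OF Z \<phi> zd])
      (use z ahom_zero[OF dualD(1)[OF Z \<phi>] lm_ag[OF Z] agrp_QZ] in \<open>simp add: dual_zero\<close>)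
  then show ?thesis using zd by blast
qed

text \<open>A flat resolution that vanishes beyond \<open>k\<close> becomes an injective resolution
  of the character module of \<open>X\<close> that does so too. Conversely, the splitting makes the
  character module of \<open>Q\<close>, the quotient of \<open>P k\<close> by the boundaries, a
  summand of that of \<open>P k\<close>; so \<open>Q\<close> is flat and can end a resolution. The
  splitting exists on characters only, so it yields no complement inside \<open>P k\<close>.\<close>

lemma fd_le_iff_isplit:
  fixes R :: "'r ring" and P :: "nat => ('r, ('r, 'x) univ) module" and X :: "('r, 'x, 'f) module_scheme"
  assumes X: "left_module R X" and P: "left_resolution R X P d e" "\<And>i. projective_module R (P i)"
  shows "fd_le R X k \<longleftrightarrow> isplit (op_ring R) (\<lambda>i. dual (P i)) (\<lambda>i. dmap (P (Suc i)) (d i)) k"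
proof
  assume "fd_le R X k"
  then obtain F :: "nat => ('r, ('r, 'x) univ) module" and d' e'
    where F: "left_resolution R X F d' e'" "\<And>i. flat_module R (F i)" "carrier (F (Suc k)) = {\<zero>\<^sub>(F (Suc k))}"
    unfolding fd_le_def by blast
  show "isplit (op_ring R) (\<lambda>i. dual (P i)) (\<lambda>i. dmap (P (Suc i)) (d i)) k"
    by (rule finite_injective_isplit[where I = "\<lambda>i. dual (P i)" and J = "\<lambda>i. dual (F i)", OF lmod_dual[OF X]
          dual_resolution[OF X P(1)] projective_dual_baer[OF P(2)] dual_resolution[OF X F(1)] flat_dual_baer[OF F(2)]
          dual_trivial[OF left_resolutionD(1)[OF F(1)] F(3)]])
next
  note p = left_resolutionD[OF P(1)]
  assume "isplit (op_ring R) (\<lambda>i. dual (P i)) (\<lambda>i. dmap (P (Suc i)) (d i)) k"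
  then obtain t where t: "t \<in> left_hom (op_ring R) (dual (P k)) (dual (P k))"
    and td: "\<And>\<phi> y. \<phi> \<in> carrier (dual (P k)) ==> y \<in> carrier (P (Suc k)) ==> t \<phi> (d k y) = \<zero>\<^sub>QZ"
    and tid: "\<And>\<phi>. \<phi> \<in> carrier (dual (P k)) ==> (\<forall>y\<in>carrier (P (Suc k)). \<phi> (d k y) = \<zero>\<^sub>QZ) ==> t \<phi> = \<phi>"
    unfolding isplit_def by (auto simp: dmap_eq_zero[OF p(1)])
  define B where "B = d k ` carrier (P (Suc k))"
  have B: "submod R (P k) B" unfolding B_def by (rule submod_image[OF p(1) p(1) p(3)])
  \<comment> \<open>The quotient by the boundaries is formed from representatives inside
    \<open>P k\<close>, so it can be a term of a resolution in the same type.\<close>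
  define c where "c = coset_rep (P k) B"
  have cP: "c x \<in> carrier (P k)" "c x \<ominus>\<^sub>(P k) x \<in> B" if "x \<in> carrier (P k)" for x
  proof -
    have "c x \<in> carrier (P k) \<and> c x \<ominus>\<^sub>(P k) x \<in> B"
      unfolding c_def coset_rep_def
      by (rule someI[of _ x]) (simp add: that ag_diff_self[OF lm_ag[OF p(1)] that] submod_zero[OF B])
    then show "c x \<in> carrier (P k)" "c x \<ominus>\<^sub>(P k) x \<in> B" by blast+
  qed
  have cc: "c x = c y \<longleftrightarrow> x \<ominus>\<^sub>(P k) y \<in> B" if "x \<in> carrier (P k)" "y \<in> carrier (P k)" for x y
    unfolding c_def by (rule coset_rep_eq_iff[OF p(1) B that])
  define Q where "Q = push c (P k)"
  note pq = push_quotient[OF p(1) B cc, folded Q_def]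
  have ck: "c x = \<zero>\<^sub>Q \<longleftrightarrow> x \<in> B" if "x \<in> carrier (P k)" for x
    using pq(5) that by (auto simp: a_kernel_eq)
  let ?s = "inv_into (carrier (P k)) c"
  have s: "?s z \<in> carrier (P k)" "c (?s z) = z" if "z \<in> carrier Q" for z
    using that by (simp_all only: pq(3) inv_into_into f_inv_into_f)
  \<comment> \<open>A map that kills the boundaries does not distinguish \<open>x\<close> from its
    representative, hence may be used on \<open>Q\<close> unchanged.\<close>
  have fc: "f (c x) = f x"
    if f: "f \<in> ahom (P k) G" and G: "abelian_group G" and fB: "\<And>y. y \<in> carrier (P (Suc k)) ==> f (d k y) = \<zero>\<^sub>G"
      and x: "x \<in> carrier (P k)" for f x and G :: "('g, 'h) ring_scheme"
  proof -
    have "f (c x \<ominus>\<^sub>(P k) x) = \<zero>\<^sub>G" using cP(2)[OF x] fB by (auto simp: B_def)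
    then show ?thesis
      using ahom_diff[OF f lm_ag[OF p(1)] G cP(1)[OF x] x] ag_diff_eq_zero[OF G] ahom_closed[OF f] cP(1)[OF x] x by simp
  qed
  have baerQ: "baer (op_ring R) (dual Q)"
  proof (rule baer_retract[OF projective_dual_baer[OF P(2)[of k]] lmod_dual[OF pq(1)] dmap_hom[OF p(1) pq(1,2)]])
    \<comment> \<open>\<open>t \<phi>\<close> kills the boundaries, so its restriction to
      representatives is a character of \<open>Q\<close>. Characters pulled back from
      \<open>Q\<close> kill the boundaries and are fixed by \<open>t\<close>, which makes
      \<open>?p\<close> a retraction.\<close>
    let ?p = "\<lambda>\<phi>. \<lambda>z\<in>carrier Q. t \<phi> z"
    have QP: "z \<in> carrier (P k)" "c z = z" if zQ: "z \<in> carrier Q" for z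
    proof -
      show z: "z \<in> carrier (P k)" using zQ cP(1) pq(3) by auto
      obtain x where x: "x \<in> carrier (P k)" "z = c x" using zQ pq(3) by auto
      then show "c z = z" using cc[OF z x(1)] cP(2)[OF x(1)] by simp
    qed
    have tD: "t \<phi> \<in> ahom (P k) QZ" if "\<phi> \<in> carrier (dual (P k))" for \<phi>
      by (rule dualD(1)[OF p(1) lh_closed[OF t that]])
    have tc: "t \<phi> (c x) = t \<phi> x" if "\<phi> \<in> carrier (dual (P k))" "x \<in> carrier (P k)" for \<phi> x
      by (rule fc[OF tD[OF that(1)] agrp_QZ td[OF that(1)] that(2)])
    have add: "t \<phi> (z \<oplus>\<^sub>Q w) = t \<phi> z \<oplus>\<^sub>QZ t \<phi> w" if "\<phi> \<in> carrier (dual (P k))" "z \<in> carrier Q" "w \<in> carrier Q" for \<phi> z w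
    proof -
      have "z \<oplus>\<^sub>Q w = c (z \<oplus>\<^sub>(P k) w)" using lh_add[OF pq(2)] QP that(2,3) by simp
      then show ?thesis using tc[OF that(1)] ahom_add[OF tD[OF that(1)]] QP that(2,3) lm_ag[OF p(1)] by (simp add: ag_closed)
    qed
    have smult: "t \<phi> (r \<odot>\<^sub>Q z) = t \<phi> (r \<odot>\<^sub>(P k) z)" if "\<phi> \<in> carrier (dual (P k))" "z \<in> carrier Q" "r \<in> carrier R" for \<phi> z r
    proof -
      have "r \<odot>\<^sub>Q z = c (r \<odot>\<^sub>(P k) z)" using lh_smult[OF pq(2)] QP that by simp
      then show ?thesis using tc[OF that(1)] QP that lm_closed[OF p(1)] by simp
    qed
    show "?p \<in> left_hom (op_ring R) (dual (P k)) (dual Q)"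
    proof (rule left_homI)
      fix \<phi> assume \<phi>: "\<phi> \<in> carrier (dual (P k))"
      have "t \<phi> \<in> ahom Q QZ" by (rule ahomI) (use QP ahom_closed[OF tD[OF \<phi>]] add[OF \<phi>] in auto)
      then show "?p \<phi> \<in> carrier (dual Q)" using dualI[OF pq(1)] by blast
      show "?p (\<phi> \<oplus>\<^sub>(dual (P k)) \<psi>) = ?p \<phi> \<oplus>\<^sub>(dual Q) ?p \<psi>" if "\<psi> \<in> carrier (dual (P k))" for \<psi>
        using lh_add[OF t \<phi> that] QP by (auto simp: fun_eq_iff dual_add)
      show "?p (r \<odot>\<^sub>(dual (P k)) \<phi>) = r \<odot>\<^sub>(dual Q) ?p \<phi>" if "r \<in> carrier (op_ring R)" for r
        using lh_smult[OF t that \<phi>] that QP lm_closed[OF pq(1)] smult[OF \<phi>] by (auto simp: fun_eq_iff dual_smult)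
    qed
    fix \<chi> assume \<chi>: "\<chi> \<in> carrier (dual Q)"
    let ?\<phi> = "dmap (P k) c \<chi>"
    have \<phi>: "?\<phi> \<in> carrier (dual (P k))" by (rule lh_closed[OF dmap_hom[OF p(1) pq(1,2)] \<chi>])
    have eq: "t ?\<phi> = ?\<phi>"
    proof (rule tid[OF \<phi>], rule ballI)
      fix y assume y: "y \<in> carrier (P (Suc k))"
      then have "c (d k y) = \<zero>\<^sub>Q" using ck[OF lh_closed[OF p(3) y]] by (simp add: B_def)
      then show "?\<phi> (d k y) = \<zero>\<^sub>QZ"
        using ahom_zero[OF dualD(1)[OF pq(1) \<chi>] lm_ag[OF pq(1)] agrp_QZ] lh_closed[OF p(3) y] by (simp add: dmap_apply)
    qed
    show "?p ?\<phi> = \<chi>"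
    proof (rule extensionalityI[OF _ dualD(2)[OF pq(1) \<chi>]])
      show "?p ?\<phi> z = \<chi> z" if "z \<in> carrier Q" for z
        using that by (simp add: eq dmap_apply QP)
    qed simp
  qed
  \<comment> \<open>\<open>P\<close> ended by \<open>Q\<close> in degree \<open>k\<close>. The old
    maps are kept below, including the one that leaves \<open>Q\<close>, which makes sense on
    representatives.\<close>
  define F where "F = (\<lambda>i. if i < k then P i else if i = k then Q else (P i)\<lparr>carrier := {\<zero>\<^sub>(P i)}\<rparr>)"
  define D where "D = (\<lambda>i. if i < k then d i else (\<lambda>_. \<zero>\<^sub>(F i)))"
  have Z: "left_module R ((P i)\<lparr>carrier := {\<zero>\<^sub>(P i)}\<rparr>)" for i by (rule lmod_sub[OF p(1) submod_zero_set[OF p(1)]])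
  have lF: "left_module R (F i)" for i using p(1) pq(1) Z by (simp add: F_def)
  have tF: "carrier (F i) = {\<zero>\<^sub>(F i)}" if "i > k" for i using that by (simp add: F_def)
  have QP: "z \<in> carrier (P k)" if "z \<in> carrier Q" for z using that cP(1) pq(3) by auto
  have lift: "f \<in> left_hom R Q Y" "f ` carrier Q = f ` carrier (P k)"
    if f: "f \<in> left_hom R (P k) Y" and Y: "left_module R Y" and fB: "\<And>y. y \<in> carrier (P (Suc k)) ==> f (d k y) = \<zero>\<^sub>Y"
    for f and Y :: "('r, 'y, 'h) module_scheme"
  proof -
    have fc: "f (c x) = f x" if "x \<in> carrier (P k)" for x
      by (rule fc[OF lh_ahom[OF f] lm_ag[OF Y] _ that]) (rule fB)
    show "f \<in> left_hom R Q Y"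
    proof (rule left_homI)
      fix z assume z: "z \<in> carrier Q"
      show "f z \<in> carrier Y" by (rule lh_closed[OF f QP[OF z]])
      show "f (z \<oplus>\<^sub>Q w) = f z \<oplus>\<^sub>Y f w" if w: "w \<in> carrier Q" for w
        using lh_add[OF pq(2) s(1)[OF z] s(1)[OF w]] s(2)[OF z] s(2)[OF w] fc[OF s(1)[OF z]] fc[OF s(1)[OF w]]
          fc[OF ag_closed[OF lm_ag[OF p(1)] s(1)[OF z] s(1)[OF w]]] lh_add[OF f s(1)[OF z] s(1)[OF w]] by simp
      show "f (r \<odot>\<^sub>Q z) = r \<odot>\<^sub>Y f z" if r: "r \<in> carrier R" for r
        using lh_smult[OF pq(2) r s(1)[OF z]] s(2)[OF z] fc[OF s(1)[OF z]]
          fc[OF lm_closed[OF p(1) r s(1)[OF z]]] lh_smult[OF f r s(1)[OF z]] by simp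
    qed
    show "f ` carrier Q = f ` carrier (P k)" by (simp add: pq(3) image_image fc cong: image_cong_simp)
  qed
  have ker: "f z = \<zero>\<^sub>Y \<longleftrightarrow> z = \<zero>\<^sub>Q"
    if f: "\<And>x. x \<in> carrier (P k) ==> f x = \<zero>\<^sub>Y \<longleftrightarrow> x \<in> B" and z: "z \<in> carrier Q" for f z and Y :: "('r, 'y, 'h) module_scheme"
  proof -
    have "c z = z" using cc[OF QP[OF z] s(1)[OF z]] cP(2)[OF s(1)[OF z]] s(2)[OF z] by simp
    then show ?thesis using f[OF QP[OF z]] ck[OF QP[OF z]] by simp
  qed
  have ed: "e (d 0 y) = \<zero>\<^sub>X" if "y \<in> carrier (P (Suc 0))" for y
    using p(5)[OF lh_closed[OF p(3) that]] that by simp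
  have dd: "d i (d (Suc i) y) = \<zero>\<^sub>(P i)" if "y \<in> carrier (P (Suc (Suc i)))" for i y
    using p(6)[OF lh_closed[OF p(3) that]] that by simp
  have eF: "e \<in> left_hom R (F 0) X" "e ` carrier (F 0) = carrier X"
    using lift[of e X] p(2,4) X ed by (cases "k = 0"; simp add: F_def)+
  have dF: "d i \<in> left_hom R (F (Suc i)) (P i)" "d i ` carrier (F (Suc i)) = d i ` carrier (P (Suc i))" if "i < k" for i
    using that lift[of "d i" "P i"] p(3)[of i] p(1)[of i] dd[of _ i] by (cases "Suc i = k"; force simp: F_def)+
  have im0: "D i ` carrier (F (Suc i)) = {\<zero>\<^sub>(F i)}" if "i \<ge> k" for i
    using that ag_zero[OF lm_ag[OF lF]] by (auto simp: D_def)
  have "left_resolution R X F D e"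
    unfolding left_resolution_def
  proof (intro conjI allI lF eF)
    show "D i \<in> left_hom R (F (Suc i)) (F i)" for i
    proof (cases "i < k")
      case True
      then have "F i = P i" "D i = d i" by (simp_all add: F_def D_def)
      then show ?thesis using dF(1)[OF True] by simp
    next
      case False
      then show ?thesis using lh_zero[OF lF] by (simp add: D_def)
    qed
    show "D 0 ` carrier (F 1) = a_kernel (F 0) X e"
    proof (cases "k = 0")
      case True
      have "e z = \<zero>\<^sub>X \<longleftrightarrow> z = \<zero>\<^sub>Q" if "z \<in> carrier Q" for z
        by (rule ker[OF _ that]) (use p(5) True in \<open>simp add: B_def\<close>)
      then show ?thesis
        using im0[of 0] True ag_zero[OF lm_ag[OF pq(1)]] by (auto simp: a_kernel_eq F_def)
    next
      case False
      then show ?thesis using dF(2)[of 0] p(5) lh_closed[OF p(3)[of 0]] by (auto simp: a_kernel_eq D_def F_def)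
    qed
    fix i
    consider "Suc i < k" | "Suc i = k" | "i \<ge> k" by linarith
    then show "D (Suc i) ` carrier (F (Suc (Suc i))) = a_kernel (F (Suc i)) (F i) (D i)"
    proof cases
      case 1
      then show ?thesis using dF(2)[of "Suc i"] p(6)[of _ i] lh_closed[OF p(3)[of "Suc i"]]
        by (auto simp: a_kernel_eq D_def F_def)
    next
      case 2
      have "d i z = \<zero>\<^sub>(P i) \<longleftrightarrow> z = \<zero>\<^sub>Q" if "z \<in> carrier Q" for z
        by (rule ker[OF _ that]) (use p(6)[of _ i] 2 in \<open>simp add: B_def\<close>)
      then show ?thesis
        using im0[of k] 2 ag_zero[OF lm_ag[OF pq(1)]] by (auto simp: a_kernel_eq F_def D_def)
    next
      case 3
      then show ?thesis using im0[of "Suc i"] tF[of "Suc i"] by (auto simp: a_kernel_eq D_def)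
    qed
  qed
  moreover have "flat_module R (F i)" for i
  proof (rule dual_baer_flat[OF lF])
    note bP = projective_dual_baer[OF P(2)[of i]]
    have "baer (op_ring R) (dual (F i))" if "i > k"
      by (rule baer_retract[OF bP lmod_dual[OF lF] lh_zero[OF lmod_dual[OF p(1)]]
            lh_zero[OF lmod_dual[OF lF]]]) (simp add: dual_trivial[OF lF tF[OF that]])
    then show "baer (op_ring R) (dual (F i))" using bP baerQ by (cases i k rule: linorder_cases) (simp_all add: F_def)
  qed
  ultimately show "fd_le R X k"
    unfolding fd_le_def using tF by (intro exI conjI allI impI)
qed

text \<open>Relabelling induces inverse isomorphisms of the character modules in degree
  \<open>k\<close>, so \<open>isplit_iso\<close> applies both ways.\<close>

lemma dual_isplit_push:
  fixes c :: "nat => 'u => 'v" and J :: "nat => ('r, 'u) module"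
  assumes lJ: "\<And>i. left_module R (J i)" and c: "\<And>i. inj_on (c i) (carrier (J i))"
    and d: "\<And>i. d i \<in> left_hom R (J (Suc i)) (J i)"
  shows "isplit (op_ring R) (\<lambda>i. dual (push (c i) (J i)))
      (\<lambda>i. dmap (push (c (Suc i)) (J (Suc i))) (\<lambda>y. c i (d i (inv_into (carrier (J (Suc i))) (c (Suc i)) y)))) k \<longleftrightarrow>
    isplit (op_ring R) (\<lambda>i. dual (J i)) (\<lambda>i. dmap (J (Suc i)) (d i)) k" (is "isplit _ ?I ?d k \<longleftrightarrow> isplit _ ?I' ?d' k")
proof -
  note pJ = push_inj[OF lJ c]
  let ?b = "inv_into (carrier (J k)) (c k)"
  let ?A = "dmap (J k) (c k)" and ?B = "dmap (push (c k) (J k)) ?b"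
  have A: "?A \<in> left_hom (op_ring R) (?I k) (?I' k)" by (rule dmap_hom[OF lJ pJ(1,2)])
  have B: "?B \<in> left_hom (op_ring R) (?I' k) (?I k)" by (rule dmap_hom[OF pJ(1) lJ pJ(3)])
  have bc: "inv_into (carrier (J i)) (c i) (c i x) = x" if "x \<in> carrier (J i)" for i x by (rule inv_into_f_f[OF c that])
  have cb: "c k (?b y) = y" if "y \<in> carrier (push (c k) (J k))" for y using that by (simp add: push_carrier' f_inv_into_f)
  note cJ = lh_closed[OF pJ(2)]
  have AB: "?A (?B \<phi>) = \<phi>" if \<phi>: "\<phi> \<in> carrier (?I' k)" for \<phi>
    by (rule dual_eqI[OF lJ lh_closed[OF A lh_closed[OF B \<phi>]] \<phi>]) (simp add: dmap_apply bc cJ)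
  have BA: "?B (?A \<phi>) = \<phi>" if \<phi>: "\<phi> \<in> carrier (?I k)" for \<phi>
    by (rule dual_eqI[OF pJ(1) lh_closed[OF B lh_closed[OF A \<phi>]] \<phi>])
      (simp add: dmap_apply cb lh_closed[OF pJ(3)])
  have ker: "?d k \<phi> = \<zero>\<^sub>(?I (Suc k)) \<longleftrightarrow> ?d' k (?A \<phi>) = \<zero>\<^sub>(?I' (Suc k))" for \<phi>
    by (simp add: dmap_eq_zero[OF pJ(1)] dmap_eq_zero[OF lJ] push_carrier' bc dmap_apply lh_closed[OF d])
  have ker': "?d' k \<phi> = \<zero>\<^sub>(?I' (Suc k)) \<longleftrightarrow> ?d k (?B \<phi>) = \<zero>\<^sub>(?I (Suc k))" if "\<phi> \<in> carrier (?I' k)" for \<phi>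
    by (rule trans[OF arg_cong[OF AB[OF that, symmetric], of "\<lambda>\<psi>. ?d' k \<psi> = \<zero>\<^sub>(?I' (Suc k))"] ker[symmetric]])
  show ?thesis
  proof
    show "isplit (op_ring R) ?I' ?d' k" if "isplit (op_ring R) ?I ?d k"
      by (rule isplit_iso[where I = ?I and I' = ?I' and d = ?d and d' = ?d' and k = k, OF A B AB BA ker that])
    show "isplit (op_ring R) ?I ?d k" if "isplit (op_ring R) ?I' ?d' k"
      by (rule isplit_iso[where I = ?I' and I' = ?I and d = ?d' and d' = ?d and k = k, OF B A BA AB ker' that])
  qed
qed

section \<open>Character modules of induced modules\<close>

context graded_extension
begin

lemma T_dual_eqI:
  assumes P: "left_module R P" and \<phi>: "\<phi> \<in> carrier (dual (T P))" and \<psi>: "\<psi> \<in> carrier (dual (T P))"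
    and eq: "\<And>s x. s \<in> carrier S ==> x \<in> carrier P ==> \<phi> (\<tau> P s x) = \<psi> (\<tau> P s x)"
  shows "\<phi> = \<psi>"
proof (rule dual_eqI[OF T_left_module[OF P] \<phi> \<psi>])
  note D = dualD(1)[OF T_left_module[OF P]]
  show "\<phi> u = \<psi> u" if "u \<in> carrier (T P)" for u
    by (rule T_hom_eq[OF P agrp_QZ D[OF \<phi>] D[OF \<psi>] eq that])
qed

text \<open>A character of \<^term>\<open>T P\<close> is a family of characters of \<^term>\<open>P\<close>, indexed by \<^term>\<open>S\<close>.\<close>

definition slice :: "('r, 'p, 'f) module_scheme => 's => (('s \<times> 'p \<Rightarrow>\<^sub>0 int) set => rat) => 'p => rat" where
  "slice P s \<phi> = (\<lambda>x\<in>carrier P. \<phi> (\<tau> P s x))"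

lemma slice_dual:
  assumes P: "left_module R P" and \<phi>: "\<phi> \<in> carrier (dual (T P))" and s: "s \<in> carrier S"
  shows "slice P s \<phi> \<in> carrier (dual P)"
proof -
  have "s \<in> carrier TB" using s by simp
  from balanced_ahom_r[OF tensor_pure_balanced[OF TBr P] this] show ?thesis
    unfolding slice_def by (rule dualI[OF P ahom_comp[OF _ dualD(1)[OF T_left_module[OF P] \<phi>]]])
qed

text \<open>\<open>t\<close> is applied to every slice of a character. The family obtained is
  balanced because slices are additive in \<open>s\<close> and the slice at
  \<open>s \<otimes>\<^sub>S \<iota> r\<close> is \<open>r\<close> times the slice at
  \<open>s\<close>; so it is again a character of \<open>T P\<close>.\<close>

lemma T_dual_map:
  assumes P: "left_module R P" and t: "t \<in> left_hom (op_ring R) (dual P) (dual P)"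
  obtains t' where "t' \<in> left_hom (op_ring S) (dual (T P)) (dual (T P))"
    "\<And>\<phi> s x. \<phi> \<in> carrier (dual (T P)) ==> s \<in> carrier S ==> x \<in> carrier P ==> t' \<phi> (\<tau> P s x) = t (slice P s \<phi>) x"
proof -
  note lT = T_left_module[OF P] and b = T_balanced[OF P]
  note lD = lmod_dual[OF P] and lDT = lmod_dual[OF lT]
  have tD: "t \<psi> \<in> ahom P QZ" if "\<psi> \<in> carrier (dual P)" for \<psi> by (rule dualD(1)[OF P lh_closed[OF t that]])
  have ex: "\<exists>\<psi>. \<psi> \<in> carrier (dual (T P)) \<and> (\<forall>s\<in>carrier S. \<forall>x\<in>carrier P. \<psi> (\<tau> P s x) = t (slice P s \<phi>) x)"
    if \<phi>: "\<phi> \<in> carrier (dual (T P))" for \<phi>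
  proof -
    note sl = slice_dual[OF P \<phi>] and \<phi>h = dualD(1)[OF lT \<phi>]
    have "balanced R TB P QZ (\<lambda>s x. t (slice P s \<phi>) x)"
    proof (rule balancedI)
      fix s x assume s: "s \<in> carrier TB" and x: "x \<in> carrier P"
      then have sS: "s \<in> carrier S" by simp
      show "t (slice P s \<phi>) x \<in> carrier QZ" by (rule ahom_closed[OF tD[OF sl[OF sS]] x])
      show "t (slice P s \<phi>) (x \<oplus>\<^sub>P y) = t (slice P s \<phi>) x \<oplus>\<^sub>QZ t (slice P s \<phi>) y" if "y \<in> carrier P" for y
        by (rule ahom_add[OF tD[OF sl[OF sS]] x that])
      show "t (slice P (s \<oplus>\<^sub>TB s') \<phi>) x = t (slice P s \<phi>) x \<oplus>\<^sub>QZ t (slice P s' \<phi>) x" if "s' \<in> carrier TB" for s'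
      proof -
        have s': "s' \<in> carrier S" using that by simp
        have "slice P (s \<oplus>\<^sub>S s') \<phi> = slice P s \<phi> \<oplus>\<^sub>(dual P) slice P s' \<phi>"
          by (auto simp: slice_def dual_add fun_eq_iff b sS s' ahom_add[OF \<phi>h])
        then show ?thesis using lh_add[OF t sl[OF sS] sl[OF s']] x by (simp add: dual_add)
      qed
      show "t (slice P (s \<odot>\<^sub>r\<^sub>TB r) \<phi>) x = t (slice P s \<phi>) (r \<odot>\<^sub>P x)" if r: "r \<in> carrier R" for r
      proof -
        have "slice P (s \<otimes>\<^sub>S \<iota> r) \<phi> = r \<odot>\<^sub>(dual P) slice P s \<phi>"
          by (auto simp: slice_def dual_smult fun_eq_iff b(4) sS r lm_closed[OF P])
        then show ?thesis using lh_smult[OF t _ sl[OF sS], of r] r x by (simp add: dual_smult)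
      qed
    qed
    from is_tensor_universal[OF T_is_tensor[OF P] agrp_QZ this]
    obtain h where h: "h \<in> ahom (T P) QZ"
      "\<And>a x. a \<in> carrier TB ==> x \<in> carrier P ==> h (\<tau> P a x) = t (slice P a \<phi>) x" by metis
    show ?thesis
      by (rule exI[of _ "restrict h (carrier (T P))"]) (use dualI[OF lT h(1)] h(2) b(1) in simp)
  qed
  then have "\<forall>\<phi>\<in>carrier (dual (T P)). \<exists>\<psi>. \<psi> \<in> carrier (dual (T P)) \<and>
      (\<forall>s\<in>carrier S. \<forall>x\<in>carrier P. \<psi> (\<tau> P s x) = t (slice P s \<phi>) x)" by blast
  from bchoice[OF this] obtain t' where t'D: "\<And>\<phi>. \<phi> \<in> carrier (dual (T P)) ==> t' \<phi> \<in> carrier (dual (T P))"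
    and t': "\<And>\<phi> s x. \<phi> \<in> carrier (dual (T P)) ==> s \<in> carrier S ==> x \<in> carrier P ==> t' \<phi> (\<tau> P s x) = t (slice P s \<phi>) x"
    by blast
  have "t' \<in> left_hom (op_ring S) (dual (T P)) (dual (T P))"
  proof (rule left_homI[OF t'D])
    fix \<phi> assume \<phi>: "\<phi> \<in> carrier (dual (T P))"
    note sl = slice_dual[OF P \<phi>]
    show "t' (\<phi> \<oplus>\<^sub>(dual (T P)) \<psi>) = t' \<phi> \<oplus>\<^sub>(dual (T P)) t' \<psi>" if \<psi>: "\<psi> \<in> carrier (dual (T P))" for \<psi>
    proof (rule T_dual_eqI[OF P t'D ag_closed[OF lm_ag[OF lDT] t'D[OF \<phi>] t'D[OF \<psi>]]])
      show a: "\<phi> \<oplus>\<^sub>(dual (T P)) \<psi> \<in> carrier (dual (T P))" by (rule ag_closed[OF lm_ag[OF lDT] \<phi> \<psi>])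
      fix s x assume s: "s \<in> carrier S" and x: "x \<in> carrier P"
      have "slice P s (\<phi> \<oplus>\<^sub>(dual (T P)) \<psi>) = slice P s \<phi> \<oplus>\<^sub>(dual P) slice P s \<psi>"
        using s b(1) by (auto simp: slice_def dual_add fun_eq_iff)
      then show "t' (\<phi> \<oplus>\<^sub>(dual (T P)) \<psi>) (\<tau> P s x) = (t' \<phi> \<oplus>\<^sub>(dual (T P)) t' \<psi>) (\<tau> P s x)"
        using lh_add[OF t sl[OF s] slice_dual[OF P \<psi> s]] t'[OF a s x] t'[OF \<phi> s x] t'[OF \<psi> s x] x b(1)[OF s x]
        by (simp add: dual_add)
    qed
    show "t' (r \<odot>\<^sub>(dual (T P)) \<phi>) = r \<odot>\<^sub>(dual (T P)) t' \<phi>" if r: "r \<in> carrier (op_ring S)" for r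
    proof (rule T_dual_eqI[OF P t'D lm_closed[OF lDT r t'D[OF \<phi>]]])
      show a: "r \<odot>\<^sub>(dual (T P)) \<phi> \<in> carrier (dual (T P))" by (rule lm_closed[OF lDT r \<phi>])
      fix s x assume s: "s \<in> carrier S" and x: "x \<in> carrier P"
      have rS: "r \<in> carrier S" "r \<otimes>\<^sub>S s \<in> carrier S" using r s S by (simp_all add: ring_rules)
      have "slice P s (r \<odot>\<^sub>(dual (T P)) \<phi>) = slice P (r \<otimes>\<^sub>S s) \<phi>"
        using s b(1) by (auto simp: slice_def dual_smult fun_eq_iff T_smult[OF P rS(1)])
      then show "t' (r \<odot>\<^sub>(dual (T P)) \<phi>) (\<tau> P s x) = (r \<odot>\<^sub>(dual (T P)) t' \<phi>) (\<tau> P s x)"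
        using t'[OF a s x] t'[OF \<phi> rS(2) x] T_smult[OF P rS(1) s x] b(1)[OF s x] by (simp add: dual_smult)
    qed
  qed
  then show ?thesis using that t' by blast
qed

text \<open>As for \<open>T_psplit_iff\<close> with arrows reversed: on the way back, characters of
  \<open>P k\<close> are pulled back along \<open>\<rho>\<close>, moved by \<open>t\<close> and
  restricted along \<open>x \<mapsto> 1 \<otimes> x\<close>.\<close>

lemma T_dual_isplit_iff:
  assumes lP: "\<And>i. left_module R (P i)" and d: "\<And>i. d i \<in> left_hom R (P (Suc i)) (P i)"
  shows "isplit (op_ring S) (\<lambda>i. dual (T (P i))) (\<lambda>i. dmap (T (P (Suc i))) (tmap R TB (P i) (d i))) k \<longleftrightarrow>
    isplit (op_ring R) (\<lambda>i. dual (P i)) (\<lambda>i. dmap (P (Suc i)) (d i)) k"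
proof -
  let ?D = "tmap R TB (P k) (d k)"
  note Dp = tmap_props[OF TBr lP lP d] and lT = T_left_module[OF lP]
  note b = T_balanced[OF lP]
  have D\<tau>: "?D (\<tau> (P (Suc k)) s y) = \<tau> (P k) s (d k y)" if "s \<in> carrier S" "y \<in> carrier (P (Suc k))" for s y
    using Dp(2) that by simp
  note simps = dmap_eq_zero[OF lP] dmap_eq_zero[OF lT]
  show ?thesis
  proof
    assume "isplit (op_ring R) (\<lambda>i. dual (P i)) (\<lambda>i. dmap (P (Suc i)) (d i)) k"
    then obtain t where t: "t \<in> left_hom (op_ring R) (dual (P k)) (dual (P k))"
      and td: "\<And>\<phi> y. \<phi> \<in> carrier (dual (P k)) ==> y \<in> carrier (P (Suc k)) ==> t \<phi> (d k y) = \<zero>\<^sub>QZ"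
      and tid: "\<And>\<phi>. \<phi> \<in> carrier (dual (P k)) ==> (\<forall>y\<in>carrier (P (Suc k)). \<phi> (d k y) = \<zero>\<^sub>QZ) ==> t \<phi> = \<phi>"
      unfolding isplit_def by (auto simp: simps)
    obtain t' where t': "t' \<in> left_hom (op_ring S) (dual (T (P k))) (dual (T (P k)))"
      and t'\<tau>: "\<And>\<phi> s x. \<phi> \<in> carrier (dual (T (P k))) ==> s \<in> carrier S ==> x \<in> carrier (P k) ==> t' \<phi> (\<tau> (P k) s x) = t (slice (P k) s \<phi>) x"
      using T_dual_map[OF lP t] by metis
    show "isplit (op_ring S) (\<lambda>i. dual (T (P i))) (\<lambda>i. dmap (T (P (Suc i))) (tmap R TB (P i) (d i))) k"
      unfolding isplit_def simps
    proof (rule bexI[OF _ t'], intro conjI ballI impI)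
      fix \<phi> v assume \<phi>: "\<phi> \<in> carrier (dual (T (P k)))" and v: "v \<in> carrier (T (P (Suc k)))"
      have z: "(\<lambda>u. \<zero>\<^sub>QZ) \<in> ahom (T (P (Suc k))) QZ"
        by (rule ahomI) (simp_all add: ag_zero[OF agrp_QZ] ag_l_zero[OF agrp_QZ] ag_zero)
      show "t' \<phi> (?D v) = \<zero>\<^sub>QZ"
        by (rule T_hom_eq[OF lP agrp_QZ ahom_comp[OF Dp(1) dualD(1)[OF lT lh_closed[OF t' \<phi>]]] z _ v])
          (simp add: D\<tau> t'\<tau>[OF \<phi>] lh_closed[OF d] td slice_dual[OF lP \<phi>])
    next
      fix \<phi> assume \<phi>: "\<phi> \<in> carrier (dual (T (P k)))" and z: "\<forall>v\<in>carrier (T (P (Suc k))). \<phi> (?D v) = \<zero>\<^sub>QZ"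
      show "t' \<phi> = \<phi>"
      proof (rule T_dual_eqI[OF lP lh_closed[OF t' \<phi>] \<phi>])
        fix s x assume s: "s \<in> carrier S" and x: "x \<in> carrier (P k)"
        have "slice (P k) s \<phi> (d k y) = \<zero>\<^sub>QZ" if y: "y \<in> carrier (P (Suc k))" for y
          using bspec[OF z b(1)[OF s y]] D\<tau>[OF s y] lh_closed[OF d y] by (simp add: slice_def)
        then have "t (slice (P k) s \<phi>) = slice (P k) s \<phi>" by (intro tid[OF slice_dual[OF lP \<phi> s]] ballI)
        then show "t' \<phi> (\<tau> (P k) s x) = \<phi> (\<tau> (P k) s x)" using t'\<tau>[OF \<phi> s x] x by (simp add: slice_def)
      qed
    qed
  next
    assume "isplit (op_ring S) (\<lambda>i. dual (T (P i))) (\<lambda>i. dmap (T (P (Suc i))) (tmap R TB (P i) (d i))) k"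
    then obtain t where t: "t \<in> left_hom (op_ring S) (dual (T (P k))) (dual (T (P k)))"
      and td: "\<And>\<phi> v. \<phi> \<in> carrier (dual (T (P k))) ==> v \<in> carrier (T (P (Suc k))) ==> t \<phi> (?D v) = \<zero>\<^sub>QZ"
      and tid: "\<And>\<phi>. \<phi> \<in> carrier (dual (T (P k))) ==> (\<forall>v\<in>carrier (T (P (Suc k))). \<phi> (?D v) = \<zero>\<^sub>QZ) ==> t \<phi> = \<phi>"
      unfolding isplit_def by (auto simp: simps)
    obtain \<rho> where \<rho>: "\<rho> \<in> ahom (T (P k)) (P k)" "\<And>s x. s \<in> carrier S ==> x \<in> carrier (P k) ==> \<rho> (\<tau> (P k) s x) = \<pi> s \<odot>\<^sub>(P k) x"
      "\<And>r u. r \<in> carrier R ==> u \<in> carrier (T (P k)) ==> \<rho> (\<iota> r \<odot>\<^sub>(T (P k)) u) = r \<odot>\<^sub>(P k) \<rho> u"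
      using T_retraction[OF lP] by metis
    obtain \<rho>' where \<rho>': "\<rho>' \<in> ahom (T (P (Suc k))) (P (Suc k))"
      "\<And>s x. s \<in> carrier S ==> x \<in> carrier (P (Suc k)) ==> \<rho>' (\<tau> (P (Suc k)) s x) = \<pi> s \<odot>\<^sub>(P (Suc k)) x"
      using T_retraction[OF lP] by metis
    have nat: "\<rho> (?D y) = d k (\<rho>' y)" if "y \<in> carrier (T (P (Suc k)))" for y
      by (rule T_hom_eq[OF lP lm_ag[OF lP] ahom_comp[OF Dp(1) \<rho>(1)] ahom_comp[OF \<rho>'(1) lh_ahom[OF d]] _ that])
        (simp add: Dp(2) \<rho>(2) \<rho>'(2) lh_closed[OF d] lh_smult[OF d \<pi>_closed])
    note \<rho>c = ahom_closed[OF \<rho>(1)]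
    let ?r = "dmap (T (P k)) \<rho>"
    let ?t = "\<lambda>\<psi>. \<lambda>x\<in>carrier (P k). t (?r \<psi>) (\<tau> (P k) \<one>\<^sub>S x)"
    have rD: "?r \<psi> \<in> carrier (dual (T (P k)))" if "\<psi> \<in> carrier (dual (P k))" for \<psi>
      unfolding dmap_def by (rule dualI[OF lT ahom_comp[OF \<rho>(1) dualD(1)[OF lP that]]])
    have tD: "t (?r \<psi>) \<in> ahom (T (P k)) QZ" if "\<psi> \<in> carrier (dual (P k))" for \<psi>
      by (rule dualD(1)[OF lT lh_closed[OF t rD[OF that]]])
    have h: "?t \<in> left_hom (op_ring R) (dual (P k)) (dual (P k))"
    proof (rule left_homI)
      fix \<psi> assume \<psi>: "\<psi> \<in> carrier (dual (P k))"
      have "\<tau> (P k) \<one>\<^sub>S \<in> ahom (P k) (T (P k))" by (rule ahomI) (simp_all add: b S1)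
      then show "?t \<psi> \<in> carrier (dual (P k))" by (rule dualI[OF lP ahom_comp[OF _ tD[OF \<psi>]]])
      show "?t (\<psi> \<oplus>\<^sub>(dual (P k)) \<chi>) = ?t \<psi> \<oplus>\<^sub>(dual (P k)) ?t \<chi>" if \<chi>: "\<chi> \<in> carrier (dual (P k))" for \<chi>
      proof -
        have "?r (\<psi> \<oplus>\<^sub>(dual (P k)) \<chi>) = ?r \<psi> \<oplus>\<^sub>(dual (T (P k))) ?r \<chi>" by (auto simp: fun_eq_iff dmap_def dual_add \<rho>c)
        then have eq: "t (?r (\<psi> \<oplus>\<^sub>(dual (P k)) \<chi>)) = t (?r \<psi>) \<oplus>\<^sub>(dual (T (P k))) t (?r \<chi>)"
          using lh_add[OF t rD[OF \<psi>] rD[OF \<chi>]] by (simp only:)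
        show ?thesis unfolding eq using b(1)[OF S1] by (auto simp: fun_eq_iff dual_add)
      qed
      show "?t (r \<odot>\<^sub>(dual (P k)) \<psi>) = r \<odot>\<^sub>(dual (P k)) ?t \<psi>" if "r \<in> carrier (op_ring R)" for r
      proof -
        have r: "r \<in> carrier R" using that by simp
        have ir: "\<iota> r \<in> carrier (op_ring S)" using \<iota>_closed[OF r] by simp
        have "?r (r \<odot>\<^sub>(dual (P k)) \<psi>) = \<iota> r \<odot>\<^sub>(dual (T (P k))) ?r \<psi>"
          using lm_closed[OF lT \<iota>_closed[OF r]] by (auto simp: fun_eq_iff dmap_def dual_smult \<rho>c \<rho>(3)[OF r])
        then have eq: "t (?r (r \<odot>\<^sub>(dual (P k)) \<psi>)) = \<iota> r \<odot>\<^sub>(dual (T (P k))) t (?r \<psi>)"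
          using lh_smult[OF t ir rD[OF \<psi>]] by (simp only:)
        have "t (?r (r \<odot>\<^sub>(dual (P k)) \<psi>)) (\<tau> (P k) \<one>\<^sub>S x) = t (?r \<psi>) (\<tau> (P k) \<one>\<^sub>S (r \<odot>\<^sub>(P k) x))" if x: "x \<in> carrier (P k)" for x
          unfolding eq using b(1)[OF S1 x] lh_smult[OF \<tau>_one_hom[OF lP] r x] by (simp add: dual_smult)
        then show ?thesis unfolding dual_smult using lm_closed[OF lP r] by (intro restrict_ext) simp
      qed
    qed
    show "isplit (op_ring R) (\<lambda>i. dual (P i)) (\<lambda>i. dmap (P (Suc i)) (d i)) k"
      unfolding isplit_def simps
    proof (rule bexI[OF _ h], intro conjI ballI impI)
      fix \<psi> y assume \<psi>: "\<psi> \<in> carrier (dual (P k))" and y: "y \<in> carrier (P (Suc k))"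
      show "?t \<psi> (d k y) = \<zero>\<^sub>QZ"
        using td[OF rD[OF \<psi>] b(1)[OF S1 y]] lh_closed[OF d y] by (simp add: D\<tau>[OF S1 y])
    next
      fix \<psi> assume \<psi>: "\<psi> \<in> carrier (dual (P k))" and z: "\<forall>y\<in>carrier (P (Suc k)). \<psi> (d k y) = \<zero>\<^sub>QZ"
      have "t (?r \<psi>) = ?r \<psi>"
        by (rule tid[OF rD[OF \<psi>]]) (use z ahom_closed[OF \<rho>'(1)] ahom_closed[OF Dp(1)] in \<open>simp add: dmap_apply nat\<close>)
      then show "?t \<psi> = \<psi>"
        using dualD(2)[OF lP \<psi>] b(1)[OF S1] by (auto simp: fun_eq_iff dmap_apply \<rho>(2)[OF S1] \<pi>_one lm_one[OF lP] extensional_def)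
    qed
  qed
qed

text \<open>Tor refers to one chosen projective resolution, so its vanishing concerns exactly this
  one. Both dimensions of \<open>X\<close> are read off from it, and those of \<open>T X\<close>
  from its relabelled image under \<open>T\<close>.\<close>

theorem T_dimensions:
  fixes X :: "('r, 'x, 'f) module_scheme" and i0 :: "'r => 's"
  assumes X: "left_module R X" and i0: "inj i0"
    and Tor: "\<And>k j. k \<ge> 1 ==> j \<ge> 1 ==> trivial_group (Tor R (N k) X j)"
  shows "pd S (T X) = pd R X" and "fd S (T X) = fd R X"
proof -
  obtain P d e where Pde: "projective_resolution R X = (P, d, e)" by (cases "projective_resolution R X") auto
  have "case projective_resolution R X of (P, d, e) => left_resolution R X P d e \<and> (\<forall>i. projective_module R (P i))"
    unfolding projective_resolution_def
    by (rule someI_ex) (use projective_resolution_exists[OF X] in auto)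
  then have res: "left_resolution R X P d e" and proj: "\<And>i. projective_module R (P i)" by (auto simp: Pde)
  note p = left_resolutionD[OF res]
  have "tensor_exact R (N k) P d i" for i k
  proof (cases k)
    case 0 then show ?thesis using tensor_exact_zero[OF res] by simp
  next
    case (Suc k') then show ?thesis using Tor_tensor_exact[OF N Pde res] Tor by simp
  qed
  then have Tres: "left_resolution S (T X) (\<lambda>i. T (P i)) (\<lambda>i. tmap R TB (P i) (d i)) (tmap R TB X e)"
    by (rule T_resolution[OF X res])
  obtain c :: "nat => ('s \<times> ('r, 'x) univ \<Rightarrow>\<^sub>0 int) set => ('s, ('s \<times> 'x \<Rightarrow>\<^sub>0 int) set) univ"
    where c: "\<And>i. inj_on (c i) (carrier (T (P i)))" using T_embed[where P = P, OF p(1) i0] by blast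
  note lT = T_left_module[OF p(1)] and Td = left_resolutionD(3)[OF Tres]
  note r = left_resolution_push[where c = c and J = "\<lambda>i. T (P i)", OF lT c T_left_module[OF X] Tres]
  note pr = T_projective[OF proj c]
  have "pd_le S (T X) k \<longleftrightarrow> pd_le R X k" for k
    unfolding pd_le_iff_psplit[where P = "\<lambda>i. push (c i) (T (P i))", OF T_left_module[OF X] r pr]
      psplit_push[where c = c and J = "\<lambda>i. T (P i)", OF lT c Td]
      T_psplit_iff[where P = P and d = d, OF p(1,3)] pd_le_iff_psplit[OF X res proj] by (rule refl)
  then show "pd S (T X) = pd R X" by (simp only: pd_eq)
  have "fd_le S (T X) k \<longleftrightarrow> fd_le R X k" for k
    unfolding fd_le_iff_isplit[where P = "\<lambda>i. push (c i) (T (P i))", OF T_left_module[OF X] r pr]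
      dual_isplit_push[where c = c and J = "\<lambda>i. T (P i)", OF lT c Td]
      T_dual_isplit_iff[where P = P and d = d, OF p(1,3)] fd_le_iff_isplit[OF X res proj] by (rule refl)
  then show "fd S (T X) = fd R X" by (simp only: fd_eq)
qed

end

theorem corollary4p3:
  fixes R :: "'r ring" and M :: "('r, 'r, 'm) bimodule" and X :: "('r, 'x) module" and n :: nat
  assumes "ring R" and "\<one>\<^bsub>R\<^esub> \<noteq> \<zero>\<^bsub>R\<^esub>"
    and "is_bimodule R R M"
    and "n \<ge> 1"
    and "left_module R X"
  shows "((\<forall>i\<ge>1. \<forall>j\<ge>1. trivial_group (Tor R (tensor_power R M i) X j)) \<longrightarrow>
            pd (triv_ext n R M) (T_functor n R M X) = pd R X \<and>
            fd (triv_ext n R M) (T_functor n R M X) = fd R X) \<and>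
         ((\<forall>i\<ge>1. \<forall>j\<ge>1. trivial_group (Ext R (tensor_power R M i) X j)) \<longrightarrow>
            injd (triv_ext n R M) (H_functor n R M X) = injd R X)"
proof -
  interpret tensor_powers R M by (rule tensor_powers.intro) fact+
  note G = TE_graded[of n]
  \<comment> \<open>An injection of element types, used to compare universes; it is not the ring map
    \<open>scalar_emb\<close>.\<close>
  have i0: "inj (\<lambda>r (_ :: nat). Scalar r :: ('r, 'm) tens)" by (auto simp: inj_def fun_eq_iff)
  show ?thesis
    unfolding T_functor_def H_functor_def
    using graded_extension.T_dimensions[OF G assms(5) i0] graded_extension.H_injd[OF G assms(5) i0] by blast
qed

end
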